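(* Let $1<p<\infty$ and $\bar\omega\in\mathbf V$ be fixed. Then for any $\varepsilon>0$ there exists some $\delta>0$ such that for any admissible map $\zeta:\mathbb R\to L^p(D)$ it holds that $$\min_{v\in\mathcal O_{\bar\omega}}\|\zeta(0)-v\|_p<\delta\quad\Longrightarrow\quad\min_{v\in\mathcal O_{\bar\omega}}\|\zeta(t)-v\|_p<\varepsilon\quad\forall\,t\in\mathbb R.$$
   Context: $D=\{\mathbf x\in\mathbb R^2: |\mathbf x|<1\}$ is the open unit disk, $(r,\theta)$ are polar coordinates, and $\|\cdot\|_p$ is the norm of $L^p(D)$. All functions are real-valued. $\mathcal G$ is the inverse of $-\Delta$ on $D$ with zero Dirichlet boundary condition: $-\Delta\mathcal Gv=v$ in $D$, $\mathcal Gv=0$ on $\partial D$. The kinetic energy is $E(v)=\frac12\int_D v\,\mathcal Gv\,d\mathbf x$, which is well defined on $L^p(D)$ for $1<p<\infty$. The rearrangement class of a measurable $\zeta:D\to\mathbb R$ is $\mathcal R_\zeta=\{v:D\to\mathbb R : |\{v>s\}|=|\{\zeta>s\}|\ \forall s\in\mathbb R\}$ (measurable functions), $|\cdot|$ being Lebesgue measure. An admissible map is a map $\zeta:\mathbb R\to L^p(D)$ (no continuity is required) such that $E(\zeta(t))=E(\zeta(0))$ and $\zeta(t)\in\mathcal R_{\zeta(0)}$ for all $t\in\mathbb R$. $J_n$ is the Bessel function of the first kind of order $n$ and $j$ is the first positive zero of $J_1$. $\mathbf V=\mathrm{span}_{\mathbb R}\{J_0(jr),\,J_1(jr)\cos\theta,\,J_1(jr)\sin\theta\}$,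 a space of functions on $D$. For $\zeta:D\to\mathbb R$, the rotation orbit is $\mathcal O_\zeta=\{\zeta(r,\theta+\beta): \beta\in\mathbb R\}$. *)

theory Defs
  imports "HOL-Analysis.Analysis"
begin

text \<open>A function on the disk is represented by a total function on \<^typ>\<open>real^2\<close>. Every notion
  below depends only on its values on the disk, and those on elements of \<open>L\<^sup>p\<close> only on its values
  almost everywhere there.\<close>

abbreviation disk :: "(real^2) set" where
  "disk \<equiv> ball 0 1"

definition polar :: "real \<Rightarrow> real \<Rightarrow> real^2" where
  "polar r \<theta> = vector [r * cos \<theta>, r * sin \<theta>]"

definition Lp_disk :: "real \<Rightarrow> (real^2 \<Rightarrow> real) set" where
  "Lp_disk p = {v \<in> borel_measurable (lebesgue_on disk).
                 integrable (lebesgue_on disk) (\<lambda>x. \<bar>v x\<bar> powr p)}"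

definition Lp_norm :: "real \<Rightarrow> (real^2 \<Rightarrow> real) \<Rightarrow> real" where
  "Lp_norm p v = (LINT x|lebesgue_on disk. \<bar>v x\<bar> powr p) powr (1 / p)"

definition partial_deriv :: "2 \<Rightarrow> (real^2 \<Rightarrow> real) \<Rightarrow> real^2 \<Rightarrow> real" where
  "partial_deriv k f x = deriv (\<lambda>s. f (x + s *\<^sub>R axis k 1)) 0"

definition laplacian :: "(real^2 \<Rightarrow> real) \<Rightarrow> real^2 \<Rightarrow> real" where
  "laplacian f x = (\<Sum>k\<in>UNIV. partial_deriv k (partial_deriv k f) x)"

text \<open>All iterated partial derivatives, in any order, exist and are continuous.\<close>

definition smooth :: "(real^2 \<Rightarrow> real) \<Rightarrow> bool" where
  "smooth f \<longleftrightarrow>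
     (\<forall>ks. continuous_on UNIV (foldr partial_deriv ks f) \<and>
           (\<forall>k x. (\<lambda>s. foldr partial_deriv ks f (x + s *\<^sub>R axis k 1)) differentiable at 0))"

definition test_function :: "(real^2 \<Rightarrow> real) \<Rightarrow> bool" where
  "test_function \<phi> \<longleftrightarrow>
     smooth \<phi> \<and> (\<exists>K. compact K \<and> K \<subseteq> disk \<and> (\<forall>x. x \<notin> K \<longrightarrow> \<phi> x = 0))"

text \<open>The Dirichlet problem \<open>- \<Delta> u = v\<close> in the disk, \<open>u = 0\<close> on its boundary. The equation is
  understood in the sense of distributions. The boundary condition is pointwise: for \<open>v\<close> in
  \<open>L\<^sup>p\<close>, \<open>p > 1\<close>, the solution is in \<open>W\<^bsup>2,p\<^esup>\<close> and so continuous on the closed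
  disk. Setting \<open>u\<close> to 0 also outside the closed disk makes it unique as a total function.\<close>

definition dirichlet_solution :: "(real^2 \<Rightarrow> real) \<Rightarrow> (real^2 \<Rightarrow> real) \<Rightarrow> bool" where
  "dirichlet_solution v u \<longleftrightarrow>
     continuous_on (closure disk) u \<and> (\<forall>x. x \<notin> disk \<longrightarrow> u x = 0) \<and>
     (\<forall>\<phi>. test_function \<phi> \<longrightarrow>
        (LINT x|lebesgue_on disk. u x * (- laplacian \<phi> x)) =
        (LINT x|lebesgue_on disk. v x * \<phi> x))"

definition green_op :: "(real^2 \<Rightarrow> real) \<Rightarrow> real^2 \<Rightarrow> real" where
  "green_op v = (THE u. dirichlet_solution v u)"

definition energy :: "(real^2 \<Rightarrow> real) \<Rightarrow> real" where
  "energy v = 1 / 2 * (LINT x|lebesgue_on disk. v x * green_op v x)"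

definition rearrangements :: "(real^2 \<Rightarrow> real) \<Rightarrow> (real^2 \<Rightarrow> real) set" where
  "rearrangements \<zeta> = {v \<in> borel_measurable (lebesgue_on disk).
     \<forall>s. measure lebesgue {x \<in> disk. v x > s} = measure lebesgue {x \<in> disk. \<zeta> x > s}}"

definition admissible_map :: "real \<Rightarrow> (real \<Rightarrow> real^2 \<Rightarrow> real) \<Rightarrow> bool" where
  "admissible_map p \<zeta> \<longleftrightarrow>
     (\<forall>t. \<zeta> t \<in> Lp_disk p \<and> energy (\<zeta> t) = energy (\<zeta> 0) \<and> \<zeta> t \<in> rearrangements (\<zeta> 0))"

definition bessel_J :: "nat \<Rightarrow> real \<Rightarrow> real" where
  "bessel_J n x = (\<Sum>k. (- 1) ^ k / (fact k * fact (k + n)) * (x / 2) ^ (2 * k + n))"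

definition j_zero :: real where
  "j_zero = (LEAST x. 0 < x \<and> bessel_J 1 x = 0)"

text \<open>The real span of \<open>J\<^sub>0(jr)\<close>, \<open>J\<^sub>1(jr) cos \<theta>\<close> and \<open>J\<^sub>1(jr) sin \<theta>\<close>
  as functions on the disk; this is unambiguous at the origin because \<open>J\<^sub>1(0) = 0\<close>.\<close>

definition V_space :: "(real^2 \<Rightarrow> real) set" where
  "V_space = {v. \<exists>a b c. \<forall>r \<theta>. 0 \<le> r \<and> r < 1 \<longrightarrow>
     v (polar r \<theta>) = a * bessel_J 0 (j_zero * r) +
                     b * (bessel_J 1 (j_zero * r) * cos \<theta>) +
                     c * (bessel_J 1 (j_zero * r) * sin \<theta>)}"

definition rotation_orbit :: "(real^2 \<Rightarrow> real) \<Rightarrow> (real^2 \<Rightarrow> real) set" where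
  "rotation_orbit \<zeta> = {v. \<exists>\<beta>. \<forall>r \<theta>. 0 \<le> r \<and> r < 1 \<longrightarrow> v (polar r \<theta>) = \<zeta> (polar r (\<theta> + \<beta>))}"

text \<open>A minimum rather than an infimum: \<open>LEAST\<close> carries information only if it is attained.\<close>

definition min_Lp_dist :: "real \<Rightarrow> (real^2 \<Rightarrow> real) \<Rightarrow> (real^2 \<Rightarrow> real) set \<Rightarrow> real" where
  "min_Lp_dist p f S = (LEAST d. d \<in> (\<lambda>v. Lp_norm p (\<lambda>x. f x - v x)) ` S)"

end

theory Submission
  imports Defs "HOL-Computational_Algebra.Polynomial"
begin

text \<open>Write \<open>j\<close> for the zero \<open>j_zero\<close> and \<open>V\<close> for the space \<open>V_space\<close>. Up to additive constants, the Green operator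
\<open>G\<close> multiplies the elements of \<open>V\<close> by \<open>1 / j\<^sup>2\<close>, and this is its largest eigenvalue on functions of mean
zero, taken modulo constants. So \<open>2 E(v) \<le> \<integral> v\<^sup>2 / j\<^sup>2\<close> for every \<open>v\<close> of mean zero, with a gap on the
orthogonal complement of \<open>V\<close> (\<open>spectral_gap\<close>): a function of mean zero whose energy is nearly the
largest one possible for its \<open>L\<^sup>2\<close> norm is close to \<open>V\<close> (\<open>near_Vfun\<close>).

An admissible map preserves the energy and, through the rearrangement class, all integrals
\<open>\<integral> \<Phi>(\<zeta>(t))\<close>. If \<open>\<zeta>(0)\<close> is close to the orbit of \<open>\<omega> \<in> V\<close>, then \<open>\<zeta>(t)\<close> has nearly mean zero, nearly the
\<open>L\<^sup>2\<close> norm of \<open>\<omega>\<close> and nearly its energy, which is the maximal one; hence \<open>\<zeta>(t)\<close> is close to some element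
of \<open>V\<close>. Which one is decided by the integrals of the second and third powers: they depend only on the
coefficient \<open>a\<close> of \<open>J\<^sub>0\<close> and on the modulus of the complex amplitude \<open>g\<close> of the \<open>J\<^sub>1\<close> part, and they
determine both (\<open>Vfun_rigidity\<close>). Two elements of \<open>V\<close> with the same \<open>a\<close> and \<open>|g|\<close> differ by a rotation.
As \<open>V\<close> has finite dimension, a compactness argument turns this into stability. The integrals of powers
and the \<open>L\<^sup>2\<close> theory are applied to truncations at the height of \<open>\<omega>\<close>; truncation commutes with
rearrangement, and what it cuts off is small in \<open>L\<^sup>p\<close> at time 0, hence at all times
(\<open>rearrangement_energy_compactness\<close>).

The spectral gap is proved without a spectral theorem. Polynomials are sums of angular modes
\<open>Q(r\<^sup>2) Re (c z\<^sup>n)\<close>, on which \<open>G\<close> acts by solving an ordinary differential equation in \<open>s = r\<^sup>2\<close>. For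
\<open>n \<ge> 2\<close> the maximum principle, with a Bessel function as barrier, shows that the iterates of \<open>G\<close> decay
faster than \<open>j\<close> to the power \<open>-2N\<close>. For \<open>n = 1\<close> the positive eigenfunction \<open>psi\<close> attracts all iterates at
a geometric rate, as in the Perron-Frobenius theorem (\<open>radial_inv_power_limit\<close>), and the case \<open>n = 0\<close>
reduces to \<open>n = 1\<close> by differentiation. So each polynomial is a constant, plus an element of \<open>V\<close>, plus a
remainder whose iterates decay faster. Since \<open>G\<close> is symmetric, the \<open>L\<^sup>2\<close> norms of these iterates are
log-convex, and the rate of decay bounds the quadratic form on the remainder (\<open>decays_energy\<close>).

On \<open>L\<^sup>p\<close> the operator \<open>G\<close> is obtained from its explicit form on polynomials by density, a sup bound from a
regularized Green function (\<open>green_pair_sup_bound\<close>), and uniqueness (\<open>dirichlet_unique\<close>).\<close>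

section \<open>Power series for the Bessel functions\<close>

text \<open>The entire function with \<open>J\<^sub>n(x) = (x/2)\<^sup>n Lam n (x\<^sup>2/4)\<close>. In the variable \<open>x\<^sup>2/4\<close> differentiation
  raises the order and changes the sign.\<close>

definition Lam :: "nat \<Rightarrow> real \<Rightarrow> real" where
  "Lam n t = (\<Sum>k. (- 1) ^ k / (fact k * fact (k + n)) * t ^ k)"

lemma Lam_summable: "summable (\<lambda>k. (- 1) ^ k / (fact k * fact (k + n)) * (t::real) ^ k)"
proof (rule summable_comparison_test')
  show "summable (\<lambda>k. inverse (fact k) * \<bar>t\<bar> ^ k)" by (rule summable_exp)
  fix k :: nat assume "0 \<le> k"
  have "(1::real) \<le> fact (k + n)" by (rule fact_ge_1)
  then have "fact k * 1 \<le> (fact k * fact (k + n) :: real)" by (intro mult_left_mono) auto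
  then have "1 / (fact k * fact (k + n)) \<le> (1 / fact k :: real)" by (intro divide_left_mono) auto
  then have "1 / (fact k * fact (k + n)) * \<bar>t\<bar> ^ k \<le> inverse (fact k) * \<bar>t\<bar> ^ k"
    by (intro mult_right_mono) (auto simp: divide_inverse)
  then show "norm ((- 1) ^ k / (fact k * fact (k + n)) * t ^ k) \<le> inverse (fact k) * \<bar>t\<bar> ^ k"
    by (simp add: abs_mult power_abs)
qed

lemma Lam_deriv: "(Lam n has_real_derivative - Lam (Suc n) t) (at t)"
proof -
  let ?c = "\<lambda>k. (- 1) ^ k / (fact k * fact (k + n)) :: real"
  have "((\<lambda>x. \<Sum>k. ?c k * x ^ k) has_field_derivative (\<Sum>k. diffs ?c k * t ^ k)) (at t)"
    by (rule termdiffs_strong_converges_everywhere) (rule Lam_summable)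
  moreover have "diffs ?c k = - ((- 1) ^ k / (fact k * fact (k + Suc n)))" for k
    by (simp add: diffs_def divide_simps del: of_nat_Suc)
  then have "(\<Sum>k. diffs ?c k * t ^ k) = (\<Sum>k. - ((- 1) ^ k / (fact k * fact (k + Suc n)) * t ^ k))" by simp
  then have "(\<Sum>k. diffs ?c k * t ^ k) = - Lam (Suc n) t"
    by (subst (asm) suminf_minus [OF Lam_summable]) (simp add: Lam_def)
  ultimately show ?thesis unfolding Lam_def [abs_def] by simp
qed

lemma Lam_deriv_chain [derivative_intros]:
  assumes "(g has_real_derivative g') (at x within S)"
  shows "((\<lambda>x. Lam n (g x)) has_real_derivative - Lam (Suc n) (g x) * g') (at x within S)"
  using DERIV_chain2 [OF Lam_deriv assms] .

lemma Lam_cont [continuous_intros]: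
  assumes "continuous_on S g" shows "continuous_on S (\<lambda>x. Lam n (g x))"
proof -
  have "continuous_on UNIV (Lam n)"
    using Lam_deriv by (intro DERIV_continuous_on) (auto intro: has_field_derivative_at_within)
  from continuous_on_compose2 [OF this assms] show ?thesis by auto
qed

lemma Lam_0: "Lam n 0 = 1 / fact n"
  using powser_zero [of "\<lambda>k. (- 1) ^ k / (fact k * fact (k + n)) :: real"] by (simp add: Lam_def)

lemma Lam_rec: "t * Lam (Suc (Suc n)) t = (real n + 1) * Lam (Suc n) t - Lam n t"
proof -
  let ?c = "\<lambda>n k. (- 1) ^ k / (fact k * fact (k + n)) :: real"
  let ?d = "\<lambda>k. (real n + 1) * (?c (Suc n) k * t ^ k) - ?c n k * t ^ k"
  have s: "summable ?d" by (intro summable_diff summable_mult Lam_summable)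
  have "(real n + 1) * Lam (Suc n) t - Lam n t = (\<Sum>k. ?d k)"
    unfolding Lam_def
    by (simp only: suminf_diff [OF summable_mult [OF Lam_summable] Lam_summable, symmetric]
        suminf_mult [OF Lam_summable, symmetric])
  also have "\<dots> = (\<Sum>k. ?d (Suc k)) + ?d 0" using suminf_split_head [OF s] by simp
  also have "?d 0 = 0" by (simp add: divide_simps)
  also have "?d (Suc k) = t * (?c (Suc (Suc n)) k * t ^ k)" for k
    by (simp add: divide_simps) (simp add: algebra_simps)
  then have "(\<Sum>k. ?d (Suc k)) = t * Lam (Suc (Suc n)) t"
    unfolding Lam_def by (simp only: suminf_mult [OF Lam_summable])
  finally show ?thesis by simp
qed

lemma pow_Lam_deriv:
  "((\<lambda>t. t ^ Suc n * Lam (Suc n) t) has_real_derivative t ^ n * Lam n t) (at t)"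
proof -
  have "((\<lambda>t. t ^ Suc n * Lam (Suc n) t) has_real_derivative
     (t ^ Suc n * (- Lam (Suc (Suc n)) t) + (real n + 1) * t ^ n * Lam (Suc n) t)) (at t)"
    by (rule DERIV_cong [OF DERIV_mult [OF DERIV_pow Lam_deriv]]) (simp add: algebra_simps)
  moreover have "t ^ Suc n * (- Lam (Suc (Suc n)) t) + (real n + 1) * t ^ n * Lam (Suc n) t
      = t ^ n * ((real n + 1) * Lam (Suc n) t - t * Lam (Suc (Suc n)) t)"
    by (simp add: algebra_simps)
  then have "t ^ Suc n * (- Lam (Suc (Suc n)) t) + (real n + 1) * t ^ n * Lam (Suc n) t = t ^ n * Lam n t"
    by (simp only: Lam_rec) simp
  ultimately show ?thesis by simp
qed

text \<open>A sign change of \<open>J\<^sub>1\<close>: without it \<open>j_zero\<close> would not be known to be a zero.\<close>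

lemma Lam1_4: "Lam 1 4 < 0"
proof -
  \<comment> \<open>Seven terms of the series suffice; from there on they are dominated by a geometric series.\<close>
  let ?a = "\<lambda>k. (- 1) ^ k / (fact k * fact (k + 1)) * (4::real) ^ k"
  have s: "summable ?a" by (rule Lam_summable)
  have a: "\<bar>?a (i + 7)\<bar> \<le> (1/2) ^ i * (1/1000)" for i
  proof (induction i)
    case 0 show ?case by (simp add: fact_numeral)
  next
    case (Suc i)
    have "\<bar>?a (Suc i + 7)\<bar> = \<bar>?a (i + 7)\<bar> * (4 / ((real i + 8) * (real i + 9)))"
    proof -
      have "fact (Suc i + 7) = (real i + 8) * fact (i + 7)"
        "fact (Suc i + 7 + 1) = (real i + 9) * fact (i + 7 + 1)"
        using fact_Suc [of "i + 7", where 'a = real] fact_Suc [of "i + 8", where 'a = real]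
        by (simp_all add: algebra_simps)
      then show ?thesis by (simp only: abs_mult abs_divide power_abs) (simp add: abs_mult power_add mult_ac)
    qed
    also have "\<dots> \<le> \<bar>?a (i + 7)\<bar> * (1/2)"
    proof (intro mult_left_mono)
      have "8 * 9 \<le> (real i + 8) * (real i + 9)" by (intro mult_mono) auto
      then show "4 / ((real i + 8) * (real i + 9)) \<le> 1/2" by (simp add: divide_simps)
    qed auto
    also have "\<dots> \<le> (1/2) ^ i * (1/1000) * (1/2)" using Suc by (intro mult_right_mono) auto
    also have "\<dots> = (1/2) ^ Suc i * (1/1000)" by simp
    finally show ?case .
  qed
  have g: "(\<lambda>i. (1/2) ^ i * (1/1000)) sums (2 * (1/1000 :: real))"
    by (rule sums_mult2) (use geometric_sums [of "1/2::real"] in simp)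
  have "(\<Sum>i. ?a (i + 7)) \<le> (\<Sum>i. (1/2) ^ i * (1/1000))"
    using a by (intro suminf_le summable_ignore_initial_segment s sums_summable [OF g])
      (meson abs_le_D1)
  also have "\<dots> = 2/1000" using sums_unique [OF g] by simp
  finally have t: "(\<Sum>i. ?a (i + 7)) \<le> 2/1000" .
  have "Lam 1 4 = (\<Sum>i. ?a (i + 7)) + (\<Sum>i<7. ?a i)"
    unfolding Lam_def using suminf_split_initial_segment [OF s, of 7] by simp
  also have "(\<Sum>i<7. ?a i) < - 1/100" by (simp add: lessThan_nat_numeral fact_numeral)
  finally show ?thesis using t by simp
qed

text \<open>The square of \<open>j\<close> in the scale in which \<open>Lam\<close> has its zeros; the eigenvalue belonging to the space \<open>V\<close>
  is \<open>1 / j\<^sup>2 = 1 / (4 * tau)\<close>.\<close>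

definition tau :: real where "tau = j_zero\<^sup>2 / 4"

lemma bessel_eq_Lam: "bessel_J n x = (x / 2) ^ n * Lam n (x\<^sup>2 / 4)"
proof -
  have *: "(x / 2) ^ (2 * k + n) = (x / 2) ^ n * (x\<^sup>2 / 4) ^ k" for k
    by (simp add: power_add power_mult power_divide) (simp add: mult.commute)
  have "bessel_J n x = (\<Sum>k. (x / 2) ^ n * ((- 1) ^ k / (fact k * fact (k + n)) * (x\<^sup>2 / 4) ^ k))"
    unfolding bessel_J_def * by (simp add: mult_ac)
  then show ?thesis unfolding Lam_def by (simp only: suminf_mult [OF Lam_summable])
qed

lemma j_zero_facts: "0 < j_zero" "Lam 1 tau = 0" "\<And>x. 0 < x \<Longrightarrow> x < j_zero \<Longrightarrow> Lam 1 (x\<^sup>2 / 4) \<noteq> 0"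
proof -
  let ?Z = "{x \<in> {0..4}. Lam 1 (x\<^sup>2 / 4) = 0}"
  have c: "continuous_on UNIV (\<lambda>x. Lam 1 (x\<^sup>2 / 4))" by (intro continuous_intros) auto
  have "\<exists>x\<ge>0. x \<le> 4 \<and> Lam 1 (x\<^sup>2 / 4) = 0"
    by (rule IVT2') (use Lam1_4 in \<open>auto simp: Lam_0 intro!: continuous_intros\<close>)
  then have ne: "?Z \<noteq> {}" by auto
  have "compact ({0..4} \<inter> {x. Lam 1 (x\<^sup>2 / 4) = 0})"
    by (intro compact_Int_closed compact_Icc closed_Collect_eq c continuous_intros)
  then have "compact ?Z" by (simp add: Int_def)
  from compact_attains_inf [OF this ne] obtain x where x: "x \<in> ?Z" "\<And>y. y \<in> ?Z \<Longrightarrow> x \<le> y" by auto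
  have x0: "x \<noteq> 0" using x(1) by (auto simp: Lam_0)
  have "j_zero = x" unfolding j_zero_def
  proof (rule Least_equality)
    show "0 < x \<and> bessel_J 1 x = 0" using x x0 by (auto simp: bessel_eq_Lam)
    fix y assume y: "0 < y \<and> bessel_J 1 y = 0"
    show "x \<le> y"
    proof (cases "y \<le> 4")
      case True then show ?thesis using y by (intro x(2)) (auto simp: bessel_eq_Lam)
    qed (use x(1) in auto)
  qed
  then show "0 < j_zero" "Lam 1 tau = 0" using x x0 by (auto simp: tau_def)
  fix y assume "0 < y" "y < j_zero"
  then have "y \<notin> ?Z" using x(2) [of y] \<open>j_zero = x\<close> by linarith
  then show "Lam 1 (y\<^sup>2 / 4) \<noteq> 0" using \<open>0 < y\<close> \<open>y < j_zero\<close> \<open>j_zero = x\<close> x(1) by simp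
qed

lemma tau_pos: "0 < tau" using j_zero_facts(1) by (simp add: tau_def)

lemma Lam1_pos: assumes "0 \<le> t" "t < tau" shows "0 < Lam 1 t"
proof (rule ccontr)
  assume "\<not> 0 < Lam 1 t"
  then have "\<exists>s\<ge>0. s \<le> t \<and> Lam 1 s = 0"
    by (intro IVT2') (use assms in \<open>auto simp: Lam_0 intro!: continuous_intros\<close>)
  then obtain s where s: "0 \<le> s" "s \<le> t" "Lam 1 s = 0" by auto
  then have "s \<noteq> 0" by (auto simp: Lam_0)
  let ?x = "2 * sqrt s"
  have "?x\<^sup>2 / 4 = s" using s by simp
  moreover have "?x\<^sup>2 < j_zero\<^sup>2" using s assms by (simp add: tau_def)
  then have "?x < j_zero" using j_zero_facts(1) by (meson less_imp_le power2_less_imp_less)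
  ultimately show False using j_zero_facts(3) [of ?x] s \<open>s \<noteq> 0\<close> by auto
qed

text \<open>\<open>t\<^sup>2 Lam 2 t\<close> is the primitive of \<open>t Lam 1 t\<close>, which is positive up to \<open>tau\<close>.\<close>

lemma Lam2_pos: assumes "0 \<le> t" "t \<le> tau" shows "0 < Lam 2 t"
proof (cases "t = 0")
  case True then show ?thesis by (simp add: Lam_0)
next
  case False
  define F where "F = (\<lambda>t. t ^ Suc 1 * Lam (Suc 1) t)"
  have "F 0 < F t"
  proof (rule DERIV_pos_imp_increasing_open [where f = F])
    show "0 < t" using assms False by simp
    fix x assume "0 < x" "x < t"
    then show "\<exists>y. (F has_real_derivative y) (at x) \<and> 0 < y"
      unfolding F_def using pow_Lam_deriv [of 1 x] Lam1_pos [of x] assms by (intro exI[of _ "x ^ 1 * Lam 1 x"]) auto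
  qed (use assms False in \<open>auto simp del: power_Suc simp: F_def intro!: continuous_intros\<close>)
  then show ?thesis using False by (simp add: F_def zero_less_mult_iff numeral_2_eq_2)
qed

text \<open>The first zero of \<open>J\<^sub>2\<close> lies strictly beyond that of \<open>J\<^sub>1\<close>. This is the spectral gap for the angular
  orders from 2 on.\<close>

lemma Lam2_pos_beyond: "\<exists>t'>tau. \<forall>t\<in>{0..t'}. 0 < Lam 2 t"
proof -
  have "isCont (Lam 2) tau" using Lam_deriv by (rule DERIV_isCont)
  from this[unfolded isCont_def, THEN order_tendstoD(1), of 0]
  have "\<forall>\<^sub>F x in at tau. 0 < Lam 2 x" using Lam2_pos[of tau] tau_pos by simp
  then obtain d where d: "d > 0" "\<And>x. x \<noteq> tau \<Longrightarrow> dist x tau < d \<Longrightarrow> 0 < Lam 2 x"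
    by (auto simp: eventually_at)
  show ?thesis
  proof (intro exI[of _ "tau + d/2"] conjI ballI)
    fix t assume t: "t \<in> {0..tau + d/2}"
    show "0 < Lam 2 t"
    proof (cases "t \<le> tau")
      case True then show ?thesis using Lam2_pos t by auto
    next
      case False then show ?thesis using d t by (intro d(2)) (auto simp: dist_real_def)
    qed
  qed (use d in auto)
qed

lemma bessel_J0_scaled: "bessel_J 0 (j_zero * r) = Lam 0 (tau * r\<^sup>2)"
  by (simp add: bessel_eq_Lam tau_def power_mult_distrib)

lemma bessel_J1_scaled: "bessel_J 1 (j_zero * r) = j_zero / 2 * r * Lam 1 (tau * r\<^sup>2)"
  by (simp add: bessel_eq_Lam tau_def power_mult_distrib)

section \<open>Integration over the disk\<close>

lemma finite_measure_ball: "finite_measure (lebesgue_on (ball (c::real^2) r))"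
  by (rule finite_measure_lebesgue_on) simp

lemma integrable_ball_bounded:
  fixes f :: "real^2 \<Rightarrow> real"
  assumes "f \<in> borel_measurable (lebesgue_on (ball c r))" "\<And>x. x \<in> ball c r \<Longrightarrow> \<bar>f x\<bar> \<le> B"
  shows "integrable (lebesgue_on (ball c r)) f"
proof -
  interpret finite_measure "lebesgue_on (ball c r)" by (rule finite_measure_ball)
  show ?thesis by (rule integrable_const_bound [of _ B]) (use assms in auto)
qed

lemma continuous_measurable_ball:
  fixes f :: "real^2 \<Rightarrow> real"
  assumes "continuous_on (ball c r) f"
  shows "f \<in> borel_measurable (lebesgue_on (ball c r))"
  using assms by (rule continuous_imp_measurable_on_sets_lebesgue) simp

lemma integrable_ball_continuous:
  fixes f :: "real^2 \<Rightarrow> real"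
  assumes "continuous_on (cball c r) f"
  shows "integrable (lebesgue_on (ball c r)) f"
proof -
  have "bounded (f ` cball c r)" using assms by (intro compact_imp_bounded compact_continuous_image) auto
  then obtain B where "\<forall>z\<in>f ` cball c r. norm z \<le> B" unfolding bounded_iff by blast
  then have "\<And>x. x \<in> cball c r \<Longrightarrow> \<bar>f x\<bar> \<le> B" by auto
  then show ?thesis
    using continuous_on_subset [OF assms ball_subset_cball]
    by (intro integrable_ball_bounded [where B = B] continuous_measurable_ball) auto
qed

lemma integral_ball_lborel:
  fixes f :: "real^2 \<Rightarrow> real"
  assumes "f \<in> borel_measurable borel"
  shows "(LINT x|lebesgue_on (ball c r). f x) = (LINT x|lborel. indicator (ball c r) x * f x)"
proof -
  have m: "(\<lambda>x. indicator (ball c r) x * f x) \<in> borel_measurable lborel"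
    using assms by (intro borel_measurable_times borel_measurable_indicator) auto
  show ?thesis
    by (subst integral_restrict_space) (use integral_completion [OF m] in auto)
qed

lemma emeasure_ball2:
  assumes "0 \<le> r"
  shows "emeasure lborel (ball (c::real^2) r) = ennreal (pi * r\<^sup>2)"
    "emeasure lborel (cball (c::real^2) r) = ennreal (pi * r\<^sup>2)"
  using assms by (auto simp: emeasure_ball emeasure_cball unit_ball_vol_2)

text \<open>The area \<open>\<pi> r\<^sup>2\<close> of a disk is linear in \<open>r\<^sup>2\<close>, so the squared distance from the centre is uniformly
  distributed. This is the reason to use \<open>s = r\<^sup>2\<close> as radial variable throughout.\<close>

lemma distr_sq_dist:
  fixes y :: "real^2"
  assumes "0 \<le> d"
  shows "distr (lebesgue_on (ball y d)) borel (\<lambda>x. (norm (x - y))\<^sup>2)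
    = density lborel (\<lambda>s. ennreal (pi * indicator {0..d\<^sup>2} s))"
proof (rule measure_eqI_lessThan)
  let ?M = "lebesgue_on (ball y d)" and ?g = "\<lambda>x. (norm (x - y))\<^sup>2"
  have g: "?g \<in> borel_measurable ?M"
    by (intro continuous_measurable_ball continuous_intros)
  fix s :: real
  have vim: "?g -` {s<..} \<inter> space ?M = (if s < 0 then ball y d else if s < d\<^sup>2 then ball y d - cball y (sqrt s) else {})"
  proof -
    consider "s < 0" | "0 \<le> s" "s < d\<^sup>2" | "0 \<le> s" "d\<^sup>2 \<le> s" by linarith
    then show ?thesis
    proof cases
      case 1
      then have "s < (norm (x - y))\<^sup>2" for x using zero_le_power2 [of "norm (x - y)"] by linarith
      with 1 show ?thesis by auto
    next
      case 2
      then have "(norm (x - y))\<^sup>2 \<le> s \<longleftrightarrow> norm (x - y) \<le> sqrt s" for x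
        by (metis norm_ge_zero real_le_rsqrt real_sqrt_le_iff real_sqrt_unique)
      with 2 show ?thesis by (auto simp: dist_norm norm_minus_commute not_le [symmetric])
    next
      case 3
      have "(norm (x - y))\<^sup>2 < d\<^sup>2" if "norm (x - y) < d" for x
        using that by (intro power_strict_mono) auto
      with 3 show ?thesis by (force simp: dist_norm norm_minus_commute)
    qed
  qed
  have l: "emeasure (distr ?M borel ?g) {s<..} = ennreal (pi * (if s < 0 then d\<^sup>2 else if s < d\<^sup>2 then d\<^sup>2 - s else 0))"
  proof -
    have "emeasure (distr ?M borel ?g) {s<..} = emeasure ?M (?g -` {s<..} \<inter> space ?M)"
      by (rule emeasure_distr [OF g]) auto
    also have "\<dots> = emeasure lebesgue (?g -` {s<..} \<inter> space ?M)"
      unfolding vim by (intro emeasure_restrict_space) auto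
    also have "\<dots> = ennreal (pi * (if s < 0 then d\<^sup>2 else if s < d\<^sup>2 then d\<^sup>2 - s else 0))"
    proof -
      have "emeasure lebesgue (ball y d - cball y (sqrt s)) = ennreal (pi * d\<^sup>2) - ennreal (pi * s)"
        if "0 \<le> s" "s < d\<^sup>2"
      proof -
        have "sqrt s < d" using that assms by (metis real_sqrt_less_iff real_sqrt_unique)
        then show ?thesis
          using that assms
          by (subst emeasure_Diff) (auto simp: emeasure_ball2)
      qed
      then show ?thesis unfolding vim
        using assms by (auto simp: emeasure_ball2 ennreal_minus right_diff_distrib)
    qed
    finally show ?thesis .
  qed
  have r: "emeasure (density lborel (\<lambda>s. ennreal (pi * indicator {0..d\<^sup>2} s))) {s<..}
      = ennreal (pi * (if s < 0 then d\<^sup>2 else if s < d\<^sup>2 then d\<^sup>2 - s else 0))"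
  proof -
    have "emeasure (density lborel (\<lambda>s. ennreal (pi * indicator {0..d\<^sup>2} s))) {s<..}
      = (\<integral>\<^sup>+x. ennreal pi * indicator ({0..d\<^sup>2} \<inter> {s<..}) x \<partial>lborel)"
      by (subst emeasure_density) (auto intro!: nn_integral_cong simp: indicator_def)
    also have "\<dots> = ennreal pi * emeasure lborel ({0..d\<^sup>2} \<inter> {s<..})"
      by (subst nn_integral_cmult_indicator) auto
    also have "{0..d\<^sup>2} \<inter> {s<..} = (if s < 0 then {0..d\<^sup>2} else {s<..d\<^sup>2})" by auto
    also have "ennreal pi * emeasure lborel (if s < 0 then {0..d\<^sup>2} else {s<..d\<^sup>2})
        = ennreal (pi * (if s < 0 then d\<^sup>2 else if s < d\<^sup>2 then d\<^sup>2 - s else 0))"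
      using assms by (auto simp: ennreal_mult' [symmetric])
    finally show ?thesis .
  qed
  show "emeasure (distr ?M borel ?g) {s<..} < \<infinity>" unfolding l by auto
  show "emeasure (distr ?M borel ?g) {s<..} = emeasure (density lborel (\<lambda>s. ennreal (pi * indicator {0..d\<^sup>2} s))) {s<..}"
    unfolding l r ..
qed auto

lemma radial_integral:
  fixes y :: "real^2"
  assumes "0 \<le> d" "f \<in> borel_measurable borel"
  shows "(LINT x|lebesgue_on (ball y d). f ((norm (x - y))\<^sup>2)) = pi * (LINT s|lborel. f s * indicator {0..d\<^sup>2} s)"
proof -
  have "(\<lambda>x. (norm (x - y))\<^sup>2) \<in> borel_measurable (lebesgue_on (ball y d))"
    by (intro continuous_measurable_ball continuous_intros)
  then have "(LINT x|lebesgue_on (ball y d). f ((norm (x - y))\<^sup>2))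
      = integral\<^sup>L (distr (lebesgue_on (ball y d)) borel (\<lambda>x. (norm (x - y))\<^sup>2)) f"
    by (rule integral_distr [OF _ assms(2), symmetric])
  also have "\<dots> = (LINT s|lborel. pi * indicator {0..d\<^sup>2} s * f s)"
    unfolding distr_sq_dist [OF assms(1)] using assms(2) by (subst integral_density) auto
  also have "\<dots> = pi * (LINT s|lborel. f s * indicator {0..d\<^sup>2} s)"
    by (subst integral_mult_right_zero [symmetric]) (simp add: mult_ac)
  finally show ?thesis .
qed

lemma radial_integral_FTC:
  fixes y :: "real^2" and f :: "real \<Rightarrow> real"
  assumes "0 \<le> d" "continuous_on UNIV f" "\<And>s. 0 \<le> s \<Longrightarrow> s \<le> d\<^sup>2 \<Longrightarrow> (F has_real_derivative f s) (at s)"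
  shows "(LINT x|lebesgue_on (ball y d). f ((norm (x - y))\<^sup>2)) = pi * (F (d\<^sup>2) - F 0)"
proof -
  have "(LINT s|lborel. f s * indicator {0..d\<^sup>2} s) = F (d\<^sup>2) - F 0"
    by (rule integral_FTC_Icc_real) (use assms in \<open>auto simp: continuous_on_eq_continuous_at\<close>)
  then show ?thesis
    using assms by (subst radial_integral) (auto intro: borel_measurable_continuous_onI)
qed

lemma sphere_null: "sphere (0::real^2) 1 \<in> null_sets lborel"
  using negligible_sphere[of "0::real^2" 1]
  by (auto simp: null_sets_completion_iff negligible_iff_null_sets)

lemma has_partial_shift:
  fixes F :: "real^2 \<Rightarrow> real"
  assumes "((\<lambda>s. F (x + t *\<^sub>R e + s *\<^sub>R e)) has_real_derivative D) (at 0)"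
  shows "((\<lambda>s. F (x + s *\<^sub>R e)) has_real_derivative D) (at t)"
proof -
  have "((\<lambda>s. F (x + (s + t) *\<^sub>R e)) has_real_derivative D) (at 0)"
    using assms by (simp add: algebra_simps)
  then show ?thesis using DERIV_shift [of "\<lambda>s. F (x + s *\<^sub>R e)" D 0 t] by simp
qed

text \<open>Extended by 0 outside the disk, \<open>F\<close> is Lipschitz along the \<open>k\<close>-th axis. Its difference quotients have
  integral 0 because Lebesgue measure is translation invariant, and they converge dominatedly to the
  derivative.\<close>

lemma integral_partial_eq_0:
  fixes F F' :: "real^2 \<Rightarrow> real" and k :: 2
  assumes cF: "continuous_on (cball 0 1) F" and F0: "\<And>x. norm x = 1 \<Longrightarrow> F x = 0"
    and cF': "continuous_on UNIV F'"
    and dF: "\<And>x. norm x < 1 \<Longrightarrow> ((\<lambda>s. F (x + s *\<^sub>R axis k 1)) has_real_derivative F' x) (at 0)"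
  shows "(LINT x|lebesgue_on disk. F' x) = 0"
proof -
  define e :: "real^2" where "e = axis k 1"
  have ne: "norm e = 1" by (simp add: e_def norm_axis_1)
  define G where "G x = (if x \<in> cball 0 1 then F x else 0)" for x
  have cG: "continuous_on UNIV G"
  proof -
    have "continuous_on (cball 0 1 \<union> - ball 0 1) (\<lambda>x. if x \<in> cball 0 1 then F x else 0)"
      by (rule continuous_on_cases) (use cF F0 in \<open>auto simp: dist_norm\<close>)
    moreover have "cball 0 1 \<union> - ball 0 1 = (UNIV :: (real^2) set)" by auto
    ultimately show ?thesis unfolding G_def [abs_def] by simp
  qed
  have G0: "G x = 0" if "1 \<le> norm x" for x using that F0 by (auto simp: G_def)
  have "bounded (F' ` cball 0 1)"
    using cF' by (intro compact_imp_bounded compact_continuous_image) (auto intro: continuous_on_subset)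
  then obtain M where "\<forall>z\<in>F' ` cball 0 1. norm z \<le> M" unfolding bounded_iff by blast
  then have M: "\<And>x. norm x \<le> 1 \<Longrightarrow> \<bar>F' x\<bar> \<le> M" by auto
  have M0: "0 \<le> M" using M [of 0] by simp
  have in_lip: "\<bar>G (x + s *\<^sub>R e) - G x\<bar> \<le> M * \<bar>s\<bar>" if x: "norm x < 1" and xs: "norm (x + s *\<^sub>R e) \<le> 1" for x s
  proof (cases "s = 0")
    case False
    have seg: "norm (x + t *\<^sub>R (s *\<^sub>R e)) < 1" if "0 \<le> t" "t < 1" for t
    proof -
      have "x + t *\<^sub>R (s *\<^sub>R e) = (1 - t) *\<^sub>R x + t *\<^sub>R (x + s *\<^sub>R e)" by (simp add: algebra_simps)
      also have "norm \<dots> \<le> (1 - t) * norm x + t * norm (x + s *\<^sub>R e)"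
        using that norm_triangle_ineq [of "(1 - t) *\<^sub>R x" "t *\<^sub>R (x + s *\<^sub>R e)"] by simp
      also have "\<dots> \<le> (1 - t) * norm x + t * 1" using that xs by (intro add_left_mono mult_left_mono) auto
      also have "\<dots> < (1 - t) * 1 + t * 1" using that x by (intro add_strict_right_mono mult_strict_left_mono) auto
      finally show ?thesis by simp
    qed
    define g where "g t = G (x + t *\<^sub>R (s *\<^sub>R e))" for t
    have dg: "(g has_real_derivative F' (x + t *\<^sub>R s *\<^sub>R e) * s) (at t)" if t: "0 < t" "t < 1" for t
    proof -
      have b: "norm (x + (t * s) *\<^sub>R e) < 1" using seg t by (metis less_imp_le scaleR_scaleR)
      have "((\<lambda>u. F (x + u *\<^sub>R e)) has_real_derivative F' (x + (t * s) *\<^sub>R e)) (at (t * s))"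
        by (rule has_partial_shift) (use dF [OF b] in \<open>simp add: e_def\<close>)
      then have "((\<lambda>t. F (x + (t * s) *\<^sub>R e)) has_real_derivative F' (x + (t * s) *\<^sub>R e) * s) (at t)"
        by (rule DERIV_chain2) (auto intro!: derivative_eq_intros)
      moreover have ev: "\<forall>\<^sub>F u in nhds t. F (x + (u * s) *\<^sub>R e) = g u"
      proof -
        have "\<forall>\<^sub>F u in nhds t. u \<in> {0<..<1}" using t by (intro eventually_nhds_in_open) auto
        then show ?thesis
        proof eventually_elim
          case (elim u)
          then show ?case using seg [of u] by (auto simp: g_def G_def)
        qed
      qed
      ultimately have "(g has_real_derivative F' (x + (t * s) *\<^sub>R e) * s) (at t)"
        using DERIV_cong_ev [OF refl ev refl] by blast
      then show ?thesis by simp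
    qed
    have cg: "continuous_on {0..1} g" unfolding g_def
      by (intro continuous_on_compose2 [OF cG] continuous_intros) auto
    obtain t where t: "0 < t" "t < 1" "g 1 - g 0 = F' (x + t *\<^sub>R (s *\<^sub>R e)) * s"
      using mvt [OF _ cg, of "\<lambda>t h. F' (x + t *\<^sub>R s *\<^sub>R e) * s * h"] dg
      by (auto simp: has_field_derivative_def)
    have "\<bar>g 1 - g 0\<bar> \<le> M * \<bar>s\<bar>"
      using t M [of "x + t *\<^sub>R (s *\<^sub>R e)"] seg [of t] by (auto simp: abs_mult intro!: mult_right_mono)
    then show ?thesis by (simp add: g_def)
  qed simp
  have out_lip: "\<bar>G (x + s *\<^sub>R e) - G x\<bar> \<le> M * \<bar>s\<bar>" if x: "norm x < 1" and xs: "1 < norm (x + s *\<^sub>R e)" for x s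
  proof -
    have "\<exists>t\<ge>0. t \<le> 1 \<and> norm (x + (t * s) *\<^sub>R e) = 1"
      by (rule IVT') (use x xs in \<open>auto intro!: continuous_intros\<close>)
    then obtain t where t: "0 \<le> t" "t \<le> 1" "norm (x + (t * s) *\<^sub>R e) = 1" by auto
    have "G (x + s *\<^sub>R e) = G (x + (t * s) *\<^sub>R e)" using xs t by (simp add: G0)
    then have "\<bar>G (x + s *\<^sub>R e) - G x\<bar> \<le> M * \<bar>t * s\<bar>" using in_lip [OF x, of "t * s"] t by simp
    also have "\<bar>t * s\<bar> \<le> 1 * \<bar>s\<bar>" unfolding abs_mult using t by (intro mult_right_mono) auto
    then have "M * \<bar>t * s\<bar> \<le> M * \<bar>s\<bar>" using M0 by (intro mult_left_mono) auto
    finally show ?thesis .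
  qed
  have lip: "\<bar>G (x + s *\<^sub>R e) - G x\<bar> \<le> M * \<bar>s\<bar>" for x s
  proof -
    consider "norm x < 1" | "1 \<le> norm x" "norm (x + s *\<^sub>R e) < 1" | "1 \<le> norm x" "1 \<le> norm (x + s *\<^sub>R e)"
      by linarith
    then show ?thesis
    proof cases
      case 1 then show ?thesis using in_lip out_lip by (cases "norm (x + s *\<^sub>R e) \<le> 1") auto
    next
      case 2
      let ?y = "x + s *\<^sub>R e"
      have "?y + (- s) *\<^sub>R e = x" by simp
      then show ?thesis using in_lip [of ?y "-s"] out_lip [of ?y "-s"] 2
        by (cases "norm x \<le> 1") (auto simp: abs_minus_commute)
    next
      case 3 then show ?thesis using M0 by (simp add: G0)
    qed
  qed
  define h where "h n = inverse (real (Suc n))" for n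
  have h: "h n > 0" "h n \<le> 1" for n by (auto simp: h_def field_simps)
  have hlim: "h \<longlonglongrightarrow> 0" unfolding h_def by (rule LIMSEQ_inverse_real_of_nat)
  define q where "q n x = (G (x + h n *\<^sub>R e) - G x) / h n" for n x
  have mG [measurable]: "G \<in> borel_measurable borel" using cG by (rule borel_measurable_continuous_onI)
  have mF' [measurable]: "F' \<in> borel_measurable borel" using cF' by (rule borel_measurable_continuous_onI)
  have iG: "integrable lborel G"
  proof -
    have "integrable lborel (\<lambda>x. indicator (cball 0 1) x *\<^sub>R G x)"
      using cG by (intro borel_integrable_compact) (auto intro: continuous_on_subset)
    moreover have "(\<lambda>x. indicator (cball 0 1) x *\<^sub>R G x) = G" by (auto simp: G_def fun_eq_iff indicator_def)
    ultimately show ?thesis by simp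
  qed
  have shift: "integrable lborel (\<lambda>x. G (x + c))" "(LINT x|lborel. G (x + c)) = (LINT x|lborel. G x)" for c
  proof -
    have d: "distr lborel borel ((+) c) = (lborel :: (real^2) measure)" by (rule lborel_distr_plus)
    show "integrable lborel (\<lambda>x. G (x + c))"
      using iG integrable_distr_eq [of "(+) c" lborel borel G] unfolding d by (simp add: add.commute)
    show "(LINT x|lborel. G (x + c)) = (LINT x|lborel. G x)"
      using integral_distr [of "(+) c" lborel borel G] unfolding d by (simp add: add.commute)
  qed
  have q0: "(LINT x|lborel. q n x) = 0" for n
    unfolding q_def using shift [of "h n *\<^sub>R e"] iG by simp
  have "(\<lambda>n. LINT x|lborel. q n x) \<longlonglongrightarrow> (LINT x|lborel. indicator disk x * F' x)"
  proof (rule integral_dominated_convergence [where w = "\<lambda>x. M * indicator (cball 0 2) x"])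
    show "q n \<in> borel_measurable lborel" for n unfolding q_def [abs_def] by measurable
    show "(\<lambda>x. indicator disk x * F' x) \<in> borel_measurable lborel"
      using mF' by (intro borel_measurable_times borel_measurable_indicator) auto
    show "integrable lborel (\<lambda>x::real^2. M * indicator (cball 0 2) x)"
      by (intro integrable_mult_right integrable_real_indicator) (auto simp: emeasure_ball2)
    show "AE x in lborel. norm (q n x) \<le> M * indicator (cball 0 2) x" for n
    proof (rule AE_I2)
      fix x :: "real^2"
      show "norm (q n x) \<le> M * indicator (cball 0 2) x"
      proof (cases "norm x \<le> 2")
        case True
        have "\<bar>G (x + h n *\<^sub>R e) - G x\<bar> \<le> M * h n" using lip [of x "h n"] h [of n] by simp
        then show ?thesis using True h [of n] by (simp add: q_def field_simps)
      next
        case False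
        have "norm x \<le> norm (x + h n *\<^sub>R e) + norm (h n *\<^sub>R e)"
          using norm_triangle_ineq4 [of "x + h n *\<^sub>R e" "h n *\<^sub>R e"] by simp
        then have "1 \<le> norm (x + h n *\<^sub>R e)" using False h [of n] ne by simp
        then show ?thesis using False by (simp add: q_def G0)
      qed
    qed
    have "AE x in lborel. x \<notin> sphere (0::real^2) 1" using sphere_null by (rule AE_not_in)
    then show "AE x in lborel. (\<lambda>n. q n x) \<longlonglongrightarrow> indicator disk x * F' x"
    proof eventually_elim
      case (elim x)
      then have "norm x < 1 \<or> 1 < norm x" by auto
      then show ?case
      proof
        assume x: "norm x < 1"
        have xn: "(\<lambda>n. x + h n *\<^sub>R e) \<longlonglongrightarrow> x" using hlim by (auto intro!: tendsto_eq_intros)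
        have "(\<lambda>s. (F (x + s *\<^sub>R e) - F x) / s) \<midarrow>0\<rightarrow> F' x"
          using dF [OF x] by (simp add: DERIV_def e_def)
        then have "(\<lambda>n. (F (x + h n *\<^sub>R e) - F x) / h n) \<longlonglongrightarrow> F' x"
        proof (rule filterlim_compose)
          show "filterlim h (at 0) sequentially"
            using hlim h(1) by (auto simp: filterlim_at less_imp_neq [symmetric])
        qed
        moreover have "\<forall>\<^sub>F n in sequentially. x + h n *\<^sub>R e \<in> ball 0 1"
          using xn x by (intro topological_tendstoD) auto
        then have "\<forall>\<^sub>F n in sequentially. (F (x + h n *\<^sub>R e) - F x) / h n = q n x"
          by eventually_elim (use x in \<open>auto simp: q_def G_def\<close>)
        ultimately show ?thesis using x by (simp add: Lim_transform_eventually)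
      next
        assume x: "1 < norm x"
        have xn: "(\<lambda>n. x + h n *\<^sub>R e) \<longlonglongrightarrow> x" using hlim by (auto intro!: tendsto_eq_intros)
        have "\<forall>\<^sub>F n in sequentially. x + h n *\<^sub>R e \<in> - cball 0 1"
          using xn x by (intro topological_tendstoD) auto
        then have "\<forall>\<^sub>F n in sequentially. q n x = 0"
          by eventually_elim (use x in \<open>auto simp: q_def G0\<close>)
        then show ?thesis using x by (auto intro: tendsto_eventually)
      qed
    qed
  qed
  then have "(LINT x|lborel. indicator disk x * F' x) = 0" by (simp add: q0 LIMSEQ_const_iff)
  then show ?thesis by (subst integral_ball_lborel) auto
qed

text \<open>Only the pure second derivatives, which make up the Laplacian, are recorded.\<close>

definition has_partials2 :: "(real^2 \<Rightarrow> real) \<Rightarrow> (2 \<Rightarrow> real^2 \<Rightarrow> real) \<Rightarrow> (2 \<Rightarrow> real^2 \<Rightarrow> real) \<Rightarrow> bool" where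
  "has_partials2 U dU ddU \<longleftrightarrow> continuous_on UNIV U \<and>
     (\<forall>k. continuous_on UNIV (dU k) \<and> continuous_on UNIV (ddU k) \<and>
       (\<forall>x. ((\<lambda>s. U (x + s *\<^sub>R axis k 1)) has_real_derivative dU k x) (at 0) \<and>
            ((\<lambda>s. dU k (x + s *\<^sub>R axis k 1)) has_real_derivative ddU k x) (at 0)))"

text \<open>The divergence of \<open>U \<nabla>W - W \<nabla>U\<close> has integral 0, since this field vanishes on the circle.\<close>

lemma green_second_identity:
  assumes U: "has_partials2 U dU ddU" and W: "has_partials2 W dW ddW"
    and b: "\<And>k x. norm x = 1 \<Longrightarrow> U x * dW k x = W x * dU k x"
  shows "(LINT x|lebesgue_on disk. U x * (\<Sum>k\<in>UNIV. ddW k x)) = (LINT x|lebesgue_on disk. W x * (\<Sum>k\<in>UNIV. ddU k x))"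
proof -
  have c: "continuous_on UNIV U" "continuous_on UNIV W" "\<And>k. continuous_on UNIV (dU k)"
    "\<And>k. continuous_on UNIV (dW k)" "\<And>k. continuous_on UNIV (ddU k)" "\<And>k. continuous_on UNIV (ddW k)"
    using U W by (auto simp: has_partials2_def)
  have k: "(LINT x|lebesgue_on disk. U x * ddW k x - W x * ddU k x) = 0" for k
  proof (rule integral_partial_eq_0 [where k = k and F = "\<lambda>x. U x * dW k x - W x * dU k x"])
    show "continuous_on (cball 0 1) (\<lambda>x. U x * dW k x - W x * dU k x)"
      by (intro continuous_intros continuous_on_subset [OF c(1)] continuous_on_subset [OF c(2)]
          continuous_on_subset [OF c(3)] continuous_on_subset [OF c(4)]) auto
    show "continuous_on UNIV (\<lambda>x. U x * ddW k x - W x * ddU k x)"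
      by (intro continuous_intros c)
    fix x :: "real^2"
    have d: "((\<lambda>s. U (x + s *\<^sub>R axis k 1)) has_real_derivative dU k x) (at 0)"
      "((\<lambda>s. dU k (x + s *\<^sub>R axis k 1)) has_real_derivative ddU k x) (at 0)"
      "((\<lambda>s. W (x + s *\<^sub>R axis k 1)) has_real_derivative dW k x) (at 0)"
      "((\<lambda>s. dW k (x + s *\<^sub>R axis k 1)) has_real_derivative ddW k x) (at 0)"
      using U W by (auto simp: has_partials2_def)
    show "((\<lambda>s. U (x + s *\<^sub>R axis k 1) * dW k (x + s *\<^sub>R axis k 1) - W (x + s *\<^sub>R axis k 1) * dU k (x + s *\<^sub>R axis k 1))
      has_real_derivative U x * ddW k x - W x * ddU k x) (at 0)"
      by (rule DERIV_cong [OF DERIV_diff [OF DERIV_mult [OF d(1,4)] DERIV_mult [OF d(3,2)]]]) simp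
  qed (use b in auto)
  have i: "integrable (lebesgue_on disk) (\<lambda>x. U x * ddW k x)" "integrable (lebesgue_on disk) (\<lambda>x. W x * ddU k x)" for k
    by (intro integrable_ball_continuous continuous_intros continuous_on_subset [OF c(1)] continuous_on_subset [OF c(2)]
        continuous_on_subset [OF c(5)] continuous_on_subset [OF c(6)]; simp)+
  have "(LINT x|lebesgue_on disk. U x * ddW k x) = (LINT x|lebesgue_on disk. W x * ddU k x)" for k
    using k [of k] i [of k] by simp
  then show ?thesis by (simp add: sum_distrib_left i Bochner_Integration.integral_sum)
qed

section \<open>The Dirichlet problem for polynomials\<close>

text \<open>A classical solution of the Dirichlet problem that extends smoothly beyond the disk, as all the explicit
  solutions do.\<close>

definition green_pair :: "(real^2 \<Rightarrow> real) \<Rightarrow> (real^2 \<Rightarrow> real) \<Rightarrow> bool" where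
  "green_pair U v \<longleftrightarrow> continuous_on UNIV v \<and> (\<forall>x. norm x = 1 \<longrightarrow> U x = 0) \<and>
     (\<exists>dU ddU. has_partials2 U dU ddU \<and> (\<forall>x. (\<Sum>k\<in>UNIV. ddU k x) = - v x))"

lemma green_pair_contD: "green_pair U v \<Longrightarrow> continuous_on UNIV U" "green_pair U v \<Longrightarrow> continuous_on UNIV v"
  by (auto simp: green_pair_def has_partials2_def)

lemma green_pair_0D: "green_pair U v \<Longrightarrow> norm x = 1 \<Longrightarrow> U x = 0"
  by (auto simp: green_pair_def)

lemma has_partials2D:
  assumes "has_partials2 U dU ddU"
  shows "continuous_on UNIV U" "continuous_on UNIV (dU k)" "continuous_on UNIV (ddU k)"
    "((\<lambda>s. U (x + s *\<^sub>R axis k 1)) has_real_derivative dU k x) (at 0)"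
    "((\<lambda>s. dU k (x + s *\<^sub>R axis k 1)) has_real_derivative ddU k x) (at 0)"
  using assms by (simp_all add: has_partials2_def)

lemma has_partials2_lincomb:
  assumes U: "has_partials2 U dU ddU" and W: "has_partials2 W dW ddW"
  shows "has_partials2 (\<lambda>x. a * U x + b * W x) (\<lambda>k x. a * dU k x + b * dW k x) (\<lambda>k x. a * ddU k x + b * ddW k x)"
  unfolding has_partials2_def
proof (intro conjI allI)
  fix k x
  show "continuous_on UNIV (\<lambda>x. a * U x + b * W x)"
    by (rule continuous_on_add continuous_on_mult_left has_partials2D(1) [OF U] has_partials2D(1) [OF W])+
  show "continuous_on UNIV (\<lambda>x. a * dU k x + b * dW k x)"
    by (rule continuous_on_add continuous_on_mult_left has_partials2D(2) [OF U] has_partials2D(2) [OF W])+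
  show "continuous_on UNIV (\<lambda>x. a * ddU k x + b * ddW k x)"
    by (rule continuous_on_add continuous_on_mult_left has_partials2D(3) [OF U] has_partials2D(3) [OF W])+
  show "((\<lambda>s. a * U (x + s *\<^sub>R axis k 1) + b * W (x + s *\<^sub>R axis k 1)) has_real_derivative a * dU k x + b * dW k x) (at 0)"
    by (rule DERIV_add DERIV_cmult has_partials2D(4) [OF U] has_partials2D(4) [OF W])+
  show "((\<lambda>s. a * dU k (x + s *\<^sub>R axis k 1) + b * dW k (x + s *\<^sub>R axis k 1)) has_real_derivative a * ddU k x + b * ddW k x) (at 0)"
    by (rule DERIV_add DERIV_cmult has_partials2D(5) [OF U] has_partials2D(5) [OF W])+
qed

lemma green_pair_lincomb:
  assumes "green_pair U v" "green_pair W w"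
  shows "green_pair (\<lambda>x. a * U x + b * W x) (\<lambda>x. a * v x + b * w x)"
proof -
  obtain dU ddU where U: "has_partials2 U dU ddU" "\<And>x. (\<Sum>k\<in>UNIV. ddU k x) = - v x"
    using assms(1) by (auto simp: green_pair_def)
  obtain dW ddW where W: "has_partials2 W dW ddW" "\<And>x. (\<Sum>k\<in>UNIV. ddW k x) = - w x"
    using assms(2) by (auto simp: green_pair_def)
  show ?thesis unfolding green_pair_def
  proof (intro conjI exI)
    show "has_partials2 (\<lambda>x. a * U x + b * W x) (\<lambda>k x. a * dU k x + b * dW k x) (\<lambda>k x. a * ddU k x + b * ddW k x)"
      by (rule has_partials2_lincomb [OF U(1) W(1)])
    show "continuous_on UNIV (\<lambda>x. a * v x + b * w x)"
      using assms by (auto simp: green_pair_def intro!: continuous_intros)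
    show "\<forall>x. (\<Sum>k\<in>UNIV. a * ddU k x + b * ddW k x) = - (a * v x + b * w x)"
      by (simp add: sum.distrib sum_distrib_left [symmetric] U W)
    show "\<forall>x. norm x = 1 \<longrightarrow> a * U x + b * W x = 0"
      using assms by (auto simp: green_pair_def)
  qed
qed

lemma green_pair_sym:
  assumes "green_pair U v" "green_pair W w"
  shows "(LINT x|lebesgue_on disk. U x * w x) = (LINT x|lebesgue_on disk. v x * W x)"
proof -
  obtain dU ddU where U: "has_partials2 U dU ddU" "\<And>x. (\<Sum>k\<in>UNIV. ddU k x) = - v x"
    using assms(1) by (auto simp: green_pair_def)
  obtain dW ddW where W: "has_partials2 W dW ddW" "\<And>x. (\<Sum>k\<in>UNIV. ddW k x) = - w x"
    using assms(2) by (auto simp: green_pair_def)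
  have "(LINT x|lebesgue_on disk. U x * (\<Sum>k\<in>UNIV. ddW k x)) = (LINT x|lebesgue_on disk. W x * (\<Sum>k\<in>UNIV. ddU k x))"
    by (rule green_second_identity [OF U(1) W(1)]) (use assms in \<open>auto simp: green_pair_def\<close>)
  then show ?thesis by (simp add: U W mult.commute)
qed

lemma test_function_partials:
  assumes "test_function \<phi>"
  shows "has_partials2 \<phi> (\<lambda>k. partial_deriv k \<phi>) (\<lambda>k. partial_deriv k (partial_deriv k \<phi>))"
proof -
  have s: "continuous_on UNIV (foldr partial_deriv ks \<phi>)"
    "(\<lambda>s. foldr partial_deriv ks \<phi> (x + s *\<^sub>R axis k 1)) differentiable at 0" for ks k x
    using assms by (auto simp: test_function_def smooth_def)
  have d: "((\<lambda>s. foldr partial_deriv ks \<phi> (x + s *\<^sub>R axis k 1)) has_real_derivative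
      partial_deriv k (foldr partial_deriv ks \<phi>) x) (at 0)" for ks k x
    using s(2) unfolding partial_deriv_def
    by (simp add: DERIV_deriv_iff_real_differentiable)
  show ?thesis unfolding has_partials2_def
    using s(1) [of "[]"] s(1) [of "[k]" for k] s(1) [of "[k,k]" for k] d [of "[]"] d [of "[k]" for k] by auto
qed

lemma test_function_zero: "test_function \<phi> \<Longrightarrow> 1 \<le> norm x \<Longrightarrow> \<phi> x = 0"
  by (force simp: test_function_def)

lemma green_pair_dirichlet:
  assumes "green_pair U v"
  shows "dirichlet_solution v (\<lambda>x. if x \<in> disk then U x else 0)"
  unfolding dirichlet_solution_def
proof (intro conjI allI impI)
  have "continuous_on (closure disk) U"
    by (rule continuous_on_subset [OF green_pair_contD(1) [OF assms]]) auto
  then show "continuous_on (closure disk) (\<lambda>x. if x \<in> disk then U x else 0)"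
    by (rule continuous_on_eq) (use green_pair_0D [OF assms] in auto)
  fix \<phi> assume \<phi>: "test_function \<phi>"
  obtain dU ddU where U: "has_partials2 U dU ddU" "\<And>x. (\<Sum>k\<in>UNIV. ddU k x) = - v x"
    using assms by (auto simp: green_pair_def)
  have "(LINT x|lebesgue_on disk. U x * (\<Sum>k\<in>UNIV. partial_deriv k (partial_deriv k \<phi>) x))
      = (LINT x|lebesgue_on disk. \<phi> x * (\<Sum>k\<in>UNIV. ddU k x))"
    by (rule green_second_identity [OF U(1) test_function_partials [OF \<phi>]])
      (use green_pair_0D [OF assms] test_function_zero [OF \<phi>] in auto)
  then have "(LINT x|lebesgue_on disk. U x * (- laplacian \<phi> x)) = (LINT x|lebesgue_on disk. v x * \<phi> x)"
    by (simp add: U laplacian_def mult.commute)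
  moreover have "(LINT x|lebesgue_on disk. (if x \<in> disk then U x else 0) * (- laplacian \<phi> x))
      = (LINT x|lebesgue_on disk. U x * (- laplacian \<phi> x))"
    by (intro Bochner_Integration.integral_cong) auto
  ultimately show "(LINT x|lebesgue_on disk. (if x \<in> disk then U x else 0) * (- laplacian \<phi> x)) = (LINT x|lebesgue_on disk. v x * \<phi> x)"
    by simp
qed auto

definition zc :: "real^2 \<Rightarrow> complex" where "zc x = Complex (x $ 1) (x $ 2)"

text \<open>In polar coordinates this is a function of \<open>r\<close> times a pure oscillation of angular frequency \<open>n\<close>. With the
  factor \<open>r\<^sup>n\<close> split off, a polynomial mode has a polynomial profile \<open>Q\<close>.\<close>

definition mode :: "nat \<Rightarrow> complex \<Rightarrow> (real \<Rightarrow> real) \<Rightarrow> real^2 \<Rightarrow> real" where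
  "mode n c Q x = Q ((norm x)\<^sup>2) * Re (c * zc x ^ n)"

text \<open>The equation \<open>- \<Delta> u = v\<close> for modes \<open>u\<close>, \<open>v\<close> of order \<open>n\<close> with profiles \<open>Q\<close>, \<open>P\<close>, in the variable \<open>s = r\<^sup>2\<close>.\<close>

definition radial_ode :: "nat \<Rightarrow> (real \<Rightarrow> real) \<Rightarrow> (real \<Rightarrow> real) \<Rightarrow> bool" where
  "radial_ode n P Q \<longleftrightarrow> Q 1 = 0 \<and> (\<exists>Q' Q''. continuous_on UNIV Q'' \<and>
     (\<forall>s. (Q has_real_derivative Q' s) (at s) \<and> (Q' has_real_derivative Q'' s) (at s) \<and>
          4 * (s * Q'' s + (real n + 1) * Q' s) = - P s))"

lemma Re_of_real_mult: "Re (of_real r * z) = r * Re z" by simp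

lemma Re_times_Re: "Re a * Re b = Re (a * b / 2) + Re (a * cnj b / 2)"
  by (simp add: diff_divide_distrib add_divide_distrib)

lemma norm_sq_2: "(norm (x::real^2))\<^sup>2 = (x $ 1)\<^sup>2 + (x $ 2)\<^sup>2"
  by (simp add: norm_vec_def L2_set_def sum_2)

lemma norm_zc [simp]: "norm (zc x) = norm x"
  using norm_sq_2 [of x] by (simp add: zc_def cmod_def norm_vec_def L2_set_def sum_2)

lemma zc_cnj: "zc x * cnj (zc x) = of_real ((norm x)\<^sup>2)"
  by (simp add: complex_norm_square [symmetric])

lemma continuous_on_zc [continuous_intros]: "continuous_on S zc"
proof -
  have zc: "zc = (\<lambda>x. of_real (x $ 1) + \<i> * of_real (x $ 2))" by (auto simp: zc_def Complex_eq)
  show ?thesis unfolding zc by (intro continuous_intros)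
qed

lemma continuous_on_mode: "continuous_on UNIV Q \<Longrightarrow> continuous_on UNIV (mode n c Q)"
  unfolding mode_def [abs_def]
  by (rule continuous_on_mult, rule continuous_on_compose2 [of UNIV Q]) (auto intro!: continuous_intros)

definition unit_c :: "2 \<Rightarrow> complex" where "unit_c k = (if k = 1 then 1 else \<i>)"

lemma zc_line: "zc (x + s *\<^sub>R axis k 1) = zc x + of_real s * unit_c k"
  using exhaust_2 [of k] by (auto simp: zc_def unit_c_def axis_def complex_eq_iff)

lemma norm_sq_line: "(norm (x + s *\<^sub>R axis k 1 :: real^2))\<^sup>2 = (norm x)\<^sup>2 + 2 * s * x $ k + s\<^sup>2"
proof -
  have "(x + s *\<^sub>R axis k 1) $ i = x $ i + (if i = k then s else 0)" for i by (simp add: axis_def)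
  moreover have "k = 1 \<or> k = 2" by (rule exhaust_2)
  ultimately show ?thesis unfolding norm_sq_2 by (auto simp: power2_sum)
qed

lemma Re_pow_line_deriv:
  "((\<lambda>s. Re (c * (z + of_real s * w) ^ n)) has_real_derivative Re (c * (of_nat n * z ^ (n - 1) * w))) (at 0)"
proof -
  have l: "((\<lambda>t. z + t * w) has_field_derivative w) (at 0)"
    by (auto intro!: derivative_eq_intros)
  have "((\<lambda>t. c * (z + t * w) ^ n) has_field_derivative c * (of_nat n * z ^ (n - 1) * w)) (at (of_real 0))"
    using DERIV_cmult [OF DERIV_power [OF l, of n], of c] by (simp add: mult_ac)
  from has_field_derivative_Re [OF has_vector_derivative_real_field [OF this]] show ?thesis .
qed

text \<open>If \<open>h\<close> is harmonic and homogeneous of degree \<open>n\<close>, then \<open>\<Delta> (Q(|x|\<^sup>2) h) = 4 (s Q'' + (n + 1) Q') h\<close>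
  with \<open>s = |x|\<^sup>2\<close>.\<close>

lemma green_pair_mode:
  assumes "radial_ode n P Q" shows "green_pair (mode n c Q) (mode n c P)"
proof -
  obtain Q' Q'' where cQ'': "continuous_on UNIV Q''"
    and dQ: "\<And>s. (Q has_real_derivative Q' s) (at s)" and dQ': "\<And>s. (Q' has_real_derivative Q'' s) (at s)"
    and ode: "\<And>s. 4 * (s * Q'' s + (real n + 1) * Q' s) = - P s" and Q1: "Q 1 = 0"
    using assms unfolding radial_ode_def by auto
  have cQ: "continuous_on UNIV Q" "continuous_on UNIV Q'"
    using dQ dQ' by (auto intro!: DERIV_continuous_on)
  have cP: "continuous_on UNIV P"
  proof -
    have "continuous_on UNIV (\<lambda>s. - (4 * (s * Q'' s + (real n + 1) * Q' s)))"
      by (intro continuous_intros cQ cQ'')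
    then show ?thesis by (simp only: ode minus_minus)
  qed
  let ?r = "\<lambda>x::real^2. (norm x)\<^sup>2"
  let ?R = "\<lambda>x. Re (c * zc x ^ n)"
  define A where "A x = c * of_nat n * zc x ^ (n - 1)" for x
  define B where "B x = c * of_nat n * of_nat (n - 1) * zc x ^ (n - 1 - 1)" for x
  let ?R1 = "\<lambda>k x. Re (A x * unit_c k)"
  let ?R2 = "\<lambda>k x. Re (B x * (unit_c k * unit_c k))"
  define dU where "dU k x = Q' (?r x) * (2 * x $ k) * ?R x + Q (?r x) * ?R1 k x" for k x
  define ddU where "ddU k x = (Q'' (?r x) * (2 * x $ k) * (2 * x $ k) + Q' (?r x) * 2) * ?R x
     + 2 * (Q' (?r x) * (2 * x $ k) * ?R1 k x) + Q (?r x) * ?R2 k x" for k x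
  have r: "((\<lambda>s. ?r (x + s *\<^sub>R axis k 1)) has_real_derivative 2 * x $ k) (at 0)" for x k
    unfolding norm_sq_line by (auto intro!: derivative_eq_intros)
  have xk: "((\<lambda>s. 2 * (x + s *\<^sub>R axis k 1) $ k) has_real_derivative 2) (at 0)" for x :: "real^2" and k
    by (auto intro!: derivative_eq_intros simp: axis_def)
  have dr: "((\<lambda>s. q (?r (x + s *\<^sub>R axis k 1))) has_real_derivative q' (?r x) * (2 * x $ k)) (at 0)"
    if "\<And>s. (q has_real_derivative q' s) (at s)" for q q' x k
    using DERIV_chain2 [OF that r, of x k] by simp
  have R: "((\<lambda>s. ?R (x + s *\<^sub>R axis k 1)) has_real_derivative ?R1 k x) (at 0)" for x k
    unfolding zc_line by (rule DERIV_cong [OF Re_pow_line_deriv]) (simp only: A_def mult_ac)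
  have R1: "((\<lambda>s. ?R1 k (x + s *\<^sub>R axis k 1)) has_real_derivative ?R2 k x) (at 0)" for x k
  proof -
    have "((\<lambda>s. Re (c * of_nat n * unit_c k * (zc x + of_real s * unit_c k) ^ (n - 1))) has_real_derivative ?R2 k x) (at 0)"
      by (rule DERIV_cong [OF Re_pow_line_deriv]) (simp only: B_def mult_ac)
    then show ?thesis unfolding zc_line A_def by (simp only: mult_ac)
  qed
  have cA: "continuous_on UNIV A" "continuous_on UNIV B"
    unfolding A_def [abs_def] B_def [abs_def] by (intro continuous_intros)+
  have "has_partials2 (mode n c Q) dU ddU"
    unfolding has_partials2_def
  proof (intro conjI allI)
    show "continuous_on UNIV (mode n c Q)" by (rule continuous_on_mode [OF cQ(1)])
    fix k
    show "continuous_on UNIV (dU k)" "continuous_on UNIV (ddU k)" unfolding dU_def [abs_def] ddU_def [abs_def]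
      by (intro continuous_intros cA continuous_on_compose2 [OF cQ(1)] continuous_on_compose2 [OF cQ(2)]
          continuous_on_compose2 [OF cQ'']; simp)+
    fix x
    show "((\<lambda>s. mode n c Q (x + s *\<^sub>R axis k 1)) has_real_derivative dU k x) (at 0)"
      unfolding mode_def by (rule DERIV_cong [OF DERIV_mult [OF dr [OF dQ] R]]) (simp add: dU_def)
    show "((\<lambda>s. dU k (x + s *\<^sub>R axis k 1)) has_real_derivative ddU k x) (at 0)"
      unfolding dU_def
      by (rule DERIV_cong [OF DERIV_add [OF DERIV_mult [OF DERIV_mult [OF dr [OF dQ'] xk] R] DERIV_mult [OF dr [OF dQ] R1]]])
        (simp add: ddU_def algebra_simps)
  qed
  moreover have "(\<Sum>k\<in>UNIV. ddU k x) = - mode n c P x" for x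
  proof -
    have "?R1 1 x * (x $ 1) + ?R1 2 x * (x $ 2) = Re (A x * zc x)"
      by (simp add: unit_c_def zc_def)
    also have "A x * zc x = of_real (real n) * (c * zc x ^ n)"
      unfolding A_def by (cases n) (simp_all add: mult_ac)
    finally have a: "?R1 1 x * (x $ 1) + ?R1 2 x * (x $ 2) = real n * ?R x"
      by (simp only: Re_of_real_mult)
    have b: "?R2 1 x + ?R2 2 x = 0" by (simp add: unit_c_def)
    have alg: "(q2 * (2 * u) * (2 * u) + q1 * 2) * r + 2 * (q1 * (2 * u) * a1) + q * b1
        + ((q2 * (2 * v) * (2 * v) + q1 * 2) * r + 2 * (q1 * (2 * v) * a2) + q * b2)
        = 4 * q2 * (u\<^sup>2 + v\<^sup>2) * r + 4 * q1 * r + 4 * q1 * (a1 * u + a2 * v) + q * (b1 + b2)"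
      for q2 q1 q u v r a1 a2 b1 b2 :: real
      by (simp add: power2_eq_square algebra_simps)
    have "(\<Sum>k\<in>UNIV. ddU k x) = 4 * Q'' (?r x) * ((x $ 1)\<^sup>2 + (x $ 2)\<^sup>2) * ?R x + 4 * Q' (?r x) * ?R x
        + 4 * Q' (?r x) * (?R1 1 x * (x $ 1) + ?R1 2 x * (x $ 2)) + Q (?r x) * (?R2 1 x + ?R2 2 x)"
      unfolding sum_2 ddU_def by (rule alg)
    also have "\<dots> = 4 * (?r x * Q'' (?r x) + (real n + 1) * Q' (?r x)) * ?R x"
      unfolding a b norm_sq_2 [symmetric] by (simp only: distrib_left distrib_right mult_ac add_ac mult_zero_right add_0_right mult_1_right)
    also have "\<dots> = - mode n c P x" unfolding ode mode_def by simp
    finally show ?thesis .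
  qed
  moreover have "norm x = 1 \<Longrightarrow> mode n c Q x = 0" for x by (simp add: mode_def Q1)
  ultimately show ?thesis unfolding green_pair_def using continuous_on_mode [OF cP] by blast
qed

text \<open>The solution operator of the radial equation: \<open>1 - s\<^bsup>i+1\<^esup>\<close> is mapped by \<open>- 4 (s Q'' + (n + 1) Q')\<close> to
  \<open>4 (i + 1) (i + 1 + n) s\<^sup>i\<close>.\<close>

definition radial_inv :: "nat \<Rightarrow> real poly \<Rightarrow> real poly" where
  "radial_inv n p = (\<Sum>i\<le>degree p. smult (coeff p i / (4 * (real i + 1) * (real i + 1 + real n))) (1 - monom 1 (Suc i)))"

lemma radial_ode_radial_inv: "radial_ode n (poly p) (poly (radial_inv n p))"
proof -
  define b where "b i = coeff p i / (4 * (real i + 1) * (real i + 1 + real n))" for i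
  have Q: "poly (radial_inv n p) = (\<lambda>s. \<Sum>i\<le>degree p. b i * (1 - s ^ Suc i))"
    by (rule ext) (simp add: radial_inv_def poly_sum poly_monom b_def)
  show ?thesis unfolding radial_ode_def
  proof (intro conjI exI allI)
    show "poly (radial_inv n p) 1 = 0" by (simp add: Q)
    fix s :: real
    show "(poly (radial_inv n p) has_real_derivative (\<Sum>i\<le>degree p. b i * - (real (Suc i) * s ^ i))) (at s)"
      unfolding Q
    proof (rule DERIV_sum)
      fix i
      show "((\<lambda>s. b i * (1 - s ^ Suc i)) has_real_derivative b i * - (real (Suc i) * s ^ i)) (at s)"
        using DERIV_cmult [OF DERIV_diff [OF DERIV_const DERIV_pow [of "Suc i" s]], of "b i" 1] by simp
    qed
    show "((\<lambda>s. \<Sum>i\<le>degree p. b i * - (real (Suc i) * s ^ i)) has_real_derivative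
        (\<Sum>i\<le>degree p. b i * - (real (Suc i) * (real i * s ^ (i - 1))))) (at s)"
    proof (rule DERIV_sum)
      fix i
      show "((\<lambda>s. b i * - (real (Suc i) * s ^ i)) has_real_derivative b i * - (real (Suc i) * (real i * s ^ (i - 1)))) (at s)"
        using DERIV_cmult [OF DERIV_pow [of i s], of "b i * - real (Suc i)"] by (simp add: mult_ac del: of_nat_Suc)
    qed
    show "continuous_on UNIV (\<lambda>s. \<Sum>i\<le>degree p. b i * - (real (Suc i) * (real i * s ^ (i - 1))))"
      by (intro continuous_intros)
    let ?A = "\<lambda>i. b i * - (real (Suc i) * (real i * s ^ (i - 1)))" and ?B = "\<lambda>i. b i * - (real (Suc i) * s ^ i)"
    have e: "4 * (s * ?A i + (real n + 1) * ?B i) = - (coeff p i * s ^ i)" for i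
    proof -
      have e1: "real i * (s * s ^ (i - 1)) = real i * s ^ i" by (cases i) auto
      have alg: "4 * (s * (b * - ((1 + r) * (r * T))) + (m + 1) * (b * - ((1 + r) * S)))
         = - (4 * b * (r + 1)) * (r * (s * T) + (m + 1) * S)" for b r T S m :: real
        by (simp add: algebra_simps)
      have e2: "4 * (s * ?A i + (real n + 1) * ?B i)
         = - (4 * b i * (real i + 1)) * (real i * (s * s ^ (i - 1)) + (real n + 1) * s ^ i)"
        unfolding of_nat_Suc by (rule alg)
      have e3: "coeff p i = 4 * b i * (real i + 1) * (real i + 1 + real n)"
      proof -
        have nz: "4 * (real i + 1) * (real i + 1 + real n) \<noteq> 0" by simp
        have "b i * (4 * (real i + 1) * (real i + 1 + real n)) = coeff p i"
          using b_def [of i] nonzero_eq_divide_eq [OF nz] by blast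
        then show ?thesis by (simp only: mult_ac)
      qed
      show ?thesis unfolding e2 e1 e3 by (simp add: algebra_simps)
    qed
    have "4 * (s * sum ?A {..degree p} + (real n + 1) * sum ?B {..degree p})
        = (\<Sum>i\<le>degree p. 4 * (s * ?A i + (real n + 1) * ?B i))"
      by (simp only: distrib_left sum_distrib_left sum.distrib)
    also have "\<dots> = - poly p s" unfolding e poly_altdef by (rule sum_negf)
    finally show "4 * (s * sum ?A {..degree p} + (real n + 1) * sum ?B {..degree p}) = - poly p s" .
  qed
qed

text \<open>These are the real polynomials in the two coordinates, organised by angular frequency.\<close>

inductive mode_sum :: "(real^2 \<Rightarrow> real) \<Rightarrow> bool" where
  mode: "mode_sum (mode n c (\<lambda>s. s ^ m))"
| add: "mode_sum f \<Longrightarrow> mode_sum g \<Longrightarrow> mode_sum (\<lambda>x. f x + g x)"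

text \<open>Collecting factors \<open>z * cnj z = |x|\<^sup>2\<close> leaves a pure power of \<open>z\<close> or of its conjugate.\<close>

lemma mode_sum_monom: "mode_sum (\<lambda>x. Re (c * zc x ^ a * cnj (zc x) ^ b))"
proof (cases "b \<le> a")
  case True
  then obtain d where a: "a = b + d" by (metis le_Suc_ex)
  have "(\<lambda>x. Re (c * zc x ^ a * cnj (zc x) ^ b)) = mode d c (\<lambda>s. s ^ b)"
  proof
    fix x
    have "c * zc x ^ a * cnj (zc x) ^ b = c * zc x ^ d * (zc x * cnj (zc x)) ^ b"
      by (simp add: a power_add power_mult_distrib mult_ac)
    also have "\<dots> = of_real (((norm x)\<^sup>2) ^ b) * (c * zc x ^ d)"
      unfolding zc_cnj by (simp add: mult_ac)
    finally show "Re (c * zc x ^ a * cnj (zc x) ^ b) = mode d c (\<lambda>s. s ^ b) x"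
      by (simp only: Re_of_real_mult mode_def)
  qed
  then show ?thesis by (simp add: mode_sum.mode)
next
  case False
  then obtain d where b: "b = a + d" by (metis le_Suc_ex nat_le_linear)
  have "(\<lambda>x. Re (c * zc x ^ a * cnj (zc x) ^ b)) = mode d (cnj c) (\<lambda>s. s ^ a)"
  proof
    fix x
    have "c * zc x ^ a * cnj (zc x) ^ b = c * cnj (zc x) ^ d * (zc x * cnj (zc x)) ^ a"
      by (simp add: b power_add power_mult_distrib mult_ac)
    also have "\<dots> = of_real (((norm x)\<^sup>2) ^ a) * cnj (cnj c * zc x ^ d)"
      unfolding zc_cnj by (simp add: mult_ac)
    finally show "Re (c * zc x ^ a * cnj (zc x) ^ b) = mode d (cnj c) (\<lambda>s. s ^ a) x"
      by (simp only: Re_of_real_mult mode_def cnj.sel)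
  qed
  then show ?thesis by (simp add: mode_sum.mode)
qed

lemma mode_is_monom: "mode n c (\<lambda>s. s ^ m) x = Re (c * zc x ^ (n + m) * cnj (zc x) ^ m)"
proof -
  have "c * zc x ^ (n + m) * cnj (zc x) ^ m = c * zc x ^ n * (zc x * cnj (zc x)) ^ m"
    by (simp add: power_add power_mult_distrib mult_ac)
  also have "\<dots> = of_real (((norm x)\<^sup>2) ^ m) * (c * zc x ^ n)"
    unfolding zc_cnj by (simp add: mult_ac)
  finally show ?thesis by (simp only: Re_of_real_mult mode_def)
qed

lemma mode_sum_mult:
  assumes "mode_sum f" "mode_sum g" shows "mode_sum (\<lambda>x. f x * g x)"
  using assms
proof (induction arbitrary: g)
  case (mode n c m)
  from mode show ?case
  proof (induction g)
    case (mode n' c' m')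
    let ?a = "\<lambda>x. c * zc x ^ (n + m) * cnj (zc x) ^ m" and ?b = "\<lambda>x. c' * zc x ^ (n' + m') * cnj (zc x) ^ m'"
    have "mode n c (\<lambda>s. s ^ m) x * mode n' c' (\<lambda>s. s ^ m') x
      = Re ((c * c' / 2) * zc x ^ (n + m + (n' + m')) * cnj (zc x) ^ (m + m'))
      + Re ((c * cnj c' / 2) * zc x ^ (n + m + m') * cnj (zc x) ^ (m + (n' + m')))" for x
    proof -
      have "Re (?a x) * Re (?b x) = Re (?a x * ?b x / 2) + Re (?a x * cnj (?b x) / 2)"
        by (rule Re_times_Re)
      also have "?a x * ?b x / 2 = (c * c' / 2) * zc x ^ (n + m + (n' + m')) * cnj (zc x) ^ (m + m')"
        by (simp add: power_add mult_ac)
      also have "?a x * cnj (?b x) / 2 = (c * cnj c' / 2) * zc x ^ (n + m + m') * cnj (zc x) ^ (m + (n' + m'))"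
        by (simp add: power_add mult_ac)
      finally show ?thesis unfolding mode_is_monom .
    qed
    then show ?case by (simp only: mode_sum.add [OF mode_sum_monom mode_sum_monom])
  next
    case (add g1 g2)
    then show ?case by (simp add: distrib_left mode_sum.add)
  qed
next
  case (add f1 f2)
  then show ?case by (simp add: distrib_right mode_sum.add)
qed

lemma polynomial_imp_mode_sum:
  assumes "real_polynomial_function f" shows "mode_sum f"
  using assms
proof (induction f)
  case (linear f)
  have "f x = Re (Complex (f (axis 1 1)) (- f (axis 2 1)) * zc x ^ 1 * cnj (zc x) ^ 0)" for x
  proof -
    have "x = x $ 1 *\<^sub>R axis 1 1 + x $ 2 *\<^sub>R axis 2 1"
      by (simp add: vec_eq_iff forall_2 axis_def)
    moreover have l: "linear f" using linear by (rule bounded_linear.linear)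
    have "f (x $ 1 *\<^sub>R axis 1 1 + x $ 2 *\<^sub>R axis 2 1) = x $ 1 * f (axis 1 1) + x $ 2 * f (axis 2 1)"
      by (simp add: linear_add [OF l] linear_scale [OF l])
    ultimately have "f x = x $ 1 * f (axis 1 1) + x $ 2 * f (axis 2 1)" by simp
    then show ?thesis by (simp add: zc_def mult.commute)
  qed
  then have "f = (\<lambda>x. Re (Complex (f (axis 1 1)) (- f (axis 2 1)) * zc x ^ 1 * cnj (zc x) ^ 0))" by (rule ext)
  then show ?case using mode_sum_monom [of "Complex (f (axis 1 1)) (- f (axis 2 1))" 1 0] by simp
next
  case (const c)
  show ?case using mode_sum_monom [of "of_real c" 0 0] by simp
qed (auto intro: mode_sum.add mode_sum_mult)

lemma mode_sum_green_pair:
  assumes "mode_sum f" shows "\<exists>U. green_pair U f"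
  using assms
proof induction
  case (mode n c m)
  have "poly (monom 1 m) = (\<lambda>s::real. s ^ m)" by (auto simp: poly_monom)
  then show ?case using green_pair_mode [OF radial_ode_radial_inv [of n "monom 1 m"]] by auto
next
  case (add f g)
  then obtain U W where "green_pair U f" "green_pair W g" by auto
  from green_pair_lincomb [OF this, of 1 1] show ?case by auto
qed

section \<open>Weakly harmonic functions\<close>

text \<open>Derivatives of \<open>exp (- 1 / t)\<close> are linear combinations of these functions, so a class of functions that
  contains all of them can be closed under differentiation.\<close>

definition bump :: "nat \<Rightarrow> real \<Rightarrow> real" where
  "bump n t = (if 0 < t then exp (- 1 / t) / t ^ n else 0)"

lemma bump_tendsto_0: "bump n \<midarrow>0\<rightarrow> 0"
proof -
  have "((\<lambda>t. (inverse t) ^ n / exp (inverse t)) \<longlongrightarrow> (0::real)) (at_right 0)"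
    by (rule filterlim_compose [OF tendsto_power_div_exp_0 filterlim_inverse_at_top_right])
  moreover have "\<forall>\<^sub>F t in at_right 0. (inverse t) ^ n / exp (inverse t) = bump n t"
    using eventually_at_right_less [of 0]
    by eventually_elim (simp add: bump_def exp_minus field_simps power_inverse)
  ultimately have "(bump n \<longlongrightarrow> 0) (at_right 0)" by (rule Lim_transform_eventually)
  moreover have "(bump n \<longlongrightarrow> 0) (at_left 0)"
  proof (rule tendsto_eventually)
    have "\<forall>\<^sub>F t in at_left (0::real). t < 0" by (simp add: eventually_at_filter)
    then show "\<forall>\<^sub>F t in at_left 0. bump n t = 0" by eventually_elim (simp add: bump_def)
  qed
  ultimately show ?thesis by (rule filterlim_split_at [rotated])
qed

lemma bump_deriv: "(bump n has_real_derivative bump (n + 2) t - real n * bump (n + 1) t) (at t)"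
proof -
  consider "0 < t" | "t < 0" | "t = 0" by linarith
  then show ?thesis
  proof cases
    case 1
    have d: "((\<lambda>t. exp (- 1 / t) / t ^ n) has_real_derivative
        (exp (- 1 / t) * (1 / t\<^sup>2) * t ^ n - exp (- 1 / t) * (real n * t ^ (n - 1))) / (t ^ n * t ^ n)) (at t)"
      using 1 by (auto intro!: derivative_eq_intros simp: power2_eq_square)
    have "(exp (- 1 / t) * (1 / t\<^sup>2) * t ^ n - exp (- 1 / t) * (real n * t ^ (n - 1))) / (t ^ n * t ^ n)
        = bump (n + 2) t - real n * bump (n + 1) t"
    proof -
      show ?thesis using 1 by (cases n) (simp_all add: bump_def power_add power2_eq_square field_simps)
    qed
    moreover have "\<forall>\<^sub>F u in nhds t. exp (- 1 / u) / u ^ n = bump n u"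
      using eventually_nhds_in_open [of "{0<..}" t] 1
      by (auto simp: bump_def elim!: eventually_mono)
    ultimately show ?thesis using DERIV_cong_ev [OF refl _ refl] d by fastforce
  next
    case 2
    have "\<forall>\<^sub>F u in nhds t. 0 = bump n u"
      using eventually_nhds_in_open [of "{..<0}" t] 2
      by (auto simp: bump_def elim!: eventually_mono)
    then have "(bump n has_real_derivative 0) (at t)"
      using DERIV_cong_ev [OF refl _ refl, of "\<lambda>u. 0" "bump n" t 0] by simp
    moreover have "bump (n + 2) t = 0" "bump (n + 1) t = 0" using 2 by (simp_all add: bump_def)
    ultimately show ?thesis by simp
  next
    case 3
    have "(bump n (0 + h) - bump n 0) / h = bump (n + 1) h" for h by (simp add: bump_def)
    then have "(\<lambda>h. (bump n (0 + h) - bump n 0) / h) \<midarrow>0\<rightarrow> 0" using bump_tendsto_0 by simp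
    then show ?thesis using 3 by (simp add: DERIV_def bump_def)
  qed
qed

text \<open>Syntactic closure makes smoothness a simple induction: partial derivatives of members are members.\<close>

inductive smooth_term :: "(real^2 \<Rightarrow> real) \<Rightarrow> bool" where
  const: "smooth_term (\<lambda>x. c)"
| coord: "smooth_term (\<lambda>x. x $ k)"
| add: "smooth_term f \<Longrightarrow> smooth_term g \<Longrightarrow> smooth_term (\<lambda>x. f x + g x)"
| mult: "smooth_term f \<Longrightarrow> smooth_term g \<Longrightarrow> smooth_term (\<lambda>x. f x * g x)"
| bump: "smooth_term f \<Longrightarrow> smooth_term (\<lambda>x. bump n (f x))"

lemma smooth_term_continuous: "smooth_term f \<Longrightarrow> continuous_on UNIV f"
proof (induction rule: smooth_term.induct)
  case (bump f n)
  have "continuous_on UNIV (bump n)"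
    by (rule DERIV_continuous_on) (rule bump_deriv)
  from continuous_on_compose2 [OF this bump.IH] show ?case by simp
qed (auto intro!: continuous_intros)

lemma smooth_term_partial:
  assumes "smooth_term f"
  shows "\<exists>g. smooth_term g \<and> (\<forall>x. ((\<lambda>s. f (x + s *\<^sub>R axis k 1)) has_real_derivative g x) (at 0))"
  using assms
proof (induction rule: smooth_term.induct)
  case (const c)
  show ?case by (intro exI [of _ "\<lambda>x. 0"]) (auto intro: smooth_term.const)
next
  case (coord i)
  have "((\<lambda>s. (x + s *\<^sub>R axis k 1) $ i) has_real_derivative (axis k 1 :: real^2) $ i) (at 0)" for x
    by (auto intro!: derivative_eq_intros)
  then show ?case using smooth_term.const by blast
next
  case (add f g)
  then obtain f' g' where "smooth_term f'" "smooth_term g'"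
    and d: "\<And>x. ((\<lambda>s. f (x + s *\<^sub>R axis k 1)) has_real_derivative f' x) (at 0)"
      "\<And>x. ((\<lambda>s. g (x + s *\<^sub>R axis k 1)) has_real_derivative g' x) (at 0)" by blast
  then show ?case
    by (intro exI [of _ "\<lambda>x. f' x + g' x"] conjI allI DERIV_add smooth_term.add) auto
next
  case (mult f g)
  then obtain f' g' where s: "smooth_term f'" "smooth_term g'"
    and d: "\<And>x. ((\<lambda>s. f (x + s *\<^sub>R axis k 1)) has_real_derivative f' x) (at 0)"
      "\<And>x. ((\<lambda>s. g (x + s *\<^sub>R axis k 1)) has_real_derivative g' x) (at 0)" by blast
  have "((\<lambda>s. f (x + s *\<^sub>R axis k 1) * g (x + s *\<^sub>R axis k 1)) has_real_derivative f' x * g x + g' x * f x) (at 0)" for x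
    using DERIV_mult [OF d(1) d(2), of x x] by simp
  moreover have "smooth_term (\<lambda>x. f' x * g x + g' x * f x)"
    by (intro smooth_term.intros s mult.hyps)
  ultimately show ?case by blast
next
  case (bump f n)
  then obtain f' where s: "smooth_term f'"
    and d: "\<And>x. ((\<lambda>s. f (x + s *\<^sub>R axis k 1)) has_real_derivative f' x) (at 0)" by blast
  have "((\<lambda>s. bump n (f (x + s *\<^sub>R axis k 1))) has_real_derivative
     (bump (n + 2) (f x) + (- real n) * bump (n + 1) (f x)) * f' x) (at 0)" for x
    using DERIV_chain2 [OF bump_deriv d, of n x] by simp
  moreover have "smooth_term (\<lambda>x. (bump (n + 2) (f x) + (- real n) * bump (n + 1) (f x)) * f' x)"
    by (intro smooth_term.intros s bump.hyps)
  ultimately show ?case by blast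
qed

lemma smooth_term_partial_deriv:
  assumes "smooth_term f"
  shows "smooth_term (partial_deriv k f)"
    "((\<lambda>s. f (x + s *\<^sub>R axis k 1)) has_real_derivative partial_deriv k f x) (at 0)"
proof -
  obtain g where g: "smooth_term g" "\<And>x. ((\<lambda>s. f (x + s *\<^sub>R axis k 1)) has_real_derivative g x) (at 0)"
    using smooth_term_partial [OF assms, of k] by blast
  have "partial_deriv k f = g"
    by (rule ext) (simp add: partial_deriv_def DERIV_imp_deriv [OF g(2)])
  then show "smooth_term (partial_deriv k f)"
    "((\<lambda>s. f (x + s *\<^sub>R axis k 1)) has_real_derivative partial_deriv k f x) (at 0)" using g by auto
qed

lemma smooth_term_smooth: assumes "smooth_term f" shows "smooth f"
proof -
  have "smooth_term (foldr partial_deriv ks f)" for ks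
    by (induction ks) (auto simp: assms smooth_term_partial_deriv)
  then show ?thesis unfolding smooth_def
    using smooth_term_continuous smooth_term_partial_deriv(2) real_differentiable_def by blast
qed

lemma smooth_term_partials2:
  "smooth_term f \<Longrightarrow> has_partials2 f (\<lambda>k. partial_deriv k f) (\<lambda>k. partial_deriv k (partial_deriv k f))"
  unfolding has_partials2_def
  by (intro conjI allI smooth_term_continuous smooth_term_partial_deriv) auto

lemma smooth_term_sum:
  assumes "\<And>i. i \<in> I \<Longrightarrow> smooth_term (f i)" shows "smooth_term (\<lambda>x. \<Sum>i\<in>I. f i x)"
  using assms by (induction I rule: infinite_finite_induct) (auto intro: smooth_term.intros)

lemma smooth_term_power: "smooth_term f \<Longrightarrow> smooth_term (\<lambda>x. f x ^ m)"
  by (induction m) (auto intro: smooth_term.intros)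

lemma smooth_term_norm_sq: "smooth_term (\<lambda>x. (norm x)\<^sup>2)"
  unfolding norm_sq_2 by (intro smooth_term.intros smooth_term_power)

lemma smooth_term_Re_pow: "smooth_term (\<lambda>x. Re (c * zc x ^ n))"
proof (induction n arbitrary: c)
  case 0 show ?case by (simp add: smooth_term.const)
next
  case (Suc n)
  have "Re (c * zc x ^ Suc n) = x $ 1 * Re (c * zc x ^ n) + x $ 2 * Re ((c * \<i>) * zc x ^ n)" for x
  proof -
    have "zc x = of_real (x $ 1) + \<i> * of_real (x $ 2)" by (simp add: zc_def Complex_eq)
    then have "c * zc x ^ Suc n = of_real (x $ 1) * (c * zc x ^ n) + of_real (x $ 2) * ((c * \<i>) * zc x ^ n)"
      by (simp add: algebra_simps)
    then show ?thesis by (simp only: plus_complex.sel Re_of_real_mult)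
  qed
  then show ?case by (simp only:) (intro smooth_term.intros Suc)
qed

text \<open>\<open>cutoff e\<close> vanishes below \<open>e\<close> and is close to the identity above; its second derivative is nonnegative and
  has integral at most 1.\<close>

definition cutoff :: "real \<Rightarrow> real \<Rightarrow> real" where "cutoff e t = (t - e) * bump 0 ((t - e) / e)"
definition cutoff' :: "real \<Rightarrow> real \<Rightarrow> real" where "cutoff' e t = bump 0 ((t - e) / e) + bump 1 ((t - e) / e)"
definition cutoff'' :: "real \<Rightarrow> real \<Rightarrow> real" where "cutoff'' e t = bump 3 ((t - e) / e) / e"

lemma bump_Suc: "t * bump (Suc n) t = bump n t"
  by (simp add: bump_def)

lemma cutoff_deriv:
  assumes "0 < e"
  shows "(cutoff e has_real_derivative cutoff' e t) (at t)" "(cutoff' e has_real_derivative cutoff'' e t) (at t)"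
proof -
  have l: "((\<lambda>t. (t - e) / e) has_real_derivative 1 / e) (at t)"
    using assms by (auto intro!: derivative_eq_intros)
  have b: "((\<lambda>t. bump n ((t - e) / e)) has_real_derivative
     (bump (n + 2) ((t - e) / e) - real n * bump (n + 1) ((t - e) / e)) * (1 / e)) (at t)" for n
    by (rule DERIV_chain2 [OF bump_deriv l])
  have m: "((\<lambda>t. t - e) has_real_derivative 1) (at t)" by (auto intro!: derivative_eq_intros)
  have "((\<lambda>t. (t - e) * bump 0 ((t - e) / e)) has_real_derivative
     1 * bump 0 ((t - e) / e) + ((bump (0 + 2) ((t - e) / e) - real 0 * bump (0 + 1) ((t - e) / e)) * (1 / e)) * (t - e)) (at t)"
    by (rule DERIV_mult [OF m b])
  moreover have "(t - e) * bump (Suc (Suc 0)) ((t - e) / e) / e = bump (Suc 0) ((t - e) / e)"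
    using bump_Suc [of "(t - e) / e" 1] by simp
  ultimately show "(cutoff e has_real_derivative cutoff' e t) (at t)"
    unfolding cutoff_def cutoff'_def by (simp add: mult_ac)
  have "((\<lambda>t. bump 0 ((t - e) / e) + bump 1 ((t - e) / e)) has_real_derivative
      (bump (0 + 2) ((t - e) / e) - real 0 * bump (0 + 1) ((t - e) / e)) * (1 / e)
      + (bump (1 + 2) ((t - e) / e) - real 1 * bump (1 + 1) ((t - e) / e)) * (1 / e)) (at t)"
    by (rule DERIV_add [OF b b])
  then show "(cutoff' e has_real_derivative cutoff'' e t) (at t)"
    unfolding cutoff'_def cutoff''_def by (rule DERIV_cong) (simp add: numeral_3_eq_3 diff_divide_distrib)
qed

lemma cutoff_zero: "0 < e \<Longrightarrow> t \<le> e \<Longrightarrow> cutoff e t = 0" "0 < e \<Longrightarrow> t \<le> e \<Longrightarrow> cutoff' e t = 0"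
  by (auto simp: cutoff_def cutoff'_def bump_def zero_less_divide_iff)

lemma cutoff_bounds:
  assumes e: "0 < e"
  shows "0 \<le> t \<Longrightarrow> \<bar>cutoff e t\<bar> \<le> t" "0 \<le> cutoff' e t" "cutoff' e t \<le> 1" "0 \<le> cutoff'' e t"
    "e < d \<Longrightarrow> d \<le> t \<Longrightarrow> cutoff'' e t \<le> e\<^sup>2 / (d - e) ^ 3"
proof -
  let ?s = "(t - e) / e"
  show "\<bar>cutoff e t\<bar> \<le> t" if "0 \<le> t"
  proof (cases "t \<le> e")
    case False
    have "bump 0 s \<le> 1" "0 \<le> bump 0 s" for s by (auto simp: bump_def)
    then have "\<bar>cutoff e t\<bar> \<le> (t - e) * 1" unfolding cutoff_def abs_mult using False
      by (intro mult_mono) auto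
    then show ?thesis using e by simp
  qed (use that e in \<open>simp add: cutoff_zero\<close>)
  have bn: "0 \<le> bump n s" for n s by (simp add: bump_def)
  show "0 \<le> cutoff' e t" "0 \<le> cutoff'' e t" using e bn by (auto simp: cutoff'_def cutoff''_def)
  show "cutoff' e t \<le> 1"
  proof (cases "t \<le> e")
    case False
    then have s: "0 < ?s" using e by simp
    have "1 + 1 / ?s \<le> exp (1 / ?s)" by (rule exp_ge_add_one_self)
    then have "(1 + 1 / ?s) * exp (- 1 / ?s) \<le> exp (1 / ?s) * exp (- 1 / ?s)" by (intro mult_right_mono) auto
    also have "\<dots> = 1" by (simp add: exp_minus)
    finally show ?thesis using s by (simp add: cutoff'_def bump_def algebra_simps)
  qed (use e in \<open>simp add: cutoff_zero\<close>)
  show "cutoff'' e t \<le> e\<^sup>2 / (d - e) ^ 3" if d: "e < d" "d \<le> t"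
  proof -
    have s: "0 < ?s" using d e by simp
    have "exp (- 1 / u) \<le> 1" if "0 < u" for u :: real using that by simp
    from this [OF s] have "exp (- 1 / ?s) \<le> 1" .
    then have "cutoff'' e t \<le> 1 / ?s ^ 3 / e" using s e
      unfolding cutoff''_def bump_def by (simp add: divide_right_mono)
    also have "\<dots> = e\<^sup>2 / (t - e) ^ 3" using e by (simp add: power_divide power2_eq_square power3_eq_cube)
    also have "\<dots> \<le> e\<^sup>2 / (d - e) ^ 3" using d e by (intro divide_left_mono power_mono mult_pos_pos) auto
    finally show ?thesis .
  qed
qed

lemma cutoff_tendsto:
  assumes "0 < t" "e \<longlonglongrightarrow> 0" "\<And>n. 0 < e n"
  shows "(\<lambda>n. cutoff (e n) t) \<longlonglongrightarrow> t" "(\<lambda>n. cutoff' (e n) t) \<longlonglongrightarrow> 1"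
proof -
  have ev: "\<forall>\<^sub>F n in sequentially. e n < t" using assms(1,2) by (auto dest: order_tendstoD(2))
  have l: "(\<lambda>n. e n / (t - e n)) \<longlonglongrightarrow> 0"
    using tendsto_divide [OF assms(2) tendsto_diff [OF tendsto_const assms(2)], of t] assms(1) by simp
  have "(\<lambda>n. (t - e n) * exp (- (e n / (t - e n)))) \<longlonglongrightarrow> t"
    using tendsto_mult [OF tendsto_diff [OF tendsto_const assms(2)] tendsto_exp [OF tendsto_minus [OF l]], of t] by simp
  moreover have "\<forall>\<^sub>F n in sequentially. (t - e n) * exp (- (e n / (t - e n))) = cutoff (e n) t"
    using ev by eventually_elim (use assms(3) in \<open>auto simp: cutoff_def bump_def\<close>)
  ultimately show "(\<lambda>n. cutoff (e n) t) \<longlonglongrightarrow> t" by (rule Lim_transform_eventually)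
  have "(\<lambda>n. (1 + e n / (t - e n)) * exp (- (e n / (t - e n)))) \<longlonglongrightarrow> 1"
    using tendsto_mult [OF tendsto_add [OF tendsto_const l] tendsto_exp [OF tendsto_minus [OF l]], of 1] by simp
  moreover have "\<forall>\<^sub>F n in sequentially. (1 + e n / (t - e n)) * exp (- (e n / (t - e n))) = cutoff' (e n) t"
    using ev by eventually_elim (use assms(3) in \<open>auto simp: cutoff'_def bump_def algebra_simps\<close>)
  ultimately show "(\<lambda>n. cutoff' (e n) t) \<longlonglongrightarrow> 1" by (rule Lim_transform_eventually)
qed

text \<open>The test functions \<open>cutoff e (1 - |x|\<^sup>2) * q\<close> approximate \<open>(1 - |x|\<^sup>2) * q\<close>. The only term in the
  Laplacian that does not converge dominatedly carries the factor \<open>cutoff''\<close>, which concentrates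
  at the boundary, where \<open>w\<close> vanishes.\<close>

lemma weakly_harmonic_orthogonal:
  assumes cw: "continuous_on (cball 0 1) w" and w0: "\<And>x. norm x = 1 \<Longrightarrow> w x = 0"
    and weak: "\<And>\<phi>. test_function \<phi> \<Longrightarrow> (LINT x|lebesgue_on disk. w x * laplacian \<phi> x) = 0"
    and q: "smooth_term q"
    and W: "green_pair (\<lambda>x. (1 - (norm x)\<^sup>2) * q x) v"
  shows "(LINT x|lebesgue_on disk. w x * v x) = 0"
proof -
  define dq where "dq k = partial_deriv k q" for k
  define ddq where "ddq k = partial_deriv k (partial_deriv k q)" for k
  have pq: "has_partials2 q dq ddq" using smooth_term_partials2 [OF q] by (simp add: dq_def [abs_def] ddq_def [abs_def])
  note dqD = has_partials2D [OF pq]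
  \<comment> \<open>The Laplacian of \<open>F(V) * q\<close> is \<open>F''(V) * 4 |x|\<^sup>2 q + F'(V) * A + F(V) * B\<close>; \<open>H\<close> is \<open>w\<close> times the first coefficient.\<close>
  define V :: "real^2 \<Rightarrow> real" where "V x = 1 - (norm x)\<^sup>2" for x
  define A where "A x = - 4 * q x - 4 * (\<Sum>k\<in>UNIV. x $ k * dq k x)" for x
  define B where "B x = (\<Sum>k\<in>UNIV. ddq k x)" for x
  define H where "H x = w x * (4 * (norm x)\<^sup>2 * q x)" for x
  have dV: "((\<lambda>s. V (x + s *\<^sub>R axis k 1)) has_real_derivative - 2 * x $ k) (at 0)" for x k
    unfolding V_def norm_sq_line by (auto intro!: derivative_eq_intros)
  have dxk: "((\<lambda>s. - 2 * (x + s *\<^sub>R axis k 1) $ k) has_real_derivative - 2) (at 0)" for x :: "real^2" and k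
    by (auto intro!: derivative_eq_intros simp: axis_def)
  have lap: "((\<lambda>s. F (V (x + s *\<^sub>R axis k 1)) * q (x + s *\<^sub>R axis k 1)) has_real_derivative
        F' (V x) * (- 2 * x $ k) * q x + F (V x) * dq k x) (at 0)" (is ?d1)
    "((\<lambda>s. F' (V (x + s *\<^sub>R axis k 1)) * (- 2 * (x + s *\<^sub>R axis k 1) $ k) * q (x + s *\<^sub>R axis k 1)
         + F (V (x + s *\<^sub>R axis k 1)) * dq k (x + s *\<^sub>R axis k 1)) has_real_derivative
      F'' (V x) * (4 * (x $ k)\<^sup>2 * q x) + F' (V x) * (- 2 * q x - 4 * x $ k * dq k x) + F (V x) * ddq k x) (at 0)" (is ?d2)
    if F: "\<And>t. (F has_real_derivative F' t) (at t)" "\<And>t. (F' has_real_derivative F'' t) (at t)" for F F' F'' k x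
  proof -
    have c: "((\<lambda>s. F (V (x + s *\<^sub>R axis k 1))) has_real_derivative F' (V x) * (- 2 * x $ k)) (at 0)"
      "((\<lambda>s. F' (V (x + s *\<^sub>R axis k 1))) has_real_derivative F'' (V x) * (- 2 * x $ k)) (at 0)"
      using DERIV_chain2 [OF F(1) dV, of x k] DERIV_chain2 [OF F(2) dV, of x k] by simp_all
    show ?d1 by (rule DERIV_cong [OF DERIV_mult [OF c(1) dqD(4)]]) simp
    show ?d2
      by (rule DERIV_cong [OF DERIV_add [OF DERIV_mult [OF DERIV_mult [OF c(2) dxk] dqD(4)] DERIV_mult [OF c(1) dqD(5)]]])
        (simp add: algebra_simps power2_eq_square)
  qed
  have sumlap: "(\<Sum>k\<in>UNIV. a * (4 * (x $ k)\<^sup>2 * q x) + b * (- 2 * q x - 4 * x $ k * dq k x) + c * ddq k x)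
      = a * (4 * (norm x)\<^sup>2 * q x) + b * A x + c * B x" for a b c x
    unfolding A_def B_def norm_sq_2 sum_2 by (simp add: algebra_simps)
  have v: "v x = - (A x + V x * B x)" for x
  proof -
    obtain dU ddU where U: "has_partials2 (\<lambda>x. (1 - (norm x)\<^sup>2) * q x) dU ddU" "\<And>x. (\<Sum>k\<in>UNIV. ddU k x) = - v x"
      using W by (auto simp: green_pair_def)
    note l = lap [of "\<lambda>t. t" "\<lambda>t. 1" "\<lambda>t. 0"]
    have d1: "dU k x = 1 * (- 2 * x $ k) * q x + V x * dq k x" for k x
      using DERIV_unique [OF has_partials2D(4) [OF U(1), folded V_def]] l(1) by auto
    have "ddU k x = 0 * (4 * (x $ k)\<^sup>2 * q x) + 1 * (- 2 * q x - 4 * x $ k * dq k x) + V x * ddq k x" for k x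
      using DERIV_unique [OF has_partials2D(5) [OF U(1), unfolded d1]] l(2) by auto
    then have "- v x = 0 * (4 * (norm x)\<^sup>2 * q x) + 1 * A x + V x * B x"
      unfolding U(2) [symmetric] sumlap [symmetric] by (intro sum.cong) auto
    then show ?thesis by simp
  qed
  define e where "e n = inverse (real (Suc (Suc n)))" for n
  have e: "0 < e n" "e n < 1" for n by (auto simp: e_def field_simps)
  have elim: "e \<longlonglongrightarrow> 0" unfolding e_def using LIMSEQ_inverse_real_of_nat by (rule LIMSEQ_Suc)
  let ?D = "lebesgue_on disk"
  have cq: "continuous_on UNIV q" "continuous_on UNIV A" "continuous_on UNIV B" "continuous_on UNIV V"
    using dqD(1-3) unfolding A_def [abs_def] B_def [abs_def] V_def [abs_def]
    by (auto intro!: continuous_intros)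
  have cF: "continuous_on UNIV (cutoff (e n))" "continuous_on UNIV (cutoff' (e n))" "continuous_on UNIV (cutoff'' (e n))" for n
  proof -
    show "continuous_on UNIV (cutoff (e n))" "continuous_on UNIV (cutoff' (e n))"
      using cutoff_deriv [OF e(1)] by (auto intro!: DERIV_continuous_on)
    have "continuous_on UNIV (bump 3)" using bump_deriv by (auto intro!: DERIV_continuous_on)
    then show "continuous_on UNIV (cutoff'' (e n))" unfolding cutoff''_def [abs_def] using e [of n]
      by (intro continuous_intros continuous_on_compose2 [of UNIV "bump 3" UNIV "\<lambda>t. (t - e n) / e n"]) auto
  qed
  have cFV: "continuous_on S (\<lambda>x. cutoff (e n) (V x))" "continuous_on S (\<lambda>x. cutoff' (e n) (V x))"
    "continuous_on S (\<lambda>x. cutoff'' (e n) (V x))" for n S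
    using continuous_on_compose2 [OF cF(1) continuous_on_subset [OF cq(4)], of S n]
      continuous_on_compose2 [OF cF(2) continuous_on_subset [OF cq(4)], of S n]
      continuous_on_compose2 [OF cF(3) continuous_on_subset [OF cq(4)], of S n] by auto
  note cq' = continuous_on_subset [OF cq(1)] continuous_on_subset [OF cq(2)] continuous_on_subset [OF cq(3)]
  have cH: "continuous_on (cball 0 1) H" unfolding H_def by (intro continuous_intros cw cq') auto
  have int: "integrable ?D (\<lambda>x. H x * cutoff'' (e n) (V x))" "integrable ?D (\<lambda>x. w x * A x * cutoff' (e n) (V x))"
    "integrable ?D (\<lambda>x. w x * B x * cutoff (e n) (V x))" for n
    by (intro integrable_ball_continuous continuous_intros cw cq' cFV cH; simp)+
  have zero: "(LINT x|?D. H x * cutoff'' (e n) (V x)) + (LINT x|?D. w x * A x * cutoff' (e n) (V x))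
      + (LINT x|?D. w x * B x * cutoff (e n) (V x)) = 0" for n
  proof -
    define \<phi> where "\<phi> x = cutoff (e n) (V x) * q x" for x
    have "smooth_term (\<lambda>x. V x)"
    proof -
      have "V = (\<lambda>x. 1 + (- 1) * (norm x)\<^sup>2)" by (auto simp: V_def)
      then show ?thesis by (simp only:) (intro smooth_term.intros smooth_term_norm_sq)
    qed
    then have "smooth_term (\<lambda>x. ((V x + - e n) * bump 0 ((V x + - e n) * (1 / e n))) * q x)"
      by (intro smooth_term.intros q)
    then have "smooth_term \<phi>" by (simp add: \<phi>_def [abs_def] cutoff_def)
    then have sm: "smooth \<phi>" by (rule smooth_term_smooth)
    have "\<phi> x = 0" if "x \<notin> cball 0 (sqrt (1 - e n))" for x
    proof -
      have "sqrt (1 - e n) < norm x" using that by simp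
      then have "1 - e n < (norm x)\<^sup>2" using real_le_rsqrt [of "norm x" "1 - e n"] by linarith
      then show ?thesis using e [of n] by (simp add: \<phi>_def V_def cutoff_zero)
    qed
    moreover have sq: "sqrt (1 - e n) < 1" using e [of n] by simp
    have "norm x < 1" if "norm x \<le> sqrt (1 - e n)" for x :: "real^2" using that sq by linarith
    then have "cball 0 (sqrt (1 - e n)) \<subseteq> disk" by auto
    ultimately have tf: "test_function \<phi>" unfolding test_function_def using sm compact_cball by blast
    note l = lap [OF cutoff_deriv [OF e(1) [of n]]]
    have p1: "partial_deriv k \<phi> = (\<lambda>x. cutoff' (e n) (V x) * (- 2 * x $ k) * q x + cutoff (e n) (V x) * dq k x)" for k
      unfolding partial_deriv_def \<phi>_def by (rule ext) (rule DERIV_imp_deriv [OF l(1)])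
    have "partial_deriv k (partial_deriv k \<phi>) x = cutoff'' (e n) (V x) * (4 * (x $ k)\<^sup>2 * q x)
        + cutoff' (e n) (V x) * (- 2 * q x - 4 * x $ k * dq k x) + cutoff (e n) (V x) * ddq k x" for k x
      unfolding p1 unfolding partial_deriv_def by (rule DERIV_imp_deriv [OF l(2)])
    then have "laplacian \<phi> x = cutoff'' (e n) (V x) * (4 * (norm x)\<^sup>2 * q x) + cutoff' (e n) (V x) * A x
        + cutoff (e n) (V x) * B x" for x
      unfolding laplacian_def sumlap [symmetric] by (intro sum.cong) auto
    then have "w x * laplacian \<phi> x = H x * cutoff'' (e n) (V x) + w x * A x * cutoff' (e n) (V x) + w x * B x * cutoff (e n) (V x)" for x
      by (simp add: H_def algebra_simps)
    then have "0 = (LINT x|?D. H x * cutoff'' (e n) (V x) + w x * A x * cutoff' (e n) (V x) + w x * B x * cutoff (e n) (V x))"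
      using weak [OF tf] by simp
    then show ?thesis using int [of n] by simp
  qed
  have disk_V: "0 < V x" "V x \<le> 1" if "x \<in> disk" for x
    using that by (auto simp: V_def power_less_one_iff abs_square_less_1)
  have i0: "integrable ?D (\<lambda>x. w x * A x)" "integrable ?D (\<lambda>x. w x * (V x * B x))"  "integrable ?D (\<lambda>x. w x * B x)"
    by (intro integrable_ball_continuous continuous_intros cw cq' continuous_on_subset [OF cq(4)]; simp)+
  have l2: "(\<lambda>n. LINT x|?D. w x * A x * cutoff' (e n) (V x)) \<longlonglongrightarrow> (LINT x|?D. w x * A x)"
  proof (rule integral_dominated_convergence [where w = "\<lambda>x. \<bar>w x * A x\<bar>"])
    show "(\<lambda>x. w x * A x) \<in> borel_measurable ?D" "\<And>n. (\<lambda>x. w x * A x * cutoff' (e n) (V x)) \<in> borel_measurable ?D"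
      "integrable ?D (\<lambda>x. \<bar>w x * A x\<bar>)" using int i0 by auto
    show "AE x in ?D. (\<lambda>n. w x * A x * cutoff' (e n) (V x)) \<longlonglongrightarrow> w x * A x"
    proof (rule AE_I2)
      fix x assume "x \<in> space ?D"
      then have "0 < V x" using disk_V by auto
      from tendsto_mult [OF tendsto_const cutoff_tendsto(2) [OF this elim e(1)], of "w x * A x"]
      show "(\<lambda>n. w x * A x * cutoff' (e n) (V x)) \<longlonglongrightarrow> w x * A x" by simp
    qed
    show "AE x in ?D. norm (w x * A x * cutoff' (e n) (V x)) \<le> \<bar>w x * A x\<bar>" for n
    proof (rule AE_I2)
      fix x
      have "\<bar>w x * A x\<bar> * cutoff' (e n) (V x) \<le> \<bar>w x * A x\<bar> * 1"
        using cutoff_bounds(2,3) [OF e(1) [of n]] by (intro mult_left_mono) auto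
      then show "norm (w x * A x * cutoff' (e n) (V x)) \<le> \<bar>w x * A x\<bar>"
        using cutoff_bounds(2) [OF e(1) [of n], of "V x"] by (simp add: abs_mult)
    qed
  qed
  have l3: "(\<lambda>n. LINT x|?D. w x * B x * cutoff (e n) (V x)) \<longlonglongrightarrow> (LINT x|?D. w x * (V x * B x))"
  proof (rule integral_dominated_convergence [where w = "\<lambda>x. \<bar>w x * B x\<bar>"])
    show "(\<lambda>x. w x * (V x * B x)) \<in> borel_measurable ?D" "\<And>n. (\<lambda>x. w x * B x * cutoff (e n) (V x)) \<in> borel_measurable ?D"
      "integrable ?D (\<lambda>x. \<bar>w x * B x\<bar>)" using int i0 by auto
    show "AE x in ?D. (\<lambda>n. w x * B x * cutoff (e n) (V x)) \<longlonglongrightarrow> w x * (V x * B x)"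
    proof (rule AE_I2)
      fix x assume "x \<in> space ?D"
      then have "0 < V x" using disk_V by auto
      from tendsto_mult [OF tendsto_const cutoff_tendsto(1) [OF this elim e(1)], of "w x * B x"]
      show "(\<lambda>n. w x * B x * cutoff (e n) (V x)) \<longlonglongrightarrow> w x * (V x * B x)" by (simp add: mult_ac)
    qed
    show "AE x in ?D. norm (w x * B x * cutoff (e n) (V x)) \<le> \<bar>w x * B x\<bar>" for n
    proof (rule AE_I2)
      fix x assume "x \<in> space ?D"
      then have "\<bar>cutoff (e n) (V x)\<bar> \<le> 1" using cutoff_bounds(1) [OF e(1) [of n], of "V x"] disk_V [of x] by auto
      then have "\<bar>w x * B x\<bar> * \<bar>cutoff (e n) (V x)\<bar> \<le> \<bar>w x * B x\<bar> * 1"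
        by (intro mult_left_mono) auto
      then show "norm (w x * B x * cutoff (e n) (V x)) \<le> \<bar>w x * B x\<bar>"
        by (simp add: abs_mult)
    qed
  qed
  have i'': "integrable ?D (\<lambda>x. cutoff'' (e n) (V x))" for n
    by (intro integrable_ball_continuous cFV)
  have mass: "(LINT x|?D. cutoff'' (e n) (V x)) \<le> pi" for n
  proof -
    have "(LINT x|m. cutoff'' (e n) (1 - (norm (x - 0))\<^sup>2)) = pi * (- cutoff' (e n) (1 - 1\<^sup>2) - - cutoff' (e n) (1 - 0))"
      if "m = lebesgue_on (ball (0::real^2) 1)" for m
      unfolding that
    proof (rule radial_integral_FTC [where f = "\<lambda>s. cutoff'' (e n) (1 - s)" and F = "\<lambda>s. - cutoff' (e n) (1 - s)"])
      show "continuous_on UNIV (\<lambda>s. cutoff'' (e n) (1 - s))"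
        by (rule continuous_on_compose2 [OF cF(3)]) (auto intro!: continuous_intros)
      fix s :: real
      have m: "((\<lambda>s. 1 - s) has_real_derivative - 1) (at s)" by (auto intro!: derivative_eq_intros)
      show "((\<lambda>s. - cutoff' (e n) (1 - s)) has_real_derivative cutoff'' (e n) (1 - s)) (at s)"
        using DERIV_minus [OF DERIV_chain2 [OF cutoff_deriv(2) [OF e(1)] m]] by simp
    qed auto
    then have "(LINT x|?D. cutoff'' (e n) (V x)) = pi * cutoff' (e n) 1"
      using e [of n] by (simp add: V_def cutoff_zero)
    also have "\<dots> \<le> pi * 1" using cutoff_bounds(3) [OF e(1)] by (intro mult_left_mono) auto
    finally show ?thesis by simp
  qed
  have l1: "(\<lambda>n. LINT x|?D. H x * cutoff'' (e n) (V x)) \<longlonglongrightarrow> 0"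
  proof (rule LIMSEQ_I)
    fix r :: real assume r: "0 < r"
    define k where "k = r / 8"
    have k: "0 < k" using r by (simp add: k_def)
    have "bounded (H ` cball 0 1)" using cH by (intro compact_imp_bounded compact_continuous_image) auto
    then obtain M where "\<forall>z\<in>H ` cball 0 1. norm z \<le> M" unfolding bounded_iff by blast
    then have M: "\<And>x. norm x \<le> 1 \<Longrightarrow> \<bar>H x\<bar> \<le> M" by auto
    have M0: "0 \<le> M" using M [of 0] by simp
    \<comment> \<open>Where \<open>H\<close> is not small, \<open>V\<close> is bounded away from 0 and \<open>cutoff''\<close> tends to 0 uniformly; elsewhere the mass bound of \<open>cutoff''\<close> applies.\<close>
    obtain d where d: "0 < d" "\<And>x. norm x \<le> 1 \<Longrightarrow> k \<le> \<bar>H x\<bar> \<Longrightarrow> d \<le> V x"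
    proof (cases "{x \<in> cball 0 1. k \<le> \<bar>H x\<bar>} = {}")
      case True then show ?thesis using that [of 1] by auto
    next
      case False
      have "closed {x \<in> cball 0 1. k \<le> \<bar>H x\<bar>}"
        by (rule continuous_closed_preimage [where T = "{k..}" and f = "\<lambda>x. \<bar>H x\<bar>", simplified vimage_def Int_def, simplified])
           (auto intro!: continuous_intros cH)
      then have "compact (cball 0 1 \<inter> {x \<in> cball 0 1. k \<le> \<bar>H x\<bar>})" by (intro compact_Int_closed) auto
      then have "compact {x \<in> cball 0 1. k \<le> \<bar>H x\<bar>}" by (simp add: Int_def conj_assoc [symmetric])
      from continuous_attains_inf [OF this False, of V] continuous_on_subset [OF cq(4)]
      obtain y where y: "y \<in> {x \<in> cball 0 1. k \<le> \<bar>H x\<bar>}" "\<And>x. x \<in> {x \<in> cball 0 1. k \<le> \<bar>H x\<bar>} \<Longrightarrow> V y \<le> V x"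
        by auto
      have "norm y \<noteq> 1" using y(1) k w0 by (auto simp: H_def)
      then have "y \<in> disk" using y(1) by auto
      then show ?thesis using that [of "V y"] y(2) disk_V by auto
    qed
    have "(\<lambda>n. (e n)\<^sup>2 / (d - e n) ^ 3) \<longlonglongrightarrow> 0\<^sup>2 / (d - 0) ^ 3"
      by (intro tendsto_intros elim) (use d in auto)
    then have "\<forall>\<^sub>F n in sequentially. (e n)\<^sup>2 / (d - e n) ^ 3 < k / (M + 1)"
      using k M0 by (intro order_tendstoD(2)) auto
    moreover have "\<forall>\<^sub>F n in sequentially. e n < d" using elim d(1) by (rule order_tendstoD(2))
    ultimately have "\<forall>\<^sub>F n in sequentially. norm ((LINT x|?D. H x * cutoff'' (e n) (V x)) - 0) < r"
    proof eventually_elim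
      case (elim n)
      have "norm (LINT x|?D. H x * cutoff'' (e n) (V x)) \<le> (LINT x|?D. k * cutoff'' (e n) (V x) + k)"
      proof (rule Bochner_Integration.integral_norm_bound_integral)
        show "integrable ?D (\<lambda>x. k * cutoff'' (e n) (V x) + k)"
          by (intro integrable_ball_continuous continuous_intros cFV)
        fix x assume "x \<in> space ?D"
        then have x: "norm x \<le> 1" by auto
        have c0: "0 \<le> cutoff'' (e n) (V x)" by (rule cutoff_bounds(4) [OF e(1)])
        have "\<bar>H x\<bar> * cutoff'' (e n) (V x) \<le> k * cutoff'' (e n) (V x) + k"
        proof (cases "k \<le> \<bar>H x\<bar>")
          case True
          then have "cutoff'' (e n) (V x) \<le> k / (M + 1)"
            using cutoff_bounds(5) [OF e(1) elim(2) d(2) [OF x True]] elim(1) by simp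
          then have "\<bar>H x\<bar> * cutoff'' (e n) (V x) \<le> (M + 1) * (k / (M + 1))"
            using M [OF x] M0 c0 by (intro mult_mono) auto
          also have "\<dots> = k" using M0 by simp
          finally show ?thesis using k c0 by (smt (verit) mult_nonneg_nonneg)
        next
          case False
          then show ?thesis using c0 k by (smt (verit) mult_right_mono)
        qed
        then show "norm (H x * cutoff'' (e n) (V x)) \<le> k * cutoff'' (e n) (V x) + k"
          using c0 by (simp add: abs_mult)
      qed (rule int)
      also have "\<dots> = k * (LINT x|?D. cutoff'' (e n) (V x)) + (LINT x|?D. k)"
        using i'' integrable_ball_continuous [of 0 1 "\<lambda>x. k"] by (subst Bochner_Integration.integral_add) auto
      also have "(LINT x|?D. k) = pi * k"
        using radial_integral_FTC [of 1 "\<lambda>s. k" "\<lambda>s. k * s" 0] by (auto intro!: derivative_eq_intros)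
      also have "k * (LINT x|?D. cutoff'' (e n) (V x)) + pi * k \<le> k * pi + pi * k"
        using mass k by (intro add_right_mono mult_left_mono) auto
      also have "\<dots> < r" using pi_less_4 r by (simp add: k_def)
      finally show ?case by simp
    qed
    then show "\<exists>no. \<forall>n\<ge>no. norm ((LINT x|?D. H x * cutoff'' (e n) (V x)) - 0) < r"
      by (simp add: eventually_sequentially)
  qed
  have "(\<lambda>n. 0) \<longlonglongrightarrow> 0 + (LINT x|?D. w x * A x) + (LINT x|?D. w x * (V x * B x))"
    using tendsto_add [OF tendsto_add [OF l1 l2] l3] by (simp only: zero)
  then have "(LINT x|?D. w x * A x) + (LINT x|?D. w x * (V x * B x)) = 0"
    by (simp add: LIMSEQ_const_iff)
  moreover have "(LINT x|?D. w x * v x) = - ((LINT x|?D. w x * A x) + (LINT x|?D. w x * (V x * B x)))"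
  proof -
    have "(LINT x|?D. w x * v x) = (LINT x|?D. - (w x * A x + w x * (V x * B x)))"
      by (simp add: v algebra_simps)
    then show ?thesis using i0 by simp
  qed
  ultimately show ?thesis by simp
qed

section \<open>Uniqueness in the Dirichlet problem\<close>

lemma mode_sum_continuous: "mode_sum f \<Longrightarrow> continuous_on UNIV f"
  using mode_sum_green_pair green_pair_contD(2) by blast

text \<open>A polynomial mode is minus the Laplacian of a polynomial divisible by \<open>1 - |x|\<^sup>2\<close>.\<close>

lemma weakly_harmonic_orthogonal_mode_sum:
  assumes cw: "continuous_on (cball 0 1) w" and w0: "\<And>x. norm x = 1 \<Longrightarrow> w x = 0"
    and weak: "\<And>\<phi>. test_function \<phi> \<Longrightarrow> (LINT x|lebesgue_on disk. w x * laplacian \<phi> x) = 0"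
    and p: "mode_sum p"
  shows "(LINT x|lebesgue_on disk. w x * p x) = 0"
  using p
proof induction
  case (mode n c m)
  let ?C = "1 / (4 * (real m + 1) * (real m + 1 + real n))"
  have "poly (radial_inv n (monom 1 m)) s = ?C * (1 - s ^ Suc m)" for s
  proof -
    have "poly (radial_inv n (monom 1 m)) s
      = (\<Sum>i\<le>m. (if m = i then 1 else 0) / (4 * (real i + 1) * (real i + 1 + real n)) * (1 - s ^ Suc i))"
      by (simp add: radial_inv_def degree_monom_eq poly_sum poly_monom)
    also have "\<dots> = (\<Sum>i\<le>m. if m = i then ?C * (1 - s ^ Suc m) else 0)" by (intro sum.cong) auto
    finally show ?thesis by simp
  qed
  then have P: "poly (radial_inv n (monom 1 m)) s = (1 - s) * (?C * (\<Sum>i<Suc m. s ^ i))" for s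
    by (simp only: one_diff_power_eq mult.left_commute)
  define q where "q x = ?C * (\<Sum>i<Suc m. ((norm x)\<^sup>2) ^ i) * Re (c * zc x ^ n)" for x
  have q: "smooth_term q" unfolding q_def [abs_def]
    by (intro smooth_term.mult smooth_term.const smooth_term_sum smooth_term_power smooth_term_norm_sq smooth_term_Re_pow)
  have "poly (monom 1 m) = (\<lambda>s::real. s ^ m)" by (auto simp: poly_monom)
  then have "green_pair (mode n c (poly (radial_inv n (monom 1 m)))) (mode n c (\<lambda>s. s ^ m))"
    using green_pair_mode [OF radial_ode_radial_inv [of n "monom 1 m"]] by auto
  moreover have "mode n c (poly (radial_inv n (monom 1 m))) = (\<lambda>x. (1 - (norm x)\<^sup>2) * q x)"
    by (rule ext) (simp only: mode_def P q_def mult.assoc)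
  ultimately show ?case
    by (intro weakly_harmonic_orthogonal [OF cw w0 weak q]) auto
next
  case (add f g)
  have "integrable (lebesgue_on disk) (\<lambda>x. w x * f x)" "integrable (lebesgue_on disk) (\<lambda>x. w x * g x)"
    by (intro integrable_ball_continuous continuous_on_mult cw continuous_on_subset [OF mode_sum_continuous] add; simp)+
  then show ?case using add by (simp add: distrib_left)
qed

lemma continuous_integral_sq_zero:
  assumes cw: "continuous_on (cball (0::real^2) 1) w" and "(LINT x|lebesgue_on disk. w x * w x) = 0" and x: "x \<in> disk"
  shows "w x = (0::real)"
proof (rule ccontr)
  assume nz: "w x \<noteq> 0"
  have i: "integrable (lebesgue_on disk) (\<lambda>x. w x * w x)"
    by (intro integrable_ball_continuous continuous_on_mult cw)
  have "AE x in lebesgue_on disk. w x * w x = 0"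
    using assms(2) integral_nonneg_eq_0_iff_AE [OF i] by simp
  then have "AE x in lebesgue. x \<in> disk \<longrightarrow> w x = 0" by (simp add: AE_restrict_space_iff)
  then have n: "negligible {x. \<not> (x \<in> disk \<longrightarrow> w x = 0)}"
    by (simp add: completion.AE_iff_null_sets negligible_iff_null_sets)
  have "open (disk \<inter> w -` (- {0}))"
    by (rule continuous_open_preimage) (auto intro: continuous_on_subset [OF cw])
  moreover have "disk \<inter> w -` (- {0}) \<noteq> {}" using x nz by auto
  ultimately have "\<not> negligible (disk \<inter> w -` (- {0}))" by (rule open_not_negligible)
  moreover have "disk \<inter> w -` (- {0}) = {x. \<not> (x \<in> disk \<longrightarrow> w x = 0)}" by auto
  ultimately show False using n by simp
qed

text \<open>By the Stone-Weierstrass theorem \<open>w\<close> is a uniform limit of functions orthogonal to it.\<close>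

lemma continuous_orthogonal_mode_sum_zero:
  assumes cw: "continuous_on (cball 0 1) w"
    and o: "\<And>p. mode_sum p \<Longrightarrow> (LINT x|lebesgue_on disk. w x * p x) = 0"
    and x: "x \<in> disk"
  shows "w x = 0"
proof (rule continuous_integral_sq_zero [OF cw _ x])
  let ?D = "lebesgue_on disk"
  have iw: "integrable ?D w" by (rule integrable_ball_continuous [OF cw])
  have i2: "integrable ?D (\<lambda>x. w x * w x)"
    by (intro integrable_ball_continuous continuous_on_mult cw)
  have "\<bar>LINT x|?D. w x * w x\<bar> \<le> e * (LINT x|?D. \<bar>w x\<bar>)" if e: "0 < e" for e
  proof -
    obtain p where p: "real_polynomial_function p" "\<And>x. x \<in> cball 0 1 \<Longrightarrow> \<bar>w x - p x\<bar> < e"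
      using Stone_Weierstrass_real_polynomial_function [OF compact_cball cw e] by blast
    have m: "mode_sum p" by (rule polynomial_imp_mode_sum [OF p(1)])
    have ip: "integrable ?D (\<lambda>x. w x * p x)"
      by (intro integrable_ball_continuous continuous_on_mult cw continuous_on_subset [OF mode_sum_continuous [OF m]]) auto
    have "(LINT x|?D. w x * w x) = (LINT x|?D. w x * w x - w x * p x)"
      using i2 ip o [OF m] by simp
    also have "norm \<dots> \<le> (LINT x|?D. e * \<bar>w x\<bar>)"
    proof (rule Bochner_Integration.integral_norm_bound_integral)
      fix x assume "x \<in> space ?D"
      then have "\<bar>w x - p x\<bar> \<le> e" using p(2) [of x] by auto
      then have "\<bar>w x\<bar> * \<bar>w x - p x\<bar> \<le> \<bar>w x\<bar> * e" by (rule mult_left_mono) auto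
      moreover have "w x * w x - w x * p x = w x * (w x - p x)" by (simp add: algebra_simps)
      ultimately show "norm (w x * w x - w x * p x) \<le> e * \<bar>w x\<bar>"
        by (simp only: abs_mult real_norm_def mult.commute)
    qed (use i2 ip iw in auto)
    also have "\<dots> = e * (LINT x|?D. \<bar>w x\<bar>)" by simp
    finally show ?thesis by simp
  qed
  note b = this
  have nn: "0 \<le> (LINT x|?D. \<bar>w x\<bar>)" by (rule integral_nonneg_AE) auto
  have "\<bar>LINT x|?D. w x * w x\<bar> \<le> 0 + e" if "0 < e" for e
  proof -
    have N: "0 < (LINT x|?D. \<bar>w x\<bar>) + 1" using nn by linarith
    then have e: "0 < e / ((LINT x|?D. \<bar>w x\<bar>) + 1)" using that by (rule divide_pos_pos [rotated])
    then have "\<bar>LINT x|?D. w x * w x\<bar> \<le> e / ((LINT x|?D. \<bar>w x\<bar>) + 1) * (LINT x|?D. \<bar>w x\<bar>)" by (rule b)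
    also have "\<dots> \<le> e / ((LINT x|?D. \<bar>w x\<bar>) + 1) * ((LINT x|?D. \<bar>w x\<bar>) + 1)"
      using e by (intro mult_left_mono) auto
    also have "\<dots> = e" using N by simp
    finally show ?thesis by simp
  qed
  then have "\<bar>LINT x|?D. w x * w x\<bar> \<le> 0" by (rule field_le_epsilon)
  then show "(LINT x|?D. w x * w x) = 0" by (simp only: abs_le_zero_iff)
qed

lemma laplacian_continuous: "test_function \<phi> \<Longrightarrow> continuous_on S (laplacian \<phi>)"
  unfolding laplacian_def [abs_def]
  by (intro continuous_on_sum continuous_on_subset [OF has_partials2D(3) [OF test_function_partials]]) auto

text \<open>The difference of two solutions is weakly harmonic with boundary value 0, so it is orthogonal to all
  polynomials.\<close>

lemma dirichlet_unique:
  assumes "dirichlet_solution v u" "dirichlet_solution v u'"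
  shows "u = u'"
proof
  fix x
  have c: "continuous_on (cball 0 1) u" "continuous_on (cball 0 1) u'"
    using assms by (auto simp: dirichlet_solution_def)
  let ?w = "\<lambda>x. u x - u' x"
  have cw: "continuous_on (cball 0 1) ?w" by (intro continuous_on_diff c)
  have weak: "(LINT x|lebesgue_on disk. ?w x * laplacian \<phi> x) = 0" if \<phi>: "test_function \<phi>" for \<phi>
  proof -
    have i: "integrable (lebesgue_on disk) (\<lambda>x. u x * (- laplacian \<phi> x))" "integrable (lebesgue_on disk) (\<lambda>x. u' x * (- laplacian \<phi> x))"
      by (intro integrable_ball_continuous continuous_on_mult continuous_on_minus c laplacian_continuous [OF \<phi>])+
    have "(LINT x|lebesgue_on disk. u x * (- laplacian \<phi> x)) = (LINT x|lebesgue_on disk. u' x * (- laplacian \<phi> x))"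
      using assms \<phi> by (auto simp: dirichlet_solution_def)
    then have "(LINT x|lebesgue_on disk. u x * (- laplacian \<phi> x) - u' x * (- laplacian \<phi> x)) = 0"
      by (simp only: Bochner_Integration.integral_diff [OF i] diff_self)
    then have "(LINT x|lebesgue_on disk. - (?w x * laplacian \<phi> x)) = 0"
      by (simp add: algebra_simps)
    then show ?thesis by simp
  qed
  show "u x = u' x"
  proof (cases "x \<in> disk")
    case True
    have "?w x = 0"
      by (rule continuous_orthogonal_mode_sum_zero [OF cw weakly_harmonic_orthogonal_mode_sum [OF cw _ weak] True])
        (use assms in \<open>auto simp: dirichlet_solution_def\<close>)
    then show ?thesis by simp
  next
    case False
    then show ?thesis using assms by (simp add: dirichlet_solution_def)
  qed
qed

lemma green_op_eqI: "dirichlet_solution v u \<Longrightarrow> green_op v = u"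
  unfolding green_op_def using dirichlet_unique by blast

lemma green_op_green_pair: "green_pair U v \<Longrightarrow> x \<in> disk \<Longrightarrow> green_op v x = U x"
  by (simp add: green_op_eqI [OF green_pair_dirichlet])

section \<open>A sup bound for the Dirichlet problem\<close>

text \<open>Young's inequality with a free scale \<open>l\<close>. It does the work of Hoelder's inequality: a bound of the form
  \<open>l * C + l powr (1 - p) * N\<close> for all \<open>l > 0\<close> becomes small with \<open>N\<close>.\<close>

lemma young_scaled:
  fixes a b l p :: real
  assumes "0 \<le> a" "0 \<le> b" "0 < l" "1 < p"
  shows "a * b \<le> l * a powr (p / (p - 1)) + l powr (1 - p) * b powr p"
proof (cases "a = 0 \<or> b = 0")
  case True then show ?thesis using assms by auto
next
  case False
  then have a: "0 < a" and b: "0 < b" using assms by auto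
  let ?q = "p / (p - 1)"
  have q: "?q = 1 + 1 / (p - 1)" using assms by (simp add: field_simps)
  show ?thesis
  proof (cases "b \<le> l * a powr (1 / (p - 1))")
    case True
    have "a * b \<le> a * (l * a powr (1 / (p - 1)))" using True a by (intro mult_left_mono) auto
    also have "\<dots> = l * a powr ?q" unfolding q powr_add using a by simp
    finally show ?thesis using assms by (smt (verit) mult_nonneg_nonneg powr_ge_zero)
  next
    case False
    then have "(l * a powr (1 / (p - 1))) powr (p - 1) \<le> b powr (p - 1)"
      using assms a by (intro powr_mono2) auto
    then have "l powr (p - 1) * a \<le> b powr (p - 1)"
      using assms a by (simp add: powr_mult powr_powr)
    then have "l powr (1 - p) * (l powr (p - 1) * a) * b \<le> l powr (1 - p) * b powr (p - 1) * b"
      using b by (intro mult_right_mono mult_left_mono) auto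
    moreover have "l powr (1 - p) * (l powr (p - 1) * a) = a"
      using assms by (simp add: mult.assoc [symmetric] powr_add [symmetric])
    moreover have "b powr (p - 1) * b = b powr p" using b by (simp add: powr_diff)
    ultimately have "a * b \<le> l powr (1 - p) * b powr p" by (simp add: mult.assoc)
    then show ?thesis using assms by (smt (verit) mult_nonneg_nonneg powr_ge_zero)
  qed
qed

lemma integrable_inverse_dist:
  fixes y :: "real^2"
  shows "integrable (lebesgue_on (ball y 2)) (\<lambda>x. 1 / norm (x - y))"
    "(LINT x|lebesgue_on (ball y 2). 1 / norm (x - y)) \<le> 4 * pi"
proof -
  let ?M = "lebesgue_on (ball y 2)" and ?g = "\<lambda>x. (norm (x - y))\<^sup>2"
  have g: "?g \<in> borel_measurable ?M"
    by (intro continuous_measurable_ball continuous_intros)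
  have "((\<lambda>s. 1 / sqrt s) has_integral (2 * sqrt 4 - 2 * sqrt 0)) {0..4}"
  proof (rule fundamental_theorem_of_calculus_interior)
    fix s :: real assume "s \<in> {0<..<4}"
    then have "((\<lambda>s. 2 * sqrt s) has_real_derivative 1 / sqrt s) (at s)"
      by (auto intro!: derivative_eq_intros simp: field_simps)
    then show "((\<lambda>s. 2 * sqrt s) has_vector_derivative 1 / sqrt s) (at s)"
      by (simp add: has_real_derivative_iff_has_vector_derivative)
  qed (auto intro!: continuous_intros)
  then have hi: "((\<lambda>s. 1 / sqrt s) has_integral 4) {0..4}" by simp
  have "(\<integral>\<^sup>+x. ennreal (1 / norm (x - y)) \<partial>?M) = (\<integral>\<^sup>+x. ennreal (1 / sqrt (?g x)) \<partial>?M)" by simp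
  also have "\<dots> = (\<integral>\<^sup>+s. ennreal (1 / sqrt s) \<partial>distr ?M borel ?g)"
    by (rule nn_integral_distr [OF g, symmetric]) measurable
  also have "\<dots> = (\<integral>\<^sup>+s. ennreal (pi * indicator {0..4} s) * ennreal (1 / sqrt s) \<partial>lborel)"
    using distr_sq_dist [of 2 y] by (simp add: nn_integral_density)
  also have "\<dots> = (\<integral>\<^sup>+s. ennreal pi * ennreal (indicator {0..4} s * (1 / sqrt s)) \<partial>lborel)"
    by (intro nn_integral_cong) (auto simp: indicator_def ennreal_mult' [symmetric])
  also have "\<dots> = ennreal pi * (\<integral>\<^sup>+s. ennreal (indicator {0..4} s * (1 / sqrt s)) \<partial>lborel)"
    by (rule nn_integral_cmult) measurable
  also have "(\<integral>\<^sup>+s. ennreal (indicator {0..4} s * (1 / sqrt s)) \<partial>lborel) = ennreal 4"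
    by (rule nn_integral_has_integral_lebesgue [OF _ hi]) auto
  finally have n: "(\<integral>\<^sup>+x. ennreal (1 / norm (x - y)) \<partial>?M) = ennreal (4 * pi)"
    by (simp add: ennreal_mult' mult.commute)
  have m: "(\<lambda>x. 1 / norm (x - y)) \<in> borel_measurable ?M"
  proof -
    have "(\<lambda>x. 1 / sqrt (?g x)) \<in> borel_measurable ?M" using g by measurable
    then show ?thesis by simp
  qed
  show "integrable ?M (\<lambda>x. 1 / norm (x - y))"
    using m n by (intro integrableI_bounded) auto
  show "(LINT x|?M. 1 / norm (x - y)) \<le> 4 * pi"
    using m n by (subst integral_eq_nn_integral) auto
qed

text \<open>For \<open>a = 1\<close> and \<open>c = |y|\<^sup>2\<close> this is the squared distance from \<open>y\<close>; for \<open>a = |y|\<^sup>2\<close> and \<open>c = 1\<close> it is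
  \<open>|y|\<^sup>2\<close> times the squared distance from the mirror image of \<open>y\<close> in the unit circle.\<close>

definition quad :: "real \<Rightarrow> real \<Rightarrow> real^2 \<Rightarrow> real^2 \<Rightarrow> real" where
  "quad a c y x = a * (norm x)\<^sup>2 - 2 * (x \<bullet> y) + c"

lemma ln_quad_partials:
  assumes pos: "\<And>x. 0 < quad a c y x"
  shows "\<exists>d dd. has_partials2 (\<lambda>x. ln (quad a c y x)) d dd \<and>
    (\<forall>x. (\<Sum>k\<in>UNIV. dd k x) = 4 * (a * c - (norm y)\<^sup>2) / (quad a c y x)\<^sup>2)"
proof -
  let ?f = "quad a c y"
  define d where "d k x = (2 * a * x $ k - 2 * y $ k) / ?f x" for k x
  define dd where "dd k x = 2 * a / ?f x - (2 * a * x $ k - 2 * y $ k)\<^sup>2 / (?f x)\<^sup>2" for k x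
  have cf: "continuous_on UNIV ?f" unfolding quad_def [abs_def] by (intro continuous_intros)
  have nz: "?f x \<noteq> 0" for x using pos [of x] by simp
  have line: "?f (x + s *\<^sub>R axis k 1) = a * ((norm x)\<^sup>2 + 2 * s * x $ k + s\<^sup>2) - 2 * (x \<bullet> y + s * y $ k) + c" for x s k
    unfolding quad_def norm_sq_line by (simp add: inner_add_left inner_axis' )
  have df: "((\<lambda>s. ?f (x + s *\<^sub>R axis k 1)) has_real_derivative 2 * a * x $ k - 2 * y $ k) (at 0)" for x k
    unfolding line by (auto intro!: derivative_eq_intros)
  have dn: "((\<lambda>s. 2 * a * (x + s *\<^sub>R axis k 1) $ k - 2 * y $ k) has_real_derivative 2 * a) (at 0)" for x :: "real^2" and k
    by (auto intro!: derivative_eq_intros simp: axis_def)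
  have "has_partials2 (\<lambda>x. ln (?f x)) d dd" unfolding has_partials2_def
  proof (intro conjI allI)
    show "continuous_on UNIV (\<lambda>x. ln (?f x))" by (intro continuous_on_ln cf) (use nz in auto)
    fix k
    show "continuous_on UNIV (d k)" "continuous_on UNIV (dd k)" unfolding d_def [abs_def] dd_def [abs_def]
      by (intro continuous_intros cf; use nz in auto)+
    fix x
    have p0: "0 < ?f (x + 0 *\<^sub>R axis k 1)" using pos by simp
    show "((\<lambda>s. ln (?f (x + s *\<^sub>R axis k 1))) has_real_derivative d k x) (at 0)"
      using DERIV_chain2 [OF DERIV_ln_divide [OF p0] df] by (simp add: d_def)
    have n0: "?f (x + 0 *\<^sub>R axis k 1) \<noteq> 0" using nz by simp
    show "((\<lambda>s. d k (x + s *\<^sub>R axis k 1)) has_real_derivative dd k x) (at 0)"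
      unfolding d_def using nz [of x]
      by (intro DERIV_cong [OF DERIV_divide [OF dn df n0]]) (simp add: dd_def field_simps power2_eq_square)
  qed
  moreover have "(\<Sum>k\<in>UNIV. dd k x) = 4 * (a * c - (norm y)\<^sup>2) / (?f x)\<^sup>2" for x
  proof -
    have "(\<Sum>k\<in>UNIV. dd k x) = (4 * a * ?f x - ((2 * a * x $ 1 - 2 * y $ 1)\<^sup>2 + (2 * a * x $ 2 - 2 * y $ 2)\<^sup>2)) / (?f x)\<^sup>2"
      unfolding sum_2 dd_def using nz [of x] by (simp add: field_simps power2_eq_square)
    also have "4 * a * ?f x - ((2 * a * x $ 1 - 2 * y $ 1)\<^sup>2 + (2 * a * x $ 2 - 2 * y $ 2)\<^sup>2) = 4 * (a * c - (norm y)\<^sup>2)"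
      unfolding quad_def norm_sq_2 inner_vec_def sum_2 by (simp add: algebra_simps power2_eq_square)
    finally show ?thesis .
  qed
  ultimately show ?thesis by blast
qed

text \<open>A regularized Green function with pole \<open>y\<close>. The same \<open>e\<close> in both logarithms makes it vanish on the unit
  circle.\<close>

definition log_kernel :: "real \<Rightarrow> real^2 \<Rightarrow> real^2 \<Rightarrow> real" where
  "log_kernel e y x = (ln (quad ((norm y)\<^sup>2) (1 + e) y x) - ln (quad 1 ((norm y)\<^sup>2 + e) y x)) / (4 * pi)"

lemma quad_dist: "quad 1 ((norm y)\<^sup>2 + e) y x = (norm (x - y))\<^sup>2 + e"
  by (simp add: quad_def power2_norm_eq_inner algebra_simps inner_commute)

lemma quad_reflected_ge: "(1 - norm x * norm y)\<^sup>2 + e \<le> quad ((norm y)\<^sup>2) (1 + e) y x"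
proof -
  have "x \<bullet> y \<le> norm x * norm y" by (rule norm_cauchy_schwarz)
  then show ?thesis by (simp add: quad_def power2_eq_square algebra_simps)
qed

lemma quad_pos:
  assumes "0 < e" shows "0 < quad 1 ((norm y)\<^sup>2 + e) y x" "0 < quad ((norm y)\<^sup>2) (1 + e) y x"
proof -
  show "0 < quad 1 ((norm y)\<^sup>2 + e) y x" unfolding quad_dist using assms by (simp add: add_nonneg_pos)
  have "0 < (1 - norm x * norm y)\<^sup>2 + e" using assms by (simp add: add_nonneg_pos)
  then show "0 < quad ((norm y)\<^sup>2) (1 + e) y x" using quad_reflected_ge [of x y e] by linarith
qed

lemma log_kernel_bounds:
  assumes e: "0 < e" and x: "x \<in> disk" and y: "y \<in> disk" and xy: "x \<noteq> y"
  shows "0 \<le> log_kernel e y x" "log_kernel e y x \<le> ln (1 + 1 / (norm (x - y))\<^sup>2)"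
proof -
  let ?f = "quad 1 ((norm y)\<^sup>2 + e) y x" and ?g = "quad ((norm y)\<^sup>2) (1 + e) y x"
  note pos = quad_pos [OF e, of y x]
  have fg: "?g - ?f = (1 - (norm x)\<^sup>2) * (1 - (norm y)\<^sup>2)" by (simp add: quad_def algebra_simps)
  have n: "(norm x)\<^sup>2 \<le> 1" "(norm y)\<^sup>2 \<le> 1" using x y by (auto intro: power_le_one)
  then have n0: "0 \<le> ?g - ?f" "?g - ?f \<le> 1"
    unfolding fg by (auto intro!: mult_nonneg_nonneg mult_le_one)
  then have l0: "ln ?f \<le> ln ?g" using pos by simp
  then show "0 \<le> log_kernel e y x" by (simp add: log_kernel_def)
  let ?s = "(norm (x - y))\<^sup>2"
  have s: "0 < ?s" using xy by simp
  have "?g / ?f = 1 + (?g - ?f) / ?f" using pos by (simp add: field_simps)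
  also have "(?g - ?f) / ?f \<le> 1 / ?s"
    using n0 pos s e by (intro frac_le) (auto simp: quad_dist)
  finally have le: "?g / ?f \<le> 1 + 1 / ?s" by simp
  have "log_kernel e y x \<le> (ln ?g - ln ?f) / 1"
    unfolding log_kernel_def using l0 pi_gt3 by (intro divide_left_mono) auto
  also have "\<dots> = ln (?g / ?f)" using pos by (simp add: ln_div)
  also have "\<dots> \<le> ln (1 + 1 / ?s)" using le pos s by (intro ln_mono) (auto intro!: divide_pos_pos add_pos_pos)
  finally show "log_kernel e y x \<le> ln (1 + 1 / ?s)" .
qed

text \<open>A power of a logarithmic singularity is dominated by the integrable singularity \<open>1 / s\<close>.\<close>

lemma log_powr_bound:
  fixes q :: real
  assumes q: "0 < q" and s: "0 < s" "s \<le> 2"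
  shows "ln (1 + 1 / s\<^sup>2) powr q \<le> 3 * (2 * q) powr q / s"
proof -
  have s2: "0 < s\<^sup>2" using s by simp
  let ?z = "1 + 1 / s\<^sup>2"
  have z: "1 \<le> ?z" using s2 by simp
  have "ln ?z \<le> ?z powr (1 / (2 * q)) / (1 / (2 * q))" using z q by (intro ln_powr_bound) auto
  then have "ln ?z powr q \<le> (2 * q * ?z powr (1 / (2 * q))) powr q"
    using z q by (intro powr_mono2) (auto simp: mult.commute)
  also have "\<dots> = (2 * q) powr q * ?z powr (1 / 2)"
    using q z by (simp add: powr_mult powr_powr)
  also have "?z powr (1 / 2) = sqrt ?z" using z by (simp add: powr_half_sqrt)
  also have "sqrt ?z \<le> 3 / s"
  proof (rule real_le_lsqrt)
    have "s\<^sup>2 \<le> 2\<^sup>2" using s by (intro power_mono) auto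
    then have "s\<^sup>2 + 1 \<le> 9" by simp
    then show "?z \<le> (3 / s)\<^sup>2" using s2 by (simp add: power_divide divide_simps)
  qed (use s in auto)
  finally show ?thesis using q by (simp add: mult_left_mono mult.commute)
qed

text \<open>Minus the Laplacian of \<open>log_kernel e y\<close> is an approximation of the unit mass at \<open>y\<close>, up to a term that is
  uniformly of order \<open>e\<close>.\<close>

lemma log_kernel_identity:
  assumes e: "0 < e" and y: "y \<in> disk" and U: "green_pair U v"
  shows "(LINT x|lebesgue_on disk. log_kernel e y x * v x)
    = (LINT x|lebesgue_on disk. U x * (e / (pi * ((norm (x - y))\<^sup>2 + e)\<^sup>2) - (e * (norm y)\<^sup>2) / (pi * (quad ((norm y)\<^sup>2) (1 + e) y x)\<^sup>2)))"
    and "continuous_on UNIV (log_kernel e y)"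
proof -
  let ?f = "quad 1 ((norm y)\<^sup>2 + e) y" and ?g = "quad ((norm y)\<^sup>2) (1 + e) y"
  obtain d1 dd1 where 1: "has_partials2 (\<lambda>x. ln (?g x)) d1 dd1"
    "\<And>x. (\<Sum>k\<in>UNIV. dd1 k x) = 4 * ((norm y)\<^sup>2 * (1 + e) - (norm y)\<^sup>2) / (?g x)\<^sup>2"
    using ln_quad_partials [of "(norm y)\<^sup>2" "1 + e" y] quad_pos(2) [OF e] by blast
  obtain d2 dd2 where 2: "has_partials2 (\<lambda>x. ln (?f x)) d2 dd2"
    "\<And>x. (\<Sum>k\<in>UNIV. dd2 k x) = 4 * (1 * ((norm y)\<^sup>2 + e) - (norm y)\<^sup>2) / (?f x)\<^sup>2"
    using ln_quad_partials [of 1 "(norm y)\<^sup>2 + e" y] quad_pos(1) [OF e] by blast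
  obtain dU ddU where U': "has_partials2 U dU ddU" "\<And>x. (\<Sum>k\<in>UNIV. ddU k x) = - v x"
    using U by (auto simp: green_pair_def)
  have K: "log_kernel e y = (\<lambda>x. 1 / (4 * pi) * ln (?g x) + - 1 / (4 * pi) * ln (?f x))"
    by (rule ext) (simp add: log_kernel_def diff_divide_distrib)
  have p: "has_partials2 (log_kernel e y) (\<lambda>k x. 1 / (4 * pi) * d1 k x + - 1 / (4 * pi) * d2 k x)
     (\<lambda>k x. 1 / (4 * pi) * dd1 k x + - 1 / (4 * pi) * dd2 k x)"
    unfolding K by (rule has_partials2_lincomb [OF 1(1) 2(1)])
  then show "continuous_on UNIV (log_kernel e y)" by (rule has_partials2D(1))
  have z: "log_kernel e y x = 0" if "norm x = 1" for x
  proof -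
    have "quad ((norm y)\<^sup>2) (1 + e) y x = quad 1 ((norm y)\<^sup>2 + e) y x" using that by (simp add: quad_def)
    then show ?thesis by (simp add: log_kernel_def)
  qed
  have "(LINT x|lebesgue_on disk. log_kernel e y x * (\<Sum>k\<in>UNIV. ddU k x))
    = (LINT x|lebesgue_on disk. U x * (\<Sum>k\<in>UNIV. 1 / (4 * pi) * dd1 k x + - 1 / (4 * pi) * dd2 k x))"
    by (rule green_second_identity [OF p U'(1)]) (simp add: z green_pair_0D [OF U])
  then have a: "(LINT x|lebesgue_on disk. log_kernel e y x * v x)
    = - (LINT x|lebesgue_on disk. U x * (\<Sum>k\<in>UNIV. 1 / (4 * pi) * dd1 k x + - 1 / (4 * pi) * dd2 k x))"
    by (simp add: U'(2))
  have "(\<Sum>k\<in>UNIV. 1 / (4 * pi) * dd1 k x + - 1 / (4 * pi) * dd2 k x)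
    = - (e / (pi * ((norm (x - y))\<^sup>2 + e)\<^sup>2) - (e * (norm y)\<^sup>2) / (pi * (?g x)\<^sup>2))" for x
    unfolding sum.distrib sum_distrib_left [symmetric] 1(2) 2(2) quad_dist
    by (simp add: field_simps)
  then show "(LINT x|lebesgue_on disk. log_kernel e y x * v x)
    = (LINT x|lebesgue_on disk. U x * (e / (pi * ((norm (x - y))\<^sup>2 + e)\<^sup>2) - (e * (norm y)\<^sup>2) / (pi * (?g x)\<^sup>2)))"
    unfolding a by (simp only: mult_minus_right Bochner_Integration.integral_minus minus_minus)
qed

lemma log_kernel_integral_bound:
  assumes p: "1 < p"
  obtains C where "0 \<le> C" "\<And>e y v l. 0 < e \<Longrightarrow> y \<in> disk \<Longrightarrow> continuous_on UNIV v \<Longrightarrow> 0 < l \<Longrightarrow>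
    \<bar>LINT x|lebesgue_on disk. log_kernel e y x * v x\<bar> \<le> l * C + l powr (1 - p) * (LINT x|lebesgue_on disk. \<bar>v x\<bar> powr p)"
proof -
  let ?q = "p / (p - 1)"
  let ?K = "3 * (2 * ?q) powr ?q"
  let ?D = "lebesgue_on disk"
  have q: "0 < ?q" using p by simp
  show thesis
  proof (rule that [of "?K * (4 * pi)"])
    show "0 \<le> ?K * (4 * pi)" by simp
    fix e l :: real and y :: "real^2" and v :: "real^2 \<Rightarrow> real"
    assume e: "0 < e" and y: "y \<in> disk" and cv: "continuous_on UNIV v" and l: "0 < l"
    have cK: "continuous_on UNIV (log_kernel e y)"
    proof -
      have "continuous_on UNIV (\<lambda>x. ln (quad ((norm y)\<^sup>2) (1 + e) y x))" "continuous_on UNIV (\<lambda>x. ln (quad 1 ((norm y)\<^sup>2 + e) y x))"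
        using ln_quad_partials [OF quad_pos(2) [OF e]] ln_quad_partials [OF quad_pos(1) [OF e]] has_partials2D(1) by blast+
      then show ?thesis unfolding log_kernel_def [abs_def] by (intro continuous_on_divide continuous_on_diff) auto
    qed
    have sub: "disk \<subseteq> ball y 2"
    proof
      fix x :: "real^2" assume "x \<in> disk"
      then have "norm (y - x) < 2" using y norm_triangle_ineq4 [of y x] by auto
      then show "x \<in> ball y 2" by (simp add: dist_norm)
    qed
    have conv: "integrable ?D (\<lambda>x. 1 / norm (x - y))" "(LINT x|?D. 1 / norm (x - y)) \<le> 4 * pi"
    proof -
      have "set_integrable lebesgue (ball y 2) (\<lambda>x. 1 / norm (x - y))"
        using integrable_inverse_dist(1) [of y] by (simp add: set_integrable_def integrable_restrict_space)
      then have "set_integrable lebesgue disk (\<lambda>x. 1 / norm (x - y))"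
        by (rule set_integrable_subset) (use sub in auto)
      then show i: "integrable ?D (\<lambda>x. 1 / norm (x - y))"
        by (simp add: set_integrable_def integrable_restrict_space)
      have "(LINT x|?D. 1 / norm (x - y)) = (LINT x|lebesgue_on (ball y 2). (if x \<in> disk then 1 / norm (x - y) else 0))"
        using sub by (subst Lebesgue_Measure.integral_restrict_Int) (auto simp: Int_absorb2)
      also have "\<dots> \<le> (LINT x|lebesgue_on (ball y 2). 1 / norm (x - y))"
        by (rule integral_mono_AE' [OF integrable_inverse_dist(1)]) auto
      finally show "(LINT x|?D. 1 / norm (x - y)) \<le> 4 * pi" using integrable_inverse_dist(2) [of y] by linarith
    qed
    have ip: "integrable ?D (\<lambda>x. \<bar>v x\<bar> powr p)"
      using p by (intro integrable_ball_continuous continuous_on_powr' continuous_on_rabs continuous_on_subset [OF cv]) auto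
    have "norm (LINT x|?D. log_kernel e y x * v x) \<le> (LINT x|?D. norm (log_kernel e y x * v x))"
      by (rule integral_norm_bound)
    also have "\<dots> \<le> (LINT x|?D. l * (?K * (1 / norm (x - y))) + l powr (1 - p) * \<bar>v x\<bar> powr p)"
    proof (rule integral_mono_AE)
      show "integrable ?D (\<lambda>x. norm (log_kernel e y x * v x))"
        by (intro integrable_norm integrable_ball_continuous continuous_on_mult continuous_on_subset [OF cK] continuous_on_subset [OF cv]) auto
      show "integrable ?D (\<lambda>x. l * (?K * (1 / norm (x - y))) + l powr (1 - p) * \<bar>v x\<bar> powr p)"
        by (intro Bochner_Integration.integrable_add integrable_mult_right conv ip)
      have "AE x in lebesgue. x \<noteq> y" by (intro AE_not_in [where N = "{y}", simplified]) (simp add: negligible_iff_null_sets [symmetric])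
      then have "AE x in ?D. x \<noteq> y \<and> x \<in> disk" by (auto simp: AE_restrict_space_iff)
      then show "AE x in ?D. norm (log_kernel e y x * v x) \<le> l * (?K * (1 / norm (x - y))) + l powr (1 - p) * \<bar>v x\<bar> powr p"
      proof eventually_elim
        case (elim x)
        note b = log_kernel_bounds [OF e _ y, of x]
        have s: "0 < norm (x - y)" "norm (x - y) \<le> 2" using elim sub by (auto simp: dist_norm norm_minus_commute subset_iff)
        have "\<bar>log_kernel e y x * v x\<bar> = log_kernel e y x * \<bar>v x\<bar>" using b(1) elim by (simp add: abs_mult)
        also have "\<dots> \<le> l * log_kernel e y x powr ?q + l powr (1 - p) * \<bar>v x\<bar> powr p"
          using b(1) elim l p by (intro young_scaled) auto
        also have "log_kernel e y x powr ?q \<le> ln (1 + 1 / (norm (x - y))\<^sup>2) powr ?q"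
          using b elim q by (intro powr_mono2) auto
        also have "\<dots> \<le> ?K / norm (x - y)" by (rule log_powr_bound [OF q s])
        finally show ?case using l by (simp add: mult_left_mono)
      qed
    qed
    also have "\<dots> = l * (?K * (LINT x|?D. 1 / norm (x - y))) + l powr (1 - p) * (LINT x|?D. \<bar>v x\<bar> powr p)"
    proof -
      have "(LINT x|?D. l * (?K * (1 / norm (x - y))) + l powr (1 - p) * \<bar>v x\<bar> powr p)
        = (LINT x|?D. l * (?K * (1 / norm (x - y)))) + (LINT x|?D. l powr (1 - p) * \<bar>v x\<bar> powr p)"
        by (intro Bochner_Integration.integral_add integrable_mult_right conv ip)
      then show ?thesis by (simp only: integral_mult_right_zero)
    qed
    also have "\<dots> \<le> l * (?K * (4 * pi)) + l powr (1 - p) * (LINT x|?D. \<bar>v x\<bar> powr p)"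
      using conv(2) l by (intro add_right_mono mult_left_mono) auto
    finally show "\<bar>LINT x|?D. log_kernel e y x * v x\<bar> \<le> l * (?K * (4 * pi)) + l powr (1 - p) * (LINT x|?D. \<bar>v x\<bar> powr p)"
      by simp
  qed
qed

lemma poisson_mass:
  fixes y :: "real^2"
  assumes "0 < e" "0 \<le> d"
  shows "(LINT x|lebesgue_on (ball y d). e / (pi * ((norm (x - y))\<^sup>2 + e)\<^sup>2)) = d\<^sup>2 / (d\<^sup>2 + e)"
proof -
  let ?f = "\<lambda>s. e / (pi * (\<bar>s\<bar> + e)\<^sup>2)" and ?F = "\<lambda>s. - (e / (s + e)) / pi"
  have nz: "\<bar>s\<bar> + e \<noteq> 0" for s using assms(1) by (smt (verit) abs_ge_zero)
  have "(LINT x|lebesgue_on (ball y d). ?f ((norm (x - y))\<^sup>2)) = pi * (?F (d\<^sup>2) - ?F 0)"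
  proof (rule radial_integral_FTC [OF assms(2)])
    show "continuous_on UNIV ?f" using nz by (intro continuous_intros) auto
    fix s :: real assume s: "0 \<le> s"
    then have "s + e \<noteq> 0" using assms(1) by simp
    then show "(?F has_real_derivative ?f s) (at s)" using s
      by (auto intro!: derivative_eq_intros simp: power2_eq_square)
  qed
  also have "\<dots> = d\<^sup>2 / (d\<^sup>2 + e)"
  proof -
    have "d\<^sup>2 + e \<noteq> 0" using assms(1) by (smt (verit) zero_le_power2)
    moreover have "pi * (- a / pi - - b / pi) = b - a" for a b by (simp add: field_simps)
    ultimately show ?thesis using assms(1) by (simp add: diff_divide_eq_iff eq_divide_eq)
  qed
  finally show ?thesis by simp
qed

text \<open>As \<open>e\<close> tends to 0 the kernel singles out the value at \<open>y\<close>. The one-sided form suffices, since \<open>- U\<close> solves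
  the problem with right-hand side \<open>- v\<close>.\<close>

lemma green_pair_upper_bound:
  assumes U: "green_pair U v" and y: "y \<in> disk"
    and B: "\<And>e. 0 < e \<Longrightarrow> (LINT x|lebesgue_on disk. log_kernel e y x * v x) \<le> B" and B0: "0 \<le> B"
  shows "U y \<le> B"
proof (rule field_le_epsilon)
  fix k :: real assume k: "0 < k"
  let ?D = "lebesgue_on disk"
  note cU = green_pair_contD(1) [OF U]
  have "bounded (U ` cball 0 1)" using continuous_on_subset [OF cU] by (intro compact_imp_bounded compact_continuous_image) auto
  then obtain M where "\<forall>z\<in>U ` cball 0 1. norm z \<le> M" unfolding bounded_iff by blast
  then have M: "\<And>x. norm x \<le> 1 \<Longrightarrow> \<bar>U x\<bar> \<le> M" by auto
  have M0: "0 \<le> M" using M [of 0] by simp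
  show "U y \<le> B + k"
  proof (cases "U y - k \<le> 0")
    case True then show ?thesis using B0 by simp
  next
    case False
    have "isCont U y" using cU by (simp add: continuous_on_eq_continuous_at)
    then obtain d1 where d1: "0 < d1" "\<And>x. dist x y < d1 \<Longrightarrow> dist (U x) (U y) < k"
      using k by (auto simp: continuous_at_eps_delta)
    obtain d2 where d2: "0 < d2" "ball y d2 \<subseteq> disk" using y open_ball openE by blast
    define d where "d = min d1 d2"
    have d: "0 < d" "ball y d \<subseteq> disk" "\<And>x. x \<in> ball y d \<Longrightarrow> U y - k \<le> U x"
    proof -
      show "0 < d" "ball y d \<subseteq> disk" using d1 d2 by (auto simp: d_def)
      fix x assume "x \<in> ball y d"
      then have "dist (U x) (U y) < k" by (intro d1) (auto simp: d_def dist_commute)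
      then show "U y - k \<le> U x" by (simp add: dist_real_def)
    qed
    define r where "r = 1 - norm y"
    have r: "0 < r" using y by (simp add: r_def)
    define P where "P e x = e / (pi * ((norm (x - y))\<^sup>2 + e)\<^sup>2)" for e x
    define R where "R e x = (e * (norm y)\<^sup>2) / (pi * (quad ((norm y)\<^sup>2) (1 + e) y x)\<^sup>2)" for e x
    define c where "c = M * (1 / (pi * (d\<^sup>2)\<^sup>2) + 1 / (pi * (r\<^sup>2)\<^sup>2))"
    \<comment> \<open>Near \<open>y\<close> the function \<open>U\<close> is at least \<open>U y - k\<close>; away from \<open>y\<close>, and in the reflected term, the kernels are of order \<open>e\<close>.\<close>
    have main: "(U y - k) * (d\<^sup>2 / (d\<^sup>2 + e)) - e * c * pi \<le> B" if e: "0 < e" for e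
    proof -
      have P0: "0 \<le> P e x" for x using e by (simp add: P_def)
      have nz: "(norm (x - y))\<^sup>2 + e \<noteq> 0" for x using e by (smt (verit) zero_le_power2)
      have cP: "continuous_on UNIV (P e)" unfolding P_def [abs_def]
        by (intro continuous_intros) (use nz in auto)
      have cR: "continuous_on UNIV (R e)" unfolding R_def [abs_def] quad_def
        by (intro continuous_intros) (use quad_pos(2) [OF e, of y] in \<open>auto simp: quad_def less_imp_neq [symmetric]\<close>)
      have iball: "integrable ?D (\<lambda>x. if x \<in> ball y d then P e x else 0)"
        "(LINT x|?D. (if x \<in> ball y d then P e x else 0)) = d\<^sup>2 / (d\<^sup>2 + e)"
      proof -
        have "(LINT x|?D. (if x \<in> ball y d then P e x else 0)) = (LINT x|lebesgue_on (ball y d \<inter> disk). P e x)"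
          by (rule Lebesgue_Measure.integral_restrict_Int) auto
        also have "ball y d \<inter> disk = ball y d" using d(2) by auto
        finally show "(LINT x|?D. (if x \<in> ball y d then P e x else 0)) = d\<^sup>2 / (d\<^sup>2 + e)"
          using poisson_mass [OF e, of d y] d(1) by (simp add: P_def)
        have iP: "integrable ?D (P e)" by (intro integrable_ball_continuous continuous_on_subset [OF cP]) auto
        show "integrable ?D (\<lambda>x. if x \<in> ball y d then P e x else 0)"
        proof (rule Bochner_Integration.integrable_bound [OF iP])
          show "(\<lambda>x. if x \<in> ball y d then P e x else 0) \<in> borel_measurable ?D"
          proof (rule measurable_If_set)
            show "P e \<in> borel_measurable ?D" using iP by auto
            show "ball y d \<inter> space ?D \<in> sets ?D" by (auto simp: sets_restrict_space_iff)
          qed auto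
        qed (use P0 in auto)
      qed
      have ic: "integrable ?D (\<lambda>x. e * c)" by (intro integrable_ball_continuous continuous_intros)
      have lc: "(LINT x|?D. e * c) = e * c * pi"
        using radial_integral_FTC [of 1 "\<lambda>s. e * c" "\<lambda>s. e * c * s" 0] by (auto intro!: derivative_eq_intros)
      have "(U y - k) * (d\<^sup>2 / (d\<^sup>2 + e)) - e * c * pi
        = (LINT x|?D. (U y - k) * (if x \<in> ball y d then P e x else 0) - e * c)"
      proof -
        have "(LINT x|?D. (U y - k) * (if x \<in> ball y d then P e x else 0) - e * c)
          = (LINT x|?D. (U y - k) * (if x \<in> ball y d then P e x else 0)) - (LINT x|?D. e * c)"
          by (intro Bochner_Integration.integral_diff integrable_mult_right iball ic)
        then show ?thesis unfolding lc unfolding integral_mult_right_zero iball(2) by simp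
      qed
      also have "\<dots> \<le> (LINT x|?D. U x * (P e x - R e x))"
      proof (rule integral_mono)
        show "integrable ?D (\<lambda>x. (U y - k) * (if x \<in> ball y d then P e x else 0) - e * c)"
          by (intro Bochner_Integration.integrable_diff integrable_mult_right iball ic)
        show "integrable ?D (\<lambda>x. U x * (P e x - R e x))"
          by (intro integrable_ball_continuous continuous_on_mult continuous_on_diff
              continuous_on_subset [OF cU] continuous_on_subset [OF cP] continuous_on_subset [OF cR]) auto
        fix x assume "x \<in> space ?D"
        then have x: "norm x < 1" by simp
        have R: "0 \<le> R e x" "R e x \<le> e * (1 / (pi * (r\<^sup>2)\<^sup>2))"
        proof -
          show "0 \<le> R e x" using e by (simp add: R_def)
          have "norm x * norm y \<le> 1 * norm y" using x by (intro mult_right_mono) auto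
          then have "r\<^sup>2 \<le> (1 - norm x * norm y)\<^sup>2" using r by (intro power_mono) (auto simp: r_def)
          then have "r\<^sup>2 \<le> quad ((norm y)\<^sup>2) (1 + e) y x" using quad_reflected_ge [of x y e] e by linarith
          then have "(r\<^sup>2)\<^sup>2 \<le> (quad ((norm y)\<^sup>2) (1 + e) y x)\<^sup>2" by (intro power_mono) auto
          moreover have "(norm y)\<^sup>2 \<le> 1" using y by (intro power_le_one) auto
          ultimately have "R e x \<le> (e * 1) / (pi * (r\<^sup>2)\<^sup>2)"
            unfolding R_def using e r by (intro frac_le mult_left_mono) auto
          then show "R e x \<le> e * (1 / (pi * (r\<^sup>2)\<^sup>2))" by simp
        qed
        have UR: "U x * R e x \<le> M * (e * (1 / (pi * (r\<^sup>2)\<^sup>2)))"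
        proof -
          have "U x * R e x \<le> \<bar>U x\<bar> * R e x" using R by (intro mult_right_mono) auto
          also have "\<dots> \<le> M * (e * (1 / (pi * (r\<^sup>2)\<^sup>2)))" using R M [of x] x M0 by (intro mult_mono) auto
          finally show ?thesis .
        qed
        have ec: "e * c = M * (e * (1 / (pi * (d\<^sup>2)\<^sup>2))) + M * (e * (1 / (pi * (r\<^sup>2)\<^sup>2)))"
          by (simp add: c_def distrib_left mult_ac)
        show "(U y - k) * (if x \<in> ball y d then P e x else 0) - e * c \<le> U x * (P e x - R e x)"
        proof (cases "x \<in> ball y d")
          case True
          have "(U y - k) * P e x \<le> U x * P e x" using d(3) [OF True] P0 by (intro mult_right_mono) auto
          moreover have "0 \<le> M * (e * (1 / (pi * (d\<^sup>2)\<^sup>2)))" using M0 e by simp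
          ultimately show ?thesis using True UR ec by (simp add: right_diff_distrib)
        next
          case False
          then have "d \<le> norm (x - y)" by (simp add: dist_norm norm_minus_commute)
          then have "d\<^sup>2 \<le> (norm (x - y))\<^sup>2 + e" using d(1) e power_mono [of d "norm (x - y)" 2] by linarith
          then have "(d\<^sup>2)\<^sup>2 \<le> ((norm (x - y))\<^sup>2 + e)\<^sup>2" by (intro power_mono) auto
          then have "P e x \<le> e / (pi * (d\<^sup>2)\<^sup>2)" unfolding P_def using e d(1) by (intro frac_le mult_left_mono) auto
          then have "\<bar>U x\<bar> * P e x \<le> M * (e * (1 / (pi * (d\<^sup>2)\<^sup>2)))" using M [of x] x M0 P0 by (intro mult_mono) auto
          moreover have "- (U x * P e x) \<le> \<bar>U x\<bar> * P e x" using P0 [of x]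
            by (metis abs_ge_minus_self minus_mult_left mult_right_mono)
          ultimately show ?thesis using False UR ec by (simp add: right_diff_distrib)
        qed
      qed
      also have "\<dots> = (LINT x|?D. log_kernel e y x * v x)"
        unfolding log_kernel_identity(1) [OF e y U] by (simp add: P_def R_def)
      also have "\<dots> \<le> B" by (rule B [OF e])
      finally show ?thesis .
    qed
    define s where "s n = inverse (real (Suc n))" for n
    have s: "0 < s n" for n by (simp add: s_def)
    have sl: "s \<longlonglongrightarrow> 0" unfolding s_def by (rule LIMSEQ_inverse_real_of_nat)
    have "(\<lambda>n. (U y - k) * (d\<^sup>2 / (d\<^sup>2 + s n)) - s n * c * pi) \<longlonglongrightarrow> (U y - k) * (d\<^sup>2 / (d\<^sup>2 + 0)) - 0 * c * pi"
      by (intro tendsto_intros sl) (use d(1) in auto)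
    then have "(\<lambda>n. (U y - k) * (d\<^sup>2 / (d\<^sup>2 + s n)) - s n * c * pi) \<longlonglongrightarrow> U y - k" using d(1) by simp
    then have "U y - k \<le> B" by (rule LIMSEQ_le_const2) (use main [OF s] in auto)
    then show ?thesis by simp
  qed
qed

text \<open>The continuity of the Green operator from \<open>L\<^sup>p\<close> to the bounded functions, in the scaled form of
  \<open>young_scaled\<close>.\<close>

lemma green_pair_sup_bound:
  assumes p: "1 < p"
  obtains C where "0 \<le> C" "\<And>U v y l. green_pair U v \<Longrightarrow> y \<in> disk \<Longrightarrow> 0 < l \<Longrightarrow>
    \<bar>U y\<bar> \<le> l * C + l powr (1 - p) * (LINT x|lebesgue_on disk. \<bar>v x\<bar> powr p)"
proof -
  obtain C where C: "0 \<le> C" "\<And>e y v l. 0 < e \<Longrightarrow> y \<in> disk \<Longrightarrow> continuous_on UNIV v \<Longrightarrow> 0 < l \<Longrightarrow>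
    \<bar>LINT x|lebesgue_on disk. log_kernel e y x * v x\<bar> \<le> l * C + l powr (1 - p) * (LINT x|lebesgue_on disk. \<bar>v x\<bar> powr p)"
    using log_kernel_integral_bound [OF p] by blast
  show thesis
  proof (rule that [OF C(1)])
    fix U v y and l :: real assume U: "green_pair U v" and y: "y \<in> disk" and l: "0 < l"
    let ?B = "l * C + l powr (1 - p) * (LINT x|lebesgue_on disk. \<bar>v x\<bar> powr p)"
    have B0: "0 \<le> ?B" using C(1) l by (intro add_nonneg_nonneg mult_nonneg_nonneg integral_nonneg_AE) auto
    note cv = green_pair_contD(2) [OF U]
    have b: "\<bar>LINT x|lebesgue_on disk. log_kernel e y x * v x\<bar> \<le> ?B" if "0 < e" for e
      by (rule C(2) [OF that y cv l])
    have "U y \<le> ?B" by (rule green_pair_upper_bound [OF U y _ B0]) (use b in \<open>simp add: abs_le_iff\<close>)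
    moreover have "- U y \<le> ?B"
    proof (rule green_pair_upper_bound [OF _ y _ B0])
      show "green_pair (\<lambda>x. - U x) (\<lambda>x. - v x)" using green_pair_lincomb [OF U U, of "- 1" 0] by simp
    qed (use b in \<open>simp add: abs_le_iff\<close>)
    ultimately show "\<bar>U y\<bar> \<le> ?B" by linarith
  qed
qed

section \<open>Density of the polynomials\<close>

text \<open>The \<open>p\<close>-th power of the norm is handier than the norm: only convergence to 0 matters, and for this
  \<open>powr_add_le\<close> is as good as Minkowski's inequality.\<close>

abbreviation Lp_power :: "real \<Rightarrow> (real^2 \<Rightarrow> real) \<Rightarrow> real" where
  "Lp_power p v \<equiv> (LINT x|lebesgue_on disk. \<bar>v x\<bar> powr p)"

definition clamp_real :: "real \<Rightarrow> real \<Rightarrow> real" where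
  "clamp_real M t = max (- M) (min M t)"

lemma clamp_real_props:
  "0 \<le> M \<Longrightarrow> \<bar>clamp_real M t\<bar> \<le> M" "\<bar>t\<bar> \<le> M \<Longrightarrow> clamp_real M t = t"
  "\<bar>clamp_real M s - clamp_real M t\<bar> \<le> \<bar>s - t\<bar>" "0 \<le> M \<Longrightarrow> \<bar>clamp_real M t\<bar> \<le> \<bar>t\<bar>"
  by (auto simp: clamp_real_def)

lemma powr_add_le:
  fixes a b p :: real
  assumes "0 < p" shows "\<bar>a + b\<bar> powr p \<le> 2 powr p * (\<bar>a\<bar> powr p + \<bar>b\<bar> powr p)"
proof -
  have "\<bar>a + b\<bar> powr p \<le> (2 * max \<bar>a\<bar> \<bar>b\<bar>) powr p" using assms by (intro powr_mono2) auto
  also have "\<dots> = 2 powr p * max \<bar>a\<bar> \<bar>b\<bar> powr p" by (simp add: powr_mult)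
  also have "max \<bar>a\<bar> \<bar>b\<bar> powr p \<le> \<bar>a\<bar> powr p + \<bar>b\<bar> powr p" by (simp add: max_def)
  finally show ?thesis by simp
qed

lemma Lp_diskD: "v \<in> Lp_disk p \<Longrightarrow> v \<in> borel_measurable (lebesgue_on disk)"
  "v \<in> Lp_disk p \<Longrightarrow> integrable (lebesgue_on disk) (\<lambda>x. \<bar>v x\<bar> powr p)"
  by (auto simp: Lp_disk_def)

lemma powr_measurable_disk:
  "v \<in> borel_measurable (lebesgue_on disk) \<Longrightarrow> (\<lambda>x. \<bar>v x\<bar> powr p) \<in> borel_measurable (lebesgue_on disk)"
  for v :: "real^2 \<Rightarrow> real" by measurable

lemma Lp_disk_bounded:
  assumes "v \<in> borel_measurable (lebesgue_on disk)" "\<And>x. x \<in> disk \<Longrightarrow> \<bar>v x\<bar> \<le> M" "0 < p"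
  shows "v \<in> Lp_disk p"
  unfolding Lp_disk_def
  using assms by (auto intro!: integrable_ball_bounded [where B = "M powr p"] powr_measurable_disk powr_mono2)

lemma Lp_disk_add:
  assumes v: "v \<in> Lp_disk p" and w: "w \<in> Lp_disk p" and p: "0 < p"
  shows "(\<lambda>x. v x + w x) \<in> Lp_disk p" "Lp_power p (\<lambda>x. v x + w x) \<le> 2 powr p * (Lp_power p v + Lp_power p w)"
proof -
  let ?D = "lebesgue_on disk"
  have i: "integrable ?D (\<lambda>x. 2 powr p * (\<bar>v x\<bar> powr p + \<bar>w x\<bar> powr p))"
    using Lp_diskD(2) [OF v] Lp_diskD(2) [OF w] by (intro integrable_mult_right Bochner_Integration.integrable_add)
  have m: "(\<lambda>x. v x + w x) \<in> borel_measurable ?D" using Lp_diskD(1) [OF v] Lp_diskD(1) [OF w] by measurable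
  have ii: "integrable ?D (\<lambda>x. \<bar>v x + w x\<bar> powr p)"
    by (rule Bochner_Integration.integrable_bound [OF i powr_measurable_disk [OF m]])
      (use powr_add_le [OF p] in \<open>auto intro!: AE_I2 simp: abs_mult\<close>)
  then show "(\<lambda>x. v x + w x) \<in> Lp_disk p" using m by (simp add: Lp_disk_def)
  have "Lp_power p (\<lambda>x. v x + w x) \<le> (LINT x|?D. 2 powr p * (\<bar>v x\<bar> powr p + \<bar>w x\<bar> powr p))"
    by (rule integral_mono [OF ii i]) (rule powr_add_le [OF p])
  also have "\<dots> = 2 powr p * (Lp_power p v + Lp_power p w)"
    using Lp_diskD(2) [OF v] Lp_diskD(2) [OF w] by simp
  finally show "Lp_power p (\<lambda>x. v x + w x) \<le> 2 powr p * (Lp_power p v + Lp_power p w)" .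
qed

lemma Lp_disk_minus: "v \<in> Lp_disk p \<Longrightarrow> (\<lambda>x. - v x) \<in> Lp_disk p"
  by (auto simp: Lp_disk_def)

lemma Lp_disk_diff:
  assumes v: "v \<in> Lp_disk p" and w: "w \<in> Lp_disk p" and p: "0 < p"
  shows "(\<lambda>x. v x - w x) \<in> Lp_disk p" "Lp_power p (\<lambda>x. v x - w x) \<le> 2 powr p * (Lp_power p v + Lp_power p w)"
  using Lp_disk_add [OF v Lp_disk_minus [OF w] p] by auto

lemma Lp_power_nonneg: "0 \<le> Lp_power p v" by (rule integral_nonneg_AE) auto

lemma integrable_disk_const: "integrable (lebesgue_on disk) (\<lambda>x. c :: real)"
  by (intro integrable_ball_continuous continuous_intros)

lemma integral_disk_const: "(LINT x|lebesgue_on disk. c :: real) = pi * c"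
  using radial_integral_FTC [of 1 "\<lambda>s. c" "\<lambda>s. c * s" 0] by (auto intro!: derivative_eq_intros)

lemma Lp_disk_integrable:
  assumes v: "v \<in> Lp_disk p" and p: "1 < p"
  shows "integrable (lebesgue_on disk) v"
    "0 < l \<Longrightarrow> (LINT x|lebesgue_on disk. \<bar>v x\<bar>) \<le> l * pi + l powr (1 - p) * Lp_power p v"
proof -
  let ?D = "lebesgue_on disk"
  have b: "\<bar>v x\<bar> \<le> l + l powr (1 - p) * \<bar>v x\<bar> powr p" if "0 < l" for l x
    using young_scaled [of 1 "\<bar>v x\<bar>" l p] that p by simp
  have i: "integrable ?D (\<lambda>x. l + l powr (1 - p) * \<bar>v x\<bar> powr p)" for l
    by (intro Bochner_Integration.integrable_add integrable_disk_const integrable_mult_right Lp_diskD(2) [OF v])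
  show iv: "integrable ?D v"
    by (rule Bochner_Integration.integrable_bound [OF i [of 1] Lp_diskD(1) [OF v]])
      (use b [of 1] in \<open>auto intro!: AE_I2\<close>)
  show "(LINT x|?D. \<bar>v x\<bar>) \<le> l * pi + l powr (1 - p) * Lp_power p v" if l: "0 < l"
  proof -
    have "(LINT x|?D. \<bar>v x\<bar>) \<le> (LINT x|?D. l + l powr (1 - p) * \<bar>v x\<bar> powr p)"
      using iv by (intro integral_mono i b l) auto
    also have "\<dots> = l * pi + l powr (1 - p) * Lp_power p v"
    proof -
      have "(LINT x|?D. l + l powr (1 - p) * \<bar>v x\<bar> powr p) = (LINT x|?D. l) + (LINT x|?D. l powr (1 - p) * \<bar>v x\<bar> powr p)"
        by (intro Bochner_Integration.integral_add integrable_disk_const integrable_mult_right Lp_diskD(2) [OF v])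
      then show ?thesis unfolding integral_disk_const integral_mult_right_zero by (simp only: mult.commute)
    qed
    finally show ?thesis .
  qed
qed

lemma integrable_mult_bounded:
  fixes v w :: "real^2 \<Rightarrow> real"
  assumes v: "integrable (lebesgue_on disk) v" and w: "w \<in> borel_measurable (lebesgue_on disk)"
    and b: "\<And>x. x \<in> disk \<Longrightarrow> \<bar>w x\<bar> \<le> M"
  shows "integrable (lebesgue_on disk) (\<lambda>x. v x * w x)" "\<bar>LINT x|lebesgue_on disk. v x * w x\<bar> \<le> M * (LINT x|lebesgue_on disk. \<bar>v x\<bar>)"
proof -
  let ?D = "lebesgue_on disk"
  have i: "integrable ?D (\<lambda>x. M * \<bar>v x\<bar>)" using v by auto
  have le: "\<bar>v x * w x\<bar> \<le> M * \<bar>v x\<bar>" if "x \<in> disk" for x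
  proof -
    have "\<bar>v x\<bar> * \<bar>w x\<bar> \<le> \<bar>v x\<bar> * M" using b [OF that] by (intro mult_left_mono) auto
    then show ?thesis by (simp add: abs_mult mult.commute)
  qed
  show ii: "integrable ?D (\<lambda>x. v x * w x)"
  proof (rule Bochner_Integration.integrable_bound [OF i])
    show "(\<lambda>x. v x * w x) \<in> borel_measurable ?D" using v w by measurable
    show "AE x in ?D. norm (v x * w x) \<le> norm (M * \<bar>v x\<bar>)"
    proof (rule AE_I2)
      fix x assume "x \<in> space ?D"
      then have "\<bar>v x * w x\<bar> \<le> M * \<bar>v x\<bar>" using le by simp
      then show "norm (v x * w x) \<le> norm (M * \<bar>v x\<bar>)" by simp
    qed
  qed
  have "norm (LINT x|?D. v x * w x) \<le> (LINT x|?D. M * \<bar>v x\<bar>)"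
    by (rule Bochner_Integration.integral_norm_bound_integral [OF ii i]) (use le in auto)
  then show "\<bar>LINT x|?D. v x * w x\<bar> \<le> M * (LINT x|?D. \<bar>v x\<bar>)" by simp
qed

lemma continuous_approx_bounded:
  fixes v :: "real^2 \<Rightarrow> real"
  assumes m: "v \<in> borel_measurable (lebesgue_on disk)" and b: "\<And>x. x \<in> disk \<Longrightarrow> \<bar>v x\<bar> \<le> M" and M: "0 \<le> M" and p: "0 < p"
    and e: "0 < e"
  obtains g where "continuous_on UNIV g" "\<And>x. \<bar>g x\<bar> \<le> M" "Lp_power p (\<lambda>x. v x - g x) < e"
proof -
  let ?D = "lebesgue_on disk"
  have "v measurable_on disk" using m by (subst measurable_on_iff_borel_measurable) auto
  then obtain N g where N: "negligible N" and cg: "\<And>n. continuous_on UNIV (g n)"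
    and lim: "\<And>x. x \<notin> N \<Longrightarrow> (\<lambda>n. g n x) \<longlonglongrightarrow> (if x \<in> disk then v x else 0)"
    unfolding measurable_on_def by blast
  define h where "h n x = clamp_real M (g n x)" for n x
  have ch: "continuous_on UNIV (h n)" for n
    unfolding h_def clamp_real_def by (intro continuous_intros cg)
  have bh: "\<bar>h n x\<bar> \<le> M" for n x by (simp add: h_def clamp_real_props M)
  have "(\<lambda>n. Lp_power p (\<lambda>x. v x - h n x)) \<longlonglongrightarrow> (LINT x|?D. 0)"
  proof (rule integral_dominated_convergence [where w = "\<lambda>x. (2 * M) powr p"])
    show "integrable ?D (\<lambda>x. (2 * M) powr p)" by (rule integrable_disk_const)
    show "(\<lambda>x. \<bar>v x - h n x\<bar> powr p) \<in> borel_measurable ?D" for n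
    proof (rule powr_measurable_disk)
      have "h n \<in> borel_measurable ?D" by (rule continuous_measurable_ball [OF continuous_on_subset [OF ch]]) auto
      then show "(\<lambda>x. v x - h n x) \<in> borel_measurable ?D" using m by measurable
    qed
    have "AE x in lebesgue. x \<notin> N" using N by (simp add: AE_not_in negligible_iff_null_sets)
    then have "AE x in ?D. x \<in> disk \<and> x \<notin> N" by (auto simp: AE_restrict_space_iff)
    then show "AE x in ?D. (\<lambda>n. \<bar>v x - h n x\<bar> powr p) \<longlonglongrightarrow> 0"
    proof eventually_elim
      case (elim x)
      then have "(\<lambda>n. g n x) \<longlonglongrightarrow> v x" using lim [of x] by simp
      then have "(\<lambda>n. h n x) \<longlonglongrightarrow> max (- M) (min M (v x))"
        unfolding h_def clamp_real_def by (intro tendsto_intros)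
      moreover have "max (- M) (min M (v x)) = v x" using b [of x] elim by auto
      ultimately have "(\<lambda>n. \<bar>v x - h n x\<bar>) \<longlonglongrightarrow> \<bar>v x - v x\<bar>" by (intro tendsto_intros) simp
      from tendsto_powr' [OF this tendsto_const [of p]] p show ?case by simp
    qed
    show "AE x in ?D. norm (\<bar>v x - h n x\<bar> powr p) \<le> (2 * M) powr p" for n
    proof (rule AE_I2)
      fix x assume "x \<in> space ?D"
      then have "\<bar>v x - h n x\<bar> \<le> 2 * M" using b [of x] bh [of n x] by auto
      then show "norm (\<bar>v x - h n x\<bar> powr p) \<le> (2 * M) powr p" using p by (simp add: powr_mono2)
    qed
  qed auto
  then have "\<forall>\<^sub>F n in sequentially. Lp_power p (\<lambda>x. v x - h n x) < e" using e by (intro order_tendstoD(2)) auto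
  then obtain n where "Lp_power p (\<lambda>x. v x - h n x) < e" by (auto simp: eventually_sequentially)
  then show thesis using that [OF ch bh] by blast
qed

text \<open>A bounded measurable function is an almost everywhere limit of continuous functions with the same bound,
  and these are uniform limits of polynomials.\<close>

lemma mode_sum_dense_bounded:
  fixes v :: "real^2 \<Rightarrow> real"
  assumes m: "v \<in> borel_measurable (lebesgue_on disk)" and b: "\<And>x. x \<in> disk \<Longrightarrow> \<bar>v x\<bar> \<le> M" and p: "0 < p" and e: "0 < e"
  obtains q where "mode_sum q" "Lp_power p (\<lambda>x. v x - q x) < e"
proof -
  have M: "0 \<le> M" using b [of 0] by simp
  define c where "c = e / (2 * 2 powr p)"
  have c: "0 < c" using e by (simp add: c_def)
  obtain g where g: "continuous_on UNIV g" "\<And>x. \<bar>g x\<bar> \<le> M" "Lp_power p (\<lambda>x. v x - g x) < c"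
    using continuous_approx_bounded [OF m b M p c] by blast
  define d where "d = (c / (2 * pi)) powr (1 / p)"
  have d: "0 < d" using c by (simp add: d_def)
  obtain q where q: "real_polynomial_function q" "\<And>x. x \<in> cball 0 1 \<Longrightarrow> \<bar>g x - q x\<bar> < d"
    using Stone_Weierstrass_real_polynomial_function [OF compact_cball continuous_on_subset [OF g(1)] d] by blast
  have ms: "mode_sum q" by (rule polynomial_imp_mode_sum [OF q(1)])
  have cq: "continuous_on UNIV q" by (rule mode_sum_continuous [OF ms])
  have mg: "g \<in> borel_measurable (lebesgue_on disk)" "q \<in> borel_measurable (lebesgue_on disk)"
    by (rule continuous_measurable_ball, rule continuous_on_subset, rule g cq, simp)+
  have vg: "(\<lambda>x. v x - g x) \<in> Lp_disk p"
  proof (rule Lp_disk_bounded [OF _ _ p])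
    show "(\<lambda>x. v x - g x) \<in> borel_measurable (lebesgue_on disk)" using m mg by measurable
    show "\<bar>v x - g x\<bar> \<le> M + M" if "x \<in> disk" for x using b [OF that] g(2) [of x] by linarith
  qed
  have gq: "(\<lambda>x. g x - q x) \<in> Lp_disk p"
  proof (rule Lp_disk_bounded [OF _ _ p])
    show "(\<lambda>x. g x - q x) \<in> borel_measurable (lebesgue_on disk)" using mg by measurable
    show "\<bar>g x - q x\<bar> \<le> d" if "x \<in> disk" for x using q(2) [of x] that by auto
  qed
  have "Lp_power p (\<lambda>x. g x - q x) \<le> (LINT x|lebesgue_on disk. c / (2 * pi))"
  proof (rule integral_mono [OF Lp_diskD(2) [OF gq] integrable_disk_const])
    fix x assume "x \<in> space (lebesgue_on disk)"
    then have "\<bar>g x - q x\<bar> \<le> d" using q(2) [of x] by auto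
    then have "\<bar>g x - q x\<bar> powr p \<le> d powr p" using p by (intro powr_mono2) auto
    also have "\<dots> = c / (2 * pi)" using p c by (simp add: d_def powr_powr)
    finally show "\<bar>g x - q x\<bar> powr p \<le> c / (2 * pi)" .
  qed
  also have "\<dots> = c / 2" unfolding integral_disk_const by simp
  finally have 2: "Lp_power p (\<lambda>x. g x - q x) < c" using c by linarith
  have "Lp_power p (\<lambda>x. v x - q x) = Lp_power p (\<lambda>x. (v x - g x) + (g x - q x))" by simp
  also have "\<dots> \<le> 2 powr p * (Lp_power p (\<lambda>x. v x - g x) + Lp_power p (\<lambda>x. g x - q x))" by (rule Lp_disk_add(2) [OF vg gq p])
  also have "\<dots> < 2 powr p * (c + c)" using g(3) 2 by (intro mult_strict_left_mono) auto
  also have "\<dots> = e" by (simp add: c_def)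
  finally show thesis using that ms by blast
qed

lemma mode_sum_Lp: assumes "mode_sum q" "0 < p" shows "q \<in> Lp_disk p"
proof -
  have c: "continuous_on UNIV q" by (rule mode_sum_continuous [OF assms(1)])
  have "bounded (q ` cball 0 1)" using continuous_on_subset [OF c] by (intro compact_imp_bounded compact_continuous_image) auto
  then obtain B where "\<forall>z\<in>q ` cball 0 1. norm z \<le> B" unfolding bounded_iff by blast
  then show ?thesis
    by (intro Lp_disk_bounded [OF _ _ assms(2), where M = B] continuous_measurable_ball continuous_on_subset [OF c]) auto
qed

lemma clamp_measurable: "v \<in> borel_measurable M \<Longrightarrow> (\<lambda>x. clamp_real c (v x)) \<in> borel_measurable M"
  for v :: "_ \<Rightarrow> real" unfolding clamp_real_def
  by (intro borel_measurable_max borel_measurable_min borel_measurable_const)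

lemma mode_sum_dense:
  assumes v: "v \<in> Lp_disk p" and p: "1 < p" and e: "0 < e"
  obtains q where "mode_sum q" "Lp_power p (\<lambda>x. v x - q x) < e"
proof -
  let ?D = "lebesgue_on disk"
  have p0: "0 < p" using p by simp
  define h where "h n x = clamp_real (real n) (v x)" for n x
  note mv = Lp_diskD(1) [OF v]
  have mh: "h n \<in> borel_measurable ?D" for n unfolding h_def by (rule clamp_measurable [OF mv])
  have bh: "\<bar>h n x\<bar> \<le> real n" for n x by (simp add: h_def clamp_real_props)
  have hL: "h n \<in> Lp_disk p" for n by (rule Lp_disk_bounded [OF mh bh p0])
  have "(\<lambda>n. Lp_power p (\<lambda>x. v x - h n x)) \<longlonglongrightarrow> (LINT x|?D. 0)"
  proof (rule integral_dominated_convergence [where w = "\<lambda>x. \<bar>v x\<bar> powr p"])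
    show "integrable ?D (\<lambda>x. \<bar>v x\<bar> powr p)" by (rule Lp_diskD(2) [OF v])
    show "(\<lambda>x. \<bar>v x - h n x\<bar> powr p) \<in> borel_measurable ?D" for n
      using mv mh by (intro powr_measurable_disk) measurable
    show "AE x in ?D. (\<lambda>n. \<bar>v x - h n x\<bar> powr p) \<longlonglongrightarrow> 0"
    proof (rule AE_I2)
      fix x
      obtain n0 :: nat where "\<bar>v x\<bar> \<le> real n0" using real_arch_simple by blast
      then have "\<bar>v x - h n x\<bar> powr p = 0" if "n0 \<le> n" for n
        using that by (simp add: h_def clamp_real_props)
      then show "(\<lambda>n. \<bar>v x - h n x\<bar> powr p) \<longlonglongrightarrow> 0"
        by (intro tendsto_eventually) (auto simp: eventually_sequentially)
    qed
    show "AE x in ?D. norm (\<bar>v x - h n x\<bar> powr p) \<le> \<bar>v x\<bar> powr p" for n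
    proof (rule AE_I2)
      fix x
      have "\<bar>v x - h n x\<bar> \<le> \<bar>v x\<bar>" by (auto simp: h_def clamp_real_def)
      then show "norm (\<bar>v x - h n x\<bar> powr p) \<le> \<bar>v x\<bar> powr p" using p0 by (simp add: powr_mono2)
    qed
  qed auto
  define c where "c = e / (2 * 2 powr p)"
  have c: "0 < c" using e by (simp add: c_def)
  have "\<forall>\<^sub>F n in sequentially. Lp_power p (\<lambda>x. v x - h n x) < c"
    using \<open>(\<lambda>n. Lp_power p (\<lambda>x. v x - h n x)) \<longlonglongrightarrow> (LINT x|?D. 0)\<close> c by (intro order_tendstoD(2)) auto
  then obtain n where n: "Lp_power p (\<lambda>x. v x - h n x) < c" by (auto simp: eventually_sequentially)
  obtain q where q: "mode_sum q" "Lp_power p (\<lambda>x. h n x - q x) < c"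
    using mode_sum_dense_bounded [OF mh bh p0 c] by blast
  have L: "(\<lambda>x. v x - h n x) \<in> Lp_disk p" "(\<lambda>x. h n x - q x) \<in> Lp_disk p"
    by (rule Lp_disk_diff [OF v hL p0] Lp_disk_diff [OF hL mode_sum_Lp [OF q(1) p0] p0])+
  have "Lp_power p (\<lambda>x. v x - q x) = Lp_power p (\<lambda>x. (v x - h n x) + (h n x - q x))" by simp
  also have "\<dots> \<le> 2 powr p * (Lp_power p (\<lambda>x. v x - h n x) + Lp_power p (\<lambda>x. h n x - q x))" by (rule Lp_disk_add(2) [OF L p0])
  also have "\<dots> < 2 powr p * (c + c)" using n q(2) by (intro mult_strict_left_mono) auto
  also have "\<dots> = e" by (simp add: c_def)
  finally show thesis using that q(1) by blast
qed

section \<open>The Green operator and the energy\<close>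

lemma dirichlet_solution_cong:
  assumes "\<And>x. x \<in> disk \<Longrightarrow> v x = v' x"
  shows "dirichlet_solution v u \<longleftrightarrow> dirichlet_solution v' u"
proof -
  have "(LINT x|lebesgue_on disk. v x * \<phi> x) = (LINT x|lebesgue_on disk. v' x * \<phi> x)" for \<phi>
    by (rule Bochner_Integration.integral_cong) (use assms in auto)
  then show ?thesis by (simp add: dirichlet_solution_def)
qed

lemma green_op_cong: "(\<And>x. x \<in> disk \<Longrightarrow> v x = v' x) \<Longrightarrow> green_op v = green_op v'"
proof -
  assume "\<And>x. x \<in> disk \<Longrightarrow> v x = v' x"
  then have "dirichlet_solution v = dirichlet_solution v'" by (intro ext dirichlet_solution_cong)
  then show ?thesis by (simp add: green_op_def)
qed

text \<open>Fix a small \<open>l\<close> first and let \<open>n\<close> grow afterwards.\<close>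

lemma scaled_bound_tendsto_0:
  fixes X N :: "nat \<Rightarrow> real"
  assumes X: "\<And>n l. 0 < l \<Longrightarrow> X n \<le> l * C + l powr a * (K * N n)" "\<And>n. 0 \<le> X n" and N: "N \<longlonglongrightarrow> 0" and C: "0 \<le> C"
  shows "X \<longlonglongrightarrow> 0"
proof (rule LIMSEQ_I)
  fix r :: real assume r: "0 < r"
  define l where "l = r / 2 / (C + 1)"
  have nz: "C + 1 \<noteq> 0" using C by linarith
  have l: "0 < l" using r C by (simp add: l_def)
  have "l * C \<le> l * (C + 1)" using l by simp
  also have "\<dots> = r / 2" using nonzero_eq_divide_eq [OF nz] l_def by blast
  finally have lC: "l * C \<le> r / 2" .
  have "(\<lambda>n. l powr a * (K * N n)) \<longlonglongrightarrow> l powr a * (K * 0)" by (intro tendsto_intros N)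
  then have "\<forall>\<^sub>F n in sequentially. l powr a * (K * N n) < r / 2" using r by (intro order_tendstoD(2)) auto
  then have "\<forall>\<^sub>F n in sequentially. norm (X n - 0) < r"
  proof eventually_elim
    case (elim n) then show ?case using X(1) [OF l, of n] X(2) [of n] lC by simp
  qed
  then show "\<exists>no. \<forall>n\<ge>no. norm (X n - 0) < r" by (simp add: eventually_sequentially)
qed

lemma test_function_bounded: "test_function \<phi> \<Longrightarrow> \<exists>B. \<forall>x\<in>disk. \<bar>\<phi> x\<bar> \<le> B"
proof -
  assume "test_function \<phi>"
  then have c: "continuous_on UNIV \<phi>" by (rule has_partials2D(1) [OF test_function_partials])
  have "bounded (\<phi> ` cball 0 1)" using continuous_on_subset [OF c] by (intro compact_imp_bounded compact_continuous_image) auto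
  then obtain B where "\<forall>z\<in>\<phi> ` cball 0 1. norm z \<le> B" unfolding bounded_iff by blast
  then show ?thesis by (intro exI [of _ B]) auto
qed

lemma test_function_measurable: "test_function \<phi> \<Longrightarrow> \<phi> \<in> borel_measurable (lebesgue_on disk)"
  by (intro continuous_measurable_ball continuous_on_subset [OF has_partials2D(1) [OF test_function_partials]]) auto

text \<open>Approximate \<open>v\<close> by polynomials in \<open>L\<^sup>p\<close>. By the sup bound, applied to differences, their solutions converge
  uniformly on the closed disk.\<close>

lemma dirichlet_solution_exists:
  assumes p: "1 < p"
  obtains C where "0 \<le> C"
    "\<And>v. v \<in> Lp_disk p \<Longrightarrow> \<exists>u. dirichlet_solution v u \<and>
       (\<forall>y. \<forall>l>0. \<bar>u y\<bar> \<le> l * C + l powr (1 - p) * (2 powr p * Lp_power p v))"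
proof -
  let ?D = "lebesgue_on disk"
  have p0: "0 < p" using p by simp
  obtain C where C: "0 \<le> C" "\<And>U v y l. green_pair U v \<Longrightarrow> y \<in> disk \<Longrightarrow> 0 < l \<Longrightarrow>
    \<bar>U y\<bar> \<le> l * C + l powr (1 - p) * (LINT x|lebesgue_on disk. \<bar>v x\<bar> powr p)"
    using green_pair_sup_bound [OF p] by blast
  show thesis
  proof (rule that [OF C(1)])
    fix v assume v: "v \<in> Lp_disk p"
    have "\<exists>q. mode_sum q \<and> Lp_power p (\<lambda>x. v x - q x) < inverse (real (Suc n))" for n
    proof -
      have "0 < inverse (real (Suc n))" by simp
      from mode_sum_dense [OF v p this] show ?thesis by blast
    qed
    then obtain q where q: "\<And>n. mode_sum (q n)" "\<And>n. Lp_power p (\<lambda>x. v x - q n x) < inverse (real (Suc n))"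
      using choice [of "\<lambda>n q. mode_sum q \<and> Lp_power p (\<lambda>x. v x - q x) < inverse (real (Suc n))"] by blast
    have qL: "q n \<in> Lp_disk p" for n by (rule mode_sum_Lp [OF q(1) p0])
    have vqL: "(\<lambda>x. v x - q n x) \<in> Lp_disk p" for n by (rule Lp_disk_diff(1) [OF v qL p0])
    have qlim: "(\<lambda>n. Lp_power p (\<lambda>x. v x - q n x)) \<longlonglongrightarrow> 0"
    proof (rule tendsto_sandwich [OF _ _ tendsto_const LIMSEQ_inverse_real_of_nat])
      show "\<forall>\<^sub>F n in sequentially. 0 \<le> Lp_power p (\<lambda>x. v x - q n x)" by (intro always_eventually allI Lp_power_nonneg)
      show "\<forall>\<^sub>F n in sequentially. Lp_power p (\<lambda>x. v x - q n x) \<le> inverse (real (Suc n))"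
        using q(2) by (intro always_eventually allI less_imp_le)
    qed
    obtain U where U: "\<And>n. green_pair (U n) (q n)" using choice [of "\<lambda>n U. green_pair U (q n)"] mode_sum_green_pair [OF q(1)] by blast
    have diff: "\<bar>U n y - U m y\<bar> \<le> l * C + l powr (1 - p) * (2 powr p * (Lp_power p (\<lambda>x. v x - q m x) + Lp_power p (\<lambda>x. v x - q n x)))"
      if y: "y \<in> cball 0 1" and l: "0 < l" for n m y l
    proof (cases "norm y = 1")
      case True
      then show ?thesis using C(1) l Lp_power_nonneg
        by (simp add: green_pair_0D [OF U])
    next
      case False
      then have y: "y \<in> disk" using y by auto
      have "\<bar>U n y - U m y\<bar> \<le> l * C + l powr (1 - p) * Lp_power p (\<lambda>x. q n x - q m x)"
        using C(2) [OF green_pair_lincomb [OF U [of n] U [of m], of 1 "-1"] y l] by simp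
      also have "\<dots> \<le> l * C + l powr (1 - p) * (2 powr p * (Lp_power p (\<lambda>x. v x - q m x) + Lp_power p (\<lambda>x. v x - q n x)))"
        using Lp_disk_diff(2) [OF vqL vqL p0, of m n] by (intro add_left_mono mult_left_mono) auto
      finally show ?thesis .
    qed
    have "uniformly_Cauchy_on (cball 0 1) U"
    proof (rule uniformly_Cauchy_onI')
      fix r :: real assume r: "0 < r"
      define l where "l = r / 2 / (C + 1)"
      have nz: "C + 1 \<noteq> 0" using C by linarith
      have l: "0 < l" using r C by (simp add: l_def)
      have "l * C \<le> l * (C + 1)" using l by simp
      also have "\<dots> = r / 2" using nonzero_eq_divide_eq [OF nz] l_def by blast
      finally have lC: "l * C \<le> r / 2" .
      define k where "k = r / (8 * (l powr (1 - p) * 2 powr p))"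
      have k: "0 < k" using r l by (simp add: k_def)
      obtain M where M: "\<And>n. n \<ge> M \<Longrightarrow> Lp_power p (\<lambda>x. v x - q n x) < k"
        using order_tendstoD(2) [OF qlim k] by (auto simp: eventually_sequentially)
      have "dist (U m y) (U n y) < r" if y: "y \<in> cball 0 1" and mn: "M \<le> m" "m < n" for y m n
      proof -
        have "dist (U m y) (U n y) \<le> l * C + l powr (1 - p) * (2 powr p * (Lp_power p (\<lambda>x. v x - q n x) + Lp_power p (\<lambda>x. v x - q m x)))"
          using diff [OF y l, of m n] by (simp add: dist_real_def)
        also have "\<dots> \<le> r / 2 + l powr (1 - p) * (2 powr p * (k + k))"
          using M [of m] M [of n] mn by (intro add_mono lC mult_left_mono) auto
        also have "l powr (1 - p) * (2 powr p * (k + k)) = r / 4" using l by (simp add: k_def field_simps)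
        finally show ?thesis using r by simp
      qed
      then show "\<exists>M. \<forall>x\<in>cball 0 1. \<forall>m\<ge>M. \<forall>n>m. dist (U m x) (U n x) < r" by blast
    qed
    then obtain u where ul: "uniform_limit (cball 0 1) U u sequentially"
      using Cauchy_uniformly_convergent uniformly_convergent_on_def by blast
    have cu: "continuous_on (cball 0 1) u"
      by (rule uniform_limit_theorem [OF _ ul])
        (auto intro!: always_eventually continuous_on_subset [OF green_pair_contD(1) [OF U]])
    have pt: "(\<lambda>n. U n x) \<longlonglongrightarrow> u x" if "x \<in> cball 0 1" for x by (rule tendsto_uniform_limitI [OF ul that])
    have u1: "u x = 0" if "norm x = 1" for x
      using pt [of x] that by (simp add: green_pair_0D [OF U] LIMSEQ_const_iff)
    define u' where "u' x = (if x \<in> disk then u x else 0)" for x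
    have cu': "continuous_on (cball 0 1) u'"
      by (rule continuous_on_eq [OF cu]) (use u1 in \<open>auto simp: u'_def\<close>)
    have "(LINT x|?D. u' x * (- laplacian \<phi> x)) = (LINT x|?D. v x * \<phi> x)" if \<phi>: "test_function \<phi>" for \<phi>
    proof -
      obtain B where B: "\<And>x. x \<in> disk \<Longrightarrow> \<bar>\<phi> x\<bar> \<le> B" using test_function_bounded [OF \<phi>] by blast
      have B0: "0 \<le> B" using B [of 0] by simp
      note m\<phi> = test_function_measurable [OF \<phi>]
      have eq: "(LINT x|?D. U n x * (- laplacian \<phi> x)) = (LINT x|?D. q n x * \<phi> x)" for n
      proof -
        have "(LINT x|?D. U n x * (- laplacian \<phi> x)) = (LINT x|?D. (if x \<in> disk then U n x else 0) * (- laplacian \<phi> x))"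
          by (rule Bochner_Integration.integral_cong) auto
        then show ?thesis using green_pair_dirichlet [OF U] \<phi> by (simp add: dirichlet_solution_def)
      qed
      have r: "(\<lambda>n. LINT x|?D. q n x * \<phi> x) \<longlonglongrightarrow> (LINT x|?D. v x * \<phi> x)"
      proof -
        have l1: "(\<lambda>n. LINT x|?D. \<bar>v x - q n x\<bar>) \<longlonglongrightarrow> 0"
          by (rule scaled_bound_tendsto_0 [where C = pi and a = "1 - p" and K = 1, OF _ _ qlim])
            (use Lp_disk_integrable(2) [OF vqL p] in \<open>auto intro!: integral_nonneg_AE\<close>)
        have "(\<lambda>n. B * (LINT x|?D. \<bar>v x - q n x\<bar>)) \<longlonglongrightarrow> B * 0" by (intro tendsto_intros l1)
        then have l2: "(\<lambda>n. B * (LINT x|?D. \<bar>v x - q n x\<bar>)) \<longlonglongrightarrow> 0" by simp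
        have "norm ((LINT x|?D. q n x * \<phi> x) - (LINT x|?D. v x * \<phi> x)) \<le> B * (LINT x|?D. \<bar>v x - q n x\<bar>)" for n
        proof -
          have "(LINT x|?D. v x * \<phi> x) - (LINT x|?D. q n x * \<phi> x) = (LINT x|?D. (v x - q n x) * \<phi> x)"
            using integrable_mult_bounded(1) [OF Lp_disk_integrable(1) [OF v p] m\<phi> B]
              integrable_mult_bounded(1) [OF Lp_disk_integrable(1) [OF qL p] m\<phi> B]
            by (simp add: left_diff_distrib)
          moreover have "\<bar>LINT x|?D. (v x - q n x) * \<phi> x\<bar> \<le> B * (LINT x|?D. \<bar>v x - q n x\<bar>)"
            by (rule integrable_mult_bounded(2) [OF Lp_disk_integrable(1) [OF vqL p] m\<phi> B])
          ultimately show ?thesis by (simp add: abs_minus_commute)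
        qed
        then have "(\<lambda>n. (LINT x|?D. q n x * \<phi> x) - (LINT x|?D. v x * \<phi> x)) \<longlonglongrightarrow> 0"
          by (intro Lim_null_comparison [OF _ l2] always_eventually) blast
        then show ?thesis by (rule LIM_zero_cancel)
      qed
      have l: "(\<lambda>n. LINT x|?D. U n x * (- laplacian \<phi> x)) \<longlonglongrightarrow> (LINT x|?D. u' x * (- laplacian \<phi> x))"
      proof -
        have "bounded (u ` cball 0 1)" using cu by (intro compact_imp_bounded compact_continuous_image) auto
        then obtain A where A: "\<forall>z\<in>u ` cball 0 1. norm z \<le> A" unfolding bounded_iff by blast
        have "\<forall>\<^sub>F n in sequentially. \<forall>x\<in>cball 0 1. dist (U n x) (u x) < 1"
          using ul by (rule uniform_limitD) simp
        then obtain n0 where n0: "\<And>n x. n \<ge> n0 \<Longrightarrow> x \<in> cball 0 1 \<Longrightarrow> dist (U n x) (u x) < 1"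
          unfolding eventually_sequentially by blast
        have "(\<lambda>n. LINT x|?D. U (n + n0) x * (- laplacian \<phi> x)) \<longlonglongrightarrow> (LINT x|?D. u' x * (- laplacian \<phi> x))"
        proof (rule integral_dominated_convergence [where w = "\<lambda>x. (A + 1) * \<bar>laplacian \<phi> x\<bar>"])
          show "integrable ?D (\<lambda>x. (A + 1) * \<bar>laplacian \<phi> x\<bar>)"
            by (intro integrable_ball_continuous continuous_on_mult continuous_on_const continuous_on_rabs laplacian_continuous [OF \<phi>])
          show "(\<lambda>x. u' x * (- laplacian \<phi> x)) \<in> borel_measurable ?D"
            by (intro continuous_measurable_ball continuous_on_mult continuous_on_minus laplacian_continuous [OF \<phi>] continuous_on_subset [OF cu']) auto
          show "(\<lambda>x. U (n + n0) x * (- laplacian \<phi> x)) \<in> borel_measurable ?D" for n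
            by (intro continuous_measurable_ball continuous_on_mult continuous_on_minus laplacian_continuous [OF \<phi>]
                continuous_on_subset [OF green_pair_contD(1) [OF U]]) auto
          show "AE x in ?D. (\<lambda>n. U (n + n0) x * (- laplacian \<phi> x)) \<longlonglongrightarrow> u' x * (- laplacian \<phi> x)"
          proof (rule AE_I2)
            fix x assume "x \<in> space ?D"
            then have x: "x \<in> disk" by simp
            then have "(\<lambda>n. U n x) \<longlonglongrightarrow> u' x" using pt [of x] by (simp add: u'_def)
            then have "(\<lambda>n. U (n + n0) x) \<longlonglongrightarrow> u' x" by (rule LIMSEQ_ignore_initial_segment)
            then show "(\<lambda>n. U (n + n0) x * (- laplacian \<phi> x)) \<longlonglongrightarrow> u' x * (- laplacian \<phi> x)"
              by (intro tendsto_mult tendsto_const)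
          qed
          show "AE x in ?D. norm (U (n + n0) x * (- laplacian \<phi> x)) \<le> (A + 1) * \<bar>laplacian \<phi> x\<bar>" for n
          proof (rule AE_I2)
            fix x assume "x \<in> space ?D"
            then have x: "x \<in> cball 0 1" by simp
            have "\<bar>U (n + n0) x - u x\<bar> < 1" using n0 [OF _ x, of "n + n0"] by (simp add: dist_real_def)
            moreover have "\<bar>u x\<bar> \<le> A" using A x by auto
            ultimately have "\<bar>U (n + n0) x\<bar> \<le> A + 1" by linarith
            then show "norm (U (n + n0) x * (- laplacian \<phi> x)) \<le> (A + 1) * \<bar>laplacian \<phi> x\<bar>"
              by (simp add: abs_mult mult_right_mono)
          qed
        qed
        then show ?thesis by (rule LIMSEQ_offset)
      qed
      show ?thesis using l r unfolding eq by (rule LIMSEQ_unique)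
    qed
    then have sol: "dirichlet_solution v u'"
      unfolding dirichlet_solution_def using cu' by (auto simp: u'_def)
    have "\<bar>u' y\<bar> \<le> l * C + l powr (1 - p) * (2 powr p * Lp_power p v)" if l: "0 < l" for y l
    proof (cases "y \<in> disk")
      case True
      have "(\<lambda>n. \<bar>U n y\<bar>) \<longlonglongrightarrow> \<bar>u' y\<bar>" using pt [of y] True by (auto simp: u'_def intro!: tendsto_rabs)
      moreover have "(\<lambda>n. l * C + l powr (1 - p) * (2 powr p * (Lp_power p v + Lp_power p (\<lambda>x. v x - q n x)))) \<longlonglongrightarrow>
          l * C + l powr (1 - p) * (2 powr p * (Lp_power p v + 0))" by (intro tendsto_intros qlim)
      moreover have "\<bar>U n y\<bar> \<le> l * C + l powr (1 - p) * (2 powr p * (Lp_power p v + Lp_power p (\<lambda>x. v x - q n x)))" for n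
      proof -
        have "\<bar>U n y\<bar> \<le> l * C + l powr (1 - p) * Lp_power p (q n)" by (rule C(2) [OF U True l])
        also have "\<dots> \<le> l * C + l powr (1 - p) * (2 powr p * (Lp_power p v + Lp_power p (\<lambda>x. v x - q n x)))"
          using Lp_disk_diff(2) [OF v vqL p0, of n] by (intro add_left_mono mult_left_mono) auto
        finally show ?thesis .
      qed
      ultimately have "\<bar>u' y\<bar> \<le> l * C + l powr (1 - p) * (2 powr p * (Lp_power p v + 0))"
        by (intro LIMSEQ_le) auto
      then show ?thesis by simp
    next
      case False
      then show ?thesis using C(1) l Lp_power_nonneg by (simp add: u'_def)
    qed
    with sol show "\<exists>u. dirichlet_solution v u \<and> (\<forall>y. \<forall>l>0. \<bar>u y\<bar> \<le> l * C + l powr (1 - p) * (2 powr p * Lp_power p v))"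
      by blast
  qed
qed

lemma green_op_bound:
  assumes p: "1 < p"
  shows "\<exists>C\<ge>0. \<forall>v\<in>Lp_disk p. dirichlet_solution v (green_op v) \<and>
    (\<forall>y. \<forall>l>0. \<bar>green_op v y\<bar> \<le> l * C + l powr (1 - p) * (2 powr p * Lp_power p v))"
proof -
  obtain C where C: "0 \<le> C" "\<And>v. v \<in> Lp_disk p \<Longrightarrow> \<exists>u. dirichlet_solution v u \<and>
       (\<forall>y. \<forall>l>0. \<bar>u y\<bar> \<le> l * C + l powr (1 - p) * (2 powr p * Lp_power p v))"
    using dirichlet_solution_exists [OF p] by blast
  show ?thesis
  proof (intro exI [of _ C] conjI [OF C(1)] ballI)
    fix v assume "v \<in> Lp_disk p"
    then obtain u where u: "dirichlet_solution v u" "\<forall>y. \<forall>l>0. \<bar>u y\<bar> \<le> l * C + l powr (1 - p) * (2 powr p * Lp_power p v)"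
      using C(2) by blast
    then show "dirichlet_solution v (green_op v) \<and>
      (\<forall>y. \<forall>l>0. \<bar>green_op v y\<bar> \<le> l * C + l powr (1 - p) * (2 powr p * Lp_power p v))"
      unfolding green_op_eqI [OF u(1)] by (rule conjI)
  qed
qed

lemma green_op_solution:
  assumes "1 < p" "v \<in> Lp_disk p" shows "dirichlet_solution v (green_op v)"
  using green_op_bound [OF assms(1)] assms(2) by auto

lemma green_op_diff:
  assumes p: "1 < p" and v: "v \<in> Lp_disk p" and w: "w \<in> Lp_disk p"
  shows "green_op (\<lambda>x. v x - w x) = (\<lambda>x. green_op v x - green_op w x)"
proof (rule green_op_eqI)
  note sv = green_op_solution [OF p v, unfolded dirichlet_solution_def]
    and sw = green_op_solution [OF p w, unfolded dirichlet_solution_def]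
  show "dirichlet_solution (\<lambda>x. v x - w x) (\<lambda>x. green_op v x - green_op w x)"
    unfolding dirichlet_solution_def
  proof (intro conjI allI impI)
    show "continuous_on (closure disk) (\<lambda>x. green_op v x - green_op w x)" using sv sw by (intro continuous_on_diff) auto
    fix \<phi> assume \<phi>: "test_function \<phi>"
    obtain B where B: "\<And>x. x \<in> disk \<Longrightarrow> \<bar>\<phi> x\<bar> \<le> B" using test_function_bounded [OF \<phi>] by blast
    note m\<phi> = test_function_measurable [OF \<phi>]
    have i: "integrable (lebesgue_on disk) (\<lambda>x. green_op v x * (- laplacian \<phi> x))"
      "integrable (lebesgue_on disk) (\<lambda>x. green_op w x * (- laplacian \<phi> x))"
      using sv sw by (intro integrable_ball_continuous continuous_on_mult continuous_on_minus laplacian_continuous [OF \<phi>]; simp)+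
    have j: "integrable (lebesgue_on disk) (\<lambda>x. v x * \<phi> x)" "integrable (lebesgue_on disk) (\<lambda>x. w x * \<phi> x)"
      by (rule integrable_mult_bounded(1) [OF Lp_disk_integrable(1) [OF _ p] m\<phi> B], rule v w, assumption)+
    show "(LINT x|lebesgue_on disk. (green_op v x - green_op w x) * (- laplacian \<phi> x)) = (LINT x|lebesgue_on disk. (v x - w x) * \<phi> x)"
      unfolding left_diff_distrib Bochner_Integration.integral_diff [OF i] Bochner_Integration.integral_diff [OF j]
      using sv sw \<phi> by simp
  qed (use sv sw in auto)
qed

lemma green_op_measurable:
  assumes "1 < p" "v \<in> Lp_disk p" shows "green_op v \<in> borel_measurable (lebesgue_on disk)"
proof -
  have "continuous_on (closure disk) (green_op v)"
    using green_op_solution [OF assms] unfolding dirichlet_solution_def by (rule conjunct1)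
  then have "continuous_on disk (green_op v)" by (rule continuous_on_subset [OF _ closure_subset])
  then show ?thesis by (rule continuous_measurable_ball)
qed

text \<open>The energy is quadratic, and the Green operator is linear and bounded from \<open>L\<^sup>p\<close> to the bounded functions.\<close>

lemma energy_tendsto:
  assumes p: "1 < p" and f: "\<And>n. f n \<in> Lp_disk p" and g: "\<And>n. g n \<in> Lp_disk p"
    and lim: "(\<lambda>n. Lp_power p (\<lambda>x. f n x - g n x)) \<longlonglongrightarrow> 0" and bd: "\<And>n. Lp_power p (g n) \<le> B"
  shows "(\<lambda>n. energy (f n) - energy (g n)) \<longlonglongrightarrow> 0"
proof -
  let ?D = "lebesgue_on disk"
  have p0: "0 < p" using p by simp
  obtain C where C: "0 \<le> C" "\<And>v y l. v \<in> Lp_disk p \<Longrightarrow> 0 < l \<Longrightarrow> \<bar>green_op v y\<bar> \<le> l * C + l powr (1 - p) * (2 powr p * Lp_power p v)"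
    using green_op_bound [OF p] by blast
  let ?d = "\<lambda>n x. f n x - g n x"
  let ?N = "\<lambda>n. Lp_power p (?d n)"
  have d: "?d n \<in> Lp_disk p" for n by (rule Lp_disk_diff(1) [OF f g p0])
  obtain B1 where B1: "\<And>n. ?N n \<le> B1"
  proof -
    have "Bseq ?N" by (rule convergent_imp_Bseq, rule convergentI, rule lim)
    then obtain K where "\<And>n. norm (?N n) \<le> K" unfolding Bseq_def by blast
    then have "?N n \<le> K" for n using abs_le_D1 [of "?N n" K] by simp
    then show thesis by (rule that)
  qed
  define S where "S = C + 2 powr p * (2 powr p * (B1 + B))"
  have fN: "Lp_power p (f n) \<le> 2 powr p * (B1 + B)" for n
  proof -
    have "Lp_power p (f n) = Lp_power p (\<lambda>x. ?d n x + g n x)" by simp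
    also have "\<dots> \<le> 2 powr p * (?N n + Lp_power p (g n))" by (rule Lp_disk_add(2) [OF d g p0])
    also have "\<dots> \<le> 2 powr p * (B1 + B)" using B1 [of n] bd [of n] by (intro mult_left_mono) auto
    finally show ?thesis .
  qed
  have Gf: "\<bar>green_op (f n) y\<bar> \<le> S" for n y
  proof -
    have "\<bar>green_op (f n) y\<bar> \<le> C + 2 powr p * Lp_power p (f n)" using C(2) [OF f, of 1 n y] by simp
    also have "\<dots> \<le> S" unfolding S_def by (intro add_left_mono mult_left_mono fN) simp
    finally show ?thesis .
  qed
  define X where "X n = (LINT x|?D. \<bar>?d n x\<bar>)" for n
  have X: "X \<longlonglongrightarrow> 0" unfolding X_def
    by (rule scaled_bound_tendsto_0 [where C = pi and a = "1 - p" and K = 1, OF _ _ lim])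
      (use Lp_disk_integrable(2) [OF d p] in \<open>auto intro!: integral_nonneg_AE\<close>)
  have gI: "(LINT x|?D. \<bar>g n x\<bar>) \<le> pi + B" for n
    using Lp_disk_integrable(2) [OF g p, of 1 n] bd [of n] by simp
  define Y where "Y n = (SUP y\<in>disk. \<bar>green_op (?d n) y\<bar>)" for n
  have Yb: "\<bar>green_op (?d n) y\<bar> \<le> C + 2 powr p * ?N n" for n y using C(2) [OF d, of 1 n y] by simp
  have Y1: "\<bar>green_op (?d n) y\<bar> \<le> Y n" if "y \<in> disk" for n y
    unfolding Y_def using Yb that by (intro cSUP_upper bdd_aboveI2) auto
  have Y: "Y \<longlonglongrightarrow> 0"
  proof (rule scaled_bound_tendsto_0 [where C = C and a = "1 - p" and K = "2 powr p", OF _ _ lim C(1)])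
    show "Y n \<le> l * C + l powr (1 - p) * (2 powr p * ?N n)" if "0 < l" for n l
      unfolding Y_def using C(2) [OF d that] by (intro cSUP_least) auto
    show "0 \<le> Y n" for n by (rule order_trans [OF abs_ge_zero Y1 [of 0]]) simp
  qed
  have b: "norm (energy (f n) - energy (g n)) \<le> S * X n + Y n * (pi + B)" for n
  proof -
    note mG = green_op_measurable [OF p]
    have i1: "integrable ?D (\<lambda>x. ?d n x * green_op (f n) x)" "\<bar>LINT x|?D. ?d n x * green_op (f n) x\<bar> \<le> S * X n"
      unfolding X_def
      by (rule integrable_mult_bounded(1) [OF Lp_disk_integrable(1) [OF d [of n] p] mG [OF f [of n]] Gf [of n]])
        (rule integrable_mult_bounded(2) [OF Lp_disk_integrable(1) [OF d [of n] p] mG [OF f [of n]] Gf [of n]])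
    have i2: "integrable ?D (\<lambda>x. g n x * green_op (?d n) x)" "\<bar>LINT x|?D. g n x * green_op (?d n) x\<bar> \<le> Y n * (LINT x|?D. \<bar>g n x\<bar>)"
      by (rule integrable_mult_bounded(1) [OF Lp_disk_integrable(1) [OF g [of n] p] mG [OF d [of n]] Y1 [of _ n]], simp)
        (rule integrable_mult_bounded(2) [OF Lp_disk_integrable(1) [OF g [of n] p] mG [OF d [of n]] Y1 [of _ n]], simp)
    have "integrable ?D (\<lambda>x. f n x * green_op (f n) x)"
      by (rule integrable_mult_bounded(1) [OF Lp_disk_integrable(1) [OF f [of n] p] mG [OF f [of n]] Gf [of n]])
    moreover have "integrable ?D (\<lambda>x. g n x * green_op (g n) x)"
    proof (rule integrable_mult_bounded(1) [OF Lp_disk_integrable(1) [OF g p] mG [OF g]])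
      show "\<bar>green_op (g n) x\<bar> \<le> C + 2 powr p * Lp_power p (g n)" for x using C(2) [OF g, of 1 n x] by simp
    qed
    ultimately have "2 * (energy (f n) - energy (g n)) = (LINT x|?D. f n x * green_op (f n) x - g n x * green_op (g n) x)"
      by (simp add: energy_def)
    also have "\<dots> = (LINT x|?D. ?d n x * green_op (f n) x + g n x * green_op (?d n) x)"
    proof -
      have "f n x * green_op (f n) x - g n x * green_op (g n) x = ?d n x * green_op (f n) x + g n x * green_op (?d n) x" for x
        unfolding green_op_diff [OF p f [of n] g [of n]] by (simp add: left_diff_distrib right_diff_distrib)
      then show ?thesis by (simp only:)
    qed
    also have "\<dots> = (LINT x|?D. ?d n x * green_op (f n) x) + (LINT x|?D. g n x * green_op (?d n) x)"
      by (rule Bochner_Integration.integral_add [OF i1(1) i2(1)])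
    finally have e: "2 * (energy (f n) - energy (g n)) = (LINT x|?D. ?d n x * green_op (f n) x) + (LINT x|?D. g n x * green_op (?d n) x)" .
    have Y0: "0 \<le> Y n" by (rule order_trans [OF abs_ge_zero Y1 [of 0]]) simp
    have "Y n * (LINT x|?D. \<bar>g n x\<bar>) \<le> Y n * (pi + B)" using gI Y0 by (intro mult_left_mono) auto
    moreover have "2 * x = a + b \<Longrightarrow> \<bar>a\<bar> \<le> A \<Longrightarrow> \<bar>b\<bar> \<le> B' \<Longrightarrow> B' \<le> B'' \<Longrightarrow> \<bar>x\<bar> \<le> A + B''"
      for x a b A B' B'' :: real by linarith
    ultimately show ?thesis unfolding real_norm_def using e i1(2) i2(2) by blast
  qed
  have "(\<lambda>n. S * X n + Y n * (pi + B)) \<longlonglongrightarrow> S * 0 + 0 * (pi + B)" by (intro tendsto_intros X Y)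
  then have "(\<lambda>n. S * X n + Y n * (pi + B)) \<longlonglongrightarrow> 0" by simp
  then show ?thesis by (rule Lim_null_comparison [OF always_eventually, rotated]) (use b in blast)
qed

section \<open>The radial equation\<close>

lemma radial_ode_lincomb:
  assumes "radial_ode n P Q" "radial_ode n P2 Q2"
  shows "radial_ode n (\<lambda>s. a * P s + b * P2 s) (\<lambda>s. a * Q s + b * Q2 s)"
proof -
  obtain d1 e1 where 1: "continuous_on UNIV e1" "\<And>s. (Q has_real_derivative d1 s) (at s)" "\<And>s. (d1 has_real_derivative e1 s) (at s)"
    "\<And>s. 4 * (s * e1 s + (real n + 1) * d1 s) = - P s" "Q 1 = 0"
    using assms(1) unfolding radial_ode_def by auto
  obtain d2 e2 where 2: "continuous_on UNIV e2" "\<And>s. (Q2 has_real_derivative d2 s) (at s)" "\<And>s. (d2 has_real_derivative e2 s) (at s)"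
    "\<And>s. 4 * (s * e2 s + (real n + 1) * d2 s) = - P2 s" "Q2 1 = 0"
    using assms(2) unfolding radial_ode_def by auto
  show ?thesis unfolding radial_ode_def
  proof (intro conjI exI allI)
    show "a * Q 1 + b * Q2 1 = 0" using 1 2 by simp
    show "continuous_on UNIV (\<lambda>s. a * e1 s + b * e2 s)"
      by (rule continuous_on_add continuous_on_mult_left 1 2)+
    fix s
    show "((\<lambda>s. a * Q s + b * Q2 s) has_real_derivative a * d1 s + b * d2 s) (at s)"
      by (intro DERIV_add DERIV_cmult 1 2)
    show "((\<lambda>s. a * d1 s + b * d2 s) has_real_derivative a * e1 s + b * e2 s) (at s)"
      by (intro DERIV_add DERIV_cmult 1 2)
    have "4 * (s * (a * e1 s + b * e2 s) + (real n + 1) * (a * d1 s + b * d2 s))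
      = a * (4 * (s * e1 s + (real n + 1) * d1 s)) + b * (4 * (s * e2 s + (real n + 1) * d2 s))"
      by (simp add: algebra_simps)
    then show "4 * (s * (a * e1 s + b * e2 s) + (real n + 1) * (a * d1 s + b * d2 s)) = - (a * P s + b * P2 s)"
      unfolding 1(4) 2(4) by simp
  qed
qed

text \<open>One integration of the equation: \<open>(s\<^bsup>n+1\<^esup> Q')' = - s\<^sup>n P / 4\<close>.\<close>

lemma radial_ode_flux:
  assumes "radial_ode n P Q" and pos: "\<And>s. 0 \<le> s \<Longrightarrow> s \<le> 1 \<Longrightarrow> 0 \<le> P s"
  shows "\<exists>d. (\<forall>s. (Q has_real_derivative d s) (at s)) \<and>
    (\<forall>s t. 0 \<le> s \<longrightarrow> s \<le> t \<longrightarrow> t \<le> 1 \<longrightarrow> t ^ Suc n * d t \<le> s ^ Suc n * d s) \<and>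
    (\<forall>s. 0 < s \<longrightarrow> s \<le> 1 \<longrightarrow> d s \<le> 0)"
proof -
  obtain d e where 1: "\<And>s. (Q has_real_derivative d s) (at s)" "\<And>s. (d has_real_derivative e s) (at s)"
    "\<And>s. 4 * (s * e s + (real n + 1) * d s) = - P s"
    using assms(1) unfolding radial_ode_def by auto
  have anti: "t ^ Suc n * d t \<le> s ^ Suc n * d s" if "0 \<le> s" "s \<le> t" "t \<le> 1" for s t
  proof (rule DERIV_nonpos_imp_nonincreasing [OF that(2)])
    fix x assume x: "s \<le> x" "x \<le> t"
    have "((\<lambda>s. s ^ Suc n * d s) has_real_derivative real (Suc n) * x ^ n * d x + e x * x ^ Suc n) (at x)"
      using DERIV_mult [OF DERIV_pow [of "Suc n" x] 1(2)] by simp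
    moreover have "real (Suc n) * x ^ n * d x + e x * x ^ Suc n = - (x ^ n * P x / 4)"
    proof -
      have "real (Suc n) * x ^ n * d x + e x * x ^ Suc n = x ^ n * (x * e x + (real n + 1) * d x)"
        by (simp add: algebra_simps)
      also have "x * e x + (real n + 1) * d x = - P x / 4" using 1(3) [of x] by simp
      finally show ?thesis by simp
    qed
    moreover have "0 \<le> x ^ n * P x / 4" using pos [of x] x that by simp
    ultimately show "\<exists>y. ((\<lambda>s. s ^ Suc n * d s) has_real_derivative y) (at x) \<and> y \<le> 0" by fastforce
  qed
  have "d s \<le> 0" if s: "0 < s" "s \<le> 1" for s
  proof -
    have "s ^ Suc n * d s \<le> 0 ^ Suc n * d 0" by (rule anti) (use s in auto)
    moreover have "0 < s ^ Suc n" using s by simp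
    ultimately show ?thesis by (simp add: mult_le_0_iff not_le del: power_Suc)
  qed
  then show ?thesis using 1(1) anti by (intro exI [of _ d] conjI allI impI)
qed

lemma radial_ode_decreasing:
  assumes "radial_ode n P Q" and pos: "\<And>s. 0 \<le> s \<Longrightarrow> s \<le> 1 \<Longrightarrow> 0 \<le> P s"
    and st: "0 \<le> s" "s \<le> t" "t \<le> 1"
  shows "Q t \<le> Q s"
proof -
  obtain d where dd: "(\<forall>s. (Q has_real_derivative d s) (at s)) \<and>
    (\<forall>s t. 0 \<le> s \<longrightarrow> s \<le> t \<longrightarrow> t \<le> 1 \<longrightarrow> t ^ Suc n * d t \<le> s ^ Suc n * d s) \<and>
    (\<forall>s. 0 < s \<longrightarrow> s \<le> 1 \<longrightarrow> d s \<le> 0)"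
    using radial_ode_flux [OF assms(1) pos] by (rule exE)
  have d: "\<And>s. (Q has_real_derivative d s) (at s)" "\<And>s. 0 < s \<Longrightarrow> s \<le> 1 \<Longrightarrow> d s \<le> 0"
    using dd by (simp_all only: simp_thms)
  show ?thesis
  proof (cases "s = t")
    case False
    then have lt: "s < t" using st by simp
    have c: "continuous_on {s..t} Q" using d(1) by (intro DERIV_continuous_on) (auto intro: has_field_derivative_at_within)
    obtain x where x: "s < x" "x < t" "Q t - Q s = d x * (t - s)"
      using mvt [OF lt c, of "\<lambda>x h. d x * h"] d(1) by (auto simp: has_field_derivative_def)
    have "d x * (t - s) \<le> 0" using d(2) [of x] x st lt by (intro mult_nonpos_nonneg) auto
    then show ?thesis using x by simp
  qed simp
qed

text \<open>The maximum principle for the radial problem.\<close>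

lemma radial_ode_nonneg:
  assumes "radial_ode n P Q" and "\<And>s. 0 \<le> s \<Longrightarrow> s \<le> 1 \<Longrightarrow> 0 \<le> P s" and "0 \<le> s" "s \<le> 1"
  shows "0 \<le> Q s"
  using radial_ode_decreasing [OF assms(1,2), of s 1] assms by (simp add: radial_ode_def)

text \<open>For \<open>k = n\<close> the profile is reproduced up to a factor and a constant; for \<open>k < n\<close> the additional term on the right-hand side makes
  \<open>Lam k (a * s)\<close> a barrier as long as it has a sign.\<close>

lemma radial_ode_Lam:
  assumes a: "0 < a" and k: "k \<le> n"
  shows "radial_ode n (\<lambda>s. Lam k (a * s) + (real n - real k) * Lam (Suc k) (a * s)) (\<lambda>s. (Lam k (a * s) - Lam k a) / (4 * a))"
  unfolding radial_ode_def
proof (intro conjI exI allI)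
  show "(Lam k (a * 1) - Lam k a) / (4 * a) = 0" by simp
  fix s
  have m: "((\<lambda>s. a * s) has_real_derivative a) (at s)" by (auto intro!: derivative_eq_intros)
  have L: "((\<lambda>s. Lam n (a * s)) has_real_derivative - Lam (Suc n) (a * s) * a) (at s)" for n
    by (rule Lam_deriv_chain [OF m])
  show "((\<lambda>s. (Lam k (a * s) - Lam k a) / (4 * a)) has_real_derivative - Lam (Suc k) (a * s) / 4) (at s)"
    using DERIV_cdivide [OF DERIV_diff [OF L [of k] DERIV_const [of "Lam k a"]], of "4 * a"] a by simp
  show "((\<lambda>s. - Lam (Suc k) (a * s) / 4) has_real_derivative a * Lam (Suc (Suc k)) (a * s) / 4) (at s)"
    using DERIV_cdivide [OF DERIV_minus [OF L [of "Suc k"]], of 4] by (simp add: mult.commute)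
  have "a * s * Lam (Suc (Suc k)) (a * s) = (real k + 1) * Lam (Suc k) (a * s) - Lam k (a * s)" by (rule Lam_rec)
  moreover have alg: "4 * (s * (a * X / 4) + (m + 1) * (- Y / 4)) = a * s * X - (m + 1) * Y" for X Y m :: real
    by (simp add: field_simps)
  ultimately have "4 * (s * (a * Lam (Suc (Suc k)) (a * s) / 4) + (real n + 1) * (- Lam (Suc k) (a * s) / 4))
     = (real k + 1) * Lam (Suc k) (a * s) - Lam k (a * s) - (real n + 1) * Lam (Suc k) (a * s)"
    unfolding alg by (simp only:)
  then show "4 * (s * (a * Lam (Suc (Suc k)) (a * s) / 4) + (real n + 1) * (- Lam (Suc k) (a * s) / 4))
     = - (Lam k (a * s) + (real n - real k) * Lam (Suc k) (a * s))"
    by (simp add: algebra_simps)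
  show "continuous_on UNIV (\<lambda>s. a * Lam (Suc (Suc k)) (a * s) / 4)"
    by (intro continuous_on_divide continuous_on_mult_left Lam_cont continuous_on_const continuous_on_id) auto
qed

lemma Lam3_nonneg:
  assumes "\<forall>t\<in>{0..T}. 0 < Lam 2 t" "0 \<le> t" "t \<le> T" shows "0 \<le> Lam 3 t"
proof (cases "t = 0")
  case True then show ?thesis by (simp add: Lam_0)
next
  case False
  define F where "F = (\<lambda>t. t ^ Suc 2 * Lam (Suc 2) t)"
  have "F 0 \<le> F t"
  proof (rule DERIV_nonneg_imp_nondecreasing [OF assms(2)])
    fix x assume "0 \<le> x" "x \<le> t"
    then show "\<exists>y. (F has_real_derivative y) (at x) \<and> 0 \<le> y"
      unfolding F_def using pow_Lam_deriv [of 2 x] assms by (intro exI [of _ "x ^ 2 * Lam 2 x"]) (auto simp: less_imp_le)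
  qed
  then have "0 \<le> t ^ 3 * Lam 3 t" by (simp add: F_def)
  moreover have "0 < t ^ 3" using False assms(2) by simp
  ultimately show ?thesis by (simp add: zero_le_mult_iff)
qed

text \<open>For angular orders from 2 on, \<open>Lam 2 (T * s)\<close> is a positive barrier that one application of the solution
  operator reduces by the factor \<open>1 / (4 * T)\<close>; as \<open>T\<close> may exceed \<open>tau\<close>, this beats the eigenvalue of \<open>V\<close>.\<close>

lemma radial_inv_contract_high:
  assumes n: "2 \<le> n" and T: "0 < T" "\<forall>t\<in>{0..T}. 0 < Lam 2 t"
    and P: "\<And>s. 0 \<le> s \<Longrightarrow> s \<le> 1 \<Longrightarrow> \<bar>P s\<bar> \<le> C * Lam 2 (T * s)" and ode: "radial_ode n P Q" and s: "0 \<le> s" "s \<le> 1"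
  shows "\<bar>Q s\<bar> \<le> C / (4 * T) * Lam 2 (T * s)"
proof -
  have Ts: "0 \<le> T * s" "T * s \<le> T" if "0 \<le> s" "s \<le> 1" for s using that T(1) by (auto intro: mult_left_le)
  have L2: "0 < Lam 2 (T * s)" if "0 \<le> s" "s \<le> 1" for s using Ts [OF that] T(2) by simp
  have L3: "0 \<le> Lam (Suc 2) (T * s)" if "0 \<le> s" "s \<le> 1" for s
    using Lam3_nonneg [OF T(2) Ts [OF that]] by (simp add: eval_nat_numeral)
  have "0 \<le> C * Lam 2 (T * 0)" using P [of 0] by simp
  then have C: "0 \<le> C" using L2 [of 0] by (simp add: zero_le_mult_iff)
  note psi = radial_ode_Lam [OF T(1) n]
  have "0 \<le> C * ((Lam 2 (T * s) - Lam 2 T) / (4 * T)) + e * Q s" if e: "e = 1 \<or> e = - 1" for e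
  proof (rule radial_ode_nonneg [OF radial_ode_lincomb [OF psi ode] _ s])
    fix s :: real assume s: "0 \<le> s" "s \<le> 1"
    have "0 \<le> (real n - real 2) * Lam (Suc 2) (T * s)" using n L3 [OF s] by (intro mult_nonneg_nonneg) auto
    then have "C * Lam 2 (T * s) \<le> C * (Lam 2 (T * s) + (real n - real 2) * Lam (Suc 2) (T * s))"
      using C by (intro mult_left_mono) auto
    moreover have "- (C * Lam 2 (T * s)) \<le> e * P s" using P [OF s] e by auto
    ultimately show "0 \<le> C * (Lam 2 (T * s) + (real n - real 2) * Lam (Suc 2) (T * s)) + e * P s" by linarith
  qed
  from this [of 1] this [of "-1"] have "\<bar>Q s\<bar> \<le> C * ((Lam 2 (T * s) - Lam 2 T) / (4 * T))" by simp
  also have "\<dots> \<le> C * (Lam 2 (T * s) / (4 * T))"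
    using C T by (intro mult_left_mono divide_right_mono) (auto intro: less_imp_le)
  finally show ?thesis by simp
qed

section \<open>The radial equation of angular order 1\<close>

text \<open>In the variable \<open>1 / s\<close> a solution of order 1 with nonnegative right-hand side is concave, and it vanishes at
  \<open>s = 1\<close>; so it lies above its chord.\<close>

lemma radial_ode_1_lower:
  assumes ode: "radial_ode 1 h H" and pos: "\<And>s. 0 \<le> s \<Longrightarrow> s \<le> 1 \<Longrightarrow> 0 \<le> h s" and s: "0 \<le> s" "s \<le> 1"
  shows "(1 - s) * H (1/2) \<le> H s"
proof -
  have H0: "0 \<le> H (1/2)" by (rule radial_ode_nonneg [OF ode pos]) auto
  have H1: "H 1 = 0" using ode by (simp add: radial_ode_def)
  show ?thesis
  proof (cases "s \<le> 1/2")
    case True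
    have "H (1/2) \<le> H s" by (rule radial_ode_decreasing [OF ode pos]) (use s True in auto)
    moreover have "(1 - s) * H (1/2) \<le> 1 * H (1/2)" using s H0 by (intro mult_right_mono) auto
    ultimately show ?thesis by simp
  next
    case False
    obtain d where dd: "(\<forall>s. (H has_real_derivative d s) (at s)) \<and>
      (\<forall>s t. 0 \<le> s \<longrightarrow> s \<le> t \<longrightarrow> t \<le> 1 \<longrightarrow> t ^ Suc 1 * d t \<le> s ^ Suc 1 * d s) \<and>
      (\<forall>s. 0 < s \<longrightarrow> s \<le> 1 \<longrightarrow> d s \<le> 0)"
      using radial_ode_flux [OF ode pos] by (rule exE)
    have d: "\<And>s. (H has_real_derivative d s) (at s)"
      "\<And>s t. 0 \<le> s \<Longrightarrow> s \<le> t \<Longrightarrow> t \<le> 1 \<Longrightarrow> t\<^sup>2 * d t \<le> s\<^sup>2 * d s"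
      using dd by (simp_all only: simp_thms Suc_1)
    \<comment> \<open>The deviation from the chord vanishes at both ends, and \<open>s\<^sup>2 f'\<close> is decreasing, so \<open>f\<close> cannot be negative in between.\<close>
    define f where "f s = H s - (1 / s - 1) * H (1/2)" for s
    define f' where "f' s = d s + H (1/2) / s\<^sup>2" for s
    have df: "(f has_real_derivative f' x) (at x)" if "0 < x" for x
      unfolding f_def f'_def using that
      by (auto intro!: derivative_eq_intros d simp: power2_eq_square field_simps)
    have cf: "continuous_on {a..b} f" if "0 < a" for a b
    proof (rule continuous_at_imp_continuous_on, rule ballI)
      fix x assume "x \<in> {a..b}"
      then show "isCont f x" using df [of x] that by (auto intro: DERIV_isCont)
    qed
    have f_half: "f (1/2) = 0" and f_one: "f 1 = 0" by (simp_all add: f_def H1)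
    have "0 \<le> f s"
    proof (rule ccontr)
      assume neg: "\<not> 0 \<le> f s"
      then have s1: "1/2 < s" "s < 1" using False s f_one by (auto simp: less_le)
      obtain u where u: "1/2 < u" "u < s" "f s - f (1/2) = f' u * (s - 1/2)"
        using mvt [OF s1(1) cf, of "\<lambda>x h. f' x * h"] df by (auto simp: has_field_derivative_def)
      obtain v where v: "s < v" "v < 1" "f 1 - f s = f' v * (1 - s)"
        using mvt [OF s1(2) cf, of "\<lambda>x h. f' x * h"] df s1 by (auto simp: has_field_derivative_def)
      have "f' u * (s - 1/2) < 0" using u(3) neg f_half by linarith
      then have u0: "f' u < 0" using s1 by (simp add: mult_less_0_iff)
      have "0 < f' v * (1 - s)" using v(3) neg f_one by linarith
      then have v0: "0 < f' v" using s1 by (simp add: zero_less_mult_iff)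
      have uv: "v\<^sup>2 * f' v \<le> u\<^sup>2 * f' u"
        using d(2) [of u v] u v by (simp add: f'_def distrib_left)
      have "0 < v\<^sup>2 * f' v" using v0 v s1 by (intro mult_pos_pos) auto
      moreover have "u\<^sup>2 * f' u < 0" using u0 u by (intro mult_pos_neg) auto
      ultimately show False using uv by linarith
    qed
    then have "(1 / s - 1) * H (1/2) \<le> H s" by (simp add: f_def)
    moreover have "(1 - s) * H (1/2) \<le> (1 / s - 1) * H (1/2)"
    proof (rule mult_right_mono [OF _ H0])
      have "(1 - s) * s \<le> (1 - s) * 1" using s by (intro mult_left_mono) auto
      then show "1 - s \<le> 1 / s - 1" using False s by (simp add: field_simps)
    qed
    ultimately show ?thesis by simp
  qed
qed

lemma Lam1_tau: "Lam 1 tau = 0" "Lam (Suc 0) tau = 0"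
  using j_zero_facts(2) by simp_all

text \<open>The profile of \<open>J\<^sub>1(jr)\<close>: the positive eigenfunction of the radial problem of order 1.\<close>

definition psi :: "real \<Rightarrow> real" where "psi s = Lam 1 (tau * s)"

lemma psi_ode: "radial_ode 1 psi (\<lambda>s. psi s / (4 * tau))"
  using radial_ode_Lam [OF tau_pos, of 1 1] by (simp add: psi_def [abs_def] Lam1_tau)

lemma psi_nonneg: "0 \<le> s \<Longrightarrow> s \<le> 1 \<Longrightarrow> 0 \<le> psi s"
proof -
  assume s: "0 \<le> s" "s \<le> 1"
  show "0 \<le> psi s"
  proof (cases "s = 1")
    case False
    then have "tau * s < tau" using s tau_pos by simp
    then show ?thesis using Lam1_pos [of "tau * s"] s tau_pos by (simp add: psi_def less_imp_le)
  qed (simp add: psi_def Lam1_tau)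
qed

lemma psi_half_pos: "0 < psi (1/2)"
  using Lam1_pos [of "tau * (1/2)"] tau_pos by (simp add: psi_def)

lemma psi_lower: assumes "0 \<le> s" "s \<le> 1" shows "(1 - s) * psi (1/2) \<le> psi s"
proof -
  have "(1 - s) * (psi (1/2) / (4 * tau)) \<le> psi s / (4 * tau)"
    by (rule radial_ode_1_lower [OF psi_ode psi_nonneg assms])
  then show ?thesis using tau_pos by (simp add: divide_simps)
qed

lemma vanishing_at_1_bound:
  assumes d: "\<And>s. (f has_real_derivative f' s) (at s)" and c: "continuous_on UNIV f'" and "f 1 = 0"
  obtains B where "0 < B" "\<And>s. 0 \<le> s \<Longrightarrow> s \<le> 1 \<Longrightarrow> \<bar>f s\<bar> \<le> B * (1 - s)"
proof -
  have "bounded (f' ` {0..1})" using c by (intro compact_imp_bounded compact_continuous_image) (auto intro: continuous_on_subset)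
  then obtain B where "\<forall>z\<in>f' ` {0..1}. norm z \<le> B" unfolding bounded_iff by blast
  then have B: "\<And>s. 0 \<le> s \<Longrightarrow> s \<le> 1 \<Longrightarrow> \<bar>f' s\<bar> \<le> B" by auto
  show thesis
  proof (rule that [of "\<bar>B\<bar> + 1"])
    fix s :: real assume s: "0 \<le> s" "s \<le> 1"
    show "\<bar>f s\<bar> \<le> (\<bar>B\<bar> + 1) * (1 - s)"
    proof (cases "s = 1")
      case False
      then have lt: "s < 1" using s by simp
      have cf: "continuous_on {s..1} f" using d by (intro DERIV_continuous_on) (auto intro: has_field_derivative_at_within)
      obtain x where x: "s < x" "x < 1" "f 1 - f s = f' x * (1 - s)"
        using mvt [OF lt cf, of "\<lambda>x h. f' x * h"] d by (auto simp: has_field_derivative_def)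
      then have "f s = - (f' x * (1 - s))" using assms(3) by simp
      then have "\<bar>f s\<bar> = \<bar>f' x\<bar> * (1 - s)" using lt by (simp add: abs_mult)
      also have "\<dots> \<le> (\<bar>B\<bar> + 1) * (1 - s)" using B [of x] x s by (intro mult_right_mono) auto
      finally show ?thesis .
    qed (simp add: assms(3))
  qed simp
qed

lemma psi_upper: obtains K where "0 < K" "\<And>s. 0 \<le> s \<Longrightarrow> s \<le> 1 \<Longrightarrow> psi s \<le> K * (1 - s)"
proof -
  have m: "((\<lambda>s. tau * s) has_real_derivative tau) (at s)" for s by (auto intro!: derivative_eq_intros)
  have d: "(psi has_real_derivative - Lam (Suc 1) (tau * s) * tau) (at s)" for s
    unfolding psi_def [abs_def] by (rule Lam_deriv_chain [OF m])
  have c: "continuous_on UNIV (\<lambda>s. - Lam (Suc 1) (tau * s) * tau)"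
    by (intro continuous_on_mult_right continuous_on_minus Lam_cont continuous_on_mult_left continuous_on_id)
  obtain B where "0 < B" "\<And>s. 0 \<le> s \<Longrightarrow> s \<le> 1 \<Longrightarrow> \<bar>psi s\<bar> \<le> B * (1 - s)"
    by (rule vanishing_at_1_bound [OF d c]) (auto simp: psi_def Lam1_tau)
  then show thesis using abs_le_D1 by (intro that [of B]) blast+
qed

text \<open>One application of the solution operator pulls the two barriers \<open>\<alpha> psi\<close> and \<open>\<beta> psi\<close> together by a fixed
  factor: by \<open>radial_ode_1_lower\<close> what lies between a barrier and the solution is spread over the whole
  interval, in proportion to \<open>1 - s\<close> and thus to \<open>psi\<close>.\<close>

lemma barrier_contraction:
  obtains \<kappa> where "0 < \<kappa>" "\<kappa> < 1"
    "\<And>Q R \<alpha> \<beta>. radial_ode 1 Q R \<Longrightarrow> (\<forall>s\<in>{0..1}. \<alpha> * psi s \<le> Q s \<and> Q s \<le> \<beta> * psi s) \<Longrightarrow>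
      \<exists>\<alpha>' \<beta>'. \<alpha> \<le> \<alpha>' \<and> \<beta>' \<le> \<beta> \<and> \<beta>' - \<alpha>' = \<kappa> * (\<beta> - \<alpha>) \<and>
        (\<forall>s\<in>{0..1}. \<alpha>' * psi s \<le> 4 * tau * R s \<and> 4 * tau * R s \<le> \<beta>' * psi s)"
proof -
  obtain K where K: "0 < K" "\<And>s. 0 \<le> s \<Longrightarrow> s \<le> 1 \<Longrightarrow> psi s \<le> K * (1 - s)" by (rule psi_upper) (rule that)
  let ?h = "psi (1/2)"
  define \<kappa> where "\<kappa> = 1 - ?h / K"
  have "?h \<le> K / 2" using K(2) [of "1/2"] by simp
  then have "?h / K < 1" using K(1) by (simp add: divide_simps)
  then have k: "0 < \<kappa>" "\<kappa> < 1" using psi_half_pos K(1) by (simp_all add: \<kappa>_def)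
  show thesis
  proof (rule that [OF k])
    fix Q R \<alpha> \<beta> assume ode: "radial_ode 1 Q R" and b: "\<forall>s\<in>{0..1}. \<alpha> * psi s \<le> Q s \<and> Q s \<le> \<beta> * psi s"
    let ?r = "4 * tau * R (1/2)"
    have low: "psi s / K * (e * ?r - \<gamma> * ?h) \<le> e * (4 * tau * R s) - \<gamma> * psi s \<and> 0 \<le> e * ?r - \<gamma> * ?h"
      if h: "\<And>s. 0 \<le> s \<Longrightarrow> s \<le> 1 \<Longrightarrow> 0 \<le> e * Q s + (- \<gamma>) * psi s" and s: "0 \<le> s" "s \<le> 1" for e \<gamma> s
    proof -
      note o = radial_ode_lincomb [OF ode psi_ode, of e "- \<gamma>"]
      have t: "4 * tau * (e * R s + - \<gamma> * (psi s / (4 * tau))) = e * (4 * tau * R s) - \<gamma> * psi s" for s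
        using tau_pos by (simp add: field_simps)
      have "(1 - s) * (e * R (1/2) + - \<gamma> * (psi (1/2) / (4 * tau))) \<le> e * R s + - \<gamma> * (psi s / (4 * tau))"
        by (rule radial_ode_1_lower [OF o h s])
      then have "4 * tau * ((1 - s) * (e * R (1/2) + - \<gamma> * (psi (1/2) / (4 * tau)))) \<le> 4 * tau * (e * R s + - \<gamma> * (psi s / (4 * tau)))"
        using tau_pos by (intro mult_left_mono) auto
      then have 1: "(1 - s) * (e * ?r - \<gamma> * ?h) \<le> e * (4 * tau * R s) - \<gamma> * psi s"
        unfolding t mult.left_commute [of "4 * tau" "1 - s"] .
      have "0 \<le> e * R (1/2) + - \<gamma> * (psi (1/2) / (4 * tau))"
        by (rule radial_ode_nonneg [OF o h]) auto
      then have "0 \<le> 4 * tau * (e * R (1/2) + - \<gamma> * (psi (1/2) / (4 * tau)))" using tau_pos by (intro mult_nonneg_nonneg) auto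
      then have 2: "0 \<le> e * ?r - \<gamma> * ?h" unfolding t .
      have "psi s / K \<le> 1 - s" using K(2) [OF s] K(1) by (simp add: divide_le_eq mult.commute)
      then have "psi s / K * (e * ?r - \<gamma> * ?h) \<le> (1 - s) * (e * ?r - \<gamma> * ?h)" using 2 by (rule mult_right_mono)
      with 1 2 show ?thesis by linarith
    qed
    have lo: "psi s / K * (?r - \<alpha> * ?h) \<le> 4 * tau * R s - \<alpha> * psi s \<and> 0 \<le> ?r - \<alpha> * ?h" if "0 \<le> s" "s \<le> 1" for s
      using low [of 1 \<alpha> s] b that by simp
    have hi: "psi s / K * (\<beta> * ?h - ?r) \<le> \<beta> * psi s - 4 * tau * R s \<and> 0 \<le> \<beta> * ?h - ?r" if "0 \<le> s" "s \<le> 1" for s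
      using low [of "-1" "-\<beta>" s] b that by simp
    define \<alpha>' where "\<alpha>' = \<alpha> + (?r - \<alpha> * ?h) / K"
    define \<beta>' where "\<beta>' = \<beta> - (\<beta> * ?h - ?r) / K"
    show "\<exists>\<alpha>' \<beta>'. \<alpha> \<le> \<alpha>' \<and> \<beta>' \<le> \<beta> \<and> \<beta>' - \<alpha>' = \<kappa> * (\<beta> - \<alpha>) \<and>
        (\<forall>s\<in>{0..1}. \<alpha>' * psi s \<le> 4 * tau * R s \<and> 4 * tau * R s \<le> \<beta>' * psi s)"
    proof (intro exI conjI ballI)
      show "\<alpha> \<le> \<alpha>'" "\<beta>' \<le> \<beta>" using lo [of 0] hi [of 0] K(1) by (auto simp: \<alpha>'_def \<beta>'_def)
      show "\<beta>' - \<alpha>' = \<kappa> * (\<beta> - \<alpha>)" using K(1) by (simp add: \<alpha>'_def \<beta>'_def \<kappa>_def field_simps)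
      fix s :: real assume "s \<in> {0..1}"
      then have s: "0 \<le> s" "s \<le> 1" by auto
      show "\<alpha>' * psi s \<le> 4 * tau * R s"
      proof -
        have "\<alpha>' * psi s = \<alpha> * psi s + psi s / K * (?r - \<alpha> * ?h)" by (simp add: \<alpha>'_def distrib_right)
        then show ?thesis using lo [OF s] by linarith
      qed
      show "4 * tau * R s \<le> \<beta>' * psi s"
      proof -
        have "\<beta>' * psi s = \<beta> * psi s - psi s / K * (\<beta> * ?h - ?r)"
        proof -
          have "(b - x / K) * q = b * q - q / K * x" for b x q :: real by (simp add: left_diff_distrib)
          then show ?thesis unfolding \<beta>'_def .
        qed
        then show ?thesis using hi [OF s] by linarith
      qed
    qed
  qed
qed

text \<open>The Perron-Frobenius theorem for the positive operator \<open>radial_inv 1\<close>: the rescaled iterates are squeezed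
  between the contracting barriers and converge geometrically to a multiple of \<open>psi\<close>.\<close>

lemma radial_inv_power_limit:
  obtains \<kappa> where "0 < \<kappa>" "\<kappa> < 1"
    "\<And>P. poly P 1 = 0 \<Longrightarrow> \<exists>\<gamma> C. 0 \<le> C \<and> (\<forall>N. \<forall>s\<in>{0..1}.
       \<bar>poly ((radial_inv 1 ^^ N) P) s - \<gamma> / (4 * tau) ^ N * psi s\<bar> \<le> C * (\<kappa> / (4 * tau)) ^ N)"
proof -
  obtain \<kappa> where k: "0 < \<kappa>" "\<kappa> < 1"
    and contr: "\<And>Q R \<alpha> \<beta>. radial_ode 1 Q R \<Longrightarrow> (\<forall>s\<in>{0..1}. \<alpha> * psi s \<le> Q s \<and> Q s \<le> \<beta> * psi s) \<Longrightarrow>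
      \<exists>\<alpha>' \<beta>'. \<alpha> \<le> \<alpha>' \<and> \<beta>' \<le> \<beta> \<and> \<beta>' - \<alpha>' = \<kappa> * (\<beta> - \<alpha>) \<and>
        (\<forall>s\<in>{0..1}. \<alpha>' * psi s \<le> 4 * tau * R s \<and> 4 * tau * R s \<le> \<beta>' * psi s)"
    by (rule barrier_contraction) (rule that)
  obtain K where K: "0 < K" "\<And>s. 0 \<le> s \<Longrightarrow> s \<le> 1 \<Longrightarrow> psi s \<le> K * (1 - s)" by (rule psi_upper) (rule that)
  show thesis
  proof (rule that [OF k])
    fix P :: "real poly" assume P1: "poly P 1 = 0"
    define T where "T N = (radial_inv 1 ^^ N) P" for N :: nat
    have T: "T 0 = P" "T (Suc N) = radial_inv 1 (T N)" for N by (simp_all add: T_def)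
    define Q where "Q N s = (4 * tau) ^ N * poly (T N) s" for N s
    have step: "radial_ode 1 (Q N) (\<lambda>s. (4 * tau) ^ N * poly (T (Suc N)) s)" for N
      using radial_ode_lincomb [OF radial_ode_radial_inv [of 1 "T N"] radial_ode_radial_inv [of 1 "T N"], of "(4 * tau) ^ N" 0]
      by (simp add: Q_def [abs_def] T)
    obtain B where B: "0 < B" "\<And>s. 0 \<le> s \<Longrightarrow> s \<le> 1 \<Longrightarrow> \<bar>poly P s\<bar> \<le> B * (1 - s)"
      by (rule vanishing_at_1_bound [of "poly P" "poly (pderiv P)"]) (auto intro: poly_DERIV continuous_on_poly simp: P1)
    define b0 where "b0 = B / psi (1/2)"
    have b0: "0 \<le> b0" using B psi_half_pos by (simp add: b0_def)
    have init: "\<bar>poly P s\<bar> \<le> b0 * psi s" if "s \<in> {0..1}" for s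
    proof -
      have "B * (1 - s) = b0 * ((1 - s) * psi (1/2))" using psi_half_pos by (simp add: b0_def)
      also have "\<dots> \<le> b0 * psi s" using psi_lower [of s] that b0 by (intro mult_left_mono) auto
      finally show ?thesis using B(2) [of s] that by simp
    qed
    define good where "good N x = (\<forall>s\<in>{0..1}. fst x * psi s \<le> Q N s \<and> Q N s \<le> snd x * psi s)" for N and x :: "real \<times> real"
    define rel where "rel x y = (fst x \<le> fst y \<and> snd y \<le> snd x \<and> snd y - fst y = \<kappa> * (snd x - fst x))" for x y :: "real \<times> real"
    have "\<exists>f. f 0 = (- b0, b0) \<and> (\<forall>N. good N (f N) \<and> rel (f N) (f (Suc N)))"
    proof (rule dependent_nat_choice [of "\<lambda>N x. good N x \<and> (N = 0 \<longrightarrow> x = (- b0, b0))" "\<lambda>N. rel", THEN exE])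
      show "\<exists>x. good 0 x \<and> (0 = 0 \<longrightarrow> x = (- b0, b0))"
      proof -
        have "(- b0) * psi s \<le> Q 0 s \<and> Q 0 s \<le> b0 * psi s" if "s \<in> {0..1}" for s
          using init [OF that] by (simp add: Q_def T) linarith
        then have "good 0 (- b0, b0)" by (simp add: good_def)
        then show ?thesis by blast
      qed
    next
      fix x N assume "good N x \<and> (N = 0 \<longrightarrow> x = (- b0, b0))"
      then have "\<forall>s\<in>{0..1}. fst x * psi s \<le> Q N s \<and> Q N s \<le> snd x * psi s" by (simp add: good_def)
      from contr [OF step this] obtain \<alpha>' \<beta>' where ab: "fst x \<le> \<alpha>'" "\<beta>' \<le> snd x" "\<beta>' - \<alpha>' = \<kappa> * (snd x - fst x)"
        "\<forall>s\<in>{0..1}. \<alpha>' * psi s \<le> 4 * tau * ((4 * tau) ^ N * poly (T (Suc N)) s) \<and>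
           4 * tau * ((4 * tau) ^ N * poly (T (Suc N)) s) \<le> \<beta>' * psi s" by blast
      then have "good (Suc N) (\<alpha>', \<beta>') \<and> rel x (\<alpha>', \<beta>')" by (simp add: good_def rel_def Q_def mult.assoc)
      then show "\<exists>y. (good (Suc N) y \<and> (Suc N = 0 \<longrightarrow> y = (- b0, b0))) \<and> rel x y" by blast
    next
      fix f assume "\<forall>N. (good N (f N) \<and> (N = 0 \<longrightarrow> f N = (- b0, b0))) \<and> rel (f N) (f (Suc N))"
      then show ?thesis by blast
    qed
    then obtain f where f0: "f 0 = (- b0, b0)" and good: "\<And>N. good N (f N)" and rel: "\<And>N. rel (f N) (f (Suc N))" by blast
    define \<alpha> where "\<alpha> N = fst (f N)" for N
    define \<beta> where "\<beta> N = snd (f N)" for N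
    have inc: "incseq \<alpha>" and dec: "decseq \<beta>" using rel by (auto simp: incseq_Suc_iff decseq_Suc_iff \<alpha>_def \<beta>_def rel_def)
    have gap: "\<beta> N - \<alpha> N = \<kappa> ^ N * (2 * b0)" for N
    proof (induction N)
      case (Suc N) then show ?case using rel [of N] by (simp add: \<alpha>_def \<beta>_def rel_def)
    qed (simp add: \<alpha>_def \<beta>_def f0)
    have ab: "\<alpha> M \<le> \<beta> N" for M N
    proof -
      have "\<alpha> M \<le> \<alpha> (max M N)" using inc by (simp add: incseq_def)
      also have "\<dots> \<le> \<beta> (max M N)" using gap [of "max M N"] k b0 by (smt (verit) mult_nonneg_nonneg zero_le_power)
      also have "\<dots> \<le> \<beta> N" using dec by (simp add: decseq_def)
      finally show ?thesis .
    qed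
    define \<gamma> where "\<gamma> = (SUP N. \<alpha> N)"
    have g: "\<alpha> N \<le> \<gamma>" "\<gamma> \<le> \<beta> N" for N
      unfolding \<gamma>_def using ab by (auto intro!: cSUP_upper cSUP_least bdd_aboveI2 [of _ _ "\<beta> 0"])
    have psiK: "psi s \<le> K" if "s \<in> {0..1}" for s
    proof -
      have "K * (1 - s) \<le> K * 1" using K(1) that by (intro mult_left_mono) auto
      then show ?thesis using K(2) [of s] that by auto
    qed
    have "\<bar>poly (T N) s - \<gamma> / (4 * tau) ^ N * psi s\<bar> \<le> 2 * b0 * K * (\<kappa> / (4 * tau)) ^ N" if s: "s \<in> {0..1}" for N s
    proof -
      have p0: "0 \<le> psi s" using psi_nonneg s by auto
      have t: "0 < (4 * tau) ^ N" using tau_pos by simp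
      have "\<alpha> N * psi s \<le> Q N s" "Q N s \<le> \<beta> N * psi s" using good [of N] s by (auto simp: good_def \<alpha>_def \<beta>_def)
      moreover have "\<alpha> N * psi s \<le> \<gamma> * psi s" "\<gamma> * psi s \<le> \<beta> N * psi s" using g [of N] p0 by (auto intro: mult_right_mono)
      ultimately have "\<bar>Q N s - \<gamma> * psi s\<bar> \<le> (\<beta> N - \<alpha> N) * psi s" by (simp add: abs_le_iff left_diff_distrib)
      also have "\<dots> \<le> (\<beta> N - \<alpha> N) * K" using psiK [OF s] ab [of N N] by (intro mult_left_mono) auto
      finally have "\<bar>Q N s - \<gamma> * psi s\<bar> \<le> \<kappa> ^ N * (2 * b0) * K" unfolding gap .
      then have "\<bar>Q N s - \<gamma> * psi s\<bar> / (4 * tau) ^ N \<le> \<kappa> ^ N * (2 * b0) * K / (4 * tau) ^ N" using t by (intro divide_right_mono) auto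
      moreover have "\<bar>Q N s - \<gamma> * psi s\<bar> / (4 * tau) ^ N = \<bar>poly (T N) s - \<gamma> / (4 * tau) ^ N * psi s\<bar>"
      proof -
        have "poly (T N) s - \<gamma> / (4 * tau) ^ N * psi s = (Q N s - \<gamma> * psi s) / (4 * tau) ^ N"
          using tau_pos by (simp add: Q_def diff_divide_distrib)
        then show ?thesis using t by (simp add: abs_divide)
      qed
      moreover have "\<kappa> ^ N * (2 * b0) * K / (4 * tau) ^ N = 2 * b0 * K * (\<kappa> / (4 * tau)) ^ N" by (simp add: power_divide mult_ac)
      ultimately show ?thesis by simp
    qed
    then show "\<exists>\<gamma> C. 0 \<le> C \<and> (\<forall>N. \<forall>s\<in>{0..1}.
       \<bar>poly ((radial_inv 1 ^^ N) P) s - \<gamma> / (4 * tau) ^ N * psi s\<bar> \<le> C * (\<kappa> / (4 * tau)) ^ N)"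
      unfolding T_def using b0 K(1) by (intro exI [of _ \<gamma>] exI [of _ "2 * b0 * K"]) auto
  qed
qed

section \<open>The space of eigenfunctions\<close>

text \<open>With a primitive \<open>F\<close> of \<open>Q / 2\<close> that vanishes at 1, the mode is a linear combination of partial derivatives of
  functions \<open>F(|x|\<^sup>2) Re (b z\<^sup>m)\<close>, \<open>m = n - 1\<close>, which vanish on the circle.\<close>

lemma mode_integral_zero:
  assumes Q: "continuous_on UNIV Q" and n: "1 \<le> n"
  shows "(LINT x|lebesgue_on disk. mode n c Q x) = 0"
proof -
  obtain m where n: "n = Suc m" using n by (cases n) auto
  have cQ: "continuous_on {-1..2} Q" by (rule continuous_on_subset [OF Q]) simp
  define F where "F s = (integral {-1..s} Q - integral {-1..1} Q) / 2" for s :: real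
  have dF: "(F has_real_derivative Q s / 2) (at s)" if "0 \<le> s" "s < 1" for s
  proof -
    have "((\<lambda>s. integral {-1..s} Q) has_real_derivative Q s) (at s within {-1..2})"
      by (rule integral_has_real_derivative [OF cQ]) (use that in auto)
    moreover have "at s within {-1..2} = at s" by (rule at_within_interior) (use that in auto)
    ultimately have "((\<lambda>s. integral {-1..s} Q) has_real_derivative Q s) (at s)" by simp
    from DERIV_cdivide [OF DERIV_diff [OF this DERIV_const [of "integral {-1..1} Q"]], of 2]
    show ?thesis by (simp add: F_def [abs_def])
  qed
  have cF: "continuous_on {-1..2} F" unfolding F_def
    by (intro continuous_on_divide continuous_on_diff indefinite_integral_continuous_1 integrable_continuous_interval cQ continuous_on_const) auto
  have F1: "F 1 = 0" by (simp add: F_def)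
  define E where "E x = F (min ((norm x)\<^sup>2) 1)" for x :: "real^2"
  have cE: "continuous_on UNIV E" unfolding E_def
  proof (rule continuous_on_compose2 [OF cF])
    show "continuous_on UNIV (\<lambda>x::real^2. min ((norm x)\<^sup>2) 1)" by (intro continuous_on_min continuous_intros)
    have "- 1 \<le> (norm x)\<^sup>2" for x :: "real^2" by (rule order_trans [OF _ zero_le_power2]) simp
    then show "(\<lambda>x::real^2. min ((norm x)\<^sup>2) 1) ` UNIV \<subseteq> {-1..2}" by (auto simp: min_le_iff_disj)
  qed
  have E_eq: "E x = F ((norm x)\<^sup>2)" if "norm x \<le> 1" for x using that by (simp add: E_def power_le_one min_absorb1)
  have cQr: "continuous_on UNIV (\<lambda>x::real^2. Q ((norm x)\<^sup>2))"
    by (rule continuous_on_compose2 [OF Q]) (auto intro!: continuous_intros)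
  define A where "A b x = Re (b * zc x ^ m)" for b x
  define A' where "A' b k x = Re (b * (of_nat m * zc x ^ (m - 1) * unit_c k))" for b k x
  have cA: "continuous_on UNIV (A b)" "continuous_on UNIV (A' b k)" for b k
    unfolding A_def [abs_def] A'_def [abs_def] by (intro continuous_intros)+
  have cx: "continuous_on UNIV (\<lambda>x::real^2. x $ k)" for k by (intro continuous_intros)
  have zero: "(LINT x|lebesgue_on disk. Q ((norm x)\<^sup>2) * x $ k * A b x + E x * A' b k x) = 0" for k b
  proof (rule integral_partial_eq_0 [where k = k and F = "\<lambda>x. E x * A b x"])
    show "continuous_on (cball 0 1) (\<lambda>x. E x * A b x)"
      by (intro continuous_on_mult continuous_on_subset [OF cE] continuous_on_subset [OF cA(1)]) auto
    show "E x * A b x = 0" if "norm x = 1" for x using that by (simp add: E_def F1)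
    show "continuous_on UNIV (\<lambda>x. Q ((norm x)\<^sup>2) * x $ k * A b x + E x * A' b k x)"
      by (intro continuous_on_add continuous_on_mult cQr cE cA cx)
    fix x :: "real^2" assume x: "norm x < 1"
    have r: "((\<lambda>s. (norm (x + s *\<^sub>R axis k 1))\<^sup>2) has_real_derivative 2 * x $ k) (at 0)"
      unfolding norm_sq_line by (auto intro!: derivative_eq_intros)
    have "(norm (x + 0 *\<^sub>R axis k 1))\<^sup>2 < 1" using x by (simp add: power_less_one_iff)
    then have "((\<lambda>s. F ((norm (x + s *\<^sub>R axis k 1))\<^sup>2)) has_real_derivative Q ((norm (x + 0 *\<^sub>R axis k 1))\<^sup>2) / 2 * (2 * x $ k)) (at 0)"
      by (intro DERIV_chain2 [OF dF r]) auto
    moreover have ev: "\<forall>\<^sub>F s in nhds 0. F ((norm (x + s *\<^sub>R axis k 1))\<^sup>2) = E (x + s *\<^sub>R axis k 1)"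
    proof -
      have "continuous_on UNIV (\<lambda>s. norm (x + s *\<^sub>R axis k 1))" by (intro continuous_intros)
      then have "open ((\<lambda>s. norm (x + s *\<^sub>R axis k 1)) -` {..<1})" by (intro open_vimage) auto
      then have "\<forall>\<^sub>F s in nhds 0. s \<in> (\<lambda>s. norm (x + s *\<^sub>R axis k 1)) -` {..<1}"
        using x by (intro eventually_nhds_in_open) auto
      then show ?thesis by eventually_elim (simp add: E_eq)
    qed
    ultimately have dE: "((\<lambda>s. E (x + s *\<^sub>R axis k 1)) has_real_derivative Q ((norm x)\<^sup>2) * x $ k) (at 0)"
      using DERIV_cong_ev [OF refl ev refl] by simp
    have dA: "((\<lambda>s. A b (x + s *\<^sub>R axis k 1)) has_real_derivative A' b k x) (at 0)"
      unfolding A_def A'_def zc_line by (rule Re_pow_line_deriv)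
    show "((\<lambda>s. E (x + s *\<^sub>R axis k 1) * A b (x + s *\<^sub>R axis k 1)) has_real_derivative
        Q ((norm x)\<^sup>2) * x $ k * A b x + E x * A' b k x) (at 0)"
      by (rule DERIV_cong [OF DERIV_mult [OF dE dA]]) simp
  qed
  have i: "integrable (lebesgue_on disk) (\<lambda>x. Q ((norm x)\<^sup>2) * x $ k * A b x + E x * A' b k x)" for k b
  proof -
    have "continuous_on UNIV (\<lambda>x. Q ((norm x)\<^sup>2) * x $ k * A b x + E x * A' b k x)"
      by (intro continuous_on_add continuous_on_mult cQr cE cA cx)
    then show ?thesis by (intro integrable_ball_continuous) (rule continuous_on_subset, assumption, simp)
  qed
  have "mode n c Q x = (Q ((norm x)\<^sup>2) * x $ 1 * A c x + E x * A' c 1 x)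
      - (Q ((norm x)\<^sup>2) * x $ 2 * A (- \<i> * c) x + E x * A' (- \<i> * c) 2 x)" for x
  proof -
    have z: "Re (zc x * w) = x $ 1 * Re w - x $ 2 * Re (- \<i> * w)" for w by (simp add: zc_def)
    have "c * zc x ^ n = zc x * (c * zc x ^ m)" by (simp add: n mult.left_commute)
    then have e1: "Re (c * zc x ^ n) = x $ 1 * A c x - x $ 2 * A (- \<i> * c) x"
      unfolding A_def mult.assoc [of "- \<i>" c] z [symmetric] by (rule arg_cong)
    have e2: "A' (- \<i> * c) 2 x = A' c 1 x" by (simp add: A'_def unit_c_def)
    show ?thesis unfolding mode_def e1 e2 by (simp add: right_diff_distrib)
  qed
  then show ?thesis
    unfolding Bochner_Integration.integral_diff [OF i i, symmetric] using zero i by simp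
qed

lemma mode0_integral:
  assumes "continuous_on UNIV k" "\<And>s. (F has_real_derivative k s) (at s)"
  shows "(LINT x|lebesgue_on disk. mode 0 c k x) = pi * (F 1 - F 0) * Re c"
proof -
  have "(LINT x|lebesgue_on (ball (0::real^2) 1). k ((norm (x - 0))\<^sup>2)) = pi * (F (1\<^sup>2) - F 0)"
    by (rule radial_integral_FTC) (use assms in auto)
  then show ?thesis by (simp add: mode_def)
qed

text \<open>Coordinates on the space \<open>V\<close> in which a rotation multiplies \<open>g\<close> by a complex number of modulus 1.\<close>

definition Vfun :: "real \<Rightarrow> complex \<Rightarrow> real^2 \<Rightarrow> real" where
  "Vfun a g x = a * Lam 0 (tau * (norm x)\<^sup>2) + psi ((norm x)\<^sup>2) * Re (g * zc x)"

lemma Vfun_modes: "Vfun a g = (\<lambda>x. 1 * mode 0 (of_real a) (\<lambda>s. Lam 0 (tau * s)) x + 1 * mode 1 g psi x)"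
  by (rule ext) (simp add: Vfun_def mode_def)

text \<open>Up to a constant, the Green operator acts on \<open>V\<close> as multiplication by \<open>1 / (4 * tau)\<close>.\<close>

lemma green_pair_Vfun: "green_pair (\<lambda>x. (Vfun a g x - a * Lam 0 tau) / (4 * tau)) (Vfun a g)"
proof -
  have 0: "radial_ode 0 (\<lambda>s. Lam 0 (tau * s)) (\<lambda>s. (Lam 0 (tau * s) - Lam 0 tau) / (4 * tau))"
    using radial_ode_Lam [OF tau_pos, of 0 0] by simp
  have "green_pair (\<lambda>x. 1 * mode 0 (of_real a) (\<lambda>s. (Lam 0 (tau * s) - Lam 0 tau) / (4 * tau)) x + 1 * mode 1 g (\<lambda>s. psi s / (4 * tau)) x) (Vfun a g)"
    unfolding Vfun_modes by (rule green_pair_lincomb [OF green_pair_mode [OF 0] green_pair_mode [OF psi_ode]])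
  moreover have "1 * mode 0 (of_real a) (\<lambda>s. (Lam 0 (tau * s) - Lam 0 tau) / (4 * tau)) x + 1 * mode 1 g (\<lambda>s. psi s / (4 * tau)) x
    = (Vfun a g x - a * Lam 0 tau) / (4 * tau)" for x
    using tau_pos by (simp add: mode_def Vfun_def field_simps)
  ultimately show ?thesis by simp
qed

lemma Vfun_continuous: "continuous_on UNIV (Vfun a g)"
  using green_pair_contD(2) [OF green_pair_Vfun] .

lemma psi_continuous: "continuous_on UNIV psi"
  unfolding psi_def [abs_def] by (intro Lam_cont continuous_on_mult_left continuous_on_id)

lemma s_psi_deriv: "((\<lambda>s. s * psi s) has_real_derivative Lam 0 (tau * s)) (at s)"
proof -
  have m: "((\<lambda>s. tau * s) has_real_derivative tau) (at s)" by (auto intro!: derivative_eq_intros)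
  have "((\<lambda>s. (tau * s) ^ Suc 0 * Lam (Suc 0) (tau * s)) has_real_derivative ((tau * s) ^ 0 * Lam 0 (tau * s)) * tau) (at s)"
    by (rule DERIV_chain2 [OF pow_Lam_deriv m])
  from DERIV_cdivide [OF this, of tau] show ?thesis using tau_pos by (simp add: psi_def)
qed

lemma Vfun_integral: "(LINT x|lebesgue_on disk. Vfun a g x) = 0"
proof -
  have c0: "continuous_on UNIV (\<lambda>s. Lam 0 (tau * s))" by (intro Lam_cont continuous_on_mult_left continuous_on_id)
  have "integrable (lebesgue_on disk) (mode 0 (of_real a) (\<lambda>s. Lam 0 (tau * s)))" "integrable (lebesgue_on disk) (mode 1 g psi)"
    by (intro integrable_ball_continuous continuous_on_subset [OF continuous_on_mode] c0 psi_continuous; simp)+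
  moreover have "(LINT x|lebesgue_on disk. mode 0 (of_real a) (\<lambda>s. Lam 0 (tau * s)) x) = 0"
    unfolding mode0_integral [OF c0 s_psi_deriv] by (simp add: psi_def Lam1_tau)
  moreover have "(LINT x|lebesgue_on disk. mode 1 g psi x) = 0" by (rule mode_integral_zero [OF psi_continuous]) simp
  ultimately show ?thesis unfolding Vfun_modes by simp
qed

section \<open>From decay of iterates to energy bounds\<close>

text \<open>The Green operator followed by the addition of a constant that restores mean zero is symmetric on functions
  of mean zero. The definition says that its iterates on \<open>d\<close> decay at the rate \<open>\<rho>\<close>, which amounts to \<open>d\<close>
  having no spectral part above \<open>\<rho>\<close>.\<close>

definition decays :: "real \<Rightarrow> (real^2 \<Rightarrow> real) \<Rightarrow> bool" where
  "decays \<rho> d \<longleftrightarrow> (\<exists>D U m C. D 0 = d \<and> (\<forall>N. green_pair (U N) (D N) \<and> (LINT x|lebesgue_on disk. D N x) = 0 \<and>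
     (\<forall>x\<in>disk. D (Suc N) x = U N x + m N \<and> \<bar>D N x\<bar> \<le> C * \<rho> ^ N)))"

lemma decaysE:
  assumes "decays \<rho> d"
  obtains D U m C where "D 0 = d" "\<And>N. green_pair (U N) (D N)" "\<And>N. (LINT x|lebesgue_on disk. D N x) = 0"
    "\<And>N x. x \<in> disk \<Longrightarrow> D (Suc N) x = U N x + m N" "\<And>N x. x \<in> disk \<Longrightarrow> \<bar>D N x\<bar> \<le> C * \<rho> ^ N" "0 \<le> C"
proof -
  obtain D U m C where a: "D 0 = d \<and> (\<forall>N. green_pair (U N) (D N) \<and> (LINT x|lebesgue_on disk. D N x) = 0 \<and>
     (\<forall>x\<in>disk. D (Suc N) x = U N x + m N \<and> \<bar>D N x\<bar> \<le> C * \<rho> ^ N))"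
    using assms unfolding decays_def by (elim exE)
  note a0 = a [THEN conjunct1] and a1 = a [THEN conjunct2, THEN spec]
  note b0 = a1 [THEN conjunct1] and b1 = a1 [THEN conjunct2, THEN conjunct1] and b2 = a1 [THEN conjunct2, THEN conjunct2, THEN bspec]
  note c1 = b2 [THEN conjunct1] and c2 = b2 [THEN conjunct2]
  have "\<bar>D 0 0\<bar> \<le> C * \<rho> ^ 0" by (rule c2) simp
  then have "0 \<le> C" by simp
  show thesis by (rule that [OF a0 b0 b1 c1 c2 \<open>0 \<le> C\<close>])
qed

lemma decaysI:
  fixes D :: "nat \<Rightarrow> real^2 \<Rightarrow> real"
  assumes "D 0 = d" "\<And>N. green_pair (U N) (D N)" "\<And>N. (LINT x|lebesgue_on disk. D N x) = 0"
    "\<And>N x. x \<in> disk \<Longrightarrow> D (Suc N) x = U N x + m N" "\<And>N x. x \<in> disk \<Longrightarrow> \<bar>D N x\<bar> \<le> C * \<rho> ^ N"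
  shows "decays \<rho> d"
  unfolding decays_def
  by (intro exI [of _ D] exI [of _ U] exI [of _ m] exI [of _ C] conjI allI ballI assms)

lemma integrable_green_pair:
  assumes "green_pair U v" shows "integrable (lebesgue_on disk) v" "integrable (lebesgue_on disk) U"
  by (intro integrable_ball_continuous continuous_on_subset [OF green_pair_contD(1) [OF assms]]
      continuous_on_subset [OF green_pair_contD(2) [OF assms]]; simp)+

lemma decays_add:
  assumes d: "decays \<rho> d" and d': "decays \<rho> d'"
  shows "decays \<rho> (\<lambda>x. d x + d' x)"
proof -
  obtain D U m C where 1: "D 0 = d" "\<And>N. green_pair (U N) (D N)" "\<And>N. (LINT x|lebesgue_on disk. D N x) = 0"
    "\<And>N x. x \<in> disk \<Longrightarrow> D (Suc N) x = U N x + m N" "\<And>N x. x \<in> disk \<Longrightarrow> \<bar>D N x\<bar> \<le> C * \<rho> ^ N" "0 \<le> C"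
    by (rule decaysE [OF d]) (rule that)
  obtain D' U' m' C' where 2: "D' 0 = d'" "\<And>N. green_pair (U' N) (D' N)" "\<And>N. (LINT x|lebesgue_on disk. D' N x) = 0"
    "\<And>N x. x \<in> disk \<Longrightarrow> D' (Suc N) x = U' N x + m' N" "\<And>N x. x \<in> disk \<Longrightarrow> \<bar>D' N x\<bar> \<le> C' * \<rho> ^ N" "0 \<le> C'"
    by (rule decaysE [OF d']) (rule that)
  show ?thesis
  proof (rule decaysI [where D = "\<lambda>N x. D N x + D' N x" and U = "\<lambda>N x. U N x + U' N x" and m = "\<lambda>N. m N + m' N" and C = "C + C'"])
    fix N
    show "green_pair (\<lambda>x. U N x + U' N x) (\<lambda>x. D N x + D' N x)" using green_pair_lincomb [OF 1(2) 2(2), of 1 N 1 N] by simp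
    show "(LINT x|lebesgue_on disk. D N x + D' N x) = 0"
      using integrable_green_pair(1) [OF 1(2)] integrable_green_pair(1) [OF 2(2)] 1(3) 2(3) by simp
    fix x :: "real^2" assume x: "x \<in> disk"
    show "D (Suc N) x + D' (Suc N) x = U N x + U' N x + (m N + m' N)" using 1(4) [OF x] 2(4) [OF x] by simp
    show "\<bar>D N x + D' N x\<bar> \<le> (C + C') * \<rho> ^ N" using 1(5) [OF x, of N] 2(5) [OF x, of N] by (simp add: distrib_right)
  qed (simp add: 1 2)
qed

lemma decays_mono:
  assumes d: "decays \<rho> d" and r: "0 \<le> \<rho>" "\<rho> \<le> \<rho>'"
  shows "decays \<rho>' d"
proof -
  obtain D U m C where 1: "D 0 = d" "\<And>N. green_pair (U N) (D N)" "\<And>N. (LINT x|lebesgue_on disk. D N x) = 0"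
    "\<And>N x. x \<in> disk \<Longrightarrow> D (Suc N) x = U N x + m N" "\<And>N x. x \<in> disk \<Longrightarrow> \<bar>D N x\<bar> \<le> C * \<rho> ^ N" "0 \<le> C"
    by (rule decaysE [OF d]) (rule that)
  show ?thesis
  proof (rule decaysI [OF 1(1-4)])
    fix N and x :: "real^2" assume x: "x \<in> disk"
    have "C * \<rho> ^ N \<le> C * \<rho>' ^ N" using r 1(6) by (intro mult_left_mono power_mono) auto
    then show "\<bar>D N x\<bar> \<le> C * \<rho>' ^ N" using 1(5) [OF x, of N] by linarith
  qed
qed

lemma integral_Cauchy_Schwarz:
  fixes f g :: "real^2 \<Rightarrow> real"
  assumes f: "continuous_on UNIV f" and g: "continuous_on UNIV g"
  shows "(LINT x|lebesgue_on disk. f x * g x)\<^sup>2 \<le> (LINT x|lebesgue_on disk. (f x)\<^sup>2) * (LINT x|lebesgue_on disk. (g x)\<^sup>2)"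
proof -
  let ?D = "lebesgue_on disk"
  define F where "F = (LINT x|?D. (f x)\<^sup>2)"
  define G where "G = (LINT x|?D. (g x)\<^sup>2)"
  define P where "P = (LINT x|?D. f x * g x)"
  have i: "integrable ?D (\<lambda>x. (f x)\<^sup>2)" "integrable ?D (\<lambda>x. (g x)\<^sup>2)" "integrable ?D (\<lambda>x. f x * g x)"
    by (intro integrable_ball_continuous continuous_on_power continuous_on_mult continuous_on_subset [OF f] continuous_on_subset [OF g]; simp)+
  have q: "0 \<le> F - 2 * s * P + s\<^sup>2 * G" for s
  proof -
    have "0 \<le> (LINT x|?D. (f x - s * g x)\<^sup>2)" by (rule integral_nonneg_AE) simp
    also have "(LINT x|?D. (f x - s * g x)\<^sup>2) = (LINT x|?D. (f x)\<^sup>2 - 2 * s * (f x * g x) + s\<^sup>2 * (g x)\<^sup>2)"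
      by (rule Bochner_Integration.integral_cong) (auto simp: power2_eq_square algebra_simps)
    also have "\<dots> = F - 2 * s * P + s\<^sup>2 * G" unfolding F_def G_def P_def using i by simp
    finally show ?thesis .
  qed
  have G0: "0 \<le> G" unfolding G_def by (rule integral_nonneg_AE) simp
  have "P\<^sup>2 \<le> F * G"
  proof (cases "G = 0")
    case True
    have "P = 0"
    proof (rule ccontr)
      assume "P \<noteq> 0"
      then have "F - 2 * ((F + 1) / (2 * P)) * P = - 1" by (simp add: field_simps)
      then show False using q [of "(F + 1) / (2 * P)"] True by simp
    qed
    then show ?thesis using True by simp
  next
    case False
    have "0 \<le> G * (F - 2 * (P / G) * P + (P / G)\<^sup>2 * G)" by (rule mult_nonneg_nonneg [OF G0 q])
    also have "\<dots> = F * G - P\<^sup>2" using False by (simp add: field_simps power2_eq_square)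
    finally show ?thesis by simp
  qed
  then show ?thesis by (simp add: F_def G_def P_def)
qed

text \<open>The ratios of successive terms increase, so the first one cannot exceed the rate of growth.\<close>

lemma log_convex_ratio:
  fixes b :: "nat \<Rightarrow> real"
  assumes nn: "\<And>N. 0 \<le> b N" and cvx: "\<And>N. (b (Suc N))\<^sup>2 \<le> b N * b (Suc (Suc N))"
    and bd: "\<And>N. b N \<le> K * r ^ N" and r: "0 < r"
  shows "b 1 \<le> r * b 0"
proof (rule ccontr)
  assume "\<not> b 1 \<le> r * b 0"
  then have gt: "r * b 0 < b 1" by simp
  moreover have "0 \<le> r * b 0" using nn r by (intro mult_nonneg_nonneg) auto
  ultimately have b1: "0 < b 1" by linarith
  have "b 0 \<noteq> 0" using cvx [of 0] b1 by auto
  then have b0: "0 < b 0" using nn [of 0] by simp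
  define t where "t = b 1 / b 0"
  have t: "r < t" using gt b0 by (simp add: t_def less_divide_eq)
  have t0: "0 < t" using t r by linarith
  have "0 < b N \<and> t * b N \<le> b (Suc N)" for N
  proof (induction N)
    case 0 show ?case using b0 by (simp add: t_def)
  next
    case (Suc N)
    have "0 < t * b N" using Suc t0 by simp
    then have p: "0 < b (Suc N)" using Suc by linarith
    have "b N * (t * b (Suc N)) = (t * b N) * b (Suc N)" by simp
    also have "\<dots> \<le> b (Suc N) * b (Suc N)" using Suc p by (intro mult_right_mono) auto
    also have "\<dots> \<le> b N * b (Suc (Suc N))" using cvx [of N] by (simp add: power2_eq_square)
    finally have "t * b (Suc N) \<le> b (Suc (Suc N))" using Suc by (simp add: mult_le_cancel_left_pos)
    with p show ?case by simp
  qed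
  note st = this
  have low: "b 0 * t ^ N \<le> b N" for N
  proof (induction N)
    case (Suc N)
    have "b 0 * t ^ Suc N = t * (b 0 * t ^ N)" by simp
    also have "\<dots> \<le> t * b N" using Suc t0 by (intro mult_left_mono) auto
    also have "\<dots> \<le> b (Suc N)" using st by simp
    finally show ?case .
  qed simp
  have "1 < t / r" using t r by (simp add: less_divide_eq)
  then obtain N where N: "K / b 0 < (t / r) ^ N" using real_arch_pow by blast
  have "b 0 * t ^ N \<le> K * r ^ N" using low [of N] bd [of N] by linarith
  then have "(t / r) ^ N \<le> K / b 0" using r b0 by (simp add: power_divide field_simps)
  with N show False by simp
qed

text \<open>By symmetry and the Cauchy-Schwarz inequality the squared norms of the iterates are log-convex; their decay at
  the rate \<open>\<rho>\<^sup>2\<close> thus bounds the very first ratio.\<close>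

lemma decays_energy:
  assumes d: "decays \<rho> d" and r: "0 < \<rho>"
  shows "\<exists>U. green_pair U d \<and> (LINT x|lebesgue_on disk. d x) = 0 \<and> (LINT x|lebesgue_on disk. d x * U x) \<le> \<rho> * (LINT x|lebesgue_on disk. (d x)\<^sup>2)"
proof -
  let ?D = "lebesgue_on disk"
  obtain D U m C where 1: "D 0 = d" "\<And>N. green_pair (U N) (D N)" "\<And>N. (LINT x|lebesgue_on disk. D N x) = 0"
    "\<And>N x. x \<in> disk \<Longrightarrow> D (Suc N) x = U N x + m N" "\<And>N x. x \<in> disk \<Longrightarrow> \<bar>D N x\<bar> \<le> C * \<rho> ^ N" "0 \<le> C"
    by (rule decaysE [OF d]) (rule that)
  note cD = green_pair_contD(2) [OF 1(2)] and cU = green_pair_contD(1) [OF 1(2)]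
  have iDD: "integrable ?D (\<lambda>x. D N x * D M x)" "integrable ?D (\<lambda>x. U N x * D M x)" for N M
    by (intro integrable_ball_continuous continuous_on_mult continuous_on_subset [OF cD] continuous_on_subset [OF cU]; simp)+
  have pair: "(LINT x|?D. D (Suc N) x * D M x) = (LINT x|?D. U N x * D M x)" for N M
  proof -
    have "(LINT x|?D. D (Suc N) x * D M x) = (LINT x|?D. U N x * D M x + m N * D M x)"
      by (rule Bochner_Integration.integral_cong) (auto simp: 1(4) distrib_right)
    also have "\<dots> = (LINT x|?D. U N x * D M x) + m N * (LINT x|?D. D M x)"
      using iDD integrable_green_pair(1) [OF 1(2)] by simp
    finally show ?thesis by (simp add: 1(3))
  qed
  define b where "b N = (LINT x|?D. (D N x)\<^sup>2)" for N
  have "b 1 \<le> \<rho>\<^sup>2 * b 0"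
  proof (rule log_convex_ratio)
    show "0 \<le> b N" for N unfolding b_def by (rule integral_nonneg_AE) simp
    show "(b (Suc N))\<^sup>2 \<le> b N * b (Suc (Suc N))" for N
    proof -
      have "b (Suc N) = (LINT x|?D. D (Suc N) x * D (Suc N) x)" by (simp add: b_def power2_eq_square)
      also have "\<dots> = (LINT x|?D. U N x * D (Suc N) x)" by (rule pair)
      also have "\<dots> = (LINT x|?D. D N x * U (Suc N) x)" by (rule green_pair_sym [OF 1(2) 1(2)])
      also have "\<dots> = (LINT x|?D. U (Suc N) x * D N x)" by (simp add: mult.commute)
      also have "\<dots> = (LINT x|?D. D (Suc (Suc N)) x * D N x)" by (rule pair [symmetric])
      finally have "b (Suc N) = (LINT x|?D. D N x * D (Suc (Suc N)) x)" by (simp add: mult.commute)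
      then show ?thesis unfolding b_def using integral_Cauchy_Schwarz [OF cD cD] by simp
    qed
    show "b N \<le> pi * C\<^sup>2 * (\<rho>\<^sup>2) ^ N" for N
    proof -
      have "b N \<le> (LINT x|?D. (C * \<rho> ^ N)\<^sup>2)" unfolding b_def
      proof (rule integral_mono)
        show "integrable ?D (\<lambda>x. (D N x)\<^sup>2)" using iDD(1) [of N N] by (simp add: power2_eq_square)
        fix x assume "x \<in> space ?D"
        then have "\<bar>D N x\<bar> \<le> C * \<rho> ^ N" using 1(5) [of x N] by simp
        then show "(D N x)\<^sup>2 \<le> (C * \<rho> ^ N)\<^sup>2" by (metis abs_ge_zero power2_abs power_mono)
      qed (rule integrable_disk_const)
      also have "\<dots> = pi * (C * \<rho> ^ N)\<^sup>2" by (rule integral_disk_const)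
      also have "(C * \<rho> ^ N)\<^sup>2 = C\<^sup>2 * (\<rho>\<^sup>2) ^ N" by (simp add: power_mult_distrib power_mult [symmetric] mult.commute)
      finally show ?thesis by (simp add: mult.assoc)
    qed
    show "0 < \<rho>\<^sup>2" using r by simp
  qed
  note b1 = this
  have b0: "0 \<le> b 0" unfolding b_def by (rule integral_nonneg_AE) simp
  let ?I = "LINT x|?D. D 1 x * D 0 x"
  have "?I\<^sup>2 \<le> b 1 * b 0" unfolding b_def by (rule integral_Cauchy_Schwarz [OF cD cD])
  also have "\<dots> \<le> (\<rho>\<^sup>2 * b 0) * b 0" using b1 b0 by (rule mult_right_mono)
  also have "\<dots> = (\<rho> * b 0)\<^sup>2" by (simp add: power2_eq_square)
  finally have sq: "?I\<^sup>2 \<le> (\<rho> * b 0)\<^sup>2" .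
  have "?I \<le> \<rho> * b 0" by (rule power2_le_imp_le [OF sq mult_nonneg_nonneg [OF less_imp_le [OF r] b0]])
  moreover have "?I = (LINT x|?D. D 0 x * U 0 x)" using pair [of 0 0] by (simp only: One_nat_def mult.commute)
  ultimately have e: "(LINT x|?D. D 0 x * U 0 x) \<le> \<rho> * (LINT x|?D. (D 0 x)\<^sup>2)" by (simp only: b_def)
  show ?thesis using 1(2) [of 0] 1(3) [of 0] e unfolding 1(1) by blast
qed

text \<open>The pairing of the iterates with an element of \<open>V\<close> shrinks by exactly \<open>1 / (4 * tau)\<close> in each step, yet it
  decays at the faster rate \<open>\<rho>\<close>.\<close>

lemma decays_orthogonal:
  assumes d: "decays \<rho> d" and r: "0 < \<rho>" "\<rho> < 1 / (4 * tau)"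
  shows "(LINT x|lebesgue_on disk. d x * Vfun a g x) = 0"
proof -
  let ?D = "lebesgue_on disk"
  obtain D U m C where 1: "D 0 = d" "\<And>N. green_pair (U N) (D N)" "\<And>N. (LINT x|lebesgue_on disk. D N x) = 0"
    "\<And>N x. x \<in> disk \<Longrightarrow> D (Suc N) x = U N x + m N" "\<And>N x. x \<in> disk \<Longrightarrow> \<bar>D N x\<bar> \<le> C * \<rho> ^ N" "0 \<le> C"
    by (rule decaysE [OF d]) (rule that)
  note cD = green_pair_contD(2) [OF 1(2)] and cU = green_pair_contD(1) [OF 1(2)] and cV = Vfun_continuous [of a g]
  have i: "integrable ?D (\<lambda>x. D N x * Vfun a g x)" "integrable ?D (\<lambda>x. U N x * Vfun a g x)" "integrable ?D (Vfun a g)" "integrable ?D (D N)" for N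
    by (intro integrable_ball_continuous continuous_on_mult continuous_on_subset [OF cD] continuous_on_subset [OF cU] continuous_on_subset [OF cV]; simp)+
  define A where "A N = (LINT x|?D. D N x * Vfun a g x)" for N
  have step: "A N = 4 * tau * A (Suc N)" for N
  proof -
    have "A (Suc N) = (LINT x|?D. U N x * Vfun a g x + m N * Vfun a g x)" unfolding A_def
      by (rule Bochner_Integration.integral_cong) (auto simp: 1(4) distrib_right)
    also have "\<dots> = (LINT x|?D. U N x * Vfun a g x)" using i by (simp add: Vfun_integral)
    also have "\<dots> = (LINT x|?D. D N x * ((Vfun a g x - a * Lam 0 tau) / (4 * tau)))"
      by (rule green_pair_sym [OF 1(2) green_pair_Vfun])
    also have "\<dots> = (LINT x|?D. (D N x * Vfun a g x - a * Lam 0 tau * D N x) / (4 * tau))"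
      by (simp add: algebra_simps)
    also have "\<dots> = A N / (4 * tau)" using i(1,4) [of N] by (simp add: A_def 1(3))
    finally show ?thesis using tau_pos by simp
  qed
  have pw: "A 0 = (4 * tau) ^ N * A N" for N
  proof (induction N)
    case (Suc N)
    have "A 0 = (4 * tau) ^ N * (4 * tau * A (Suc N))" using Suc by (simp only: step [of N, symmetric])
    then show ?case by (simp only: power_Suc2 mult.assoc)
  qed simp
  define S where "S = C * (LINT x|?D. \<bar>Vfun a g x\<bar>)"
  have bd: "\<bar>A N\<bar> \<le> S * \<rho> ^ N" for N
  proof -
    have "\<bar>LINT x|?D. Vfun a g x * D N x\<bar> \<le> (C * \<rho> ^ N) * (LINT x|?D. \<bar>Vfun a g x\<bar>)"
      by (rule integrable_mult_bounded(2) [OF i(3)]) (use i(4) 1(5) in auto)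
    then show ?thesis by (simp add: A_def S_def mult_ac)
  qed
  have le: "\<bar>A 0\<bar> \<le> S * (4 * tau * \<rho>) ^ N" for N
  proof -
    have "\<bar>A 0\<bar> = (4 * tau) ^ N * \<bar>A N\<bar>" unfolding pw [of N] using tau_pos by (simp add: abs_mult)
    also have "\<dots> \<le> (4 * tau) ^ N * (S * \<rho> ^ N)" using bd tau_pos by (intro mult_left_mono) auto
    finally show ?thesis by (simp add: power_mult_distrib mult_ac)
  qed
  have "4 * tau * \<rho> < 1" using r tau_pos by (simp add: less_divide_eq mult.commute)
  then have "(\<lambda>N. (4 * tau * \<rho>) ^ N) \<longlonglongrightarrow> 0" using r tau_pos by (intro LIMSEQ_realpow_zero) auto
  then have "(\<lambda>N. S * (4 * tau * \<rho>) ^ N) \<longlonglongrightarrow> S * 0" by (intro tendsto_mult tendsto_const)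
  then have "\<bar>A 0\<bar> \<le> S * 0" by (rule LIMSEQ_le_const) (use le in auto)
  then show ?thesis by (simp add: A_def 1(1))
qed

section \<open>Decay of the angular modes\<close>

lemma Re_pow_bound: "norm x \<le> 1 \<Longrightarrow> \<bar>Re (c * zc x ^ n)\<bar> \<le> cmod c"
proof -
  assume "norm x \<le> 1"
  then have "cmod (zc x) ^ n \<le> 1" by (simp add: power_le_one)
  then have "cmod c * cmod (zc x) ^ n \<le> cmod c * 1" by (intro mult_left_mono) auto
  then have "cmod (c * zc x ^ n) \<le> cmod c" by (simp add: norm_mult norm_power)
  then show ?thesis using abs_Re_le_cmod order_trans by blast
qed

lemma mode_bound:
  assumes "x \<in> disk" "\<And>s. 0 \<le> s \<Longrightarrow> s \<le> 1 \<Longrightarrow> \<bar>Q s\<bar> \<le> B"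
  shows "\<bar>mode n c Q x\<bar> \<le> B * cmod c"
proof -
  have "\<bar>Q ((norm x)\<^sup>2)\<bar> \<le> B" using assms by (intro assms(2)) (auto simp: power_le_one)
  then show ?thesis unfolding mode_def abs_mult
    using Re_pow_bound [of x c n] assms(1) by (intro mult_mono) auto
qed

lemma continuous_bound_unit:
  fixes f :: "real \<Rightarrow> real"
  assumes "continuous_on UNIV f"
  shows "\<exists>B\<ge>0. \<forall>s. 0 \<le> s \<longrightarrow> s \<le> 1 \<longrightarrow> \<bar>f s\<bar> \<le> B"
proof -
  have "bounded (f ` {0..1})" using assms by (intro compact_imp_bounded compact_continuous_image) (auto intro: continuous_on_subset)
  then obtain B where B: "\<forall>z\<in>f ` {0..1}. norm z \<le> B" unfolding bounded_iff by blast
  have b: "\<bar>f s\<bar> \<le> B" if "0 \<le> s" "s \<le> 1" for s using B that by auto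
  have "0 \<le> B" using b [of 0] by simp
  with b show ?thesis by blast
qed

lemma high_mode_decays:
  assumes T: "0 < T" "\<forall>t\<in>{0..T}. 0 < Lam 2 t" and n: "2 \<le> n"
  shows "decays (1 / (4 * T)) (mode n c (poly P))"
proof -
  define p where "p N = (radial_inv n ^^ N) P" for N :: nat
  have p: "p 0 = P" "p (Suc N) = radial_inv n (p N)" for N by (simp_all add: p_def)
  have cP: "continuous_on UNIV (poly (p N))" for N by (intro continuous_on_poly continuous_on_id)
  have cL: "continuous_on UNIV (\<lambda>s. Lam 2 (T * s))" by (intro Lam_cont continuous_on_mult_left continuous_on_id)
  have Ts: "T * s \<in> {0..T}" if "0 \<le> s" "s \<le> 1" for s using that T(1) by (auto intro: mult_left_le)
  obtain B where B: "0 \<le> B" "\<And>s. 0 \<le> s \<Longrightarrow> s \<le> 1 \<Longrightarrow> \<bar>poly P s\<bar> \<le> B"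
    using continuous_bound_unit [OF cP [of 0]] unfolding p by blast
  obtain M where M: "0 \<le> M" "\<And>s. 0 \<le> s \<Longrightarrow> s \<le> 1 \<Longrightarrow> \<bar>Lam 2 (T * s)\<bar> \<le> M"
    using continuous_bound_unit [OF cL] by blast
  obtain s0 where s0: "s0 \<in> {0..1}" "\<forall>s\<in>{0..1}. Lam 2 (T * s0) \<le> Lam 2 (T * s)"
    using continuous_attains_inf [of "{0..1::real}" "\<lambda>s. Lam 2 (T * s)"] continuous_on_subset [OF cL] by auto
  define \<mu> where "\<mu> = Lam 2 (T * s0)"
  have mu: "0 < \<mu>" using Ts [of s0] s0 T(2) by (auto simp: \<mu>_def)
  have ind: "\<bar>poly (p N) s\<bar> \<le> B / \<mu> * (1 / (4 * T)) ^ N * Lam 2 (T * s)" if "0 \<le> s" "s \<le> 1" for N s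
    using that
  proof (induction N arbitrary: s)
    case 0
    have "B = B / \<mu> * \<mu>" using mu by simp
    also have "\<dots> \<le> B / \<mu> * Lam 2 (T * s)" using s0(2) 0 B(1) mu by (intro mult_left_mono) (auto simp: \<mu>_def)
    finally show ?case using B(2) [OF 0] by (simp add: p)
  next
    case (Suc N)
    have "\<bar>poly (p (Suc N)) s\<bar> \<le> B / \<mu> * (1 / (4 * T)) ^ N / (4 * T) * Lam 2 (T * s)"
      unfolding p by (rule radial_inv_contract_high [OF n T Suc.IH radial_ode_radial_inv Suc.prems])
    then show ?case by simp
  qed
  show ?thesis
  proof (rule decaysI [where D = "\<lambda>N. mode n c (poly (p N))" and U = "\<lambda>N. mode n c (poly (p (Suc N)))"
        and m = "\<lambda>N. 0" and C = "B / \<mu> * M * cmod c"])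
    show "mode n c (poly (p 0)) = mode n c (poly P)" by (simp add: p)
    fix N
    show "green_pair (mode n c (poly (p (Suc N)))) (mode n c (poly (p N)))"
      unfolding p by (rule green_pair_mode [OF radial_ode_radial_inv])
    show "(LINT x|lebesgue_on disk. mode n c (poly (p N)) x) = 0" by (rule mode_integral_zero [OF cP]) (use n in simp)
    fix x :: "real^2" assume x: "x \<in> disk"
    have "\<bar>mode n c (poly (p N)) x\<bar> \<le> B / \<mu> * (1 / (4 * T)) ^ N * M * cmod c"
    proof (rule mode_bound [OF x])
      fix s :: real assume s: "0 \<le> s" "s \<le> 1"
      have "B / \<mu> * (1 / (4 * T)) ^ N * Lam 2 (T * s) \<le> B / \<mu> * (1 / (4 * T)) ^ N * M"
        using M(2) [OF s] B mu T by (intro mult_left_mono) auto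
      then show "\<bar>poly (p N) s\<bar> \<le> B / \<mu> * (1 / (4 * T)) ^ N * M" using ind [OF s, of N] by linarith
    qed
    then show "\<bar>mode n c (poly (p N)) x\<bar> \<le> B / \<mu> * M * cmod c * (1 / (4 * T)) ^ N" by (simp add: mult_ac)
  qed simp
qed

lemma psi_deriv: "(psi has_real_derivative - (tau * Lam 2 (tau * s))) (at s)"
proof -
  have m: "((\<lambda>s. tau * s) has_real_derivative tau) (at s)" by (auto intro!: derivative_eq_intros)
  have "(psi has_real_derivative - Lam (Suc 1) (tau * s) * tau) (at s)"
    unfolding psi_def [abs_def] by (rule Lam_deriv_chain [OF m])
  then show ?thesis by (simp add: numeral_2_eq_2 mult.commute)
qed

lemma psi_Lam0: "psi s - s * (tau * Lam 2 (tau * s)) = Lam 0 (tau * s)"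
  using Lam_rec [of "tau * s" 0] by (simp add: psi_def numeral_2_eq_2 algebra_simps)

lemma eventually_geometric_bound:
  fixes r :: real
  assumes r: "0 < r" and "0 \<le> B" "0 \<le> C" and f0: "f 0 \<le> B" and S: "\<And>N. f (Suc N) \<le> C * r ^ N"
  shows "f N \<le> (B + C / r) * r ^ N"
proof (cases N)
  case 0
  have "0 \<le> C / r" using assms by simp
  then have "f 0 \<le> B + C / r" using f0 by linarith
  then show ?thesis using 0 by simp
next
  case (Suc M)
  have "f (Suc M) \<le> C / r * r ^ Suc M" using S [of M] r by simp
  also have "\<dots> \<le> (B + C / r) * r ^ Suc M" using assms by (intro mult_right_mono) auto
  finally show ?thesis using Suc by simp
qed

text \<open>After one application of the solution operator the profile vanishes at 1, so \<open>lim\<close> applies to the later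
  iterates; subtracting the limiting multiple of \<open>psi\<close> leaves the faster decay.\<close>

lemma mode1_decays:
  assumes k: "0 < \<kappa>" and lim: "\<And>P. poly P 1 = 0 \<Longrightarrow> \<exists>\<gamma> C. 0 \<le> C \<and> (\<forall>N. \<forall>s\<in>{0..1}.
       \<bar>poly ((radial_inv 1 ^^ N) P) s - \<gamma> / (4 * tau) ^ N * psi s\<bar> \<le> C * (\<kappa> / (4 * tau)) ^ N)"
  shows "\<exists>\<gamma>. decays (\<kappa> / (4 * tau)) (mode 1 c (\<lambda>s. poly P s - \<gamma> * psi s))"
proof -
  let ?r = "\<kappa> / (4 * tau)"
  have r: "0 < ?r" using k tau_pos by simp
  define q where "q N = (radial_inv 1 ^^ N) P" for N :: nat
  have q: "q 0 = P" "q (Suc N) = radial_inv 1 (q N)" for N by (simp_all add: q_def)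
  have "poly (radial_inv 1 P) 1 = 0" using radial_ode_radial_inv [of 1 P] by (simp add: radial_ode_def)
  then obtain \<gamma> C where C: "0 \<le> C" and gb: "\<And>N s. s \<in> {0..1} \<Longrightarrow>
     \<bar>poly ((radial_inv 1 ^^ N) (radial_inv 1 P)) s - \<gamma> / (4 * tau) ^ N * psi s\<bar> \<le> C * ?r ^ N"
    using lim [of "radial_inv 1 P"] by blast
  have qS: "(radial_inv 1 ^^ N) (radial_inv 1 P) = q (Suc N)" for N
    by (simp add: q_def funpow_swap1)
  define \<delta> where "\<delta> N = \<gamma> * (4 * tau) / (4 * tau) ^ N" for N :: nat
  have dS: "\<delta> (Suc N) = \<gamma> / (4 * tau) ^ N" "\<delta> (Suc N) = \<delta> N / (4 * tau)" for N using tau_pos by (simp_all add: \<delta>_def)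
  define R where "R N s = poly (q N) s - \<delta> N * psi s" for N s
  have cR: "continuous_on UNIV (R N)" for N unfolding R_def
    by (intro continuous_on_diff continuous_on_mult_left continuous_on_poly continuous_on_id psi_continuous)
  have ode: "radial_ode 1 (R N) (R (Suc N))" for N
    using radial_ode_lincomb [OF radial_ode_radial_inv [of 1 "q N"] psi_ode, of 1 "- \<delta> N"]
    by (simp add: R_def [abs_def] q dS(2))
  obtain B where B: "0 \<le> B" "\<And>s. 0 \<le> s \<Longrightarrow> s \<le> 1 \<Longrightarrow> \<bar>R 0 s\<bar> \<le> B"
    using continuous_bound_unit [OF cR [of 0]] by blast
  have bd: "\<bar>R N s\<bar> \<le> (B + C / ?r) * ?r ^ N" if s: "0 \<le> s" "s \<le> 1" for N s
    by (rule eventually_geometric_bound [OF r B(1) C, where f = "\<lambda>N. \<bar>R N s\<bar>"])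
      (use B(2) [OF s] gb [of s, unfolded qS] s in \<open>simp_all add: R_def dS(1)\<close>)
  have "decays ?r (mode 1 c (R 0))"
  proof (rule decaysI [where D = "\<lambda>N. mode 1 c (R N)" and U = "\<lambda>N. mode 1 c (R (Suc N))" and m = "\<lambda>N. 0"
        and C = "(B + C / ?r) * cmod c"])
    fix N
    show "green_pair (mode 1 c (R (Suc N))) (mode 1 c (R N))" by (rule green_pair_mode [OF ode])
    show "(LINT x|lebesgue_on disk. mode 1 c (R N) x) = 0" by (rule mode_integral_zero [OF cR]) simp
    fix x :: "real^2" assume x: "x \<in> disk"
    have "\<bar>mode 1 c (R N) x\<bar> \<le> (B + C / ?r) * ?r ^ N * cmod c" by (rule mode_bound [OF x bd])
    then show "\<bar>mode 1 c (R N) x\<bar> \<le> (B + C / ?r) * cmod c * ?r ^ N" by (simp only: mult_ac)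
  qed simp_all
  then show ?thesis by (intro exI [of _ "\<delta> 0"]) (simp add: R_def [abs_def] q)
qed

text \<open>If \<open>S\<close> solves the problem of order 1 for \<open>R\<close>, then \<open>(s S)'\<close> solves, up to a constant, the problem of order
  0 for \<open>(s R)'\<close>. The profiles of order 0 with mean zero are the derivatives of \<open>s R\<close> with \<open>R 1 = 0\<close>, so this
  reduces order 0 to order 1. The bound on the derivative comes from comparison with \<open>M * (1 - s) / 8\<close>, the
  solution for the constant right-hand side \<open>M\<close>.\<close>

lemma radial_ode_shift:
  assumes ode: "radial_ode 1 R S" and R: "\<And>s. (R has_real_derivative R' s) (at s)" and cR': "continuous_on UNIV R'"
    and S: "\<And>s. (S has_real_derivative S' s) (at s)"
  shows "radial_ode 0 (\<lambda>s. R s + s * R' s) (\<lambda>s. S s + s * S' s - S' 1)"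
    "(\<And>s. 0 \<le> s \<Longrightarrow> s \<le> 1 \<Longrightarrow> \<bar>R s\<bar> \<le> M) \<Longrightarrow> 0 \<le> t \<Longrightarrow> t \<le> 1 \<Longrightarrow> \<bar>t * S' t\<bar> \<le> M / 8"
proof -
  obtain d e where 1: "S 1 = 0" "\<And>s. (S has_real_derivative d s) (at s)" "\<And>s. (d has_real_derivative e s) (at s)"
    "\<And>s. 4 * (s * e s + (real 1 + 1) * d s) = - R s"
    using ode unfolding radial_ode_def by auto
  have "d = S'" using DERIV_unique [OF 1(2) S] by (rule ext)
  then have S': "\<And>s. (S' has_real_derivative e s) (at s)" "\<And>s. S' s + S' s + s * e s = - R s / 4"
    using 1(3) 1(4) by (auto simp: field_simps)
  show "radial_ode 0 (\<lambda>s. R s + s * R' s) (\<lambda>s. S s + s * S' s - S' 1)"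
    unfolding radial_ode_def
  proof (intro conjI exI allI)
    show "S 1 + 1 * S' 1 - S' 1 = 0" by (simp add: 1)
    fix s
    have "((\<lambda>s. S s + s * S' s - S' 1) has_real_derivative S' s + (1 * S' s + e s * s) - 0) (at s)"
      by (intro DERIV_diff DERIV_add S DERIV_mult DERIV_ident S'(1) DERIV_const)
    moreover have "S' s + (1 * S' s + e s * s) - 0 = - R s / 4" using S'(2) [of s] by (simp add: mult.commute)
    ultimately show "((\<lambda>s. S s + s * S' s - S' 1) has_real_derivative - R s / 4) (at s)" by (simp only:)
    show "((\<lambda>s. - R s / 4) has_real_derivative - R' s / 4) (at s)" by (intro DERIV_cdivide DERIV_minus R)
    show "continuous_on UNIV (\<lambda>s. - R' s / 4)" by (intro continuous_on_divide continuous_on_minus cR' continuous_on_const) auto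
    show "4 * (s * (- R' s / 4) + (real 0 + 1) * (- R s / 4)) = - (R s + s * R' s)" by simp
  qed
  show "\<bar>t * S' t\<bar> \<le> M / 8" if b: "\<And>s. 0 \<le> s \<Longrightarrow> s \<le> 1 \<Longrightarrow> \<bar>R s\<bar> \<le> M" and t: "0 \<le> t" "t \<le> 1"
  proof (cases "t = 0")
    case True
    have "0 \<le> M" using b [of 0] by simp
    then show ?thesis using True by simp
  next
    case False
    then have t0: "0 < t" using t by simp
    have l: "((\<lambda>s. M * (1 - s) / 8) has_real_derivative - M / 8) (at s)" for s
      by (auto intro!: derivative_eq_intros)
    have o: "radial_ode 1 (\<lambda>s. M) (\<lambda>s. M * (1 - s) / 8)"
      unfolding radial_ode_def
    proof (intro conjI exI allI)
      fix s
      show "((\<lambda>s. M * (1 - s) / 8) has_real_derivative - M / 8) (at s)" by (rule l)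
      show "((\<lambda>s. - M / 8) has_real_derivative 0) (at s)" by (rule DERIV_const)
    qed auto
    have e: "- M / 8 + e * S' t \<le> 0" if e: "e = 1 \<or> e = - 1" for e
    proof -
      obtain d where dd: "(\<forall>s. ((\<lambda>s. 1 * (M * (1 - s) / 8) + e * S s) has_real_derivative d s) (at s)) \<and>
        (\<forall>s t. 0 \<le> s \<longrightarrow> s \<le> t \<longrightarrow> t \<le> 1 \<longrightarrow> t ^ Suc 1 * d t \<le> s ^ Suc 1 * d s) \<and>
        (\<forall>s. 0 < s \<longrightarrow> s \<le> 1 \<longrightarrow> d s \<le> 0)"
      proof (rule exE [OF radial_ode_flux [OF radial_ode_lincomb [OF o ode, of 1 e]]])
        fix s :: real assume s: "0 \<le> s" "s \<le> 1"
        show "0 \<le> 1 * M + e * R s" using b [OF s] e by auto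
      qed (rule that)
      have "((\<lambda>s. 1 * (M * (1 - s) / 8) + e * S s) has_real_derivative 1 * (- M / 8) + e * S' t) (at t)"
        by (intro DERIV_add DERIV_cmult l S)
      then have "d t = 1 * (- M / 8) + e * S' t" using dd DERIV_unique by blast
      moreover have "d t \<le> 0" using dd t0 t by blast
      ultimately show ?thesis by simp
    qed
    have "\<bar>S' t\<bar> \<le> M / 8" using e [of 1] e [of "-1"] by simp
    moreover have "t * \<bar>S' t\<bar> \<le> 1 * \<bar>S' t\<bar>" using t by (intro mult_right_mono) auto
    ultimately show ?thesis using t by (simp add: abs_mult)
  qed
qed

text \<open>\<open>s\<^sup>m - 1 / (m + 1)\<close> is the derivative of \<open>s P\<close> for \<open>P = (s\<^sup>m - 1) / (m + 1)\<close>, and \<open>Lam 0 (tau * s)\<close> is that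
  of \<open>s psi\<close>; so the decay for order 1 is transported by \<open>radial_ode_shift\<close>.\<close>

lemma mode0_decays:
  assumes k: "0 < \<kappa>" and lim: "\<And>P. poly P 1 = 0 \<Longrightarrow> \<exists>\<gamma> C. 0 \<le> C \<and> (\<forall>N. \<forall>s\<in>{0..1}.
       \<bar>poly ((radial_inv 1 ^^ N) P) s - \<gamma> / (4 * tau) ^ N * psi s\<bar> \<le> C * (\<kappa> / (4 * tau)) ^ N)"
  shows "\<exists>\<gamma>. decays (\<kappa> / (4 * tau)) (mode 0 c (\<lambda>s. s ^ m - 1 / (real m + 1) - \<gamma> * Lam 0 (tau * s)))"
proof -
  let ?r = "\<kappa> / (4 * tau)"
  have r: "0 < ?r" using k tau_pos by simp
  define P :: "real poly" where "P = smult (1 / (real m + 1)) (monom 1 m - 1)"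
  have P: "poly P s = (s ^ m - 1) / (real m + 1)" for s by (simp add: P_def poly_monom)
  have P': "poly (pderiv P) s = real m * s ^ (m - 1) / (real m + 1)" for s
    by (simp add: P_def pderiv_smult pderiv_diff pderiv_monom poly_monom)
  define q where "q N = (radial_inv 1 ^^ N) P" for N :: nat
  have q: "q 0 = P" "q (Suc N) = radial_inv 1 (q N)" for N by (simp_all add: q_def)
  obtain \<gamma> C where C: "0 \<le> C" and gb: "\<And>N s. s \<in> {0..1} \<Longrightarrow>
     \<bar>poly (q N) s - \<gamma> / (4 * tau) ^ N * psi s\<bar> \<le> C * ?r ^ N"
  proof -
    have "poly P 1 = 0" by (simp add: P)
    from lim [OF this] that show thesis unfolding q_def by blast
  qed
  define \<delta> where "\<delta> N = \<gamma> / (4 * tau) ^ N" for N :: nat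
  have dS: "\<delta> (Suc N) = \<delta> N / (4 * tau)" for N using tau_pos by (simp add: \<delta>_def)
  define R where "R N s = poly (q N) s - \<delta> N * psi s" for N s
  define R' where "R' N s = poly (pderiv (q N)) s - \<delta> N * - (tau * Lam 2 (tau * s))" for N s
  have dR: "(R N has_real_derivative R' N s) (at s)" for N s unfolding R_def R'_def
    by (intro DERIV_diff DERIV_cmult psi_deriv poly_DERIV)
  have cR': "continuous_on UNIV (R' N)" for N unfolding R'_def
    by (intro continuous_on_diff continuous_on_mult_left continuous_on_poly continuous_on_id continuous_on_minus Lam_cont)
  have cR: "continuous_on UNIV (R N)" for N unfolding R_def
    by (intro continuous_on_diff continuous_on_mult_left continuous_on_poly continuous_on_id psi_continuous)
  have ode: "radial_ode 1 (R N) (R (Suc N))" for N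
    using radial_ode_lincomb [OF radial_ode_radial_inv [of 1 "q N"] psi_ode, of 1 "- \<delta> N"]
    by (simp add: R_def [abs_def] q dS)
  have R1: "R N 1 = 0" for N
  proof (cases N)
    case 0 then show ?thesis by (simp add: R_def q P psi_def Lam1_tau)
  next
    case (Suc M) then show ?thesis using ode [of M] by (simp add: radial_ode_def)
  qed
  define K where "K N s = R N s + s * R' N s" for N s
  have cK: "continuous_on UNIV (K N)" for N unfolding K_def
    by (intro continuous_on_add continuous_on_mult cR cR' continuous_on_id)
  have odeK: "radial_ode 0 (K N) (\<lambda>s. K (Suc N) s - R' (Suc N) 1)" for N
    using radial_ode_shift(1) [OF ode dR cR' dR] by (simp add: K_def [abs_def])
  have Rb: "\<bar>R N s\<bar> \<le> C * ?r ^ N" if "0 \<le> s" "s \<le> 1" for N s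
    using gb [of s N] that by (simp add: R_def \<delta>_def)
  obtain B where B: "0 \<le> B" "\<And>s. 0 \<le> s \<Longrightarrow> s \<le> 1 \<Longrightarrow> \<bar>K 0 s\<bar> \<le> B"
    using continuous_bound_unit [OF cK [of 0]] by blast
  define C' where "C' = C * ?r + C / 8"
  have C': "0 \<le> C'" using mult_nonneg_nonneg [OF C less_imp_le [OF r]] C unfolding C'_def by linarith
  have KS: "\<bar>K (Suc N) s\<bar> \<le> C' * ?r ^ N" if s: "0 \<le> s" "s \<le> 1" for N s
  proof -
    have "\<bar>s * R' (Suc N) s\<bar> \<le> C * ?r ^ N / 8"
      by (rule radial_ode_shift(2) [OF ode dR cR' dR Rb s])
    moreover have "\<bar>R (Suc N) s\<bar> \<le> C * ?r ^ Suc N" by (rule Rb [OF s])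
    moreover have "C' * ?r ^ N = C * ?r ^ Suc N + C * ?r ^ N / 8" by (simp add: C'_def distrib_right)
    ultimately show ?thesis unfolding K_def by linarith
  qed
  have bd: "\<bar>K N s\<bar> \<le> (B + C' / ?r) * ?r ^ N" if s: "0 \<le> s" "s \<le> 1" for N s
    by (rule eventually_geometric_bound [OF r B(1) C' B(2) [OF s] KS [OF s]])
  have "decays ?r (mode 0 c (K 0))"
  proof (rule decaysI [where D = "\<lambda>N. mode 0 c (K N)" and U = "\<lambda>N. mode 0 c (\<lambda>s. K (Suc N) s - R' (Suc N) 1)"
        and m = "\<lambda>N. R' (Suc N) 1 * Re c" and C = "(B + C' / ?r) * cmod c"])
    fix N
    show "green_pair (mode 0 c (\<lambda>s. K (Suc N) s - R' (Suc N) 1)) (mode 0 c (K N))" by (rule green_pair_mode [OF odeK])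
    have "((\<lambda>s. s * R N s) has_real_derivative K N s) (at s)" for s
      using DERIV_mult [OF DERIV_ident dR [of N s]] by (simp add: K_def mult.commute)
    from mode0_integral [OF cK this]
    show "(LINT x|lebesgue_on disk. mode 0 c (K N) x) = 0" by (simp add: R1)
    fix x :: "real^2" assume x: "x \<in> disk"
    show "mode 0 c (K (Suc N)) x = mode 0 c (\<lambda>s. K (Suc N) s - R' (Suc N) 1) x + R' (Suc N) 1 * Re c"
      by (simp add: mode_def left_diff_distrib)
    have "\<bar>mode 0 c (K N) x\<bar> \<le> (B + C' / ?r) * ?r ^ N * cmod c" by (rule mode_bound [OF x bd])
    then show "\<bar>mode 0 c (K N) x\<bar> \<le> (B + C' / ?r) * cmod c * ?r ^ N" by (simp only: mult_ac)
  qed simp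
  moreover have "K 0 = (\<lambda>s. s ^ m - 1 / (real m + 1) - \<gamma> * Lam 0 (tau * s))"
  proof (rule ext)
    fix s
    have "poly P s + s * poly (pderiv P) s = s ^ m - 1 / (real m + 1)"
    proof -
      have "s * (real m * s ^ (m - 1)) = real m * s ^ m" by (cases m) auto
      then have "poly P s + s * poly (pderiv P) s = (s ^ m - 1 + real m * s ^ m) / (real m + 1)"
        unfolding P P' by (simp add: add_divide_distrib)
      also have "s ^ m - 1 + real m * s ^ m = (real m + 1) * s ^ m - 1" by (simp add: algebra_simps)
      also have "((real m + 1) * s ^ m - 1) / (real m + 1) = s ^ m - 1 / (real m + 1)" by (simp add: diff_divide_distrib)
      finally show ?thesis .
    qed
    moreover have "K 0 s = poly P s + s * poly (pderiv P) s - \<gamma> * (psi s - s * (tau * Lam 2 (tau * s)))"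
      by (simp add: K_def R_def R'_def q \<delta>_def algebra_simps)
    ultimately show "K 0 s = s ^ m - 1 / (real m + 1) - \<gamma> * Lam 0 (tau * s)" by (simp only: psi_Lam0)
  qed
  ultimately show ?thesis by (intro exI [of _ \<gamma>]) simp
qed

lemma mode_sum_decomposition:
  "\<exists>\<rho>. 0 < \<rho> \<and> \<rho> < 1 / (4 * tau) \<and> (\<forall>f. mode_sum f \<longrightarrow>
     (\<exists>c a g d. decays \<rho> d \<and> (\<forall>x. f x = c + Vfun a g x + d x)))"
proof -
  obtain T where T: "tau < T" "\<forall>t\<in>{0..T}. 0 < Lam 2 t" using Lam2_pos_beyond by blast
  have T0: "0 < T" using T(1) tau_pos by simp
  obtain \<kappa> where k: "0 < \<kappa>" "\<kappa> < 1" and lim: "\<And>P. poly P 1 = 0 \<Longrightarrow> \<exists>\<gamma> C. 0 \<le> C \<and> (\<forall>N. \<forall>s\<in>{0..1}.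
       \<bar>poly ((radial_inv 1 ^^ N) P) s - \<gamma> / (4 * tau) ^ N * psi s\<bar> \<le> C * (\<kappa> / (4 * tau)) ^ N)"
    by (rule radial_inv_power_limit) (rule that)
  define \<rho> where "\<rho> = max (1 / (4 * T)) (\<kappa> / (4 * tau))"
  have r: "0 < \<rho>" "\<rho> < 1 / (4 * tau)" "1 / (4 * T) \<le> \<rho>" "\<kappa> / (4 * tau) \<le> \<rho>" "0 \<le> 1 / (4 * T)" "0 \<le> \<kappa> / (4 * tau)"
    using T T0 tau_pos k by (auto simp: \<rho>_def less_max_iff_disj intro!: divide_strict_left_mono divide_strict_right_mono)
  have "\<exists>c a g d. decays \<rho> d \<and> (\<forall>x. f x = c + Vfun a g x + d x)" if "mode_sum f" for f
    using that
  proof induction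
    case (mode n c m)
    have pm: "poly (monom 1 m) = (\<lambda>s::real. s ^ m)" by (auto simp: poly_monom)
    consider "n = 0" | "n = 1" | "2 \<le> n" by linarith
    then show ?case
    proof cases
      case 1
      obtain \<gamma> where d: "decays (\<kappa> / (4 * tau)) (mode 0 c (\<lambda>s. s ^ m - 1 / (real m + 1) - \<gamma> * Lam 0 (tau * s)))"
        using mode0_decays [OF k(1) lim] by blast
      have "mode n c (\<lambda>s. s ^ m) x = Re c / (real m + 1) + Vfun (\<gamma> * Re c) 0 x
         + mode 0 c (\<lambda>s. s ^ m - 1 / (real m + 1) - \<gamma> * Lam 0 (tau * s)) x" for x
        by (simp add: 1 mode_def Vfun_def algebra_simps)
      then show ?thesis using decays_mono [OF d r(6,4)] by blast
    next
      case 2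
      obtain \<gamma> where d: "decays (\<kappa> / (4 * tau)) (mode 1 c (\<lambda>s. poly (monom 1 m) s - \<gamma> * psi s))"
        using mode1_decays [OF k(1) lim] by blast
      have "mode n c (\<lambda>s. s ^ m) x = 0 + Vfun 0 (of_real \<gamma> * c) x + mode 1 c (\<lambda>s. poly (monom 1 m) s - \<gamma> * psi s) x" for x
      proof -
        have "Re (of_real \<gamma> * c * zc x) = \<gamma> * Re (c * zc x)" by (simp only: mult.assoc Re_of_real_mult)
        then show ?thesis by (simp add: 2 mode_def Vfun_def pm left_diff_distrib)
      qed
      then show ?thesis using decays_mono [OF d r(6,4)] by blast
    next
      case 3
      have "decays \<rho> (mode n c (poly (monom 1 m)))" by (rule decays_mono [OF high_mode_decays [OF T0 T(2) 3] r(5,3)])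
      moreover have "mode n c (\<lambda>s. s ^ m) x = 0 + Vfun 0 0 x + mode n c (poly (monom 1 m)) x" for x
        by (simp add: pm Vfun_def)
      ultimately show ?thesis by blast
    qed
  next
    case (add f f')
    then obtain c a g d c' a' g' d' where d: "decays \<rho> d" "decays \<rho> d'"
      and e: "\<And>x. f x = c + Vfun a g x + d x" "\<And>x. f' x = c' + Vfun a' g' x + d' x" by blast
    have "f x + f' x = (c + c') + Vfun (a + a') (g + g') x + (d x + d' x)" for x
      unfolding e Vfun_def by (simp add: algebra_simps)
    then show ?case using decays_add [OF d] by blast
  qed
  then show ?thesis using r(1,2) by blast
qed

text \<open>The decomposition is orthogonal also for the energy, on \<open>V\<close> the Green operator is \<open>1 / (4 * tau)\<close>, and on the
  remainder \<open>decays_energy\<close> applies.\<close>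

lemma spectral_gap:
  "\<exists>\<rho>. 0 < \<rho> \<and> \<rho> < 1 / (4 * tau) \<and> (\<forall>f. mode_sum f \<longrightarrow>
     (\<exists>c a g d. (\<forall>x. f x = c + Vfun a g x + d x) \<and> continuous_on UNIV d \<and>
        (LINT x|lebesgue_on disk. d x) = 0 \<and> (LINT x|lebesgue_on disk. d x * Vfun a g x) = 0 \<and>
        2 * energy (\<lambda>x. Vfun a g x + d x) \<le> (LINT x|lebesgue_on disk. (Vfun a g x)\<^sup>2) / (4 * tau) + \<rho> * (LINT x|lebesgue_on disk. (d x)\<^sup>2)))"
proof -
  let ?D = "lebesgue_on disk"
  obtain \<rho> where r: "0 < \<rho>" "\<rho> < 1 / (4 * tau)" and dec: "\<And>f. mode_sum f \<Longrightarrow>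
     \<exists>c a g d. decays \<rho> d \<and> (\<forall>x. f x = c + Vfun a g x + d x)" using mode_sum_decomposition by blast
  have "\<exists>c a g d. (\<forall>x. f x = c + Vfun a g x + d x) \<and> continuous_on UNIV d \<and>
        (LINT x|?D. d x) = 0 \<and> (LINT x|?D. d x * Vfun a g x) = 0 \<and>
        2 * energy (\<lambda>x. Vfun a g x + d x) \<le> (LINT x|?D. (Vfun a g x)\<^sup>2) / (4 * tau) + \<rho> * (LINT x|?D. (d x)\<^sup>2)"
    if f: "mode_sum f" for f
  proof -
    obtain c a g d where d: "decays \<rho> d" and e: "\<forall>x. f x = c + Vfun a g x + d x" using dec [OF f] by blast
    obtain U where U: "green_pair U d" "(LINT x|?D. d x) = 0" "(LINT x|?D. d x * U x) \<le> \<rho> * (LINT x|?D. (d x)\<^sup>2)"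
      using decays_energy [OF d r(1)] by blast
    have orth: "(LINT x|?D. d x * Vfun a g x) = 0" by (rule decays_orthogonal [OF d r])
    define W where "W x = (Vfun a g x - a * Lam 0 tau) / (4 * tau)" for x
    have W: "green_pair W (Vfun a g)" using green_pair_Vfun [of a g] by (simp add: W_def [abs_def])
    note c = green_pair_contD [OF U(1)] green_pair_contD [OF W]
    have i: "integrable ?D (\<lambda>x. Vfun a g x * W x)" "integrable ?D (\<lambda>x. Vfun a g x * U x)" "integrable ?D (\<lambda>x. d x * W x)"
      "integrable ?D (\<lambda>x. d x * U x)" "integrable ?D (\<lambda>x. Vfun a g x * Vfun a g x)" "integrable ?D (Vfun a g)"
      "integrable ?D (\<lambda>x. d x * Vfun a g x)" "integrable ?D d"
      by (intro integrable_ball_continuous continuous_on_mult continuous_on_subset [OF c(1)] continuous_on_subset [OF c(2)]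
          continuous_on_subset [OF c(3)] continuous_on_subset [OF c(4)]; simp)+
    have gp: "green_pair (\<lambda>x. W x + U x) (\<lambda>x. Vfun a g x + d x)" using green_pair_lincomb [OF W U(1), of 1 1] by simp
    have "2 * energy (\<lambda>x. Vfun a g x + d x) = (LINT x|?D. (Vfun a g x + d x) * (W x + U x))"
      unfolding energy_def using green_op_green_pair [OF gp] by (auto intro!: Bochner_Integration.integral_cong)
    also have "\<dots> = (LINT x|?D. (Vfun a g x * W x + Vfun a g x * U x) + (d x * W x + d x * U x))"
      by (rule Bochner_Integration.integral_cong) (auto simp: algebra_simps)
    also have "\<dots> = (LINT x|?D. Vfun a g x * W x) + (LINT x|?D. Vfun a g x * U x) + ((LINT x|?D. d x * W x) + (LINT x|?D. d x * U x))"
      using i(1-4) by simp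
    also have "(LINT x|?D. Vfun a g x * W x) = (LINT x|?D. (Vfun a g x)\<^sup>2) / (4 * tau)"
    proof -
      have "(LINT x|?D. Vfun a g x * W x) = (LINT x|?D. (Vfun a g x * Vfun a g x - a * Lam 0 tau * Vfun a g x) / (4 * tau))"
        by (rule Bochner_Integration.integral_cong) (auto simp: W_def algebra_simps)
      also have "\<dots> = ((LINT x|?D. Vfun a g x * Vfun a g x) - a * Lam 0 tau * (LINT x|?D. Vfun a g x)) / (4 * tau)"
        using i(5,6) by simp
      finally show ?thesis by (simp add: Vfun_integral power2_eq_square)
    qed
    also have dW: "(LINT x|?D. d x * W x) = 0"
    proof -
      have "(LINT x|?D. d x * W x) = (LINT x|?D. (d x * Vfun a g x - a * Lam 0 tau * d x) / (4 * tau))"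
        by (rule Bochner_Integration.integral_cong) (auto simp: W_def algebra_simps)
      also have "\<dots> = ((LINT x|?D. d x * Vfun a g x) - a * Lam 0 tau * (LINT x|?D. d x)) / (4 * tau)"
        using i(7,8) by simp
      finally show ?thesis by (simp add: orth U(2))
    qed
    also have "(LINT x|?D. Vfun a g x * U x) = 0"
    proof -
      have "(LINT x|?D. U x * Vfun a g x) = (LINT x|?D. d x * W x)" by (rule green_pair_sym [OF U(1) W])
      then show ?thesis using dW by (simp add: mult.commute)
    qed
    finally have "2 * energy (\<lambda>x. Vfun a g x + d x) \<le> (LINT x|?D. (Vfun a g x)\<^sup>2) / (4 * tau) + \<rho> * (LINT x|?D. (d x)\<^sup>2)"
      using U(3) by simp
    with e c(2) U(2) orth show ?thesis by blast
  qed
  with r show ?thesis by blast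
qed

section \<open>Moments of the eigenfunctions\<close>

abbreviation radial_mean :: "(real \<Rightarrow> real) \<Rightarrow> real" where
  "radial_mean f \<equiv> (LINT x|lebesgue_on disk. f ((norm x)\<^sup>2))"

definition phi :: "real \<Rightarrow> real" where "phi s = Lam 0 (tau * s)"

lemma phi_continuous: "continuous_on UNIV phi"
  unfolding phi_def [abs_def] by (intro Lam_cont continuous_on_mult_left continuous_on_id)

lemma phi_deriv: "(phi has_real_derivative - (tau * psi s)) (at s)"
proof -
  have m: "((\<lambda>s. tau * s) has_real_derivative tau) (at s)" by (auto intro!: derivative_eq_intros)
  have "(phi has_real_derivative - Lam (Suc 0) (tau * s) * tau) (at s)"
    unfolding phi_def [abs_def] by (rule Lam_deriv_chain [OF m])
  then show ?thesis by (simp add: psi_def mult.commute)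
qed

lemma s_psi_phi: "((\<lambda>s. s * psi s) has_real_derivative phi s) (at s)"
  using s_psi_deriv by (simp add: phi_def)

lemma psi_1: "psi 1 = 0" by (simp add: psi_def Lam1_tau)

lemma mode_integrable: "continuous_on UNIV Q \<Longrightarrow> integrable (lebesgue_on disk) (mode n c Q)"
  by (intro integrable_ball_continuous continuous_on_subset [OF continuous_on_mode]) auto

lemma radial_integrable: "continuous_on UNIV (f :: real \<Rightarrow> real) \<Longrightarrow> integrable (lebesgue_on disk) (\<lambda>x. f ((norm x)\<^sup>2))"
  using mode_integrable [of f 0 1] by (simp add: mode_def [abs_def])

lemma radial_mean_FTC:
  assumes "continuous_on UNIV k" "\<And>s. (F has_real_derivative k s) (at s)" "F 1 = F 0"
  shows "radial_mean k = 0"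
  using mode0_integral [OF assms(1,2), of 1] assms(3) by (simp add: mode_def)

lemma radial_mean_pos:
  assumes c: "continuous_on UNIV f" and f: "\<And>s. 0 \<le> s \<Longrightarrow> s \<le> 1 \<Longrightarrow> 0 \<le> f s" and p: "0 < f (1/2)"
  shows "0 < radial_mean f"
proof (rule ccontr)
  assume "\<not> 0 < radial_mean f"
  moreover have nn: "0 \<le> f ((norm x)\<^sup>2)" if "x \<in> disk" for x :: "real^2"
    using that by (intro f) (auto simp: power_le_one)
  then have "0 \<le> radial_mean f" by (intro integral_nonneg_AE AE_I2) auto
  ultimately have z: "radial_mean f = 0" by simp
  define w where "w x = sqrt (f ((norm x)\<^sup>2))" for x :: "real^2"
  have cw: "continuous_on UNIV w" unfolding w_def
    by (intro continuous_on_real_sqrt continuous_on_compose2 [OF c] continuous_intros) auto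
  have "(LINT x|lebesgue_on disk. w x * w x) = radial_mean f"
    by (rule Bochner_Integration.integral_cong) (use nn in \<open>auto simp: w_def\<close>)
  then have i: "(LINT x|lebesgue_on disk. w x * w x) = 0" using z by simp
  define y :: "real^2" where "y = sqrt (1/2) *\<^sub>R axis 1 1"
  have y: "(norm y)\<^sup>2 = 1/2" by (simp add: y_def power_mult_distrib)
  then have "norm y < 1" by (smt (verit) one_le_power field_sum_of_halves)
  then have "w y = 0" using i by (intro continuous_integral_sq_zero [OF continuous_on_subset [OF cw]]) auto
  then show False using p by (simp add: w_def y)
qed

lemma sq_moment_pos: "0 < radial_mean (\<lambda>s. s * (psi s)\<^sup>2)"
  by (rule radial_mean_pos) (use psi_half_pos in \<open>auto intro!: continuous_intros psi_continuous\<close>)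

lemma phi_sq_moment: "radial_mean (\<lambda>s. (phi s)\<^sup>2) = tau * radial_mean (\<lambda>s. s * (psi s)\<^sup>2)"
proof -
  have c: "continuous_on UNIV (\<lambda>s. (phi s)\<^sup>2)" "continuous_on UNIV (\<lambda>s. s * (psi s)\<^sup>2)"
    by (intro continuous_intros psi_continuous phi_continuous)+
  have "radial_mean (\<lambda>s. (phi s)\<^sup>2 - tau * (s * (psi s)\<^sup>2)) = 0"
  proof (rule radial_mean_FTC [where F = "\<lambda>s. s * psi s * phi s"])
    show "((\<lambda>s. s * psi s * phi s) has_real_derivative (phi s)\<^sup>2 - tau * (s * (psi s)\<^sup>2)) (at s)" for s
      by (rule DERIV_cong [OF DERIV_mult [OF s_psi_phi phi_deriv]]) (simp add: power2_eq_square algebra_simps)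
  qed (auto intro!: continuous_on_diff continuous_on_mult_left c simp: psi_1)
  then show ?thesis using radial_integrable [OF c(1)] radial_integrable [OF c(2)] by simp
qed

lemma phi_cube_moment: "radial_mean (\<lambda>s. phi s ^ 3) = 2 * tau * radial_mean (\<lambda>s. phi s * (s * (psi s)\<^sup>2))"
proof -
  have c: "continuous_on UNIV (\<lambda>s. phi s ^ 3)" "continuous_on UNIV (\<lambda>s. phi s * (s * (psi s)\<^sup>2))"
    by (intro continuous_intros psi_continuous phi_continuous)+
  have "radial_mean (\<lambda>s. phi s ^ 3 - 2 * tau * (phi s * (s * (psi s)\<^sup>2))) = 0"
  proof (rule radial_mean_FTC [where F = "\<lambda>s. s * psi s * (phi s * phi s)"])
    show "((\<lambda>s. s * psi s * (phi s * phi s)) has_real_derivative phi s ^ 3 - 2 * tau * (phi s * (s * (psi s)\<^sup>2))) (at s)" for s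
      by (rule DERIV_cong [OF DERIV_mult [OF s_psi_phi DERIV_mult [OF phi_deriv phi_deriv]]])
        (simp add: power2_eq_square power3_eq_cube algebra_simps)
  qed (auto intro!: continuous_on_diff continuous_on_mult_left c simp: psi_1)
  then show ?thesis using radial_integrable [OF c(1)] radial_integrable [OF c(2)] by simp
qed

text \<open>\<open>phi\<close> changes sign, but the derivative of \<open>s\<^sup>2 psi\<^sup>3\<close> relates this integral to that of \<open>s psi\<^sup>3\<close>.\<close>

lemma mixed_moment_pos: "0 < radial_mean (\<lambda>s. phi s * (s * (psi s)\<^sup>2))"
proof -
  have c: "continuous_on UNIV (\<lambda>s. s * psi s ^ 3)" "continuous_on UNIV (\<lambda>s. phi s * (s * (psi s)\<^sup>2))"
    by (intro continuous_intros psi_continuous phi_continuous)+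
  have "radial_mean (\<lambda>s. 3 * (phi s * (s * (psi s)\<^sup>2)) - s * psi s ^ 3) = 0"
  proof (rule radial_mean_FTC [where F = "\<lambda>s. (s * psi s) * (s * psi s) * psi s"])
    fix s
    have "psi s - s * (tau * Lam 2 (tau * s)) = phi s" by (simp add: psi_Lam0 phi_def)
    then have e: "s * (tau * Lam 2 (tau * s)) = psi s - phi s" by simp
    have "(s * psi s) * (s * psi s) * - (tau * Lam 2 (tau * s)) = - (s * psi s * psi s) * (s * (tau * Lam 2 (tau * s)))"
      by simp
    then show "((\<lambda>s. (s * psi s) * (s * psi s) * psi s) has_real_derivative 3 * (phi s * (s * (psi s)\<^sup>2)) - s * psi s ^ 3) (at s)"
      by (intro DERIV_cong [OF DERIV_mult [OF DERIV_mult [OF s_psi_phi s_psi_phi] psi_deriv]])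
        (simp only: e, simp add: power2_eq_square power3_eq_cube algebra_simps)
  qed (auto intro!: continuous_on_diff continuous_on_mult_left c simp: psi_1)
  then have "3 * radial_mean (\<lambda>s. phi s * (s * (psi s)\<^sup>2)) = radial_mean (\<lambda>s. s * psi s ^ 3)"
    using radial_integrable [OF c(1)] radial_integrable [OF c(2)] by simp
  moreover have "0 < radial_mean (\<lambda>s. s * psi s ^ 3)"
    by (rule radial_mean_pos [OF c(1)]) (use psi_half_pos psi_nonneg in auto)
  ultimately show ?thesis by simp
qed

lemma Re_sq: "(Re w)\<^sup>2 = (cmod w)\<^sup>2 / 2 + Re (w\<^sup>2 / 2)"
  unfolding cmod_power2 by (simp add: power2_eq_square field_simps)

lemma Re_cube: "Re w ^ 3 = 3 / 4 * (cmod w)\<^sup>2 * Re w + Re (w ^ 3 / 4)"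
  unfolding cmod_power2 by (simp add: power2_eq_square power3_eq_cube field_simps)

text \<open>The square is expanded into angular modes, of which only the one of order 0 contributes. The same is done for
  the cube below.\<close>

lemma Vfun_square_integral:
  "(LINT x|lebesgue_on disk. (Vfun a g x)\<^sup>2) = radial_mean (\<lambda>s. s * (psi s)\<^sup>2) * (tau * a\<^sup>2 + (cmod g)\<^sup>2 / 2)"
proof -
  note cs = continuous_intros psi_continuous phi_continuous
  have c: "continuous_on UNIV (\<lambda>s. (phi s)\<^sup>2)" "continuous_on UNIV (\<lambda>s. s * (psi s)\<^sup>2)"
    "continuous_on UNIV (\<lambda>s. 2 * a * phi s * psi s)" "continuous_on UNIV (\<lambda>s. (psi s)\<^sup>2)"
    by (intro cs)+
  have "(Vfun a g x)\<^sup>2 = (a\<^sup>2 * (phi ((norm x)\<^sup>2))\<^sup>2 + (cmod g)\<^sup>2 / 2 * ((norm x)\<^sup>2 * (psi ((norm x)\<^sup>2))\<^sup>2))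
     + mode 1 g (\<lambda>s. 2 * a * phi s * psi s) x + mode 2 (g\<^sup>2 / 2) (\<lambda>s. (psi s)\<^sup>2) x" for x
  proof -
    have r: "(Re (g * zc x))\<^sup>2 = (cmod g)\<^sup>2 * (norm x)\<^sup>2 / 2 + Re (g\<^sup>2 / 2 * zc x ^ 2)"
      unfolding Re_sq [of "g * zc x"] by (simp add: norm_mult power_mult_distrib)
    have "(Vfun a g x)\<^sup>2 = a\<^sup>2 * (phi ((norm x)\<^sup>2))\<^sup>2 + 2 * a * phi ((norm x)\<^sup>2) * psi ((norm x)\<^sup>2) * Re (g * zc x)
        + (psi ((norm x)\<^sup>2))\<^sup>2 * (Re (g * zc x))\<^sup>2"
      unfolding Vfun_def phi_def power2_eq_square by algebra
    then show ?thesis unfolding r mode_def by (simp add: algebra_simps)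
  qed
  then have "(LINT x|lebesgue_on disk. (Vfun a g x)\<^sup>2) =
      a\<^sup>2 * radial_mean (\<lambda>s. (phi s)\<^sup>2) + (cmod g)\<^sup>2 / 2 * radial_mean (\<lambda>s. s * (psi s)\<^sup>2)"
    using radial_integrable [OF c(1)] radial_integrable [OF c(2)] mode_integrable [OF c(3)] mode_integrable [OF c(4)]
      mode_integral_zero [OF c(3), of 1 g] mode_integral_zero [OF c(4), of 2 "g\<^sup>2 / 2"]
    by simp
  then show ?thesis by (simp add: phi_sq_moment algebra_simps)
qed

lemma Vfun_cube_integral:
  "(LINT x|lebesgue_on disk. Vfun a g x ^ 3) =
     radial_mean (\<lambda>s. phi s * (s * (psi s)\<^sup>2)) * (2 * tau * a ^ 3 + 3 / 2 * a * (cmod g)\<^sup>2)"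
proof -
  note cs = continuous_intros psi_continuous phi_continuous
  define q1 where "q1 s = 3 * a\<^sup>2 * (phi s)\<^sup>2 * psi s + 3 / 4 * (cmod g)\<^sup>2 * s * psi s ^ 3" for s
  define q2 where "q2 s = 3 * a * phi s * (psi s)\<^sup>2" for s
  have c: "continuous_on UNIV (\<lambda>s. phi s ^ 3)" "continuous_on UNIV (\<lambda>s. phi s * (s * (psi s)\<^sup>2))"
    "continuous_on UNIV q1" "continuous_on UNIV q2" "continuous_on UNIV (\<lambda>s. psi s ^ 3)"
    unfolding q1_def q2_def by (intro cs)+
  have "Vfun a g x ^ 3 = (a ^ 3 * phi ((norm x)\<^sup>2) ^ 3 + 3 / 2 * a * (cmod g)\<^sup>2 * (phi ((norm x)\<^sup>2) * ((norm x)\<^sup>2 * (psi ((norm x)\<^sup>2))\<^sup>2)))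
     + mode 1 g q1 x + mode 2 (g\<^sup>2 / 2) q2 x + mode 3 (g ^ 3 / 4) (\<lambda>s. psi s ^ 3) x" for x
  proof -
    have r: "(Re (g * zc x))\<^sup>2 = (cmod g)\<^sup>2 * (norm x)\<^sup>2 / 2 + Re (g\<^sup>2 / 2 * zc x ^ 2)"
      unfolding Re_sq [of "g * zc x"] by (simp add: norm_mult power_mult_distrib)
    have r3: "Re (g * zc x) ^ 3 = 3 / 4 * ((cmod g)\<^sup>2 * (norm x)\<^sup>2) * Re (g * zc x) + Re (g ^ 3 / 4 * zc x ^ 3)"
      unfolding Re_cube [of "g * zc x"] by (simp add: norm_mult power_mult_distrib)
    have "Vfun a g x ^ 3 = a ^ 3 * phi ((norm x)\<^sup>2) ^ 3 + 3 * a\<^sup>2 * (phi ((norm x)\<^sup>2))\<^sup>2 * psi ((norm x)\<^sup>2) * Re (g * zc x)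
        + 3 * a * phi ((norm x)\<^sup>2) * (psi ((norm x)\<^sup>2))\<^sup>2 * (Re (g * zc x))\<^sup>2 + psi ((norm x)\<^sup>2) ^ 3 * Re (g * zc x) ^ 3"
      unfolding Vfun_def phi_def power2_eq_square power3_eq_cube by algebra
    then show ?thesis unfolding r r3 mode_def q1_def q2_def power_one_right by algebra
  qed
  then have "(LINT x|lebesgue_on disk. Vfun a g x ^ 3) =
      a ^ 3 * radial_mean (\<lambda>s. phi s ^ 3) + 3 / 2 * a * (cmod g)\<^sup>2 * radial_mean (\<lambda>s. phi s * (s * (psi s)\<^sup>2))"
    using radial_integrable [OF c(1)] radial_integrable [OF c(2)] mode_integrable [OF c(3)] mode_integrable [OF c(4)] mode_integrable [OF c(5)]
      mode_integral_zero [OF c(3), of 1 g] mode_integral_zero [OF c(4), of 2 "g\<^sup>2 / 2"] mode_integral_zero [OF c(5), of 3 "g ^ 3 / 4"]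
    by simp
  then show ?thesis by (simp add: phi_cube_moment algebra_simps)
qed

lemma Vfun_energy: "energy (Vfun a g) = (LINT x|lebesgue_on disk. (Vfun a g x)\<^sup>2) / (8 * tau)"
proof -
  let ?D = "lebesgue_on disk"
  have i: "integrable ?D (\<lambda>x. Vfun a g x * Vfun a g x)" "integrable ?D (Vfun a g)"
    by (intro integrable_ball_continuous continuous_on_mult continuous_on_subset [OF Vfun_continuous]; simp)+
  have "(LINT x|?D. Vfun a g x * green_op (Vfun a g) x) = (LINT x|?D. (Vfun a g x * Vfun a g x - a * Lam 0 tau * Vfun a g x) / (4 * tau))"
    by (rule Bochner_Integration.integral_cong) (simp_all add: green_op_green_pair [OF green_pair_Vfun] algebra_simps)
  then have "2 * energy (Vfun a g) = (LINT x|?D. (Vfun a g x * Vfun a g x - a * Lam 0 tau * Vfun a g x) / (4 * tau))"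
    unfolding energy_def by simp
  also have "\<dots> = ((LINT x|?D. Vfun a g x * Vfun a g x) - a * Lam 0 tau * (LINT x|?D. Vfun a g x)) / (4 * tau)"
    using i by simp
  finally show ?thesis by (simp add: Vfun_integral power2_eq_square field_simps)
qed

text \<open>With \<open>S = tau a\<^sup>2 + |g|\<^sup>2 / 2\<close> given, the second quantity is \<open>3 a S - tau a\<^sup>3\<close>, which is injective in \<open>a\<close> on
  the range \<open>tau a\<^sup>2 \<le> S\<close>.\<close>

lemma Vfun_rigidity:
  assumes S: "tau * a'\<^sup>2 + (cmod g')\<^sup>2 / 2 = tau * a\<^sup>2 + (cmod g)\<^sup>2 / 2"
    and C: "2 * tau * a' ^ 3 + 3 / 2 * a' * (cmod g')\<^sup>2 = 2 * tau * a ^ 3 + 3 / 2 * a * (cmod g)\<^sup>2"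
  shows "a' = a \<and> cmod g' = cmod g"
proof -
  define S where "S = tau * a\<^sup>2 + (cmod g)\<^sup>2 / 2"
  have g: "(cmod g)\<^sup>2 = 2 * (S - tau * a\<^sup>2)" "(cmod g')\<^sup>2 = 2 * (S - tau * a'\<^sup>2)" using S by (simp_all add: S_def)
  have 1: "tau * a\<^sup>2 \<le> S" "tau * a'\<^sup>2 \<le> S" using zero_le_power2 [of "cmod g"] zero_le_power2 [of "cmod g'"] unfolding g by simp_all
  have "(a' - a) * (3 * S - tau * (a'\<^sup>2 + a' * a + a\<^sup>2)) = 0"
    using C unfolding g by (simp add: power2_eq_square power3_eq_cube algebra_simps)
  moreover have "tau * (a'\<^sup>2 + a' * a + a\<^sup>2) = 3/2 * (tau * a\<^sup>2 + tau * a'\<^sup>2) - tau * (a' - a)\<^sup>2 / 2"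
    by (simp add: power2_eq_square field_simps)
  ultimately have z: "a' = a \<or> 3/2 * (tau * a\<^sup>2 + tau * a'\<^sup>2) - tau * (a' - a)\<^sup>2 / 2 = 3 * S" by auto
  have "a' = a"
  proof (rule disjE [OF z])
    assume "3/2 * (tau * a\<^sup>2 + tau * a'\<^sup>2) - tau * (a' - a)\<^sup>2 / 2 = 3 * S"
    then have "tau * (a' - a)\<^sup>2 \<le> 0" using 1 by argo
    then show ?thesis using tau_pos by (simp add: mult_le_0_iff)
  qed
  then have "(cmod g')\<^sup>2 = (cmod g)\<^sup>2" using g by simp
  then show ?thesis using \<open>a' = a\<close> by simp
qed

lemma Vfun_diff: "Vfun a g x - Vfun a' g' x = Vfun (a - a') (g - g') x"
  by (simp add: Vfun_def algebra_simps)

lemma Vfun_bound: "\<exists>L\<ge>0. \<forall>a g. \<forall>x\<in>disk. \<bar>Vfun a g x\<bar> \<le> L * (\<bar>a\<bar> + cmod g)"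
proof -
  obtain A where A: "0 \<le> A" "\<And>s. 0 \<le> s \<Longrightarrow> s \<le> 1 \<Longrightarrow> \<bar>phi s\<bar> \<le> A"
    using continuous_bound_unit [OF phi_continuous] by blast
  obtain B where B: "0 \<le> B" "\<And>s. 0 \<le> s \<Longrightarrow> s \<le> 1 \<Longrightarrow> \<bar>psi s\<bar> \<le> B"
    using continuous_bound_unit [OF psi_continuous] by blast
  have "\<bar>Vfun a g x\<bar> \<le> (A + B) * (\<bar>a\<bar> + cmod g)" if x: "x \<in> disk" for a g x
  proof -
    have m: "\<bar>mode 0 (of_real a) phi x\<bar> \<le> A * cmod (of_real a)" "\<bar>mode 1 g psi x\<bar> \<le> B * cmod g"
      by (rule mode_bound [OF x A(2)] mode_bound [OF x B(2)]; assumption)+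
    have "Vfun a g x = mode 0 (of_real a) phi x + mode 1 g psi x" by (simp add: Vfun_def mode_def phi_def)
    then have "\<bar>Vfun a g x\<bar> \<le> A * \<bar>a\<bar> + B * cmod g" using m by simp
    also have "\<dots> \<le> (A + B) * \<bar>a\<bar> + (A + B) * cmod g" using A B by (intro add_mono mult_right_mono) auto
    finally show ?thesis by (simp add: distrib_left)
  qed
  then show ?thesis using A B by (intro exI [of _ "A + B"]) auto
qed

section \<open>Functions of nearly maximal energy\<close>

lemma Lp_power_2: "Lp_power 2 v = (LINT x|lebesgue_on disk. (v x)\<^sup>2)"
  by simp

lemma Lp_disk_2D: "v \<in> Lp_disk 2 \<Longrightarrow> integrable (lebesgue_on disk) (\<lambda>x. (v x)\<^sup>2)"
  using Lp_diskD(2) [of v 2] by simp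

lemma L1_tendsto_0:
  assumes "1 < p" "\<And>n::nat. x n \<in> Lp_disk p" "(\<lambda>n. Lp_power p (x n)) \<longlonglongrightarrow> 0"
  shows "(\<lambda>n. LINT y|lebesgue_on disk. \<bar>x n y\<bar>) \<longlonglongrightarrow> 0"
proof (rule scaled_bound_tendsto_0 [where C = pi and a = "1 - p" and K = 1 and N = "\<lambda>n. Lp_power p (x n)"])
  show "(LINT y|lebesgue_on disk. \<bar>x n y\<bar>) \<le> l * pi + l powr (1 - p) * (1 * Lp_power p (x n))" if "0 < l" for n l
    using Lp_disk_integrable(2) [OF assms(2,1) that, of n] by simp
  show "0 \<le> (LINT y|lebesgue_on disk. \<bar>x n y\<bar>)" for n by (rule integral_nonneg_AE) auto
qed (use assms in auto)

lemma Lp_power_tendsto_0_bounded: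
  assumes m: "\<And>n::nat. x n \<in> borel_measurable (lebesgue_on disk)" and b: "\<And>n y. y \<in> disk \<Longrightarrow> \<bar>x n y\<bar> \<le> B"
    and p: "1 < p" and p': "1 \<le> p'" and lim: "(\<lambda>n. Lp_power p (x n)) \<longlonglongrightarrow> 0"
  shows "(\<lambda>n. Lp_power p' (x n)) \<longlonglongrightarrow> 0"
proof -
  let ?D = "lebesgue_on disk"
  have xp: "x n \<in> Lp_disk p" for n using p by (intro Lp_disk_bounded [OF m b]) auto
  have xp': "x n \<in> Lp_disk p'" for n using p' by (intro Lp_disk_bounded [OF m b]) auto
  have "Lp_power p' (x n) \<le> B powr (p' - 1) * (LINT y|?D. \<bar>x n y\<bar>)" for n
  proof -
    have i: "integrable ?D (\<lambda>y. \<bar>x n y\<bar>)" using Lp_disk_integrable(1) [OF xp p] by auto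
    have "Lp_power p' (x n) \<le> (LINT y|?D. B powr (p' - 1) * \<bar>x n y\<bar>)"
    proof (rule integral_mono_AE [OF Lp_diskD(2) [OF xp']])
      show "integrable ?D (\<lambda>y. B powr (p' - 1) * \<bar>x n y\<bar>)" using i by auto
      have "\<bar>x n y\<bar> powr p' \<le> B powr (p' - 1) * \<bar>x n y\<bar>" if y: "y \<in> disk" for y
      proof (cases "x n y = 0")
        case False
        have "\<bar>x n y\<bar> powr p' = \<bar>x n y\<bar> powr (p' - 1) * \<bar>x n y\<bar> powr 1" by (simp only: powr_add [symmetric]) simp
        also have "\<dots> \<le> B powr (p' - 1) * \<bar>x n y\<bar>" using b [OF y, of n] p' by (intro mult_mono powr_mono2) auto
        finally show ?thesis .
      qed simp
      then show "AE y in ?D. \<bar>x n y\<bar> powr p' \<le> B powr (p' - 1) * \<bar>x n y\<bar>" by (intro AE_I2) auto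
    qed
    then show ?thesis by simp
  qed
  then have 1: "\<forall>\<^sub>F n in sequentially. norm (Lp_power p' (x n)) \<le> B powr (p' - 1) * (LINT y|?D. \<bar>x n y\<bar>)"
    using Lp_power_nonneg by (intro always_eventually) simp
  have "(\<lambda>n. B powr (p' - 1) * (LINT y|?D. \<bar>x n y\<bar>)) \<longlonglongrightarrow> 0"
    by (rule tendsto_mult_right_zero [OF L1_tendsto_0 [OF p xp lim]])
  from Lim_null_comparison [OF 1 this] show ?thesis .
qed

lemma power_lipschitz: "\<exists>C\<ge>0. \<forall>s t. \<bar>s\<bar> \<le> B \<longrightarrow> \<bar>t\<bar> \<le> B \<longrightarrow> \<bar>s ^ i - t ^ i\<bar> \<le> C * \<bar>s - t\<bar>" if B: "0 \<le> B" for B :: real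
proof (induction i)
  case (Suc i)
  then obtain C where C: "0 \<le> C" "\<And>s t. \<bar>s\<bar> \<le> B \<Longrightarrow> \<bar>t\<bar> \<le> B \<Longrightarrow> \<bar>s ^ i - t ^ i\<bar> \<le> C * \<bar>s - t\<bar>" by blast
  have "\<bar>s ^ Suc i - t ^ Suc i\<bar> \<le> (B * C + B ^ i) * \<bar>s - t\<bar>" if st: "\<bar>s\<bar> \<le> B" "\<bar>t\<bar> \<le> B" for s t
  proof -
    have "\<bar>s ^ Suc i - t ^ Suc i\<bar> = \<bar>s * (s ^ i - t ^ i) + (s - t) * t ^ i\<bar>" by (simp add: algebra_simps)
    also have "\<dots> \<le> \<bar>s\<bar> * \<bar>s ^ i - t ^ i\<bar> + \<bar>s - t\<bar> * \<bar>t\<bar> ^ i" using abs_triangle_ineq by (simp add: abs_mult [symmetric] power_abs [symmetric])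
    also have "\<dots> \<le> B * (C * \<bar>s - t\<bar>) + \<bar>s - t\<bar> * B ^ i"
      using st C B by (intro add_mono mult_mono power_mono) auto
    finally show ?thesis by (simp add: algebra_simps)
  qed
  then show ?case using B C by (intro exI [of _ "B * C + B ^ i"]) auto
qed auto

lemma power_integral_tendsto:
  assumes v: "\<And>n::nat. v n \<in> borel_measurable (lebesgue_on disk)" "\<And>n y. y \<in> disk \<Longrightarrow> \<bar>v n y\<bar> \<le> B"
    and w: "\<And>n. w n \<in> borel_measurable (lebesgue_on disk)" "\<And>n y. y \<in> disk \<Longrightarrow> \<bar>w n y\<bar> \<le> B"
    and p: "1 < p" and lim: "(\<lambda>n. Lp_power p (\<lambda>x. v n x - w n x)) \<longlonglongrightarrow> 0"
  shows "(\<lambda>n. (LINT x|lebesgue_on disk. v n x ^ i) - (LINT x|lebesgue_on disk. w n x ^ i)) \<longlonglongrightarrow> 0"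
proof -
  let ?D = "lebesgue_on disk"
  have p0: "0 < p" using p by simp
  have B: "0 \<le> B" using order_trans [OF abs_ge_zero v(2) [of 0 0]] by simp
  obtain C where C: "0 \<le> C" "\<And>s t. \<bar>s\<bar> \<le> B \<Longrightarrow> \<bar>t\<bar> \<le> B \<Longrightarrow> \<bar>s ^ i - t ^ i\<bar> \<le> C * \<bar>s - t\<bar>"
    using power_lipschitz [OF B, of i] by blast
  have d: "(\<lambda>x. v n x - w n x) \<in> Lp_disk p" for n
    by (rule Lp_disk_diff(1) [OF Lp_disk_bounded [OF v p0] Lp_disk_bounded [OF w p0] p0])
  have iv: "integrable ?D (\<lambda>x. v n x ^ i)" "integrable ?D (\<lambda>x. w n x ^ i)" for n
    by (rule integrable_ball_bounded [where B = "B ^ i"];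
        use v w in \<open>auto intro!: borel_measurable_power power_mono simp: power_abs\<close>)+
  have "norm ((LINT x|?D. v n x ^ i) - (LINT x|?D. w n x ^ i)) \<le> C * (LINT x|?D. \<bar>v n x - w n x\<bar>)" for n
  proof -
    have id: "integrable ?D (\<lambda>x. \<bar>v n x - w n x\<bar>)" using Lp_disk_integrable(1) [OF d p] by auto
    have "(LINT x|?D. v n x ^ i) - (LINT x|?D. w n x ^ i) = (LINT x|?D. v n x ^ i - w n x ^ i)" using iv by simp
    also have "norm \<dots> \<le> (LINT x|?D. norm (v n x ^ i - w n x ^ i))" by (rule integral_norm_bound)
    also have "\<dots> \<le> (LINT x|?D. C * \<bar>v n x - w n x\<bar>)"
      by (rule integral_mono_AE) (use iv id C(2) v(2) w(2) in \<open>auto intro!: AE_I2\<close>)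
    finally show ?thesis by simp
  qed
  then have "\<forall>\<^sub>F n in sequentially. norm ((LINT x|?D. v n x ^ i) - (LINT x|?D. w n x ^ i)) \<le> C * (LINT x|?D. \<bar>v n x - w n x\<bar>)"
    by simp
  from Lim_null_comparison [OF this tendsto_mult_right_zero [OF L1_tendsto_0 [OF p d lim]]] show ?thesis .
qed

lemma square_integral_tendsto:
  assumes v: "\<And>n::nat. v n \<in> Lp_disk 2"
    and w: "\<And>n. w n \<in> borel_measurable (lebesgue_on disk)" "\<And>n y. y \<in> disk \<Longrightarrow> \<bar>w n y\<bar> \<le> B"
    and lim: "(\<lambda>n. Lp_power 2 (\<lambda>x. v n x - w n x)) \<longlonglongrightarrow> 0"
  shows "(\<lambda>n. (LINT x|lebesgue_on disk. (v n x)\<^sup>2) - (LINT x|lebesgue_on disk. (w n x)\<^sup>2)) \<longlonglongrightarrow> 0"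
proof -
  let ?D = "lebesgue_on disk"
  have w2: "w n \<in> Lp_disk 2" for n by (rule Lp_disk_bounded [OF w]) auto
  have d: "(\<lambda>x. v n x - w n x) \<in> Lp_disk 2" for n by (rule Lp_disk_diff(1) [OF v w2]) simp
  have i: "integrable ?D (\<lambda>x. (v n x)\<^sup>2)" "integrable ?D (\<lambda>x. (w n x)\<^sup>2)" "integrable ?D (\<lambda>x. (v n x - w n x)\<^sup>2)"
    "integrable ?D (\<lambda>x. \<bar>v n x - w n x\<bar>)" for n
    using Lp_disk_2D [OF v] Lp_disk_2D [OF w2] Lp_disk_2D [OF d] Lp_disk_integrable(1) [OF d] by auto
  have "norm ((LINT x|?D. (v n x)\<^sup>2) - (LINT x|?D. (w n x)\<^sup>2)) \<le> Lp_power 2 (\<lambda>x. v n x - w n x) + 2 * B * (LINT x|?D. \<bar>v n x - w n x\<bar>)" for n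
  proof -
    have "(LINT x|?D. (v n x)\<^sup>2) - (LINT x|?D. (w n x)\<^sup>2) = (LINT x|?D. (v n x)\<^sup>2 - (w n x)\<^sup>2)" using i by simp
    also have "norm \<dots> \<le> (LINT x|?D. norm ((v n x)\<^sup>2 - (w n x)\<^sup>2))" by (rule integral_norm_bound)
    also have "\<dots> \<le> (LINT x|?D. (v n x - w n x)\<^sup>2 + 2 * B * \<bar>v n x - w n x\<bar>)"
    proof (rule integral_mono_AE)
      have "norm ((v n x)\<^sup>2 - (w n x)\<^sup>2) \<le> (v n x - w n x)\<^sup>2 + 2 * B * \<bar>v n x - w n x\<bar>" if "x \<in> disk" for x
      proof -
        have "(v n x)\<^sup>2 - (w n x)\<^sup>2 = (v n x - w n x)\<^sup>2 + 2 * w n x * (v n x - w n x)" by (simp add: power2_eq_square algebra_simps)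
        also have "norm \<dots> \<le> \<bar>(v n x - w n x)\<^sup>2\<bar> + \<bar>2 * w n x * (v n x - w n x)\<bar>"
          unfolding real_norm_def by (rule abs_triangle_ineq)
        also have "\<bar>2 * w n x * (v n x - w n x)\<bar> \<le> 2 * B * \<bar>v n x - w n x\<bar>"
          unfolding abs_mult using w(2) [OF that, of n] by (intro mult_right_mono) auto
        finally show ?thesis by simp
      qed
      then show "AE x in ?D. norm ((v n x)\<^sup>2 - (w n x)\<^sup>2) \<le> (v n x - w n x)\<^sup>2 + 2 * B * \<bar>v n x - w n x\<bar>"
        by (intro AE_I2) auto
    qed (use i in auto)
    finally show ?thesis using i by simp
  qed
  then have "\<forall>\<^sub>F n in sequentially. norm ((LINT x|?D. (v n x)\<^sup>2) - (LINT x|?D. (w n x)\<^sup>2)) \<le> Lp_power 2 (\<lambda>x. v n x - w n x) + 2 * B * (LINT x|?D. \<bar>v n x - w n x\<bar>)"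
    by (rule always_eventually [OF allI])
  moreover have "(\<lambda>n. Lp_power 2 (\<lambda>x. v n x - w n x) + 2 * B * (LINT x|?D. \<bar>v n x - w n x\<bar>)) \<longlonglongrightarrow> 0"
    using tendsto_add [OF lim tendsto_mult_right_zero [OF L1_tendsto_0 [OF _ d lim], of "2 * B"]] by simp
  ultimately show ?thesis by (rule Lim_null_comparison)
qed

lemma Lp_power_sum_tendsto_0:
  assumes "\<And>n::nat. v n \<in> Lp_disk p" "\<And>n. w n \<in> Lp_disk p" "0 < p" "(\<lambda>n. Lp_power p (v n)) \<longlonglongrightarrow> 0" "(\<lambda>n. Lp_power p (w n)) \<longlonglongrightarrow> 0"
  shows "(\<lambda>n. Lp_power p (\<lambda>x. v n x + w n x)) \<longlonglongrightarrow> 0"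
proof -
  have "\<forall>\<^sub>F n in sequentially. norm (Lp_power p (\<lambda>x. v n x + w n x)) \<le> 2 powr p * (Lp_power p (v n) + Lp_power p (w n))"
    using Lp_disk_add(2) [OF assms(1,2,3)] Lp_power_nonneg by (intro always_eventually) simp
  moreover have "(\<lambda>n. 2 powr p * (Lp_power p (v n) + Lp_power p (w n))) \<longlonglongrightarrow> 0"
    using tendsto_mult_right_zero [OF tendsto_add_zero [OF assms(4,5)]] .
  ultimately show ?thesis by (rule Lim_null_comparison)
qed

lemma Vfun_measurable: "Vfun a g \<in> borel_measurable (lebesgue_on disk)"
  by (intro continuous_measurable_ball continuous_on_subset [OF Vfun_continuous]) auto

lemma Vfun_Lp: "0 < p \<Longrightarrow> Vfun a g \<in> Lp_disk p"
proof -
  obtain L where "\<forall>a g. \<forall>x\<in>disk. \<bar>Vfun a g x\<bar> \<le> L * (\<bar>a\<bar> + cmod g)" using Vfun_bound by blast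
  then show "0 < p \<Longrightarrow> Vfun a g \<in> Lp_disk p"
    by (intro Lp_disk_bounded [OF Vfun_measurable, where M = "L * (\<bar>a\<bar> + cmod g)"]) auto
qed

text \<open>Replace \<open>w n\<close> by polynomials and split these as in \<open>spectral_gap\<close>. The constants vanish in the limit with the
  mean, and the remainders because otherwise the energy would stay below its maximal value \<open>S / (8 * tau)\<close>.\<close>

lemma near_Vfun:
  assumes w: "\<And>n::nat. w n \<in> borel_measurable (lebesgue_on disk)" "\<And>n y. y \<in> disk \<Longrightarrow> \<bar>w n y\<bar> \<le> B"
    and m1: "(\<lambda>n. LINT x|lebesgue_on disk. w n x) \<longlonglongrightarrow> 0"
    and m2: "(\<lambda>n. LINT x|lebesgue_on disk. (w n x)\<^sup>2) \<longlonglongrightarrow> S"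
    and en: "(\<lambda>n. energy (w n)) \<longlonglongrightarrow> S / (8 * tau)"
  obtains a g where "(\<lambda>n. Lp_power 2 (\<lambda>x. w n x - Vfun (a n) (g n) x)) \<longlonglongrightarrow> 0"
proof -
  let ?D = "lebesgue_on disk"
  have w2: "w n \<in> Lp_disk 2" for n by (rule Lp_disk_bounded [OF w]) auto
  have "\<exists>q. mode_sum q \<and> Lp_power 2 (\<lambda>x. w n x - q x) < inverse (real (Suc n))" for n
  proof -
    have 0: "0 < inverse (real (Suc n))" by simp
    obtain q where "mode_sum q" "Lp_power 2 (\<lambda>x. w n x - q x) < inverse (real (Suc n))"
      by (rule mode_sum_dense_bounded [OF w(1) [of n] w(2) [where n = n] _ 0, where p = 2], assumption, simp, rule that)
    then show ?thesis by blast
  qed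
  then obtain q where q: "\<And>n. mode_sum (q n)" "\<And>n. Lp_power 2 (\<lambda>x. w n x - q n x) < inverse (real (Suc n))" by metis
  have q2: "q n \<in> Lp_disk 2" for n by (rule mode_sum_Lp [OF q(1)]) simp
  have e0: "(\<lambda>n. Lp_power 2 (\<lambda>x. w n x - q n x)) \<longlonglongrightarrow> 0"
    by (rule Lim_null_comparison [OF _ LIMSEQ_inverse_real_of_nat])
      (use q(2) in \<open>auto intro!: always_eventually less_imp_le\<close>)
  obtain \<rho> where r: "0 < \<rho>" "\<rho> < 1 / (4 * tau)" and gap: "\<And>f. mode_sum f \<Longrightarrow>
     (\<exists>c a g d. (\<forall>x. f x = c + Vfun a g x + d x) \<and> continuous_on UNIV d \<and>
        (LINT x|?D. d x) = 0 \<and> (LINT x|?D. d x * Vfun a g x) = 0 \<and>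
        2 * energy (\<lambda>x. Vfun a g x + d x) \<le> (LINT x|?D. (Vfun a g x)\<^sup>2) / (4 * tau) + \<rho> * (LINT x|?D. (d x)\<^sup>2))"
    using spectral_gap by blast
  have "\<forall>n. \<exists>c a g d. (\<forall>x. q n x = c + Vfun a g x + d x) \<and> continuous_on UNIV d \<and>
        (LINT x|?D. d x) = 0 \<and> (LINT x|?D. d x * Vfun a g x) = 0 \<and>
        2 * energy (\<lambda>x. Vfun a g x + d x) \<le> (LINT x|?D. (Vfun a g x)\<^sup>2) / (4 * tau) + \<rho> * (LINT x|?D. (d x)\<^sup>2)"
    using gap [OF q(1)] by blast
  then obtain c a g d where dec: "\<And>n x. q n x = c n + Vfun (a n) (g n) x + d n x" and dc: "\<And>n. continuous_on UNIV (d n)"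
    and d0: "\<And>n. (LINT x|?D. d n x) = 0" and dV: "\<And>n. (LINT x|?D. d n x * Vfun (a n) (g n) x) = 0"
    and en_le: "\<And>n. 2 * energy (\<lambda>x. Vfun (a n) (g n) x + d n x) \<le>
        (LINT x|?D. (Vfun (a n) (g n) x)\<^sup>2) / (4 * tau) + \<rho> * (LINT x|?D. (d n x)\<^sup>2)"
    unfolding choice_iff by blast
  define V where "V n = Vfun (a n) (g n)" for n
  define h where "h n x = V n x + d n x" for n x
  note cV = Vfun_continuous [of "a n" "g n" for n, folded V_def]
  have i: "integrable ?D (V n)" "integrable ?D (d n)" "integrable ?D (\<lambda>x. (V n x)\<^sup>2)" "integrable ?D (\<lambda>x. (d n x)\<^sup>2)"
    "integrable ?D (\<lambda>x. d n x * V n x)" for n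
    by (intro integrable_ball_continuous continuous_on_mult continuous_on_power
        continuous_on_subset [OF cV] continuous_on_subset [OF dc]; simp)+
  have V2: "V n \<in> Lp_disk 2" for n unfolding V_def by (rule Vfun_Lp) simp
  have d2: "d n \<in> Lp_disk 2" for n
    using i(4) [of n] by (auto simp: Lp_disk_def intro!: continuous_measurable_ball continuous_on_subset [OF dc])
  have h2: "h n \<in> Lp_disk 2" for n unfolding h_def by (rule Lp_disk_add(1) [OF V2 d2]) simp
  have cL: "(\<lambda>x. c n) \<in> Lp_disk 2" for n by (rule Lp_disk_bounded [where M = "\<bar>c n\<bar>"]) auto
  have ed: "(\<lambda>x. w n x - q n x) \<in> Lp_disk 2" for n by (rule Lp_disk_diff(1) [OF w2 q2]) simp
  \<comment> \<open>Integrating the decomposition gives the constant, since the other two parts have mean zero.\<close>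
  have c0: "c \<longlonglongrightarrow> 0"
  proof -
    have ce: "c n = ((LINT x|?D. w n x) - (LINT x|?D. w n x - q n x)) / pi" for n
    proof -
      have "(LINT x|?D. w n x) - (LINT x|?D. w n x - q n x) = (LINT x|?D. q n x)"
        using Lp_disk_integrable(1) [OF w2] Lp_disk_integrable(1) [OF q2] by simp
      also have "\<dots> = (LINT x|?D. c n + V n x + d n x)" by (simp add: dec V_def)
      also have "\<dots> = (LINT x|?D. c n) + (LINT x|?D. V n x) + (LINT x|?D. d n x)"
        using i(1,2) integrable_disk_const by simp
      also have "\<dots> = pi * c n + (LINT x|?D. V n x)" by (simp only: d0 integral_disk_const)
      finally show ?thesis by (simp add: V_def Vfun_integral)
    qed
    have "(\<lambda>n. LINT x|?D. w n x - q n x) \<longlonglongrightarrow> 0"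
    proof (rule Lim_null_comparison [OF _ L1_tendsto_0 [OF _ ed e0]])
      show "\<forall>\<^sub>F n in sequentially. norm (LINT x|?D. w n x - q n x) \<le> (LINT x|?D. \<bar>w n x - q n x\<bar>)"
        by (intro always_eventually allI) (simp only: real_norm_def, rule integral_abs_bound)
    qed simp
    from tendsto_divide [OF tendsto_diff [OF m1 this] tendsto_const [of pi]]
    have "(\<lambda>n. ((LINT x|?D. w n x) - (LINT x|?D. w n x - q n x)) / pi) \<longlonglongrightarrow> 0" by simp
    then show ?thesis by (simp only: ce [symmetric])
  qed
  have hw: "(\<lambda>n. Lp_power 2 (\<lambda>x. h n x - w n x)) \<longlonglongrightarrow> 0"
  proof -
    have "(\<lambda>n. Lp_power 2 (\<lambda>x. (w n x - q n x) + c n)) \<longlonglongrightarrow> 0"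
    proof (rule Lp_power_sum_tendsto_0 [OF ed cL _ e0])
      have "Lp_power 2 (\<lambda>x. c n) = pi * \<bar>c n\<bar> powr 2" for n by (rule integral_disk_const)
      moreover have "(\<lambda>n. pi * \<bar>c n\<bar> powr 2) \<longlonglongrightarrow> 0"
        using tendsto_mult_right_zero [OF tendsto_null_power [OF c0], of 2 pi] by simp
      ultimately show "(\<lambda>n. Lp_power 2 (\<lambda>x. c n)) \<longlonglongrightarrow> 0" by (simp only:)
    qed simp
    moreover have "Lp_power 2 (\<lambda>x. (w n x - q n x) + c n) = Lp_power 2 (\<lambda>x. h n x - w n x)" for n
    proof -
      have "\<bar>(w n x - q n x) + c n\<bar> = \<bar>h n x - w n x\<bar>" for x by (simp add: dec h_def V_def)
      then show ?thesis by (simp only:)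
    qed
    ultimately show ?thesis by (simp only:)
  qed
  have hS: "(\<lambda>n. LINT x|?D. (h n x)\<^sup>2) \<longlonglongrightarrow> S"
    using tendsto_add [OF square_integral_tendsto [OF h2 w hw] m2] by simp
  have hE: "(\<lambda>n. energy (h n)) \<longlonglongrightarrow> S / (8 * tau)"
  proof -
    have "Lp_power 2 (w n) \<le> pi * B\<^sup>2" for n
    proof -
      have "(LINT x|?D. (w n x)\<^sup>2) \<le> (LINT x|?D. B\<^sup>2)"
        by (rule integral_mono_AE [OF Lp_disk_2D [OF w2] integrable_disk_const])
          (auto intro!: AE_I2 abs_le_square_iff [THEN iffD1] order_trans [OF w(2)])
      then show ?thesis unfolding Lp_power_2 by (simp only: integral_disk_const)
    qed
    then have "(\<lambda>n. energy (h n) - energy (w n)) \<longlonglongrightarrow> 0"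
      by (intro energy_tendsto [OF _ h2 w2 hw]) auto
    from tendsto_add [OF this en] show ?thesis by simp
  qed
  \<comment> \<open>The difference between the maximal energy and the actual one dominates the norm of the remainder.\<close>
  have d_lim: "(\<lambda>n. Lp_power 2 (d n)) \<longlonglongrightarrow> 0"
  proof -
    define k where "k = 1 / (4 * tau) - \<rho>"
    have k: "0 < k" using r by (simp add: k_def)
    have b: "Lp_power 2 (d n) \<le> ((LINT x|?D. (h n x)\<^sup>2) / (4 * tau) - 2 * energy (h n)) / k" for n
    proof -
      have "(LINT x|?D. (h n x)\<^sup>2) = (LINT x|?D. (V n x)\<^sup>2 + 2 * (d n x * V n x) + (d n x)\<^sup>2)"
        by (rule Bochner_Integration.integral_cong) (auto simp: h_def power2_eq_square algebra_simps)
      also have "\<dots> = (LINT x|?D. (V n x)\<^sup>2) + (LINT x|?D. (d n x)\<^sup>2)"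
        using i dV [of n] by (simp add: V_def)
      finally have "2 * energy (h n) \<le> (LINT x|?D. (h n x)\<^sup>2) / (4 * tau) - k * (LINT x|?D. (d n x)\<^sup>2)"
        using en_le [of n] by (simp add: h_def [abs_def] V_def k_def algebra_simps add_divide_distrib)
      then show ?thesis using k by (simp add: pos_le_divide_eq mult.commute)
    qed
    have "(\<lambda>n. ((LINT x|?D. (h n x)\<^sup>2) / (4 * tau) - 2 * energy (h n)) / k) \<longlonglongrightarrow> (S / (4 * tau) - 2 * (S / (8 * tau))) / k"
      using k tau_pos by (intro tendsto_intros hS hE) auto
    then have "(\<lambda>n. ((LINT x|?D. (h n x)\<^sup>2) / (4 * tau) - 2 * energy (h n)) / k) \<longlonglongrightarrow> 0"
      by simp
    moreover have "\<forall>\<^sub>F n in sequentially. norm (Lp_power 2 (d n)) \<le> ((LINT x|?D. (h n x)\<^sup>2) / (4 * tau) - 2 * energy (h n)) / k"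
      unfolding real_norm_def abs_of_nonneg [OF Lp_power_nonneg] by (intro always_eventually allI b)
    ultimately show ?thesis by (rule Lim_null_comparison [rotated])
  qed
  have "(\<lambda>n. Lp_power 2 (\<lambda>x. (h n x - w n x) + (- d n x))) \<longlonglongrightarrow> 0"
    by (rule Lp_power_sum_tendsto_0 [OF Lp_disk_diff(1) [OF h2 w2] Lp_disk_minus [OF d2] _ hw]) (use d_lim in auto)
  moreover have "Lp_power 2 (\<lambda>x. (h n x - w n x) + (- d n x)) = Lp_power 2 (\<lambda>x. w n x - Vfun (a n) (g n) x)" for n
  proof -
    have "\<bar>(h n x - w n x) + (- d n x)\<bar> = \<bar>w n x - Vfun (a n) (g n) x\<bar>" for x by (simp add: h_def V_def)
    then show ?thesis by (simp only:)
  qed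
  ultimately have "(\<lambda>n. Lp_power 2 (\<lambda>x. w n x - Vfun (a n) (g n) x)) \<longlonglongrightarrow> 0" by (simp only:)
  then show ?thesis by (rule that)
qed

text \<open>The coordinates are bounded by the \<open>L\<^sup>2\<close> norm, so they converge along a subsequence; the second and third
  moments identify the limit up to a rotation.\<close>

lemma Vfun_parameters_converge:
  assumes lim: "(\<lambda>n. Lp_power 2 (\<lambda>x. w n x - Vfun (a n) (g n) x)) \<longlonglongrightarrow> 0"
    and w: "\<And>n::nat. w n \<in> borel_measurable (lebesgue_on disk)" "\<And>n y. y \<in> disk \<Longrightarrow> \<bar>w n y\<bar> \<le> B"
    and m2: "(\<lambda>n. LINT x|lebesgue_on disk. (w n x)\<^sup>2) \<longlonglongrightarrow> (LINT x|lebesgue_on disk. (Vfun a0 g0 x)\<^sup>2)"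
    and m3: "(\<lambda>n. LINT x|lebesgue_on disk. w n x ^ 3) \<longlonglongrightarrow> (LINT x|lebesgue_on disk. Vfun a0 g0 x ^ 3)"
  obtains r g' where "strict_mono r" "cmod g' = cmod g0" "(\<lambda>n. Lp_power 2 (\<lambda>x. w (r n) x - Vfun a0 g' x)) \<longlonglongrightarrow> 0"
proof -
  let ?D = "lebesgue_on disk"
  let ?K2 = "radial_mean (\<lambda>s. s * (psi s)\<^sup>2)" and ?K3 = "radial_mean (\<lambda>s. phi s * (s * (psi s)\<^sup>2))"
  define S where "S a g = tau * a\<^sup>2 + (cmod g)\<^sup>2 / 2" for a g
  define T where "T a g = 2 * tau * a ^ 3 + 3 / 2 * a * (cmod g)\<^sup>2" for a g
  note K = sq_moment_pos mixed_moment_pos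
  have w2: "w n \<in> Lp_disk 2" for n by (rule Lp_disk_bounded [OF w]) auto
  have V2: "Vfun a g \<in> Lp_disk 2" for a g by (rule Vfun_Lp) simp
  have "(\<lambda>n. Lp_power 2 (\<lambda>x. Vfun (a n) (g n) x - w n x)) \<longlonglongrightarrow> 0" using lim by (simp add: power2_commute)
  from tendsto_add [OF square_integral_tendsto [OF V2 w this] m2]
  have "(\<lambda>n. ?K2 * S (a n) (g n)) \<longlonglongrightarrow> ?K2 * S a0 g0" by (simp add: Vfun_square_integral S_def)
  from tendsto_divide [OF this tendsto_const [of ?K2]]
  have S_lim: "(\<lambda>n. S (a n) (g n)) \<longlonglongrightarrow> S a0 g0" using K by simp
  then obtain M where M: "\<And>n. \<bar>S (a n) (g n)\<bar> \<le> M"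
    using convergent_imp_Bseq [OF convergentI] Bseq_def by (metis real_norm_def)
  have "bounded (range (\<lambda>n. (a n, g n)))"
    unfolding bounded_iff
  proof (intro exI ballI)
    fix z assume "z \<in> range (\<lambda>n. (a n, g n))"
    then obtain n where z: "z = (a n, g n)" by blast
    have b: "tau * (a n)\<^sup>2 + (cmod (g n))\<^sup>2 / 2 \<le> M" using M [of n] by (simp add: S_def)
    have "0 \<le> tau * (a n)\<^sup>2" using tau_pos by simp
    then have "tau * (a n)\<^sup>2 \<le> M" "(cmod (g n))\<^sup>2 \<le> 2 * M" using b zero_le_power2 [of "cmod (g n)"] by linarith+
    then have "(a n)\<^sup>2 \<le> M / tau" "(cmod (g n))\<^sup>2 \<le> 2 * M" using tau_pos by (simp_all add: pos_le_divide_eq mult.commute)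
    then have "\<bar>a n\<bar> \<le> sqrt (M / tau)" "cmod (g n) \<le> sqrt (2 * M)"
      using real_sqrt_le_mono by fastforce+
    then show "norm z \<le> sqrt (M / tau) + sqrt (2 * M)"
      unfolding z by (intro order_trans [OF norm_Pair_le]) auto
  qed
  from bounded_imp_convergent_subsequence [OF this]
  obtain l r where r: "strict_mono r" "((\<lambda>n. (a n, g n)) \<circ> r) \<longlonglongrightarrow> l" by blast
  define a' g' where "a' = fst l" and "g' = snd l"
  have al: "(\<lambda>n. a (r n)) \<longlonglongrightarrow> a'" and gl: "(\<lambda>n. g (r n)) \<longlonglongrightarrow> g'"
    using tendsto_fst [OF r(2)] tendsto_snd [OF r(2)] by (simp_all add: a'_def g'_def o_def)
  have sub: "f \<longlonglongrightarrow> z \<Longrightarrow> (\<lambda>n. f (r n)) \<longlonglongrightarrow> z" for f :: "nat \<Rightarrow> real" and z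
    using LIMSEQ_subseq_LIMSEQ [OF _ r(1), of f z] by (simp add: o_def)
  have dV: "(\<lambda>n. Lp_power 2 (\<lambda>x. Vfun (a (r n)) (g (r n)) x - Vfun a' g' x)) \<longlonglongrightarrow> 0"
  proof -
    have "(\<lambda>n. ?K2 * (tau * (a (r n) - a')\<^sup>2 + (cmod (g (r n) - g'))\<^sup>2 / 2)) \<longlonglongrightarrow> ?K2 * (tau * (a' - a')\<^sup>2 + (cmod (g' - g'))\<^sup>2 / 2)"
      by (intro tendsto_intros al gl) auto
    then show ?thesis by (simp add: Vfun_diff Vfun_square_integral)
  qed
  have "(\<lambda>n. Lp_power 2 (\<lambda>x. (w (r n) x - Vfun (a (r n)) (g (r n)) x) + (Vfun (a (r n)) (g (r n)) x - Vfun a' g' x))) \<longlonglongrightarrow> 0"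
    by (rule Lp_power_sum_tendsto_0 [OF Lp_disk_diff(1) [OF w2 V2] Lp_disk_diff(1) [OF V2 V2] _ sub [OF lim] dV]) auto
  then have wl: "(\<lambda>n. Lp_power 2 (\<lambda>x. w (r n) x - Vfun a' g' x)) \<longlonglongrightarrow> 0" by simp
  obtain L where L: "\<And>a g x. x \<in> disk \<Longrightarrow> \<bar>Vfun a g x\<bar> \<le> L * (\<bar>a\<bar> + cmod g)" using Vfun_bound by blast
  define B' where "B' = max B (L * (\<bar>a'\<bar> + cmod g'))"
  have i: "(LINT x|?D. Vfun a' g' x ^ i) = z"
    if "(\<lambda>n. LINT x|?D. w n x ^ i) \<longlonglongrightarrow> z" for i z
  proof -
    have "(\<lambda>n. (LINT x|?D. w (r n) x ^ i) - (LINT x|?D. Vfun a' g' x ^ i)) \<longlonglongrightarrow> 0"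
    proof (rule power_integral_tendsto [where B = B' and p = 2])
      show "\<bar>w (r n) y\<bar> \<le> B'" if "y \<in> disk" for n y using w(2) [OF that, of "r n"] by (simp add: B'_def)
      show "\<bar>Vfun a' g' y\<bar> \<le> B'" if "y \<in> disk" for y using L [OF that, of a' g'] by (simp add: B'_def)
    qed (use w wl Vfun_measurable in auto)
    from tendsto_diff [OF sub [OF that] this] have "(\<lambda>n::nat. LINT x|?D. Vfun a' g' x ^ i) \<longlonglongrightarrow> z" by simp
    then show ?thesis by (simp add: LIMSEQ_const_iff)
  qed
  have "?K2 * S a' g' = ?K2 * S a0 g0" using i [OF m2] by (simp add: Vfun_square_integral S_def)
  moreover have "?K3 * T a' g' = ?K3 * T a0 g0" using i [OF m3] by (simp add: Vfun_cube_integral T_def)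
  ultimately have "S a' g' = S a0 g0" "T a' g' = T a0 g0" using K by simp_all
  then have e: "a' = a0" "cmod g' = cmod g0" using Vfun_rigidity [of a' g' a0 g0] by (auto simp: S_def T_def)
  show ?thesis using that [OF r(1) e(2)] wl unfolding e(1) by blast
qed

section \<open>Rearrangements of nearly optimal functions\<close>

lemma rearrangement_distr:
  assumes f: "f \<in> borel_measurable (lebesgue_on disk)" and g: "g \<in> rearrangements f"
  shows "distr (lebesgue_on disk) borel g = distr (lebesgue_on disk) borel f"
proof -
  let ?D = "lebesgue_on disk"
  have gm: "g \<in> borel_measurable ?D" and eq: "\<And>s. measure lebesgue {x \<in> disk. g x > s} = measure lebesgue {x \<in> disk. f x > s}"
    using g by (auto simp: rearrangements_def)
  have em: "emeasure (distr ?D borel h) {s<..} = ennreal (measure lebesgue {x \<in> disk. h x > s})"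
    if h: "h \<in> borel_measurable ?D" for h :: "real^2 \<Rightarrow> real" and s
  proof -
    have v: "h -` {s<..} \<inter> space ?D = {x \<in> disk. h x > s}" by auto
    interpret finite_measure ?D by (rule finite_measure_ball)
    have "emeasure (distr ?D borel h) {s<..} = emeasure ?D {x \<in> disk. h x > s}"
      by (subst emeasure_distr [OF h]) (simp_all only: v, simp)
    also have "\<dots> = ennreal (measure ?D {x \<in> disk. h x > s})" by (rule emeasure_eq_measure)
    also have "measure ?D {x \<in> disk. h x > s} = measure lebesgue {x \<in> disk. h x > s}"
      by (rule measure_restrict_space) auto
    finally show ?thesis .
  qed
  show ?thesis by (rule measure_eqI_lessThan) (use em [OF gm] em [OF f] eq in auto)
qed

lemma rearrangement_integral:
  fixes \<Phi> :: "real \<Rightarrow> real"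
  assumes f: "f \<in> borel_measurable (lebesgue_on disk)" and g: "g \<in> rearrangements f" and P: "\<Phi> \<in> borel_measurable borel"
  shows "(LINT x|lebesgue_on disk. \<Phi> (g x)) = (LINT x|lebesgue_on disk. \<Phi> (f x))"
proof -
  have gm: "g \<in> borel_measurable (lebesgue_on disk)" using g by (simp add: rearrangements_def)
  show ?thesis using integral_distr [OF gm P] integral_distr [OF f P] rearrangement_distr [OF f g] by simp
qed

lemma clamp_borel: "clamp_real M \<in> borel_measurable borel"
  using clamp_measurable [of "\<lambda>t. t" borel M] by simp

text \<open>Truncation at a height \<open>M\<close> that bounds the elements of the orbit reduces to bounded functions. The part of
  \<open>f n\<close> that is cut off is at most its distance from the orbit, and the part of \<open>h n\<close> has the same norm.\<close>

lemma rearrangement_energy_compactness: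
  assumes p: "1 < p" and f: "\<And>n::nat. f n \<in> Lp_disk p" and h: "\<And>n. h n \<in> Lp_disk p"
    and re: "\<And>n. h n \<in> rearrangements (f n)" and en: "\<And>n. energy (h n) = energy (f n)"
    and g: "\<And>n. cmod (g n) = cmod g0"
    and lim: "(\<lambda>n. Lp_power p (\<lambda>x. f n x - Vfun a (g n) x)) \<longlonglongrightarrow> 0"
  obtains r g' where "strict_mono r" "cmod g' = cmod g0" "(\<lambda>n. Lp_power p (\<lambda>x. h (r n) x - Vfun a g' x)) \<longlonglongrightarrow> 0"
proof -
  let ?D = "lebesgue_on disk"
  have p0: "0 < p" using p by simp
  obtain L where L: "\<And>a g x. x \<in> disk \<Longrightarrow> \<bar>Vfun a g x\<bar> \<le> L * (\<bar>a\<bar> + cmod g)" using Vfun_bound by blast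
  define M where "M = max 0 (L * (\<bar>a\<bar> + cmod g0))"
  have M: "0 \<le> M" by (simp add: M_def)
  define v where "v n = Vfun a (g n)" for n
  have vb: "\<bar>v n x\<bar> \<le> M" if "x \<in> disk" for n x
    using L [OF that, of a "g n"] by (simp add: v_def M_def g le_max_iff_disj)
  define c where "c = clamp_real M"
  note cp = clamp_real_props [where M = M, folded c_def]
  have cb: "c \<in> borel_measurable borel" unfolding c_def by (rule clamp_borel)
  have m: "f n \<in> borel_measurable ?D" "h n \<in> borel_measurable ?D" "v n \<in> borel_measurable ?D"
    "(\<lambda>x. c (f n x)) \<in> borel_measurable ?D" "(\<lambda>x. c (h n x)) \<in> borel_measurable ?D" for n
    unfolding v_def c_def
    by (intro clamp_measurable Vfun_measurable Lp_diskD(1) [OF f] Lp_diskD(1) [OF h])+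
  have Lp: "v n \<in> Lp_disk p" "(\<lambda>x. c (f n x)) \<in> Lp_disk p" "(\<lambda>x. c (h n x)) \<in> Lp_disk p" for n
    by (rule Lp_disk_bounded [where M = M]; use m vb cp(1) [OF M] p0 in simp)+
  have lim: "(\<lambda>n. Lp_power p (\<lambda>x. f n x - v n x)) \<longlonglongrightarrow> 0" using lim by (simp add: v_def)
  have cmp: "(\<lambda>n. Lp_power p (u n)) \<longlonglongrightarrow> 0"
    if u: "\<And>n. u n \<in> Lp_disk p" and le: "\<And>n x. x \<in> disk \<Longrightarrow> \<bar>u n x\<bar> \<le> \<bar>f n x - v n x\<bar>" for u
  proof (rule Lim_null_comparison [OF _ lim])
    have "Lp_power p (u n) \<le> Lp_power p (\<lambda>x. f n x - v n x)" for n
      by (rule integral_mono_AE [OF Lp_diskD(2) [OF u] Lp_diskD(2) [OF Lp_disk_diff(1) [OF f Lp(1) p0]]])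
        (use le p0 in \<open>auto intro!: AE_I2 powr_mono2\<close>)
    then show "\<forall>\<^sub>F n in sequentially. norm (Lp_power p (u n)) \<le> Lp_power p (\<lambda>x. f n x - v n x)"
      using Lp_power_nonneg by (intro always_eventually) simp
  qed
  \<comment> \<open>\<open>f n x - c (f n x)\<close> is the distance of \<open>f n x\<close> from \<open>[-M, M]\<close>, an interval that contains \<open>v n x\<close>.\<close>
  have fc: "(\<lambda>n. Lp_power p (\<lambda>x. f n x - c (f n x))) \<longlonglongrightarrow> 0"
  proof (rule cmp [OF Lp_disk_diff(1) [OF f Lp(2) p0]])
    show "\<bar>f n x - c (f n x)\<bar> \<le> \<bar>f n x - v n x\<bar>" if "x \<in> disk" for n x
      using vb [OF that, of n] by (auto simp: c_def clamp_real_def)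
  qed
  have cv: "(\<lambda>n. Lp_power p (\<lambda>x. c (f n x) - v n x)) \<longlonglongrightarrow> 0"
  proof (rule cmp [OF Lp_disk_diff(1) [OF Lp(2) Lp(1) p0]])
    show "\<bar>c (f n x) - v n x\<bar> \<le> \<bar>f n x - v n x\<bar>" if "x \<in> disk" for n x
      using cp(3) [of "f n x" "v n x"] cp(2) [OF vb [OF that]] by simp
  qed
  have hc: "(\<lambda>n. Lp_power p (\<lambda>x. h n x - c (h n x))) \<longlonglongrightarrow> 0"
  proof -
    have "(\<lambda>t. \<bar>t - c t\<bar> powr p) \<in> borel_measurable borel" using cb by measurable
    from rearrangement_integral [OF m(1) re this] fc show ?thesis by simp
  qed
  have mom: "(\<lambda>n. (LINT x|?D. c (h n x) ^ i) - (LINT x|?D. v n x ^ i)) \<longlonglongrightarrow> 0" for i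
  proof -
    have "(\<lambda>t. c t ^ i) \<in> borel_measurable borel" using cb by measurable
    from rearrangement_integral [OF m(1) re this]
    have "(LINT x|?D. c (h n x) ^ i) = (LINT x|?D. c (f n x) ^ i)" for n .
    then show ?thesis using power_integral_tendsto [OF m(4) _ m(3) vb p cv, of i] cp(1) [OF M] by simp
  qed
  have bd: "Lp_power p u \<le> pi * M powr p" if "u \<in> Lp_disk p" "\<And>x. x \<in> disk \<Longrightarrow> \<bar>u x\<bar> \<le> M" for u
  proof -
    have "Lp_power p u \<le> (LINT x|?D. M powr p)"
      by (rule integral_mono_AE [OF Lp_diskD(2) [OF that(1)] integrable_disk_const])
        (use that(2) p0 in \<open>auto intro!: AE_I2 powr_mono2\<close>)
    then show ?thesis by (simp only: integral_disk_const)
  qed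
  define S where "S = (LINT x|?D. (Vfun a g0 x)\<^sup>2)"
  have vS: "(LINT x|?D. (v n x)\<^sup>2) = S" "(LINT x|?D. v n x ^ 3) = (LINT x|?D. Vfun a g0 x ^ 3)"
    "energy (v n) = S / (8 * tau)" "(LINT x|?D. v n x) = 0" for n
    by (simp_all add: v_def S_def Vfun_square_integral Vfun_cube_integral Vfun_energy g Vfun_integral)
  have e: "(\<lambda>n. energy (c \<circ> h n)) \<longlonglongrightarrow> S / (8 * tau)"
  proof -
    have "(\<lambda>n. energy (f n) - energy (v n)) \<longlonglongrightarrow> 0" using energy_tendsto [OF p f Lp(1) lim bd [OF Lp(1) vb]] .
    moreover have "(\<lambda>n. energy (h n) - energy (\<lambda>x. c (h n x))) \<longlonglongrightarrow> 0"
      using energy_tendsto [OF p h Lp(3) hc bd [OF Lp(3) cp(1) [OF M]]] .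
    ultimately have "(\<lambda>n. (energy (f n) - energy (v n)) - (energy (h n) - energy (\<lambda>x. c (h n x))) + S / (8 * tau))
       \<longlonglongrightarrow> 0 - 0 + S / (8 * tau)" by (intro tendsto_intros)
    then show ?thesis by (simp add: en vS o_def)
  qed
  have 1: "(\<lambda>n. LINT x|?D. c (h n x)) \<longlonglongrightarrow> 0" using mom [of 1] by (simp add: vS)
  have 2: "(\<lambda>n. LINT x|?D. (c (h n x))\<^sup>2) \<longlonglongrightarrow> S" using mom [of 2] by (simp add: vS LIM_zero_iff)
  have 3: "(\<lambda>n. LINT x|?D. c (h n x) ^ 3) \<longlonglongrightarrow> (LINT x|?D. Vfun a g0 x ^ 3)" using mom [of 3] by (simp add: vS LIM_zero_iff)
  obtain b k where near: "(\<lambda>n. Lp_power 2 (\<lambda>x. c (h n x) - Vfun (b n) (k n) x)) \<longlonglongrightarrow> 0"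
    by (rule near_Vfun [of "\<lambda>n x. c (h n x)", OF m(5) cp(1) [OF M] 1 2]) (use e in \<open>simp_all add: o_def\<close>)
  obtain r g' where r: "strict_mono r" "cmod g' = cmod g0" "(\<lambda>n. Lp_power 2 (\<lambda>x. c (h (r n) x) - Vfun a g' x)) \<longlonglongrightarrow> 0"
    by (rule Vfun_parameters_converge [of "\<lambda>n x. c (h n x)", OF near m(5) cp(1) [OF M] 2 [unfolded S_def] 3])
  have g'b: "\<bar>Vfun a g' x\<bar> \<le> M" if "x \<in> disk" for x
    using L [OF that, of a g'] by (simp add: M_def r(2) le_max_iff_disj)
  have V': "Vfun a g' \<in> Lp_disk p" by (rule Vfun_Lp [OF p0])
  have "(\<lambda>n. Lp_power p (\<lambda>x. c (h (r n) x) - Vfun a g' x)) \<longlonglongrightarrow> 0"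
  proof (rule Lp_power_tendsto_0_bounded [OF _ _ _ _ r(3), where B = "2 * M"])
    show "(\<lambda>x. c (h (r n) x) - Vfun a g' x) \<in> borel_measurable ?D" for n
      by (intro borel_measurable_diff m Vfun_measurable)
    show "\<bar>c (h (r n) y) - Vfun a g' y\<bar> \<le> 2 * M" if "y \<in> disk" for n y
      using cp(1) [OF M, of "h (r n) y"] g'b [OF that] by linarith
  qed (use p in auto)
  moreover have "(\<lambda>n. Lp_power p (\<lambda>x. h (r n) x - c (h (r n) x))) \<longlonglongrightarrow> 0"
    using LIMSEQ_subseq_LIMSEQ [OF hc r(1)] by (simp add: o_def)
  ultimately have "(\<lambda>n. Lp_power p (\<lambda>x. (h (r n) x - c (h (r n) x)) + (c (h (r n) x) - Vfun a g' x))) \<longlonglongrightarrow> 0"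
    by (intro Lp_power_sum_tendsto_0 Lp_disk_diff(1) h Lp V' p0)
  then have "(\<lambda>n. Lp_power p (\<lambda>x. h (r n) x - Vfun a g' x)) \<longlonglongrightarrow> 0" by simp
  then show ?thesis by (rule that [OF r(1,2)])
qed

section \<open>Rotation orbits\<close>

lemma polar_coordinates: "zc (polar r \<theta>) = of_real r * cis \<theta>" "0 \<le> r \<Longrightarrow> norm (polar r \<theta>) = r"
proof -
  show z: "zc (polar r \<theta>) = of_real r * cis \<theta>"
    by (simp add: zc_def polar_def complex_eq_iff)
  show "norm (polar r \<theta>) = r" if "0 \<le> r"
    using that unfolding norm_zc [symmetric] z by (simp add: norm_mult)
qed

lemma polar_surj:
  fixes x :: "real^2"
  assumes "x \<in> disk" obtains r \<theta> where "0 \<le> r" "r < 1" "x = polar r \<theta>"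
proof
  show "x = polar (norm x) (Arg (zc x))"
  proof -
    have "zc x = of_real (norm x) * cis (Arg (zc x))" using rcis_cmod_Arg [of "zc x"] by (simp add: rcis_def)
    then have "zc x = zc (polar (norm x) (Arg (zc x)))" by (simp only: polar_coordinates)
    then show ?thesis by (simp add: zc_def vec_eq_iff forall_2)
  qed
qed (use assms in auto)

lemma Vfun_polar: "0 \<le> r \<Longrightarrow> Vfun a g (polar r \<theta>) = a * Lam 0 (tau * r\<^sup>2) + psi (r\<^sup>2) * (r * Re (g * cis \<theta>))"
proof -
  assume r: "0 \<le> r"
  have "g * (of_real r * cis \<theta>) = of_real r * (g * cis \<theta>)" by simp
  then show ?thesis unfolding Vfun_def polar_coordinates(1) polar_coordinates(2) [OF r] by (simp only: Re_of_real_mult)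
qed

lemma V_space_Vfun:
  assumes "\<omega> \<in> V_space" obtains a g where "\<And>x. x \<in> disk \<Longrightarrow> \<omega> x = Vfun a g x"
proof -
  obtain a b c where w: "\<And>r \<theta>. 0 \<le> r \<Longrightarrow> r < 1 \<Longrightarrow>
     \<omega> (polar r \<theta>) = a * bessel_J 0 (j_zero * r) + b * (bessel_J 1 (j_zero * r) * cos \<theta>) + c * (bessel_J 1 (j_zero * r) * sin \<theta>)"
    using assms unfolding V_space_def by blast
  have "\<omega> x = Vfun a (Complex (j_zero / 2 * b) (- (j_zero / 2 * c))) x" if x: "x \<in> disk" for x
  proof -
    obtain r \<theta> where r: "0 \<le> r" "r < 1" "x = polar r \<theta>" by (rule polar_surj [OF x])
    show ?thesis unfolding r(3) w [OF r(1,2)] Vfun_polar [OF r(1)] bessel_J0_scaled bessel_J1_scaled psi_def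
      by (simp add: algebra_simps)
  qed
  then show ?thesis by (rule that)
qed

lemma rotation_orbit_Vfun:
  assumes w: "\<And>x. x \<in> disk \<Longrightarrow> \<omega> x = Vfun a g x"
  shows "v \<in> rotation_orbit \<omega> \<longleftrightarrow> (\<exists>u. cmod u = 1 \<and> (\<forall>x\<in>disk. v x = Vfun a (g * u) x))"
proof -
  have in_disk: "polar r \<theta> \<in> disk" if "0 \<le> r" "r < 1" for r \<theta> using that by (simp add: polar_coordinates)
  have rot: "\<omega> (polar r (\<theta> + \<beta>)) = Vfun a (g * cis \<beta>) (polar r \<theta>)" if r: "0 \<le> r" "r < 1" for r \<theta> \<beta>
    unfolding w [OF in_disk [OF r]] Vfun_polar [OF r(1)] by (simp add: cis_mult [symmetric] mult_ac)
  have "(\<forall>r \<theta>. 0 \<le> r \<and> r < 1 \<longrightarrow> v (polar r \<theta>) = \<omega> (polar r (\<theta> + \<beta>))) \<longleftrightarrow> (\<forall>x\<in>disk. v x = Vfun a (g * cis \<beta>) x)" for \<beta>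
    using rot in_disk by (metis polar_surj)
  then have "v \<in> rotation_orbit \<omega> \<longleftrightarrow> (\<exists>\<beta>. \<forall>x\<in>disk. v x = Vfun a (g * cis \<beta>) x)"
    by (simp add: rotation_orbit_def)
  moreover have "\<exists>\<beta>. u = cis \<beta>" if "cmod u = 1" for u
    using rcis_cmod_Arg [of u] that by (intro exI [of _ "Arg u"]) (simp add: rcis_def)
  ultimately show ?thesis by (metis norm_cis)
qed

lemma Lp_norm_cong: "(\<And>x. x \<in> disk \<Longrightarrow> v x = v' x) \<Longrightarrow> Lp_norm p v = Lp_norm p v'"
proof -
  assume e: "\<And>x. x \<in> disk \<Longrightarrow> v x = v' x"
  have "Lp_power p v = Lp_power p v'" by (rule Bochner_Integration.integral_cong) (use e in auto)
  then show ?thesis by (simp add: Lp_norm_def)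
qed

text \<open>Continuity along the orbit, by dominated convergence, is what makes the minimal distance attained.\<close>

lemma Lp_power_Vfun_continuous:
  assumes p: "1 < p" and f: "f \<in> Lp_disk p"
  shows "continuous_on UNIV (\<lambda>u. Lp_power p (\<lambda>x. f x - Vfun a (g * u) x))"
proof -
  let ?D = "lebesgue_on disk"
  have p0: "0 < p" using p by simp
  obtain L where L: "0 \<le> L" "\<And>a g x. x \<in> disk \<Longrightarrow> \<bar>Vfun a g x\<bar> \<le> L * (\<bar>a\<bar> + cmod g)" using Vfun_bound by blast
  show ?thesis
    unfolding continuous_on_sequentially
  proof (intro allI ballI impI, elim conjE)
    fix s :: "nat \<Rightarrow> complex" and u assume s: "s \<longlonglongrightarrow> u"
    have "Bseq s" using s by (intro convergent_imp_Bseq convergentI)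
    then obtain R where R: "\<And>n. cmod (s n) \<le> R" unfolding Bseq_def by blast
    define M where "M = L * (\<bar>a\<bar> + cmod g * R)"
    have b: "\<bar>Vfun a (g * s n) x\<bar> \<le> \<bar>M\<bar>" if "x \<in> disk" for n x
    proof -
      have "\<bar>Vfun a (g * s n) x\<bar> \<le> L * (\<bar>a\<bar> + cmod (g * s n))" by (rule L(2) [OF that])
      also have "\<dots> \<le> M" unfolding M_def norm_mult using R [of n] L(1) by (intro mult_left_mono add_left_mono) auto
      finally show ?thesis by simp
    qed
    have m: "(\<lambda>x. \<bar>f x - Vfun a k x\<bar> powr p) \<in> borel_measurable ?D" for k
      using powr_measurable_disk [OF borel_measurable_diff [OF Lp_diskD(1) [OF f] Vfun_measurable]] .
    have "(\<lambda>n. Lp_power p (\<lambda>x. f x - Vfun a (g * s n) x)) \<longlonglongrightarrow> Lp_power p (\<lambda>x. f x - Vfun a (g * u) x)"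
    proof (rule integral_dominated_convergence [where w = "\<lambda>x. 2 powr p * (\<bar>f x\<bar> powr p + \<bar>M\<bar> powr p)"])
      show "integrable ?D (\<lambda>x. 2 powr p * (\<bar>f x\<bar> powr p + \<bar>M\<bar> powr p))"
        using Lp_diskD(2) [OF f] integrable_disk_const by (intro integrable_mult_right Bochner_Integration.integrable_add)
      have "(\<lambda>n. Vfun a (g * s n) x) \<longlonglongrightarrow> Vfun a (g * u) x" for x
        unfolding Vfun_def by (intro tendsto_intros s)
      then show "AE x in ?D. (\<lambda>n. \<bar>f x - Vfun a (g * s n) x\<bar> powr p) \<longlonglongrightarrow> \<bar>f x - Vfun a (g * u) x\<bar> powr p"
        using p0 by (intro AE_I2 tendsto_powr2 tendsto_intros) auto
      have "\<bar>f x - Vfun a (g * s n) x\<bar> powr p \<le> 2 powr p * (\<bar>f x\<bar> powr p + \<bar>M\<bar> powr p)" if "x \<in> disk" for n x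
      proof -
        have "\<bar>f x + - Vfun a (g * s n) x\<bar> powr p \<le> 2 powr p * (\<bar>f x\<bar> powr p + \<bar>- Vfun a (g * s n) x\<bar> powr p)"
          by (rule powr_add_le [OF p0])
        also have "\<dots> \<le> 2 powr p * (\<bar>f x\<bar> powr p + \<bar>M\<bar> powr p)"
          using b [OF that, of n] p0 by (intro mult_left_mono add_left_mono powr_mono2) auto
        finally show ?thesis by simp
      qed
      then show "AE x in ?D. norm (\<bar>f x - Vfun a (g * s n) x\<bar> powr p) \<le> 2 powr p * (\<bar>f x\<bar> powr p + \<bar>M\<bar> powr p)" for n
        by (intro AE_I2) auto
    qed (use m in auto)
    then show "((\<lambda>u. Lp_power p (\<lambda>x. f x - Vfun a (g * u) x)) \<circ> s) \<longlonglongrightarrow> Lp_power p (\<lambda>x. f x - Vfun a (g * u) x)"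
      by (simp add: o_def)
  qed
qed

lemma min_Lp_dist_attained:
  assumes w: "\<And>x. x \<in> disk \<Longrightarrow> \<omega> x = Vfun a g x" and p: "1 < p" and f: "f \<in> Lp_disk p"
  obtains u where "cmod u = 1" "min_Lp_dist p f (rotation_orbit \<omega>) = Lp_norm p (\<lambda>x. f x - Vfun a (g * u) x)"
    "\<And>u'. cmod u' = 1 \<Longrightarrow> min_Lp_dist p f (rotation_orbit \<omega>) \<le> Lp_norm p (\<lambda>x. f x - Vfun a (g * u') x)"
proof -
  let ?N = "\<lambda>u. Lp_power p (\<lambda>x. f x - Vfun a (g * u) x)" and ?L = "\<lambda>u. Lp_norm p (\<lambda>x. f x - Vfun a (g * u) x)"
  have "compact (sphere (0::complex) 1)" "sphere (0::complex) 1 \<noteq> {}" by auto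
  from continuous_attains_inf [OF this continuous_on_subset [OF Lp_power_Vfun_continuous [OF p f, where g = g and a = a]]]
  obtain u where u: "cmod u = 1" "\<And>u'. cmod u' = 1 \<Longrightarrow> ?N u \<le> ?N u'" by auto
  have le: "?L u \<le> ?L u'" if "cmod u' = 1" for u'
    unfolding Lp_norm_def using p u(2) [OF that] Lp_power_nonneg by (intro powr_mono2) auto
  have im: "(\<lambda>v. Lp_norm p (\<lambda>x. f x - v x)) ` rotation_orbit \<omega> = ?L ` sphere 0 1"
  proof (intro equalityI subsetI)
    fix d assume "d \<in> (\<lambda>v. Lp_norm p (\<lambda>x. f x - v x)) ` rotation_orbit \<omega>"
    then obtain v where v: "v \<in> rotation_orbit \<omega>" "d = Lp_norm p (\<lambda>x. f x - v x)" by blast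
    obtain u where "cmod u = 1" "\<forall>x\<in>disk. v x = Vfun a (g * u) x" using v(1) rotation_orbit_Vfun [OF w] by blast
    then show "d \<in> ?L ` sphere 0 1" unfolding v(2) by (intro image_eqI [of _ _ u] Lp_norm_cong) auto
  next
    fix d assume "d \<in> ?L ` sphere 0 1"
    then obtain u where u: "cmod u = 1" "d = ?L u" by auto
    have "Vfun a (g * u) \<in> rotation_orbit \<omega>" using rotation_orbit_Vfun [OF w] u(1) by blast
    then show "d \<in> (\<lambda>v. Lp_norm p (\<lambda>x. f x - v x)) ` rotation_orbit \<omega>" unfolding u(2) by blast
  qed
  have "min_Lp_dist p f (rotation_orbit \<omega>) = ?L u"
    unfolding min_Lp_dist_def im by (rule Least_equality) (use u(1) le in auto)
  with u(1) le show ?thesis by (intro that) auto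
qed

section \<open>Stability of the orbits\<close>

theorem theorem5p2:
  fixes p :: real and \<omega> :: "real^2 \<Rightarrow> real"
  assumes "1 < p" and "\<omega> \<in> V_space"
  shows "\<forall>\<epsilon>>0. \<exists>\<delta>>0. \<forall>\<zeta>. admissible_map p \<zeta> \<longrightarrow>
           min_Lp_dist p (\<zeta> 0) (rotation_orbit \<omega>) < \<delta> \<longrightarrow>
           (\<forall>t. min_Lp_dist p (\<zeta> t) (rotation_orbit \<omega>) < \<epsilon>)"
proof (intro allI impI, rule ccontr)
  fix \<epsilon> :: real assume e: "0 < \<epsilon>"
  assume neg: "\<not> (\<exists>\<delta>>0. \<forall>\<zeta>. admissible_map p \<zeta> \<longrightarrow> min_Lp_dist p (\<zeta> 0) (rotation_orbit \<omega>) < \<delta> \<longrightarrow>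
           (\<forall>t. min_Lp_dist p (\<zeta> t) (rotation_orbit \<omega>) < \<epsilon>))"
  have p0: "0 < p" using assms(1) by simp
  obtain a g where w: "\<And>x. x \<in> disk \<Longrightarrow> \<omega> x = Vfun a g x" by (rule V_space_Vfun [OF assms(2)]) (rule that, simp)
  let ?d = "\<lambda>f. min_Lp_dist p f (rotation_orbit \<omega>)"
  have "\<exists>\<zeta> t. admissible_map p \<zeta> \<and> ?d (\<zeta> 0) < inverse (real (Suc n)) \<and> \<epsilon> \<le> ?d (\<zeta> t)" for n
  proof -
    have "0 < inverse (real (Suc n))" by simp
    then show ?thesis using neg by (meson not_le)
  qed
  then obtain \<zeta> t where z: "\<And>n. admissible_map p (\<zeta> n)" "\<And>n. ?d (\<zeta> n 0) < inverse (real (Suc n))" "\<And>n. \<epsilon> \<le> ?d (\<zeta> n (t n))"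
    by metis
  define f h where "f n = \<zeta> n 0" and "h n = \<zeta> n (t n)" for n
  have fh: "f n \<in> Lp_disk p" "h n \<in> Lp_disk p" "h n \<in> rearrangements (f n)" "energy (h n) = energy (f n)" for n
    using z(1) [of n] unfolding admissible_map_def f_def h_def by blast+
  have "\<exists>u. cmod u = 1 \<and> ?d (f n) = Lp_norm p (\<lambda>x. f n x - Vfun a (g * u) x)" for n
    by (rule min_Lp_dist_attained [OF w assms(1) fh(1) [of n]]) auto
  then obtain u where u: "\<And>n. cmod (u n) = 1" "\<And>n. ?d (f n) = Lp_norm p (\<lambda>x. f n x - Vfun a (g * u n) x)" by metis
  have NL: "Lp_power p v = Lp_norm p v powr p" for v
    using p0 Lp_power_nonneg [of v p] by (simp add: Lp_norm_def powr_powr)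
  have "(\<lambda>n. Lp_norm p (\<lambda>x. f n x - Vfun a (g * u n) x)) \<longlonglongrightarrow> 0"
  proof (rule Lim_null_comparison [OF _ LIMSEQ_inverse_real_of_nat])
    have "norm (Lp_norm p (\<lambda>x. f n x - Vfun a (g * u n) x)) \<le> inverse (real (Suc n))" for n
      using z(2) [of n] unfolding f_def [symmetric] u(2) by (simp add: Lp_norm_def)
    then show "\<forall>\<^sub>F n in sequentially. norm (Lp_norm p (\<lambda>x. f n x - Vfun a (g * u n) x)) \<le> inverse (real (Suc n))" by simp
  qed
  from tendsto_powr2 [OF this tendsto_const [of p]]
  have lim: "(\<lambda>n. Lp_power p (\<lambda>x. f n x - Vfun a (g * u n) x)) \<longlonglongrightarrow> 0"
    unfolding NL using p0 by (simp add: Lp_norm_def)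
  have "cmod (g * u n) = cmod g" for n by (simp add: norm_mult u(1))
  from rearrangement_energy_compactness [OF assms(1) fh this lim]
  obtain r g' where r: "cmod g' = cmod g" "(\<lambda>n. Lp_power p (\<lambda>x. h (r n) x - Vfun a g' x)) \<longlonglongrightarrow> 0" by blast
  obtain v where v: "cmod v = 1" "g * v = g'"
  proof (cases "g = 0")
    case True
    then show ?thesis using that [of 1] r(1) by simp
  next
    case False
    then show ?thesis using that [of "g' / g"] r(1) by (simp add: norm_divide)
  qed
  have "\<epsilon> powr p \<le> Lp_power p (\<lambda>x. h (r n) x - Vfun a g' x)" for n
  proof -
    have "\<epsilon> \<le> ?d (h (r n))" using z(3) by (simp add: h_def)
    also have "\<dots> \<le> Lp_norm p (\<lambda>x. h (r n) x - Vfun a (g * v) x)"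
      using min_Lp_dist_attained [OF w assms(1) fh(2) [of "r n"]] v(1) by metis
    finally show ?thesis unfolding NL v(2) using e p0 by (intro powr_mono2) auto
  qed
  then have "\<epsilon> powr p \<le> 0" using r(2) by (intro LIMSEQ_le_const) auto
  then show False using e by simp
qed

end
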